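(* Let $\Gamma$ be a finitely generated virtually nilpotent group with finite generating set $S$, let $E$ be the edge set of the Cayley graph of $(\Gamma,S)$, let $d$ be the word metric, and let $N$ be a finite-index normal torsion-free nilpotent subgroup of $\Gamma$. Let $\Psi$ be a norm on $N^{ab}\otimes\mathbb R$ which is conjugation-invariant. Then there exist ergodic stationary random weights $w:E\to\mathbb R_{\ge0}$ such that the associated FPP metric $T$ is bi-Lipschitz to $d$, i.e. there are constants $0<k<K<\infty$ with $$k\,d(x,y)\le T(x,y)\le K\,d(x,y)\quad\text{for all }x,y\in\Gamma,\ \text{almost surely},$$ and such that the subadditive function $\tilde T$ on $N^{ab}_{free}$ induced by $\mathbb E\,T(1,\cdot)$ is asymptotically equivalent to $\Psi$, i.e. $\tilde T(y)-\Psi(y)=o(\|y\|)$ as $y\to\infty$ in $N^{ab}_{free}$, for any norm $\|\cdot\|$ on $N^{ab}\otimes\mathbb R$.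
   Context: **FPP.** The Cayley graph of $(\Gamma,S)$ has vertex set $\Gamma$ and edge set $E=\{\{g,gs\}:g\in\Gamma,s\in S\}$; $d(x,y)=|x^{-1}y|$ is the word metric for $S$. A random function $w:E\to[0,\infty)$ is *stationary* if for all $f_1,\dots,f_k\in E$ and $g\in\Gamma$ the vectors $(w(f_1),\dots,w(f_k))$ and $(w(g^{-1}f_1),\dots,w(g^{-1}f_k))$ have the same law; it is *ergodic* if all $\Gamma$-invariant events of the underlying probability space (on which $\Gamma$ acts by measure-preserving transformations) have probability $0$ or $1$. For an edge path $\gamma=(f_1,\dots,f_k)$ put $T(\gamma)=\sum_iw(f_i)$, and $T(x,y)$ is the infimum of $T(\gamma)$ over edge paths from $x$ to $y$. **Abelianization.** $N^{ab}=N/[N,N]$, $N^{ab}_{tor}$ is its torsion subgroup, and $N^{ab}_{free}=N^{ab}/N^{ab}_{tor}\cong\mathbb Z^{\mathfrak d}$ for some integer $\mathfrak d\ge 0$, a lattice in $N^{ab}\otimes\mathbb R$. Write $x\mapsto x^{ab}_{free}$ for the quotient map $N\to N^{ab}_{free}$. The function induced by $\mathbb E\,T(1,\cdot)$ is $$\tilde T(y)=\inf\{\mathbb E\,T(1,x):x\in N,\ x^{ab}_{free}=y\},\qquad y\in N^{ab}_{free}.$$ **Conjugation invariance.** The conjugation action $x\mapsto g^{-1}xg$ of $\Gamma$ on $N$ induces a linear (right) action of $\Gamma$ on $N^{ab}\otimes\mathbb R$; a norm is *conjugation-invariant* if it is invariant under this action. *)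

theory Defs
  imports
    "HOL-Algebra.Algebra"
    "HOL-Probability.Probability"
    "HOL-Library.Landau_Symbols"
begin

definition finite_index :: "('a, 'b) monoid_scheme \<Rightarrow> 'a set \<Rightarrow> bool" where
  "finite_index G H \<longleftrightarrow> finite (rcosets\<^bsub>G\<^esub> H)"

fun lower_central :: "('a, 'b) monoid_scheme \<Rightarrow> nat \<Rightarrow> 'a set" where
  "lower_central G 0 = carrier G"
| "lower_central G (Suc n) =
     generate G {x \<otimes>\<^bsub>G\<^esub> y \<otimes>\<^bsub>G\<^esub> inv\<^bsub>G\<^esub> x \<otimes>\<^bsub>G\<^esub> inv\<^bsub>G\<^esub> y | x y.
                   x \<in> carrier G \<and> y \<in> lower_central G n}"

definition nilpotent_group :: "('a, 'b) monoid_scheme \<Rightarrow> bool" where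
  "nilpotent_group G \<longleftrightarrow> group G \<and> (\<exists>n. lower_central G n = {\<one>\<^bsub>G\<^esub>})"

definition virtually_nilpotent :: "('a, 'b) monoid_scheme \<Rightarrow> bool" where
  "virtually_nilpotent G \<longleftrightarrow>
     (\<exists>H. subgroup H G \<and> finite_index G H \<and> nilpotent_group (G\<lparr>carrier := H\<rparr>))"

definition torsion :: "('a, 'b) monoid_scheme \<Rightarrow> 'a set" where
  "torsion G = {x \<in> carrier G. \<exists>n::nat. n > 0 \<and> x [^]\<^bsub>G\<^esub> n = \<one>\<^bsub>G\<^esub>}"

definition torsion_free :: "('a, 'b) monoid_scheme \<Rightarrow> bool" where
  "torsion_free G \<longleftrightarrow> torsion G = {\<one>\<^bsub>G\<^esub>}"

definition word_length :: "('a, 'b) monoid_scheme \<Rightarrow> 'a set \<Rightarrow> 'a \<Rightarrow> nat" where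
  "word_length G S g =
     (LEAST n. \<exists>ss. length ss = n \<and> set ss \<subseteq> S \<union> (\<lambda>s. inv\<^bsub>G\<^esub> s) ` S
                   \<and> foldr (\<lambda>a b. a \<otimes>\<^bsub>G\<^esub> b) ss \<one>\<^bsub>G\<^esub> = g)"

definition word_dist :: "('a, 'b) monoid_scheme \<Rightarrow> 'a set \<Rightarrow> 'a \<Rightarrow> 'a \<Rightarrow> nat" where
  "word_dist G S x y = word_length G S (inv\<^bsub>G\<^esub> x \<otimes>\<^bsub>G\<^esub> y)"

definition abelianization :: "('a, 'b) monoid_scheme \<Rightarrow> 'a set monoid" where
  "abelianization G = G Mod (derived G (carrier G))"

definition free_part :: "('a, 'b) monoid_scheme \<Rightarrow> 'a set monoid" where
  "free_part A = A Mod (torsion A)"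

definition ab_map :: "('a, 'b) monoid_scheme \<Rightarrow> 'a \<Rightarrow> 'a set" where
  "ab_map G x = derived G (carrier G) #>\<^bsub>G\<^esub> x"

definition ab_free_map :: "('a, 'b) monoid_scheme \<Rightarrow> 'a \<Rightarrow> 'a set set" where
  "ab_free_map G x = torsion (abelianization G) #>\<^bsub>abelianization G\<^esub> ab_map G x"

definition induced_fun :: "('a, 'b) monoid_scheme \<Rightarrow> ('a \<Rightarrow> real) \<Rightarrow> 'a set set \<Rightarrow> real" where
  "induced_fun G f y = (INF x\<in>{x \<in> carrier G. ab_free_map G x = y}. f x)"

text \<open>
  The tensor product over the integers of an abelian group \<open>A\<close> (written multiplicatively)
  with the additive group of the reals: the free abelian group on all pairs \<open>(a, r)\<close>,
  modulo biadditivity.  Its group operation \<open>\<otimes>\<close> is vector addition and \<open>\<one>\<close> is the zero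
  vector.
\<close>

definition tensor_free :: "('a, 'b) monoid_scheme \<Rightarrow> (('a \<times> real) \<Rightarrow>\<^sub>0 int) monoid" where
  "tensor_free A = free_Abelian_group (carrier A \<times> (UNIV :: real set))"

definition tensor_rels :: "('a, 'b) monoid_scheme \<Rightarrow> (('a \<times> real) \<Rightarrow>\<^sub>0 int) set" where
  "tensor_rels A = generate (tensor_free A)
     ({frag_of (a \<otimes>\<^bsub>A\<^esub> b, r) - frag_of (a, r) - frag_of (b, r) | a b r.
          a \<in> carrier A \<and> b \<in> carrier A}
      \<union> {frag_of (a, r + s) - frag_of (a, r) - frag_of (a, s) | a r s. a \<in> carrier A})"

definition real_tensor :: "('a, 'b) monoid_scheme \<Rightarrow> (('a \<times> real) \<Rightarrow>\<^sub>0 int) set monoid" where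
  "real_tensor A = tensor_free A Mod tensor_rels A"

definition pure_tensor :: "('a, 'b) monoid_scheme \<Rightarrow> 'a \<Rightarrow> real \<Rightarrow> (('a \<times> real) \<Rightarrow>\<^sub>0 int) set" where
  "pure_tensor A a r = tensor_rels A #>\<^bsub>tensor_free A\<^esub> frag_of (a, r)"

text \<open>
  A map \<open>\<theta>\<close> on pairs extends linearly to formal sums. When this extension respects the
  biadditivity relations, it induces a map on cosets. The image of a coset may be a proper
  subset of a coset (for instance if \<open>\<theta>\<close> is multiplication by \<open>0\<close>), hence the product
  with the relation subgroup.
\<close>

definition tensor_lift ::
  "('a, 'b) monoid_scheme \<Rightarrow> ('a \<times> real \<Rightarrow> 'a \<times> real) \<Rightarrow>
     (('a \<times> real) \<Rightarrow>\<^sub>0 int) set \<Rightarrow> (('a \<times> real) \<Rightarrow>\<^sub>0 int) set" where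
  "tensor_lift A \<theta> v =
     tensor_rels A <#>\<^bsub>tensor_free A\<^esub> (frag_extend (\<lambda>p. frag_of (\<theta> p)) ` v)"

definition tensor_scale ::
  "('a, 'b) monoid_scheme \<Rightarrow> real \<Rightarrow> (('a \<times> real) \<Rightarrow>\<^sub>0 int) set \<Rightarrow> (('a \<times> real) \<Rightarrow>\<^sub>0 int) set"
  where "tensor_scale A c = tensor_lift A (\<lambda>(a, r). (a, c * r))"

definition tensor_map ::
  "('a, 'b) monoid_scheme \<Rightarrow> ('a \<Rightarrow> 'a) \<Rightarrow>
     (('a \<times> real) \<Rightarrow>\<^sub>0 int) set \<Rightarrow> (('a \<times> real) \<Rightarrow>\<^sub>0 int) set"
  where "tensor_map A \<phi> = tensor_lift A (\<lambda>(a, r). (\<phi> a, r))"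

definition tensor_norm ::
  "('a, 'b) monoid_scheme \<Rightarrow> ((('a \<times> real) \<Rightarrow>\<^sub>0 int) set \<Rightarrow> real) \<Rightarrow> bool" where
  "tensor_norm A \<Psi> \<longleftrightarrow>
     (\<forall>v\<in>carrier (real_tensor A). \<Psi> v \<ge> 0 \<and> (\<Psi> v = 0 \<longleftrightarrow> v = \<one>\<^bsub>real_tensor A\<^esub>)) \<and>
     (\<forall>v\<in>carrier (real_tensor A). \<forall>c. \<Psi> (tensor_scale A c v) = \<bar>c\<bar> * \<Psi> v) \<and>
     (\<forall>u\<in>carrier (real_tensor A). \<forall>v\<in>carrier (real_tensor A).
        \<Psi> (u \<otimes>\<^bsub>real_tensor A\<^esub> v) \<le> \<Psi> u + \<Psi> v)"

text \<open>
  The embedding of \<open>free_part A\<close> as a lattice. A torsion element has zero tensor product with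
  every real, so the choice of the representative of the coset \<open>y\<close> is immaterial.
\<close>

definition lattice_vec ::
  "('a, 'b) monoid_scheme \<Rightarrow> 'a set \<Rightarrow> (('a \<times> real) \<Rightarrow>\<^sub>0 int) set" where
  "lattice_vec A y = pure_tensor A (SOME a. a \<in> y) 1"

definition lattice_at_infinity ::
  "('a, 'b) monoid_scheme \<Rightarrow> ((('a \<times> real) \<Rightarrow>\<^sub>0 int) set \<Rightarrow> real) \<Rightarrow> 'a set filter" where
  "lattice_at_infinity A nrm =
     inf (filtercomap (\<lambda>y. nrm (lattice_vec A y)) at_top) (principal (carrier (free_part A)))"

text \<open>
  Conjugation by \<open>g\<close> on a normal subgroup \<open>N\<close> maps cosets of the commutator subgroup
  of \<open>N\<close> to such cosets.
\<close>

definition conj_tensor ::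
  "('a, 'b) monoid_scheme \<Rightarrow> 'a set \<Rightarrow> 'a \<Rightarrow>
     (('a set \<times> real) \<Rightarrow>\<^sub>0 int) set \<Rightarrow> (('a set \<times> real) \<Rightarrow>\<^sub>0 int) set" where
  "conj_tensor G N g =
     tensor_map (abelianization (G\<lparr>carrier := N\<rparr>))
       (\<lambda>C. (\<lambda>x. inv\<^bsub>G\<^esub> g \<otimes>\<^bsub>G\<^esub> x \<otimes>\<^bsub>G\<^esub> g) ` C)"

definition conj_invariant ::
  "('a, 'b) monoid_scheme \<Rightarrow> 'a set \<Rightarrow> ((('a set \<times> real) \<Rightarrow>\<^sub>0 int) set \<Rightarrow> real) \<Rightarrow> bool" where
  "conj_invariant G N \<Psi> \<longleftrightarrow>
     (\<forall>g\<in>carrier G. \<forall>v\<in>carrier (real_tensor (abelianization (G\<lparr>carrier := N\<rparr>))).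
        \<Psi> (conj_tensor G N g v) = \<Psi> v)"

definition cayley_edges :: "('a, 'b) monoid_scheme \<Rightarrow> 'a set \<Rightarrow> 'a set set" where
  "cayley_edges G S = {{g, g \<otimes>\<^bsub>G\<^esub> s} | g s. g \<in> carrier G \<and> s \<in> S}"

fun edge_path :: "'v set set \<Rightarrow> 'v \<Rightarrow> 'v set list \<Rightarrow> 'v \<Rightarrow> bool" where
  "edge_path E x [] y \<longleftrightarrow> x = y"
| "edge_path E x (f # fs) y \<longleftrightarrow> f \<in> E \<and> (\<exists>z. f = {x, z} \<and> edge_path E z fs y)"

definition passage_time :: "'v set set \<Rightarrow> ('v set \<Rightarrow> real) \<Rightarrow> 'v \<Rightarrow> 'v \<Rightarrow> real" where
  "passage_time E w x y = (INF fs\<in>{fs. edge_path E x fs y}. sum_list (map w fs))"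

definition random_weights :: "'v set set \<Rightarrow> 'w measure \<Rightarrow> ('w \<Rightarrow> 'v set \<Rightarrow> real) \<Rightarrow> bool" where
  "random_weights E M w \<longleftrightarrow>
     prob_space M \<and>
     (\<forall>f\<in>E. (\<lambda>\<omega>. w \<omega> f) \<in> borel_measurable M) \<and>
     (\<forall>\<omega>\<in>space M. \<forall>f\<in>E. w \<omega> f \<ge> 0)"

definition stationary_weights ::
  "('a, 'b) monoid_scheme \<Rightarrow> 'a set set \<Rightarrow> 'w measure \<Rightarrow> ('w \<Rightarrow> 'a set \<Rightarrow> real) \<Rightarrow> bool" where
  "stationary_weights G E M w \<longleftrightarrow>
     (\<forall>k::nat. \<forall>f. \<forall>g\<in>carrier G. (\<forall>i<k. f i \<in> E) \<longrightarrow>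
        distr M (PiM {..<k} (\<lambda>_. borel)) (\<lambda>\<omega>. \<lambda>i\<in>{..<k}. w \<omega> (f i)) =
        distr M (PiM {..<k} (\<lambda>_. borel)) (\<lambda>\<omega>. \<lambda>i\<in>{..<k}. w \<omega> (inv\<^bsub>G\<^esub> g <#\<^bsub>G\<^esub> f i)))"

text \<open>
  Ergodicity refers to a measure-preserving action of the group on the underlying probability
  space; the equivariance condition ties this action to the translation of edges.
\<close>

definition ergodic_weights ::
  "('a, 'b) monoid_scheme \<Rightarrow> 'a set set \<Rightarrow> 'w measure \<Rightarrow> ('a \<Rightarrow> 'w \<Rightarrow> 'w) \<Rightarrow>
     ('w \<Rightarrow> 'a set \<Rightarrow> real) \<Rightarrow> bool" where
  "ergodic_weights G E M act w \<longleftrightarrow>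
     group_action G (space M) act \<and>
     (\<forall>g\<in>carrier G. act g \<in> measurable M M \<and> distr M M (act g) = M) \<and>
     (\<forall>g\<in>carrier G. \<forall>\<omega>\<in>space M. \<forall>f\<in>E. w (act g \<omega>) f = w \<omega> (inv\<^bsub>G\<^esub> g <#\<^bsub>G\<^esub> f)) \<and>
     (\<forall>A\<in>sets M. (\<forall>g\<in>carrier G. act g ` A = A) \<longrightarrow> measure M A = 0 \<or> measure M A = 1)"

end

theory Submission
  imports Defs
begin

section \<open>Word length\<close>

lemma (in group) inv_mult_cancel [simp]:
  "x \<in> carrier G \<Longrightarrow> y \<in> carrier G \<Longrightarrow> inv x \<otimes> (x \<otimes> y) = y"
  by (simp flip: m_assoc)

lemma (in group) mult_inv_cancel [simp]:
  "x \<in> carrier G \<Longrightarrow> y \<in> carrier G \<Longrightarrow> x \<otimes> (inv x \<otimes> y) = y"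
  by (simp flip: m_assoc)

definition left_cosets :: "('a, 'b) monoid_scheme \<Rightarrow> 'a set \<Rightarrow> 'a set set" where
  "left_cosets G H = {g <#\<^bsub>G\<^esub> H | g. g \<in> carrier G}"

locale cayley = group G for G (structure) +
  fixes S
  assumes fin_S: "finite S" and S_sub: "S \<subseteq> carrier G" and gen_S: "generate G S = carrier G"
begin

definition letters where "letters = S \<union> (\<lambda>s. inv s) ` S"

definition wprod where "wprod ss = foldr (\<lambda>a b. a \<otimes> b) ss \<one>"

abbreviation len where "len \<equiv> word_length G S"

lemma letters_sub: "letters \<subseteq> carrier G"
  using S_sub by (auto simp: letters_def)

lemma letters_carrier [simp]: "s \<in> letters \<Longrightarrow> s \<in> carrier G"
  using letters_sub by auto

lemma finite_letters: "finite letters"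
  using fin_S by (auto simp: letters_def)

lemma inv_letters: "s \<in> letters \<Longrightarrow> inv s \<in> letters"
  using S_sub by (auto simp: letters_def)

lemma wprod_Nil [simp]: "wprod [] = \<one>"
  and wprod_Cons [simp]: "wprod (s # ss) = s \<otimes> wprod ss"
  by (simp_all add: wprod_def)

lemma wprod_closed [simp]: "set ss \<subseteq> letters \<Longrightarrow> wprod ss \<in> carrier G"
  by (induction ss) auto

lemma wprod_append: "set ss \<subseteq> letters \<Longrightarrow> set ts \<subseteq> letters \<Longrightarrow> wprod (ss @ ts) = wprod ss \<otimes> wprod ts"
  by (induction ss) (auto simp: m_assoc)

lemma wprod_inv: "set ss \<subseteq> letters \<Longrightarrow> wprod (rev (map (\<lambda>s. inv s) ss)) = inv (wprod ss)"
proof (induction ss)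
  case (Cons s ss)
  have "set (rev (map (\<lambda>s. inv s) ss)) \<subseteq> letters" "set [inv s] \<subseteq> letters"
    using Cons.prems inv_letters by auto
  then show ?case using Cons by (simp add: wprod_append inv_mult_group)
qed simp

lemma ex_word: "g \<in> carrier G \<Longrightarrow> \<exists>ss. set ss \<subseteq> letters \<and> wprod ss = g"
proof -
  assume "g \<in> carrier G"
  then have "g \<in> generate G S" by (simp add: gen_S)
  then show ?thesis
  proof induction
    case one then show ?case by (intro exI[of _ "[]"]) auto
  next
    case (incl h) then show ?case using S_sub by (intro exI[of _ "[h]"]) (auto simp: letters_def)
  next
    case (inv h) then show ?case using S_sub by (intro exI[of _ "[inv h]"]) (auto simp: letters_def)
  next
    case (eng h1 h2)
    then obtain ss ts where "set ss \<subseteq> letters" "wprod ss = h1" "set ts \<subseteq> letters" "wprod ts = h2"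
      by auto
    then show ?case by (intro exI[of _ "ss @ ts"]) (auto simp: wprod_append)
  qed
qed

lemma word_length_alt: "len g = (LEAST n. \<exists>ss. length ss = n \<and> set ss \<subseteq> letters \<and> wprod ss = g)"
  unfolding word_length_def letters_def wprod_def by simp

lemma len_word:
  assumes "g \<in> carrier G"
  obtains ss where "set ss \<subseteq> letters" "wprod ss = g" "length ss = len g"
proof -
  obtain ss where "set ss \<subseteq> letters" "wprod ss = g" using ex_word[OF assms] by auto
  then have "\<exists>n ss. length ss = n \<and> set ss \<subseteq> letters \<and> wprod ss = g" by auto
  then have "\<exists>ss. length ss = len g \<and> set ss \<subseteq> letters \<and> wprod ss = g"
    unfolding word_length_alt by (rule LeastI_ex)
  then show ?thesis using that by auto
qed

lemma len_le: "set ss \<subseteq> letters \<Longrightarrow> len (wprod ss) \<le> length ss"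
  unfolding word_length_alt by (rule Least_le) auto

lemma len_one [simp]: "len \<one> = 0"
  using len_le[of "[]"] by simp

lemma len_letter: "s \<in> letters \<Longrightarrow> len s \<le> 1"
  using len_le[of "[s]"] by simp

lemma len_mult: "g \<in> carrier G \<Longrightarrow> h \<in> carrier G \<Longrightarrow> len (g \<otimes> h) \<le> len g + len h"
  by (metis (no_types, lifting) len_le len_word length_append le_sup_iff set_append wprod_append)

lemma len_inv_le: "g \<in> carrier G \<Longrightarrow> len (inv g) \<le> len g"
proof -
  assume "g \<in> carrier G"
  then obtain ss where ss: "set ss \<subseteq> letters" "wprod ss = g" "length ss = len g" by (rule len_word)
  have "set (rev (map (\<lambda>s. inv s) ss)) \<subseteq> letters" using ss inv_letters by auto
  from len_le[OF this] show ?thesis using ss by (simp add: wprod_inv)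
qed

lemma len_inv [simp]: "g \<in> carrier G \<Longrightarrow> len (inv g) = len g"
  using len_inv_le[of g] len_inv_le[of "inv g"] by simp

lemma len_eq_0: "g \<in> carrier G \<Longrightarrow> len g = 0 \<longleftrightarrow> g = \<one>"
  by (metis len_one len_word length_0_conv wprod_Nil)

lemma len_mult3: "g \<in> carrier G \<Longrightarrow> h \<in> carrier G \<Longrightarrow> k \<in> carrier G \<Longrightarrow>
    len (g \<otimes> h \<otimes> k) \<le> len g + len h + len k"
  using len_mult[of "g \<otimes> h" k] len_mult[of g h] by simp

lemma len_pow: "g \<in> carrier G \<Longrightarrow> len (g [^] (n::nat)) \<le> n * len g"
proof (induction n)
  case (Suc n)
  then show ?case using len_mult[of "g [^] n" g] by simp
qed simp

lemma len_int_pow: "g \<in> carrier G \<Longrightarrow> len (g [^] (n::int)) \<le> nat \<bar>n\<bar> * len g"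
proof (cases "n \<ge> 0")
  case True
  assume "g \<in> carrier G"
  then show ?thesis using len_pow[of g "nat n"] True by (simp add: int_pow_def nat_pow_def)
next
  case False
  assume g: "g \<in> carrier G"
  have "g [^] n = inv (g [^] nat (- n))"
    using False g by (simp add: int_pow_def nat_pow_def)
  then show ?thesis using len_pow[OF g, of "nat (-n)"] False g by simp
qed

lemma finite_ball: "finite {g \<in> carrier G. len g \<le> n}"
proof -
  have "{g \<in> carrier G. len g \<le> n} \<subseteq> wprod ` {ss. set ss \<subseteq> letters \<and> length ss \<le> n}"
  proof
    fix g assume "g \<in> {g \<in> carrier G. len g \<le> n}"
    then have g: "g \<in> carrier G" "len g \<le> n" by auto
    obtain ss where "set ss \<subseteq> letters" "wprod ss = g" "length ss = len g"
      using g by (auto elim: len_word)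
    then show "g \<in> wprod ` {ss. set ss \<subseteq> letters \<and> length ss \<le> n}" using g by auto
  qed
  then show ?thesis using finite_lists_length_le[OF finite_letters] finite_surj by blast
qed

lemma countable_carrier: "countable (carrier G)"
proof -
  have "countable (\<Union>n. {g \<in> carrier G. len g \<le> n})"
    by (intro countable_UN) (auto intro: countable_finite finite_ball)
  moreover have "(\<Union>n. {g \<in> carrier G. len g \<le> n}) = carrier G" by auto
  ultimately show ?thesis by simp
qed

abbreviation dist where "dist x y \<equiv> len (inv x \<otimes> y)"

lemma dist_sym: "x \<in> carrier G \<Longrightarrow> y \<in> carrier G \<Longrightarrow> dist x y = dist y x"
  using len_inv[of "inv x \<otimes> y"] by (simp add: inv_mult_group)

lemma dist_triangle: "x \<in> carrier G \<Longrightarrow> y \<in> carrier G \<Longrightarrow> z \<in> carrier G \<Longrightarrow> dist x z \<le> dist x y + dist y z"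
  using len_mult[of "inv x \<otimes> y" "inv y \<otimes> z"] by (simp add: m_assoc)

lemma subadditive_le_len:
  fixes p :: "'a \<Rightarrow> real"
  assumes sub: "\<And>g h. g \<in> carrier G \<Longrightarrow> h \<in> carrier G \<Longrightarrow> p (g \<otimes> h) \<le> p g + p h"
    and P: "\<And>s. s \<in> letters \<Longrightarrow> p s \<le> P" and g: "g \<in> carrier G"
  shows "p g \<le> P * len g + p \<one>"
    and "g \<noteq> \<one> \<Longrightarrow> p g \<le> P * len g"
proof -
  have *: "set ss \<subseteq> letters \<Longrightarrow> p (wprod ss) \<le> P * length ss + p \<one>" for ss
  proof (induction ss)
    case (Cons s ss)
    then have "p (s \<otimes> wprod ss) \<le> p s + p (wprod ss)" by (intro sub) auto
    then show ?case using Cons P[of s] by (simp add: algebra_simps)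
  qed simp
  have **: "set ss \<subseteq> letters \<Longrightarrow> ss \<noteq> [] \<Longrightarrow> p (wprod ss) \<le> P * length ss" for ss
  proof (induction ss)
    case (Cons s ss)
    then have "p (s \<otimes> wprod ss) \<le> p s + p (wprod ss)" by (intro sub) auto
    then show ?case using Cons P[of s] by (cases "ss = []") (auto simp: algebra_simps)
  qed simp
  obtain ss where "set ss \<subseteq> letters" "wprod ss = g" "length ss = len g"
    using g by (auto elim: len_word)
  then show "p g \<le> P * len g + p \<one>" "g \<noteq> \<one> \<Longrightarrow> p g \<le> P * len g"
    using *[of ss] **[of ss] by (cases "ss = []"; auto)+
qed

end

section \<open>Bounded generation of nilpotent groups and slow conjugation\<close>

definition commutator :: "('a, 'b) monoid_scheme \<Rightarrow> 'a \<Rightarrow> 'a \<Rightarrow> 'a" where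
  "commutator G x y = x \<otimes>\<^bsub>G\<^esub> y \<otimes>\<^bsub>G\<^esub> inv\<^bsub>G\<^esub> x \<otimes>\<^bsub>G\<^esub> inv\<^bsub>G\<^esub> y"

definition power_product :: "('a, 'b) monoid_scheme \<Rightarrow> ('a \<times> int) list \<Rightarrow> 'a" where
  "power_product G l = foldr (\<lambda>(a, s) r. a [^]\<^bsub>G\<^esub> s \<otimes>\<^bsub>G\<^esub> r) l \<one>\<^bsub>G\<^esub>"

definition boundedly_generated :: "('a, 'b) monoid_scheme \<Rightarrow> 'a set \<Rightarrow> 'a set \<Rightarrow> bool" where
  "boundedly_generated G A V \<longleftrightarrow>
     (\<exists>B. \<forall>h\<in>V. \<exists>l. length l \<le> B \<and> fst ` set l \<subseteq> A \<and> h = power_product G l)"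

fun series :: "('a, 'b) monoid_scheme \<Rightarrow> 'a set \<Rightarrow> nat \<Rightarrow> 'a set" where
  "series G A 0 = generate G A"
| "series G A (Suc n) = generate G {commutator G x y | x y. x \<in> generate G A \<and> y \<in> series G A n}"

context group begin

abbreviation cm where "cm x y \<equiv> commutator G x y"

lemma cm_closed [simp]: "x \<in> carrier G \<Longrightarrow> y \<in> carrier G \<Longrightarrow> cm x y \<in> carrier G"
  by (simp add: commutator_def)

lemma conj_eq_cm: "x \<in> carrier G \<Longrightarrow> y \<in> carrier G \<Longrightarrow> x \<otimes> y \<otimes> inv x = cm x y \<otimes> y"
  by (simp add: commutator_def m_assoc)

lemma power_product_Nil [simp]: "power_product G [] = \<one>"
  and power_product_Cons [simp]: "power_product G ((a, s) # l) = a [^] s \<otimes> power_product G l"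
  by (simp_all add: power_product_def)

lemma power_product_closed [simp]: "A \<subseteq> carrier G \<Longrightarrow> fst ` set l \<subseteq> A \<Longrightarrow> power_product G l \<in> carrier G"
  by (induction l) auto

lemma power_product_append:
  "A \<subseteq> carrier G \<Longrightarrow> fst ` set l \<subseteq> A \<Longrightarrow> fst ` set l' \<subseteq> A \<Longrightarrow>
    power_product G (l @ l') = power_product G l \<otimes> power_product G l'"
proof (induction l)
  case (Cons p l)
  have "power_product G l \<in> carrier G" "power_product G l' \<in> carrier G" "fst p \<in> carrier G"
    using Cons.prems power_product_closed[of A] by auto
  then show ?case using Cons by (cases p) (auto simp: m_assoc)
qed (auto simp: power_product_closed[of A])

lemma generate_int_pow: "A \<subseteq> carrier G \<Longrightarrow> a \<in> generate G A \<Longrightarrow> a [^] (s::int) \<in> generate G A"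
  by (meson generate_is_subgroup subgroup_int_pow_closed)

lemma power_product_in_generate: "A \<subseteq> carrier G \<Longrightarrow> fst ` set l \<subseteq> A \<Longrightarrow> power_product G l \<in> generate G A"
proof (induction l)
  case (Cons p l)
  obtain a s where p: "p = (a, s)" by (cases p)
  then have "a [^] s \<in> generate G A" using Cons.prems by (intro generate_int_pow generate.incl) auto
  then show ?case using Cons p by (auto intro: generate.eng)
qed (auto intro: generate.one)

lemma boundedly_generated_sub: "A \<subseteq> carrier G \<Longrightarrow> boundedly_generated G A V \<Longrightarrow> V \<subseteq> generate G A"
  using power_product_in_generate unfolding boundedly_generated_def by (metis subsetI)

lemma boundedly_generated_mult:
  assumes A: "A \<subseteq> carrier G" and V: "boundedly_generated G A V" and Y: "boundedly_generated G A Y"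
  shows "boundedly_generated G A (V <#> Y)"
proof -
  obtain B where B: "\<forall>h\<in>V. \<exists>l. length l \<le> B \<and> fst ` set l \<subseteq> A \<and> h = power_product G l"
    using V unfolding boundedly_generated_def by auto
  obtain C where C: "\<forall>h\<in>Y. \<exists>l. length l \<le> C \<and> fst ` set l \<subseteq> A \<and> h = power_product G l"
    using Y unfolding boundedly_generated_def by auto
  have "\<exists>l. length l \<le> B + C \<and> fst ` set l \<subseteq> A \<and> h = power_product G l" if "h \<in> V <#> Y" for h
  proof -
    obtain x y where "x \<in> V" "y \<in> Y" "h = x \<otimes> y" using \<open>h \<in> V <#> Y\<close> unfolding set_mult_def by auto
    then obtain l l' where "length l \<le> B" "fst ` set l \<subseteq> A" "x = power_product G l"
      "length l' \<le> C" "fst ` set l' \<subseteq> A" "y = power_product G l'"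
      using B C by blast
    then show ?thesis using \<open>h = x \<otimes> y\<close> power_product_append[OF A, of l l']
      by (intro exI[of _ "l @ l'"]) auto
  qed
  then show ?thesis unfolding boundedly_generated_def by blast
qed

lemma boundedly_generated_subset: "boundedly_generated G A V \<Longrightarrow> Y \<subseteq> V \<Longrightarrow> boundedly_generated G A Y"
  unfolding boundedly_generated_def by (meson subsetD)

lemma boundedly_generated_powers:
  "A \<subseteq> carrier G \<Longrightarrow> a \<in> A \<Longrightarrow> boundedly_generated G A {a [^] s | s::int. True}"
  unfolding boundedly_generated_def
  apply (rule exI[of _ 1])
  apply clarify
  subgoal for h s by (rule exI[of _ "[(a, s)]"]) auto
  done

lemma boundedly_generated_singleton:
  assumes A: "A \<subseteq> carrier G" and h: "h \<in> generate G A"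
  shows "boundedly_generated G A {h}"
  using h
proof induction
  case one
  show ?case unfolding boundedly_generated_def by (auto intro!: exI[of _ "[]"])
next
  case (incl h)
  have "h = h [^] (1::int)" using incl A by auto
  then show ?case by (intro boundedly_generated_subset[OF boundedly_generated_powers[OF A incl]]) blast
next
  case (inv h)
  have "inv h = h [^] (-1::int)" using inv A by (auto simp: int_pow_neg)
  then show ?case by (intro boundedly_generated_subset[OF boundedly_generated_powers[OF A inv]]) blast
next
  case (eng h1 h2)
  have "{h1 \<otimes> h2} = {h1} <#> {h2}" by (auto simp: set_mult_def)
  then show ?case using boundedly_generated_mult[OF A] eng by metis
qed

lemma commutator_generate_left:
  assumes A: "A \<subseteq> carrier G" and U: "subgroup U G"
    and norm: "\<And>h u. h \<in> generate G A \<Longrightarrow> u \<in> U \<Longrightarrow> h \<otimes> u \<otimes> inv h \<in> U"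
    and y: "y \<in> carrier G" and a: "\<And>a. a \<in> A \<Longrightarrow> cm a y \<in> U" and x: "x \<in> generate G A"
  shows "cm x y \<in> U"
proof -
  have H: "generate G A \<subseteq> carrier G" using generate_in_carrier[OF A] by auto
  show ?thesis using x
  proof induction
    case one
    then show ?case using y U by (simp add: commutator_def subgroup.one_closed)
  next
    case (incl h) then show ?case using a by auto
  next
    case (inv h)
    have h: "h \<in> carrier G" using inv A by auto
    have "cm (inv h) y = inv h \<otimes> inv (cm h y) \<otimes> inv (inv h)"
      using h y by (simp add: commutator_def inv_mult_group m_assoc)
    also have "\<dots> \<in> U"
      using U a[OF inv] inv by (intro norm) (auto intro: generate.inv subgroup.m_inv_closed)
    finally show ?case .
  next
    case (eng h1 h2)
    then have h: "h1 \<in> carrier G" "h2 \<in> carrier G" using H by auto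
    have "cm (h1 \<otimes> h2) y = (h1 \<otimes> cm h2 y \<otimes> inv h1) \<otimes> cm h1 y"
      using h y by (simp add: commutator_def inv_mult_group m_assoc)
    also have "\<dots> \<in> U" by (rule subgroup.m_closed[OF U norm[OF eng.hyps(1) eng.IH(2)] eng.IH(1)])
    finally show ?case .
  qed
qed

lemma commutator_generate_right:
  assumes T: "T \<subseteq> carrier G" and U: "subgroup U G"
    and norm: "\<And>h u. h \<in> generate G T \<Longrightarrow> u \<in> U \<Longrightarrow> h \<otimes> u \<otimes> inv h \<in> U"
    and x: "x \<in> carrier G" and t: "\<And>t. t \<in> T \<Longrightarrow> cm x t \<in> U" and y: "y \<in> generate G T"
  shows "cm x y \<in> U"
proof -
  have H: "generate G T \<subseteq> carrier G" using generate_in_carrier[OF T] by auto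
  show ?thesis using y
  proof induction
    case one
    then show ?case using x U by (simp add: commutator_def subgroup.one_closed)
  next
    case (incl h) then show ?case using t by auto
  next
    case (inv h)
    have h: "h \<in> carrier G" using inv T by auto
    have "cm x (inv h) = inv h \<otimes> inv (cm x h) \<otimes> inv (inv h)"
      using h x by (simp add: commutator_def inv_mult_group m_assoc)
    also have "\<dots> \<in> U"
      using U t[OF inv] inv by (intro norm) (auto intro: generate.inv subgroup.m_inv_closed)
    finally show ?case .
  next
    case (eng h1 h2)
    then have h: "h1 \<in> carrier G" "h2 \<in> carrier G" using H by auto
    have "cm x (h1 \<otimes> h2) = cm x h1 \<otimes> (h1 \<otimes> cm x h2 \<otimes> inv h1)"
      using h x by (simp add: commutator_def inv_mult_group m_assoc)
    also have "\<dots> \<in> U" by (rule subgroup.m_closed[OF U eng.IH(1) norm[OF eng.hyps(1) eng.IH(2)]])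
    finally show ?case .
  qed
qed

context
  fixes A assumes A: "A \<subseteq> carrier G"
begin

lemma gen_A_subgroup: "subgroup (generate G A) G"
  using generate_is_subgroup[OF A] .

lemma series_sub: "series G A (Suc n) \<subseteq> series G A n"
proof (induction n)
  case 0
  have "{cm x y | x y. x \<in> generate G A \<and> y \<in> generate G A} \<subseteq> generate G A"
    unfolding commutator_def using gen_A_subgroup
    by (auto intro!: subgroup.m_closed subgroup.m_inv_closed)
  then show ?case using generate_subgroup_incl[OF _ gen_A_subgroup] by auto
next
  case (Suc n)
  then show ?case unfolding series.simps(2)[of G A "Suc n"] series.simps(2)[of G A n]
    by (intro mono_generate) (use Suc in auto)
qed

lemma series_sub_gen: "series G A n \<subseteq> generate G A"
  by (induction n) (use series_sub in auto)

lemma gen_A_carrier: "generate G A \<subseteq> carrier G"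
  using subgroup.subset[OF gen_A_subgroup] .

lemma series_subgroup: "subgroup (series G A n) G"
proof (cases n)
  case 0 then show ?thesis using gen_A_subgroup by simp
next
  case (Suc m)
  have "{cm x y | x y. x \<in> generate G A \<and> y \<in> series G A m} \<subseteq> carrier G"
    using series_sub_gen[of m] gen_A_carrier by (auto intro!: cm_closed)
  then show ?thesis using Suc generate_is_subgroup by auto
qed

lemma series_carrier: "series G A n \<subseteq> carrier G"
  using subgroup.subset[OF series_subgroup] .

lemma cm_in_series: "h \<in> generate G A \<Longrightarrow> u \<in> series G A n \<Longrightarrow> cm h u \<in> series G A (Suc n)"
  by (auto intro!: generate.incl)

lemma series_normal: "h \<in> generate G A \<Longrightarrow> u \<in> series G A n \<Longrightarrow> h \<otimes> u \<otimes> inv h \<in> series G A n"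
proof -
  assume h: "h \<in> generate G A" and u: "u \<in> series G A n"
  have "cm h u \<in> series G A n" using cm_in_series[OF h u] series_sub by auto
  then show ?thesis
    using h u gen_A_carrier series_carrier
    by (subst conj_eq_cm) (auto intro!: subgroup.m_closed[OF series_subgroup])
qed

lemma series_normal': "h \<in> generate G A \<Longrightarrow> u \<in> series G A n \<Longrightarrow> inv h \<otimes> u \<otimes> h \<in> series G A n"
  using series_normal[of "inv h" u n] subgroup.m_inv_closed[OF gen_A_subgroup, of h] gen_A_carrier
  by auto

end

text \<open>Modulo the next term of the series, the commutator with a fixed element is a homomorphism.\<close>

lemma commutator_power:
  assumes A: "A \<subseteq> carrier G" and a: "a \<in> A" and t: "t \<in> series G A n"
  shows "\<exists>m\<in>series G A (Suc (Suc n)). cm a t [^] (s::int) = cm (a [^] s) t \<otimes> m"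
proof -
  let ?M = "series G A (Suc (Suc n))"
  let ?c = "cm a t" and ?f = "\<lambda>s::int. cm (a [^] s) t"
  note M = series_subgroup[OF A, of "Suc (Suc n)"]
  have aH: "a \<in> generate G A" using a by (simp add: generate.incl)
  have tH: "t \<in> generate G A" using t series_sub_gen[OF A] by auto
  have ac [simp]: "a \<in> carrier G" and tc [simp]: "t \<in> carrier G"
    using aH tH gen_A_carrier[OF A] by auto
  have fH: "?f s \<in> series G A (Suc n)" for s
    using generate_int_pow[OF A aH, of s] t by (intro cm_in_series[OF A]) auto
  have fc [simp]: "?f s \<in> carrier G" for s by simp
  have cH: "?c \<in> generate G A" using cm_in_series[OF A aH t] series_sub_gen[OF A] by blast
  have step: "\<exists>m\<in>?M. ?f (s + 1) = ?f s \<otimes> ?c \<otimes> m" for s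
  proof -
    let ?g = "?f s \<otimes> ?c"
    have g: "?g \<in> generate G A" "?g \<in> carrier G"
      using subsetD[OF series_sub_gen[OF A] fH[of s]] cH by (auto intro!: generate.eng)
    have k: "cm a (?f s) \<in> ?M" by (intro cm_in_series[OF A] aH fH)
    then have kc [simp]: "cm a (?f s) \<in> carrier G" using series_carrier[OF A] by blast
    have "?f (s + 1) = cm a (?f s) \<otimes> ?g"
    proof -
      have "a [^] (s + 1) = a \<otimes> a [^] s" using int_pow_mult[of a 1 s] by (simp add: add.commute)
      then show ?thesis
        using int_pow_closed[of a s]
        by (simp add: commutator_def inv_mult_group m_assoc)
    qed
    also have "\<dots> = ?g \<otimes> (inv ?g \<otimes> cm a (?f s) \<otimes> ?g)"
      using g(2) by (simp add: m_assoc)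
    finally show ?thesis using series_normal'[OF A g(1) k] by blast
  qed
  show ?thesis
  proof (induction s rule: int_induct[where k = 0])
    case base
    then show ?case using subgroup.one_closed[OF M] by (intro bexI[of _ "\<one>"]) (auto simp: commutator_def)
  next
    case (step1 i)
    then obtain m where m: "m \<in> ?M" "?c [^] i = ?f i \<otimes> m" by auto
    obtain m' where m': "m' \<in> ?M" "?f (i + 1) = ?f i \<otimes> ?c \<otimes> m'" using step by auto
    have [simp]: "m \<in> carrier G" "m' \<in> carrier G" using m m' series_carrier[OF A] by blast+
    have "?c [^] (i + 1) = ?f i \<otimes> m \<otimes> ?c" using m by (simp add: int_pow_mult)
    also have "\<dots> = ?f (i + 1) \<otimes> (inv m' \<otimes> (inv ?c \<otimes> m \<otimes> ?c))"
      unfolding m'(2) by (simp add: m_assoc)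
    finally show ?case using series_normal'[OF A cH m(1)] subgroup.m_inv_closed[OF M m'(1)]
        subgroup.m_closed[OF M] by blast
  next
    case (step2 i)
    then obtain m where m: "m \<in> ?M" "?c [^] i = ?f i \<otimes> m" by auto
    obtain m' where m': "m' \<in> ?M" "?f (i - 1 + 1) = ?f (i - 1) \<otimes> ?c \<otimes> m'" using step by blast
    have m'': "?f i = ?f (i - 1) \<otimes> ?c \<otimes> m'" using m'(2) by simp
    have [simp]: "m \<in> carrier G" "m' \<in> carrier G" using m m' series_carrier[OF A] by blast+
    have "?c [^] (i - 1) = ?c [^] i \<otimes> inv ?c" using int_pow_mult[of ?c i "-1"] by (simp add: int_pow_neg)
    also have "\<dots> = ?f (i - 1) \<otimes> (?c \<otimes> (m' \<otimes> m) \<otimes> inv ?c)"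
      unfolding m(2) unfolding m'' by (simp add: m_assoc)
    finally show ?case using series_normal[OF A cH, of "m' \<otimes> m"] m m' subgroup.m_closed[OF M] by blast
  qed
qed

lemma generate_insert_normalizing:
  assumes U: "subgroup U G" and t: "t \<in> carrier G"
    and n1: "\<And>u. u \<in> U \<Longrightarrow> t \<otimes> u \<otimes> inv t \<in> U" and n2: "\<And>u. u \<in> U \<Longrightarrow> inv t \<otimes> u \<otimes> t \<in> U"
    and h: "h \<in> generate G (insert t U)"
  shows "\<exists>s::int. \<exists>u\<in>U. h = t [^] s \<otimes> u"
proof -
  have Uc: "U \<subseteq> carrier G" using subgroup.subset[OF U] .
  have conj: "inv (t [^] s) \<otimes> u \<otimes> t [^] s \<in> U" if "u \<in> U" for u and s :: int
    using that
  proof (induction s arbitrary: u rule: int_induct[where k = 0])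
    case base then show ?case using Uc by auto
  next
    case (step1 i)
    have "u \<in> carrier G" using step1 Uc by auto
    moreover have "t [^] (i + 1) = t [^] i \<otimes> t" using t by (simp add: int_pow_mult)
    ultimately have "inv (t [^] (i + 1)) \<otimes> u \<otimes> t [^] (i + 1) = inv t \<otimes> (inv (t [^] i) \<otimes> u \<otimes> t [^] i) \<otimes> t"
      using t by (simp add: inv_mult_group m_assoc)
    then show ?case using n2 step1 by auto
  next
    case (step2 i)
    have "u \<in> carrier G" using step2 Uc by auto
    moreover have "t [^] (i - 1) = t [^] i \<otimes> inv t" using t int_pow_mult[of t i "-1"] by (simp add: int_pow_neg)
    ultimately have "inv (t [^] (i - 1)) \<otimes> u \<otimes> t [^] (i - 1) = t \<otimes> (inv (t [^] i) \<otimes> u \<otimes> t [^] i) \<otimes> inv t"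
      using t by (simp add: inv_mult_group m_assoc)
    then show ?case using n1 step2 by auto
  qed
  show ?thesis using h
  proof induction
    case one then show ?case using U by (intro exI[of _ 0] bexI[of _ \<one>]) (auto simp: subgroup.one_closed)
  next
    case (incl h)
    then consider "h = t" | "h \<in> U" by auto
    then show ?case
    proof cases
      case 1 then show ?thesis using t U by (intro exI[of _ 1] bexI[of _ \<one>]) (auto simp: subgroup.one_closed)
    next
      case 2 then show ?thesis using Uc by (intro exI[of _ 0] bexI[of _ h]) auto
    qed
  next
    case (inv h)
    then consider "h = t" | "h \<in> U" by auto
    then show ?case
    proof cases
      case 1 then show ?thesis using t U
        by (intro exI[of _ "-1"] bexI[of _ \<one>]) (auto simp: subgroup.one_closed int_pow_neg)
    next
      case 2 then show ?thesis using U Uc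
        by (intro exI[of _ 0] bexI[of _ "inv h"]) (auto simp: subgroup.m_inv_closed)
    qed
  next
    case (eng h1 h2)
    then obtain s1 u1 s2 u2 where *: "u1 \<in> U" "h1 = t [^] (s1::int) \<otimes> u1" "u2 \<in> U" "h2 = t [^] (s2::int) \<otimes> u2"
      by auto
    then have [simp]: "u1 \<in> carrier G" "u2 \<in> carrier G" using Uc by auto
    have "h1 \<otimes> h2 = t [^] (s1 + s2) \<otimes> ((inv (t [^] s2) \<otimes> u1 \<otimes> t [^] s2) \<otimes> u2)"
      using t by (simp add: * int_pow_mult m_assoc)
    then show ?case using conj[OF *(1)] *(3) subgroup.m_closed[OF U] by blast
  qed
qed

lemma series_generators:
  assumes A: "A \<subseteq> carrier G" and fin: "finite A"
  shows "\<exists>T. finite T \<and> T \<subseteq> series G A n \<and> series G A n \<subseteq> generate G (T \<union> series G A (Suc n)) \<and>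
    (\<forall>t\<in>T. \<exists>Y. boundedly_generated G A Y \<and> (\<forall>s::int. \<exists>y\<in>Y. \<exists>m\<in>series G A (Suc n). t [^] s = y \<otimes> m))"
proof (induction n)
  case 0
  have "\<exists>Y. boundedly_generated G A Y \<and> (\<forall>s::int. \<exists>y\<in>Y. \<exists>m\<in>series G A (Suc 0). t [^] s = y \<otimes> m)"
    if "t \<in> A" for t
    using that A boundedly_generated_powers[OF A that] subgroup.one_closed[OF series_subgroup[OF A, of "Suc 0"]]
    by (intro exI[of _ "{t [^] s | s::int. True}"] conjI allI)
      (auto intro!: bexI[of _ "\<one>"] exI)
  then show ?case using fin by (intro exI[of _ A])
      (auto intro: generate.incl subsetD[OF mono_generate, of A])
next
  case (Suc n)
  then obtain T where T: "finite T" "T \<subseteq> series G A n" "series G A n \<subseteq> generate G (T \<union> series G A (Suc n))"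
    by auto
  let ?T = "(\<lambda>(a, t). cm a t) ` (A \<times> T)"
  let ?M = "series G A (Suc (Suc n))"
  let ?U = "generate G (?T \<union> ?M)"
  have Tc: "T \<subseteq> carrier G" using T(2) series_carrier[OF A] by blast
  have TH: "?T \<subseteq> series G A (Suc n)"
    using T(2) by (auto intro!: generate.incl)
  have Mc: "?M \<subseteq> carrier G" by (rule series_carrier[OF A])
  have Tc': "?T \<union> ?M \<subseteq> carrier G" using TH series_carrier[OF A, of "Suc n"] Mc by blast
  have U: "subgroup ?U G" using generate_is_subgroup[OF Tc'] .
  have MU: "?M \<subseteq> ?U" by (auto intro: generate.incl)
  have UH: "?U \<subseteq> series G A (Suc n)"
    by (rule generate_subgroup_incl[OF _ series_subgroup[OF A]]) (use TH series_sub[OF A, of "Suc n"] in blast)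
  have norm: "h \<otimes> u \<otimes> inv h \<in> ?U" if "h \<in> generate G A" "u \<in> ?U" for h u
  proof -
    have "cm h u \<in> ?M" using that UH by (intro cm_in_series[OF A]) auto
    then have "cm h u \<otimes> u \<in> ?U" using MU that U by (auto intro!: subgroup.m_closed)
    then show ?thesis using that gen_A_carrier[OF A] subgroup.subset[OF U] by (subst conj_eq_cm) auto
  qed
  have TH': "generate G (T \<union> series G A (Suc n)) \<subseteq> generate G A"
    by (rule generate_subgroup_incl[OF _ gen_A_subgroup[OF A]])
       (use T(2) series_sub_gen[OF A, of n] series_sub_gen[OF A, of "Suc n"] in blast)
  have 1: "cm x t \<in> ?U" if x: "x \<in> generate G A" and t: "t \<in> T \<union> series G A (Suc n)" for x t
  proof (cases "t \<in> T")
    case True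
    show ?thesis
      by (rule commutator_generate_left[OF A U norm]) (use True Tc x in \<open>auto intro!: generate.incl\<close>)
  next
    case False
    then have "cm x t \<in> ?M" using x t by (intro cm_in_series[OF A]) auto
    then show ?thesis using MU by auto
  qed
  have "cm x y \<in> ?U" if x: "x \<in> generate G A" and y: "y \<in> series G A n" for x y
  proof (rule commutator_generate_right[where T = "T \<union> series G A (Suc n)"])
    show "T \<union> series G A (Suc n) \<subseteq> carrier G" using Tc series_carrier[OF A, of "Suc n"] by blast
    show "x \<in> carrier G" using x gen_A_carrier[OF A] by auto
    show "y \<in> generate G (T \<union> series G A (Suc n))" using y T by auto
  qed (use U norm TH' 1 x in auto)
  then have "series G A (Suc n) \<subseteq> ?U"
    unfolding series.simps(2)[of G A n] by (intro generate_subgroup_incl[OF _ U]) auto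
  moreover have "\<exists>Y. boundedly_generated G A Y \<and> (\<forall>s::int. \<exists>y\<in>Y. \<exists>m\<in>?M. cm a t [^] s = y \<otimes> m)"
    if a: "a \<in> A" and t: "t \<in> T" for a t
  proof -
    have ac: "a \<in> carrier G" and tc: "t \<in> carrier G" using a t A Tc by auto
    have tH: "t \<in> generate G A" using t T(2) series_sub_gen[OF A] by blast
    let ?V = "{a [^] s | s::int. True}"
    let ?Y = "(?V <#> {t}) <#> (?V <#> {inv t})"
    have "boundedly_generated G A ?Y"
      using a tH boundedly_generated_powers[OF A a] subgroup.m_inv_closed[OF gen_A_subgroup[OF A] tH]
      by (intro boundedly_generated_mult[OF A] boundedly_generated_singleton[OF A]) auto
    moreover have "\<exists>y\<in>?Y. \<exists>m\<in>?M. cm a t [^] s = y \<otimes> m" for s :: int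
    proof -
      obtain m where "m \<in> ?M" "cm a t [^] s = cm (a [^] s) t \<otimes> m"
        using commutator_power[OF A a, of t n s] t T by blast
      moreover have "cm (a [^] s) t = (a [^] s \<otimes> t) \<otimes> (a [^] (-s) \<otimes> inv t)"
        using ac tc by (simp add: commutator_def m_assoc int_pow_neg)
      then have "cm (a [^] s) t \<in> ?Y" unfolding set_mult_def by blast
      ultimately show ?thesis by blast
    qed
    ultimately show ?thesis by blast
  qed
  ultimately show ?case using T fin TH
    by (intro exI[of _ ?T]) (auto simp del: series.simps)
qed

lemma series_bounded_mod_next:
  assumes A: "A \<subseteq> carrier G" and fin: "finite A"
  shows "\<exists>Y. boundedly_generated G A Y \<and> series G A n \<subseteq> Y <#> series G A (Suc n)"
proof -
  let ?M = "series G A (Suc n)"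
  obtain T where T: "finite T" "T \<subseteq> series G A n" "series G A n \<subseteq> generate G (T \<union> ?M)"
    "\<forall>t\<in>T. \<exists>Y. boundedly_generated G A Y \<and> (\<forall>s::int. \<exists>y\<in>Y. \<exists>m\<in>?M. t [^] s = y \<otimes> m)"
    using series_generators[OF A fin, of n] by (elim exE conjE) (rule that)
  have M: "subgroup ?M G" by (rule series_subgroup[OF A])
  have "\<exists>Y. boundedly_generated G A Y \<and> generate G (T \<union> ?M) \<subseteq> Y <#> ?M"
    using T(1,2,4)
  proof (induction T rule: finite_induct)
    case empty
    have "generate G ?M \<subseteq> ?M" using generate_subgroup_incl[OF _ M] by auto
    also have "\<dots> \<subseteq> {\<one>} <#> ?M" using subgroup.subset[OF M] by (force simp: set_mult_def)
    finally show ?case using boundedly_generated_singleton[OF A generate.one] by (intro exI[of _ "{\<one>}"]) auto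
  next
    case (insert t T)
    obtain Y where Y: "boundedly_generated G A Y" "generate G (T \<union> ?M) \<subseteq> Y <#> ?M"
      using insert by auto
    obtain Z where Z: "boundedly_generated G A Z" "\<And>s::int. \<exists>y\<in>Z. \<exists>m\<in>?M. t [^] s = y \<otimes> m"
      using insert.prems by auto
    let ?U = "generate G (T \<union> ?M)"
    have TM: "T \<union> ?M \<subseteq> series G A n" using insert.prems(1) series_sub[OF A] by blast
    then have TMc: "T \<union> ?M \<subseteq> carrier G" using series_carrier[OF A] by blast
    have U: "subgroup ?U G" using generate_is_subgroup[OF TMc] .
    have UH: "?U \<subseteq> series G A n" using generate_subgroup_incl[OF TM series_subgroup[OF A]] .
    have MU: "?M \<subseteq> ?U" by (auto intro: generate.incl)
    have tH: "t \<in> generate G A" using insert.prems(1) series_sub_gen[OF A] by blast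
    then have tc: "t \<in> carrier G" using gen_A_carrier[OF A] by auto
    have n: "h \<otimes> u \<otimes> inv h \<in> ?U" if h: "h \<in> generate G A" and u: "u \<in> ?U" for h u
    proof -
      have "cm h u \<in> ?U" using cm_in_series[OF A h, of u n] u UH MU by blast
      then have "cm h u \<otimes> u \<in> ?U" using u U by (auto intro: subgroup.m_closed)
      then show ?thesis using h u gen_A_carrier[OF A] subgroup.subset[OF U] by (subst conj_eq_cm) auto
    qed
    have n2: "inv t \<otimes> u \<otimes> t \<in> ?U" if "u \<in> ?U" for u
      using n[of "inv t" u] that tH tc subgroup.m_inv_closed[OF gen_A_subgroup[OF A] tH] by simp
    have "generate G (insert t T \<union> ?M) \<subseteq> generate G (insert t ?U)"
      by (rule mono_generate) (auto intro: generate.incl)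
    also have "\<dots> \<subseteq> (Z <#> Y) <#> ?M"
    proof
      fix h assume "h \<in> generate G (insert t ?U)"
      then obtain s :: int and u where su: "u \<in> ?U" "h = t [^] s \<otimes> u"
        using generate_insert_normalizing[OF U tc n[OF tH] n2] by blast
      obtain z m where zm: "z \<in> Z" "m \<in> ?M" "t [^] s = z \<otimes> m" using Z(2) by blast
      obtain y m' where ym: "y \<in> Y" "m' \<in> ?M" "u = y \<otimes> m'" using su Y(2) by (auto simp: set_mult_def)
      have yH: "y \<in> generate G A" and zH: "z \<in> generate G A"
        using ym zm boundedly_generated_sub[OF A] Y Z by auto
      have [simp]: "y \<in> carrier G" "z \<in> carrier G" "m \<in> carrier G" "m' \<in> carrier G"
        using yH zH gen_A_carrier[OF A] zm ym subgroup.subset[OF M] by auto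
      have "h = (z \<otimes> y) \<otimes> ((inv y \<otimes> m \<otimes> y) \<otimes> m')"
        unfolding su zm ym by (simp add: m_assoc)
      moreover have "(inv y \<otimes> m \<otimes> y) \<otimes> m' \<in> ?M"
        using series_normal'[OF A yH zm(2)] ym(2) subgroup.m_closed[OF M] by blast
      ultimately show "h \<in> (Z <#> Y) <#> ?M" using zm(1) ym(1) unfolding set_mult_def by blast
    qed
    finally show ?case using boundedly_generated_mult[OF A Z(1) Y(1)] by blast
  qed
  then show ?thesis using T(3) by blast
qed

text \<open>
  A finitely generated nilpotent group is boundedly generated: every layer of its lower central
  series is generated, modulo the next layer, by finitely many commutators \<open>[a, t]\<close> with
  \<open>a\<close> a generator, and \<open>[a, t]\<^sup>s\<close> agrees modulo the next layer with \<open>[a\<^sup>s, t]\<close>, which costs a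
  bounded number of powers of generators.
\<close>

theorem nilpotent_boundedly_generated:
  assumes A: "A \<subseteq> carrier G" and fin: "finite A" and nil: "series G A c = {\<one>}"
  shows "boundedly_generated G A (generate G A)"
proof -
  have "\<exists>Y. boundedly_generated G A Y \<and> generate G A \<subseteq> Y <#> series G A n" for n
  proof (induction n)
    case 0
    show ?case using boundedly_generated_singleton[OF A generate.one] gen_A_carrier[OF A]
      by (intro exI[of _ "{\<one>}"]) (force simp: set_mult_def)
  next
    case (Suc n)
    then obtain Y where Y: "boundedly_generated G A Y" "generate G A \<subseteq> Y <#> series G A n" by auto
    obtain Z where Z: "boundedly_generated G A Z" "series G A n \<subseteq> Z <#> series G A (Suc n)"
      using series_bounded_mod_next[OF A fin] by auto
    have "Y <#> series G A n \<subseteq> Y <#> (Z <#> series G A (Suc n))"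
      using Z(2) by (intro mono_set_mult) auto
    also have "\<dots> = (Y <#> Z) <#> series G A (Suc n)"
      using boundedly_generated_sub[OF A Y(1)] boundedly_generated_sub[OF A Z(1)] gen_A_carrier[OF A]
        series_carrier[OF A, of "Suc n"]
      by (intro set_mult_assoc[symmetric]) auto
    finally show ?case using Y(2) boundedly_generated_mult[OF A Y(1) Z(1)] by blast
  qed
  from this[of c] obtain Y where Y: "boundedly_generated G A Y" "generate G A \<subseteq> Y <#> {\<one>}"
    using nil by auto
  have "Y <#> {\<one>} \<subseteq> Y"
    using boundedly_generated_sub[OF A Y(1)] gen_A_carrier[OF A] by (auto simp: set_mult_def)
  then show ?thesis using Y boundedly_generated_subset by blast
qed

end

lemma (in group) generate_conj:
  assumes A: "A \<subseteq> carrier G" and x: "x \<in> carrier G" and e: "e \<in> generate G A"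
  shows "x \<otimes> e \<otimes> inv x \<in> generate G ((\<lambda>y. x \<otimes> y \<otimes> inv x) ` A)"
  using e
proof induction
  case one then show ?case using x by (simp add: generate.one)
next
  case (incl h) then show ?case by (auto intro: generate.incl)
next
  case (inv h)
  then have "x \<otimes> inv h \<otimes> inv x = inv (x \<otimes> h \<otimes> inv x)"
    using A x by (auto simp: inv_mult_group m_assoc)
  then show ?case using inv by (auto intro: generate.inv)
next
  case (eng h1 h2)
  then have "h1 \<in> carrier G" "h2 \<in> carrier G" using generate_in_carrier[OF A] by auto
  then have "x \<otimes> (h1 \<otimes> h2) \<otimes> inv x = (x \<otimes> h1 \<otimes> inv x) \<otimes> (x \<otimes> h2 \<otimes> inv x)"
    using x by (simp add: m_assoc)
  then show ?case using eng by (auto intro: generate.eng)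
qed

text \<open>
  Expanding the iterated commutator \<open>[x, [x, \<dots> [x, g]]]\<close> with \<open>j\<close> entries \<open>x\<close> gives a product
  of conjugates of \<open>g\<^sup>\<plusminus>\<^sup>1\<close> in which the conjugate by \<open>x\<^sup>j\<close> occurs exactly once. Since this
  commutator is trivial for large \<open>j\<close>, all conjugates by powers of \<open>x\<close> lie in the group
  generated by the first few.
\<close>

lemma (in group) nilpotent_conjugates_generate:
  assumes nil: "lower_central G c = {\<one>}" and x: "x \<in> carrier G" and g: "g \<in> carrier G"
  defines "a \<equiv> \<lambda>k::nat. x [^] k \<otimes> g \<otimes> inv (x [^] k)"
  shows "a k \<in> generate G (a ` {..<c})"
proof -
  define D where "D = rec_nat g (\<lambda>_ d. commutator G x d)"
  have D0: "D 0 = g" and DS: "D (Suc j) = commutator G x (D j)" for j by (simp_all add: D_def)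
  have Dc: "D j \<in> carrier G" for j by (induction j) (use x g in \<open>auto simp: D0 DS\<close>)
  have Dl: "D j \<in> lower_central G j" for j
    by (induction j) (use x g in \<open>auto simp: D0 DS commutator_def intro!: generate.incl\<close>)
  have ac: "a k \<in> carrier G" for k using x g by (simp add: a_def)
  have aS: "a (Suc k) = x \<otimes> a k \<otimes> inv x" for k
  proof -
    have "x [^] Suc k = x \<otimes> x [^] k" using x nat_pow_Suc2 by blast
    then show ?thesis using x g by (simp add: a_def inv_mult_group m_assoc del: nat_pow_Suc)
  qed
  have gen_sub: "generate G (a ` {..<j}) \<subseteq> carrier G" for j
    by (rule subgroup.subset[OF generate_is_subgroup]) (use ac in auto)
  have sub: "generate G (a ` {..<j}) \<subseteq> generate G (a ` {..<Suc j})" for j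
    by (intro mono_generate) auto
  have shift: "x \<otimes> e \<otimes> inv x \<in> generate G (a ` {..<Suc j})" if "e \<in> generate G (a ` {..<j})" for e j
  proof -
    have "x \<otimes> e \<otimes> inv x \<in> generate G ((\<lambda>y. x \<otimes> y \<otimes> inv x) ` a ` {..<j})"
      using ac x that by (intro generate_conj) auto
    moreover have "(\<lambda>y. x \<otimes> y \<otimes> inv x) ` a ` {..<j} \<subseteq> a ` {..<Suc j}"
      by (auto simp: aS[symmetric])
    ultimately show ?thesis using mono_generate by blast
  qed
  have ex: "\<exists>e\<in>generate G (a ` {..<j}). D j = a j \<otimes> e" for j
  proof (induction j)
    case 0
    then show ?case using g by (intro bexI[of _ \<one>]) (auto simp: D0 a_def intro: generate.one)
  next
    case (Suc j)
    then obtain e where e: "e \<in> generate G (a ` {..<j})" "D j = a j \<otimes> e" by auto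
    have ec: "e \<in> carrier G" using e(1) gen_sub by auto
    have "D (Suc j) = a (Suc j) \<otimes> ((x \<otimes> e \<otimes> inv x) \<otimes> inv (a j \<otimes> e))"
      unfolding DS aS e(2) commutator_def using x ac ec by (simp add: m_assoc inv_mult_group)
    moreover have "a j \<otimes> e \<in> generate G (a ` {..<Suc j})"
      using e(1) sub by (intro generate.eng) (auto intro: generate.incl)
    then have "inv (a j \<otimes> e) \<in> generate G (a ` {..<Suc j})"
      using ac by (intro generate_m_inv_closed) auto
    ultimately show ?case using shift[OF e(1)] by (blast intro: generate.eng)
  qed
  have top: "a c \<in> generate G (a ` {..<c})"
  proof -
    obtain e where e: "e \<in> generate G (a ` {..<c})" "D c = a c \<otimes> e" using ex by auto
    have "a c \<otimes> e = \<one>" using Dl[of c] nil e by auto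
    moreover have "e \<in> carrier G" using e(1) gen_sub by blast
    ultimately have "a c = inv e" using ac[of c] inv_equality[of "a c" e] by simp
    then show ?thesis using e(1) ac generate_m_inv_closed[of "a ` {..<c}"] by auto
  qed
  have stable: "x \<otimes> e \<otimes> inv x \<in> generate G (a ` {..<c})" if "e \<in> generate G (a ` {..<c})" for e
  proof -
    have "generate G (a ` {..<Suc c}) \<subseteq> generate G (a ` {..<c})"
    proof (rule generate_subgroup_incl)
      show "subgroup (generate G (a ` {..<c})) G" using ac by (intro generate_is_subgroup) auto
      show "a ` {..<Suc c} \<subseteq> generate G (a ` {..<c})"
        using top generate.incl[of _ "a ` {..<c}" G] by (auto simp: less_Suc_eq)
    qed
    then show ?thesis using shift[OF that] by auto
  qed
  show ?thesis
  proof (induction k)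
    case 0
    show ?case
    proof (cases "c = 0")
      case True
      then have "g = \<one>" using nil g by auto
      then show ?thesis using x by (simp add: a_def generate.one)
    qed (auto intro: generate.incl)
  next
    case (Suc k) then show ?case using stable by (simp add: aS)
  qed
qed

lemma (in group) int_pow_conj:
  assumes x: "x \<in> carrier G" and g: "g \<in> carrier G"
  shows "(x \<otimes> g \<otimes> inv x) [^] (s::int) = x \<otimes> g [^] s \<otimes> inv x"
proof -
  have n: "(x \<otimes> g \<otimes> inv x) [^] (k::nat) = x \<otimes> g [^] k \<otimes> inv x" for k
    by (induction k) (use x g in \<open>auto simp: m_assoc\<close>)
  show ?thesis
  proof (cases "s < 0")
    case True
    then show ?thesis unfolding int_pow_def2 n using x g by (simp add: inv_mult_group m_assoc)
  next
    case False
    then show ?thesis unfolding int_pow_def2 n by simp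
  qed
qed

definition sequence_group :: "('a, 'b) monoid_scheme \<Rightarrow> (nat \<Rightarrow> 'a) monoid" where
  "sequence_group G = \<lparr>carrier = {f. \<forall>n. f n \<in> carrier G}, monoid.mult = (\<lambda>f g n. f n \<otimes>\<^bsub>G\<^esub> g n), one = (\<lambda>n. \<one>\<^bsub>G\<^esub>)\<rparr>"

context group begin

lemma sequence_group_simps [simp]:
  "f \<in> carrier (sequence_group G) \<longleftrightarrow> (\<forall>n. f n \<in> carrier G)"
  "f \<otimes>\<^bsub>sequence_group G\<^esub> h = (\<lambda>n. f n \<otimes> h n)"
  "\<one>\<^bsub>sequence_group G\<^esub> = (\<lambda>n. \<one>)"
  by (simp_all add: sequence_group_def)

lemma sequence_group: "group (sequence_group G)"
proof (rule groupI)
  fix f assume "f \<in> carrier (sequence_group G)"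
  then show "\<exists>h\<in>carrier (sequence_group G). h \<otimes>\<^bsub>sequence_group G\<^esub> f = \<one>\<^bsub>sequence_group G\<^esub>"
    by (intro bexI[of _ "\<lambda>n. inv (f n)"]) auto
qed (auto simp: m_assoc)

lemma sequence_group_inv [simp]:
  assumes "\<And>n. f n \<in> carrier G" shows "inv\<^bsub>sequence_group G\<^esub> f = (\<lambda>n. inv (f n))"
  by (rule group.inv_equality[OF sequence_group]) (use assms in auto)

lemma sequence_group_pow [simp]: "f [^]\<^bsub>sequence_group G\<^esub> (k::nat) = (\<lambda>n. f n [^] k)"
  by (induction k) simp_all

lemma sequence_group_int_pow [simp]:
  assumes "\<And>n. f n \<in> carrier G" shows "f [^]\<^bsub>sequence_group G\<^esub> (k::int) = (\<lambda>n. f n [^] k)"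
  using assms unfolding int_pow_def2 by (auto simp: nat_pow_closed)

lemma sequence_group_generate:
  "f \<in> generate (sequence_group G) A \<Longrightarrow> A \<subseteq> {f. \<forall>n. f n \<in> B n} \<Longrightarrow> B n \<subseteq> carrier G \<Longrightarrow>
     (\<And>n. B n \<subseteq> carrier G) \<Longrightarrow> f n \<in> generate G (B n)"
proof (induction rule: generate.induct)
  case (inv h)
  then have "\<And>n. h n \<in> carrier G" by blast
  then show ?case using inv by (auto intro: generate.inv)
qed (auto intro: generate.one generate.incl generate.eng)

lemma lower_central_carrier: "lower_central G k \<subseteq> carrier G"
proof (induction k)
  case (Suc k)
  have "{x \<otimes> y \<otimes> inv x \<otimes> inv y |x y. x \<in> carrier G \<and> y \<in> lower_central G k} \<subseteq> carrier G"
    using Suc by auto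
  then show ?case using generate_in_carrier by auto
qed auto

lemma lower_central_sequence_group:
  "lower_central (sequence_group G) k \<subseteq> {f. \<forall>n. f n \<in> lower_central G k}"
proof (induction k)
  case (Suc k)
  let ?B = "{x \<otimes> y \<otimes> inv x \<otimes> inv y |x y. x \<in> carrier G \<and> y \<in> lower_central G k}"
  have B: "?B \<subseteq> carrier G" using subsetD[OF lower_central_carrier] by auto
  have "{x \<otimes>\<^bsub>sequence_group G\<^esub> y \<otimes>\<^bsub>sequence_group G\<^esub> inv\<^bsub>sequence_group G\<^esub> x \<otimes>\<^bsub>sequence_group G\<^esub> inv\<^bsub>sequence_group G\<^esub> y |x y.
      x \<in> carrier (sequence_group G) \<and> y \<in> lower_central (sequence_group G) k} \<subseteq> {f. \<forall>n. f n \<in> ?B}"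
  proof clarify
    fix x y n assume x: "x \<in> carrier (sequence_group G)" and y: "y \<in> lower_central (sequence_group G) k"
    have y': "\<And>n. y n \<in> lower_central G k" using y Suc by auto
    then have "\<And>n. y n \<in> carrier G" using lower_central_carrier by blast
    then show "\<exists>xa ya. (x \<otimes>\<^bsub>sequence_group G\<^esub> y \<otimes>\<^bsub>sequence_group G\<^esub> inv\<^bsub>sequence_group G\<^esub> x \<otimes>\<^bsub>sequence_group G\<^esub>
        inv\<^bsub>sequence_group G\<^esub> y) n = xa \<otimes> ya \<otimes> inv xa \<otimes> inv ya \<and> xa \<in> carrier G \<and> ya \<in> lower_central G k"
      using x y' by (intro exI[of _ "x n"] exI[of _ "y n"]) auto
  qed
  from sequence_group_generate[OF _ this B B] show ?case by (auto simp: subset_iff)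
qed auto

lemma series_le_lower_central: "A \<subseteq> carrier G \<Longrightarrow> series G A k \<subseteq> lower_central G k"
proof (induction k)
  case 0 then show ?case using generate_in_carrier by auto
next
  case (Suc k)
  have "{commutator G x y | x y. x \<in> generate G A \<and> y \<in> series G A k}
    \<subseteq> {x \<otimes> y \<otimes> inv x \<otimes> inv y |x y. x \<in> carrier G \<and> y \<in> lower_central G k}"
    using generate_in_carrier[OF Suc(2)] Suc unfolding commutator_def by blast
  then show ?case by (simp add: mono_generate)
qed

lemma length_power_product:
  fixes L :: "'a \<Rightarrow> real"
  assumes one: "L \<one> = 0" and mult: "\<And>g h. g \<in> carrier G \<Longrightarrow> h \<in> carrier G \<Longrightarrow> L (g \<otimes> h) \<le> L g + L h"
    and bound: "\<And>a s. (a, s) \<in> set l \<Longrightarrow> a \<in> carrier G \<and> L (a [^] (s::int)) \<le> b (a, s)"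
  shows "power_product G l \<in> carrier G \<and> L (power_product G l) \<le> (\<Sum>q\<leftarrow>l. b q)"
  using bound
proof (induction l)
  case (Cons q l)
  obtain a s where q: "q = (a, s)" by (cases q)
  have "L (a [^] s \<otimes> power_product G l) \<le> L (a [^] s) + L (power_product G l)"
    using Cons q by (intro mult) auto
  then show ?case using Cons q by fastforce
qed (simp add: one)

lemma sequence_power_product:
  assumes "\<And>q. q \<in> set l \<Longrightarrow> (\<forall>n. fst q n \<in> carrier G)"
  shows "power_product (sequence_group G) l n = power_product G (map (\<lambda>(f, s). (f n, s)) l)"
  using assms
proof (induction l)
  case (Cons q l)
  obtain f s where q: "q = (f, s)" by (cases q)
  have "(f [^]\<^bsub>sequence_group G\<^esub> s) n = f n [^] s"
    using Cons.prems[of q] q by (subst sequence_group_int_pow) auto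
  then show ?case using Cons q by (auto simp: power_product_def)
qed (simp add: power_product_def)

text \<open>
  In the group of sequences, the sequence \<open>m \<mapsto> x\<^sup>D\<^sup>m g x\<^sup>-\<^sup>D\<^sup>m\<close> is a product of powers of the first
  few sequences \<open>m \<mapsto> x\<^sup>k\<^sup>m g x\<^sup>-\<^sup>k\<^sup>m\<close>, and the number of factors does not depend on \<open>D\<close>. Each
  factor has length of order \<open>m\<close>, while \<open>D\<close> can be taken as large as desired.
\<close>

theorem nilpotent_conjugation_sublinear:
  fixes L :: "'a \<Rightarrow> real" and \<epsilon> :: real
  assumes nil: "lower_central G c = {\<one>}"
    and L1: "L \<one> = 0" and L0: "\<And>g. g \<in> carrier G \<Longrightarrow> L g \<ge> 0"
    and Lm: "\<And>g h. g \<in> carrier G \<Longrightarrow> h \<in> carrier G \<Longrightarrow> L (g \<otimes> h) \<le> L g + L h"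
    and Li: "\<And>g. g \<in> carrier G \<Longrightarrow> L (inv g) = L g"
    and x: "x \<in> carrier G" and g: "g \<in> carrier G" and eps: "\<epsilon> > 0"
  shows "\<exists>C. \<forall>n. L (x [^] (n::nat) \<otimes> g \<otimes> inv (x [^] n)) \<le> \<epsilon> * real n + C"
proof -
  define Q where "Q = sequence_group G"
  interpret Q: group Q unfolding Q_def by (rule sequence_group)
  define xs where "xs = (\<lambda>m::nat. x [^] m)"
  define gs where "gs = (\<lambda>m::nat. g)"
  define a where "a = (\<lambda>k::nat. xs [^]\<^bsub>Q\<^esub> k \<otimes>\<^bsub>Q\<^esub> gs \<otimes>\<^bsub>Q\<^esub> inv\<^bsub>Q\<^esub> (xs [^]\<^bsub>Q\<^esub> k))"
  have xc: "xs \<in> carrier Q" "gs \<in> carrier Q" using x g by (auto simp: Q_def xs_def gs_def)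
  have ac: "a k \<in> carrier Q" for k using xc by (simp add: a_def)
  have a_eq: "a k m = x [^] (k * m) \<otimes> g \<otimes> inv (x [^] (k * m))" for k m
    using x g unfolding a_def Q_def xs_def gs_def by (simp add: nat_pow_pow mult.commute)
  have nilQ: "lower_central Q c = {\<one>\<^bsub>Q\<^esub>}"
  proof
    show "lower_central Q c \<subseteq> {\<one>\<^bsub>Q\<^esub>}"
      using lower_central_sequence_group[of c] nil by (auto simp: Q_def)
    show "{\<one>\<^bsub>Q\<^esub>} \<subseteq> lower_central Q c" by (cases c) (auto intro: generate.one)
  qed
  let ?A = "a ` {..<c}"
  have A: "?A \<subseteq> carrier Q" using ac by auto
  have "series Q ?A c = {\<one>\<^bsub>Q\<^esub>}"
    using Q.series_le_lower_central[OF A, of c] nilQ subgroup.one_closed[OF Q.series_subgroup[OF A, of c]] by auto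
  from Q.nilpotent_boundedly_generated[OF A _ this] obtain B where
    B: "\<forall>h\<in>generate Q ?A. \<exists>l. length l \<le> B \<and> fst ` set l \<subseteq> ?A \<and> h = power_product Q l"
    unfolding boundedly_generated_def by auto
  have Lpow: "L (y [^] (n::nat)) \<le> n * L y" if "y \<in> carrier G" for y n
  proof (induction n)
    case (Suc n) then show ?case using Lm[of "y [^] n" y] that by (simp add: algebra_simps)
  qed (simp add: L1)
  have Lipow: "L (y [^] (s::int)) \<le> \<bar>s\<bar> * L y" if "y \<in> carrier G" for y s
  proof (cases "s < 0")
    case True
    have "y [^] s = inv (y [^] nat (- s))" using True unfolding int_pow_def2 by (rule if_P)
    then have "L (y [^] s) = L (y [^] nat (- s))" using Li[OF nat_pow_closed[OF that]] by metis
    then show ?thesis using Lpow[OF that, of "nat (- s)"] True by simp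
  next
    case False
    have "y [^] s = y [^] nat s" using False unfolding int_pow_def2 by (rule if_not_P)
    then show ?thesis using Lpow[OF that, of "nat s"] False by auto
  qed
  have Lconj: "L (y \<otimes> h \<otimes> inv y) \<le> 2 * L y + L h" if "y \<in> carrier G" "h \<in> carrier G" for y h
    using Lm[of "y \<otimes> h" "inv y"] Lm[of y h] Li[of y] that by simp
  have main: "\<exists>C. \<forall>m::nat. L (a D m) \<le> (2 * B * c * L x) * m + C" for D
  proof -
    have "a D \<in> generate Q ?A" unfolding a_def
      by (rule Q.nilpotent_conjugates_generate[OF nilQ xc])
    then obtain l where l: "length l \<le> B" "fst ` set l \<subseteq> ?A" "a D = power_product Q l" using B by auto
    define C where "C = (\<Sum>q\<leftarrow>l. \<bar>snd q\<bar> * L g)"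
    have "L (a D m) \<le> (2 * B * c * L x) * m + C" for m :: nat
    proof -
      have "a D m = power_product G (map (\<lambda>(f, s). (f m, s)) l)"
        unfolding l(3) Q_def using l(2) ac
        by (intro sequence_power_product) (auto simp: Q_def)
      also have "L \<dots> \<le> (\<Sum>q\<leftarrow>map (\<lambda>(f, s). (f m, s)) l. (\<lambda>(y, s). 2 * (c * m * L x) + \<bar>s\<bar> * L g) q)"
      proof (rule conjunct2[OF length_power_product[OF L1 Lm]])
        fix y s assume "(y, s) \<in> set (map (\<lambda>(f, s). (f m, s)) l)"
        then obtain f where f: "(f, s) \<in> set l" "y = f m" by auto
        then obtain k where k: "k < c" "f = a k" using l(2) by force
        have y: "y = x [^] (k * m) \<otimes> g \<otimes> inv (x [^] (k * m))" using f k a_eq by simp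
        have ys: "y [^] s = x [^] (k * m) \<otimes> g [^] s \<otimes> inv (x [^] (k * m))"
          unfolding y using x g by (simp add: int_pow_conj)
        have "L (y [^] s) \<le> 2 * L (x [^] (k * m)) + L (g [^] s)"
          unfolding ys using x g by (intro Lconj) auto
        also have "\<dots> \<le> 2 * (real (k * m) * L x) + \<bar>s\<bar> * L g"
          using Lpow[OF x, of "k * m"] Lipow[OF g, of s] by simp
        also have "\<dots> \<le> 2 * (c * m * L x) + \<bar>s\<bar> * L g"
          using k L0[OF x] by (auto intro!: mult_right_mono)
        finally show "y \<in> carrier G \<and> L (y [^] s) \<le> (\<lambda>(y, s). 2 * (c * m * L x) + \<bar>s\<bar> * L g) (y, s)"
          using x g y by auto
      qed auto
      also have "\<dots> = length l * (2 * (c * m * L x)) + C"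
        unfolding C_def by (induction l) (auto simp: algebra_simps)
      also have "\<dots> \<le> B * (2 * (c * m * L x)) + C"
        using l(1) L0[OF x] by (auto intro!: mult_right_mono)
      finally show ?thesis by (simp add: algebra_simps)
    qed
    then show ?thesis by blast
  qed
  obtain D :: nat where D: "D > 0" "2 * B * c * L x \<le> \<epsilon> * D"
  proof -
    obtain D :: nat where "2 * B * c * L x / \<epsilon> < D" using reals_Archimedean2 by blast
    then have "2 * B * c * L x \<le> \<epsilon> * Suc D" using eps by (simp add: field_simps)
    then show ?thesis using that[of "Suc D"] by simp
  qed
  obtain C where C: "\<And>m. L (a D m) \<le> (2 * B * c * L x) * m + C" using main by blast
  show ?thesis
  proof (intro exI allI)
    fix n :: nat
    define m r where "m = n div D" and "r = n mod D"
    have n: "n = r + D * m" unfolding m_def r_def by simp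
    have "x [^] n \<otimes> g \<otimes> inv (x [^] n) = x [^] r \<otimes> a D m \<otimes> inv (x [^] r)"
      unfolding n a_eq using x g by (simp add: nat_pow_mult[symmetric] inv_mult_group m_assoc)
    also have "L \<dots> \<le> 2 * L (x [^] r) + L (a D m)"
      using x ac[of D] by (intro Lconj) (auto simp: Q_def)
    also have "\<dots> \<le> 2 * (D * L x) + ((2 * B * c * L x) * m + C)"
    proof -
      have "r * L x \<le> D * L x" unfolding r_def using D(1) L0[OF x]
        by (intro mult_right_mono) (auto intro: less_imp_le)
      then show ?thesis using Lpow[OF x, of r] C[of m] by linarith
    qed
    also have "\<dots> \<le> 2 * (D * L x) + (\<epsilon> * D * m + C)"
      using D(2) by (intro add_left_mono add_right_mono mult_right_mono) auto
    also have "\<dots> \<le> \<epsilon> * n + (2 * (D * L x) + C)"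
      unfolding n using eps by (simp add: algebra_simps)
    finally show "L (x [^] n \<otimes> g \<otimes> inv (x [^] n)) \<le> \<epsilon> * n + (2 * (D * L x) + C)" .
  qed
qed

end

section \<open>Finite-index subgroups and the rank of a finitely generated abelian group\<close>

locale cayley_normal = cayley +
  fixes N
  assumes normal_N: "N \<lhd> G" and fin_index: "finite_index G N"
begin

lemma N_subgroup: "subgroup N G"
  using normal_N by (simp add: normal_imp_subgroup)

lemma N_carrier: "N \<subseteq> carrier G"
  using subgroup.subset[OF N_subgroup] .

lemma N_in_carrier [simp]: "x \<in> N \<Longrightarrow> x \<in> carrier G"
  using N_carrier by auto

lemma N_one [simp]: "\<one> \<in> N"
  using subgroup.one_closed[OF N_subgroup] .

lemma N_mult [simp]: "x \<in> N \<Longrightarrow> y \<in> N \<Longrightarrow> x \<otimes> y \<in> N"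
  using subgroup.m_closed[OF N_subgroup] .

lemma N_inv [simp]: "x \<in> N \<Longrightarrow> inv x \<in> N"
  using subgroup.m_inv_closed[OF N_subgroup] .

lemma N_pow [simp]: "x \<in> N \<Longrightarrow> x [^] (n::nat) \<in> N"
  by (induction n) auto

lemma N_int_pow [simp]: "x \<in> N \<Longrightarrow> x [^] (n::int) \<in> N"
  by (rule subgroup_int_pow_closed[OF N_subgroup])

lemma N_conj: "g \<in> carrier G \<Longrightarrow> x \<in> N \<Longrightarrow> g \<otimes> x \<otimes> inv g \<in> N"
  using normal.inv_op_closed2[OF normal_N] .

lemma N_conj': "g \<in> carrier G \<Longrightarrow> x \<in> N \<Longrightarrow> inv g \<otimes> x \<otimes> g \<in> N"
  using normal.inv_op_closed1[OF normal_N] .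

definition rep where
  "rep g = (if g \<in> N then \<one> else SOME t. t \<in> N #> g)"

lemma rep_in:
  assumes "g \<in> carrier G"
  shows "rep g \<in> N #> g"
proof (cases "g \<in> N")
  case True
  then have "N #> g = N" using coset_join2[OF assms N_subgroup] by simp
  then show ?thesis using True by (simp add: rep_def)
next
  case False
  have "g \<in> N #> g" using assms by (simp add: rcos_self N_subgroup)
  then have "(SOME t. t \<in> N #> g) \<in> N #> g" by (rule someI)
  then show ?thesis using False by (simp add: rep_def)
qed

lemma rep_carrier [simp]: "g \<in> carrier G \<Longrightarrow> rep g \<in> carrier G"
  using rep_in[of g] by (auto simp: r_coset_def)

lemma rep_N: "g \<in> carrier G \<Longrightarrow> g \<otimes> inv (rep g) \<in> N"
  using rep_in[of g] by (auto simp: r_coset_def inv_mult_group m_assoc)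

lemma rep_mult: "x \<in> N \<Longrightarrow> g \<in> carrier G \<Longrightarrow> rep (x \<otimes> g) = rep g"
proof -
  assume x: "x \<in> N" and g: "g \<in> carrier G"
  have "g \<in> N" if "x \<otimes> g \<in> N" using N_mult[OF N_inv[OF x] that] x g by simp
  then have "x \<otimes> g \<in> N \<longleftrightarrow> g \<in> N" using N_mult[OF x] by blast
  moreover have "N #> (x \<otimes> g) = N #> g"
    using x g coset_mult_assoc[OF N_carrier, of x g] coset_join2[OF _ N_subgroup, of x] by simp
  ultimately show ?thesis by (simp add: rep_def)
qed

lemma rep_in_N [simp]: "g \<in> N \<Longrightarrow> rep g = \<one>"
  by (simp add: rep_def)

lemma finite_rep: "finite (rep ` carrier G)"
proof -
  have "rep ` carrier G \<subseteq> insert \<one> ((\<lambda>C. SOME t. t \<in> C) ` (rcosets N))"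
    by (auto simp: rep_def RCOSETS_def)
  then show ?thesis using fin_index unfolding finite_index_def by (meson finite_imageI finite_insert finite_subset)
qed

text \<open>Schreier's lemma.\<close>

lemma N_finitely_generated: "\<exists>Y. finite Y \<and> Y \<subseteq> N \<and> generate G Y = N"
proof -
  let ?Y = "(\<lambda>(t, s). t \<otimes> s \<otimes> inv (rep (t \<otimes> s))) ` (rep ` carrier G \<times> letters)"
  have Y: "?Y \<subseteq> N" using rep_N by auto
  have main: "set ss \<subseteq> letters \<Longrightarrow> wprod ss \<otimes> inv (rep (wprod ss)) \<in> generate G ?Y" for ss
  proof (induction ss rule: rev_induct)
    case Nil then show ?case by (simp add: generate.one)
  next
    case (snoc s ss)
    let ?g = "wprod ss"
    have g: "?g \<in> carrier G" and s: "s \<in> letters" using snoc by auto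
    have "rep (?g \<otimes> s) = rep (?g \<otimes> inv (rep ?g) \<otimes> (rep ?g \<otimes> s))"
      using g s by (simp add: m_assoc)
    also have "\<dots> = rep (rep ?g \<otimes> s)" using g s by (intro rep_mult rep_N) auto
    finally have eq: "rep (?g \<otimes> s) = rep (rep ?g \<otimes> s)" .
    have "?g \<otimes> s \<otimes> inv (rep (?g \<otimes> s)) =
        (?g \<otimes> inv (rep ?g)) \<otimes> (rep ?g \<otimes> s \<otimes> inv (rep (rep ?g \<otimes> s)))"
      unfolding eq using g s by (simp add: m_assoc)
    also have "\<dots> \<in> generate G ?Y"
    proof (rule generate.eng)
      show "?g \<otimes> inv (rep ?g) \<in> generate G ?Y" using snoc by simp
      show "rep ?g \<otimes> s \<otimes> inv (rep (rep ?g \<otimes> s)) \<in> generate G ?Y"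
        using g s by (intro generate.incl image_eqI[of _ _ "(rep ?g, s)"]) auto
    qed
    finally show ?case using snoc s by (simp add: wprod_append)
  qed
  have "N \<subseteq> generate G ?Y"
  proof
    fix x assume x: "x \<in> N"
    obtain ss where "set ss \<subseteq> letters" "wprod ss = x" using ex_word[of x] x by auto
    then show "x \<in> generate G ?Y" using main[of ss] x by auto
  qed
  moreover have "generate G ?Y \<subseteq> N" using generate_subgroup_incl[OF Y N_subgroup] .
  ultimately show ?thesis using Y finite_rep finite_letters
    by (intro exI[of _ ?Y]) auto
qed

end

lemma (in group) additive_nat_pow:
  fixes k :: "'a \<Rightarrow> int"
  assumes H: "subgroup H G" and k: "\<And>x y. x \<in> H \<Longrightarrow> y \<in> H \<Longrightarrow> k (x \<otimes> y) = k x + k y" and x: "x \<in> H"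
  shows "k (x [^] (n::nat)) = int n * k x"
proof -
  have *: "x [^] (n::nat) \<in> H" for n
    by (induction n) (use H x in \<open>auto intro: subgroup.one_closed subgroup.m_closed\<close>)
  have "k (\<one> \<otimes> \<one>) = k \<one> + k \<one>" using H by (intro k) (auto intro: subgroup.one_closed)
  then have "k \<one> = 0" by simp
  then show ?thesis by (induction n) (use * x in \<open>auto simp: k algebra_simps\<close>)
qed

text \<open>
  Coordinates on a finitely generated abelian group, up to torsion. Adjoining a generator \<open>g\<close> to
  a subgroup \<open>H\<close> either gives a new coordinate, or some power \<open>g\<^sup>k\<close> lies in \<open>H\<close>; then \<open>x\<^sup>k\<close> lies
  in \<open>H\<close> for all \<open>x\<close> in the larger group, and the coordinates of \<open>x\<^sup>k\<close> serve as coordinates of \<open>x\<close>.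
\<close>

lemma (in comm_group) coordinates_exist:
  assumes fin: "finite Y" and Y: "Y \<subseteq> carrier G"
  shows "\<exists>d (m::int) e (K :: 'a \<Rightarrow> nat \<Rightarrow> int). m > 0 \<and> (\<forall>j<d. e j \<in> generate G Y) \<and>
    (\<forall>x\<in>generate G Y. \<forall>y\<in>generate G Y. \<forall>j. K (x \<otimes> y) j = K x j + K y j) \<and>
    (\<forall>i<d. \<forall>j<d. K (e i) j = (if i = j then m else 0)) \<and>
    (\<forall>x\<in>generate G Y. (\<forall>j<d. K x j = 0) \<longrightarrow> (\<exists>n::nat. n > 0 \<and> x [^] n = \<one>))"
  using assms
proof (induction Y rule: finite_induct)
  case empty
  have "generate G {} = {\<one>}" by (simp add: generate_empty)
  then show ?case
    by (intro exI[of _ 0] exI[of _ 1] exI[of _ "\<lambda>_. \<one>"] exI[of _ "\<lambda>_ _. 0"])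
       (auto intro!: exI[of _ 1])
next
  case (insert g Y)
  then have g: "g \<in> carrier G" and Y: "Y \<subseteq> carrier G" by auto
  let ?H = "generate G Y" and ?H' = "generate G (insert g Y)"
  obtain d m e K where IH: "m > (0::int)" "\<forall>j<(d::nat). e j \<in> ?H"
    "\<forall>x\<in>?H. \<forall>y\<in>?H. \<forall>j. K (x \<otimes> y) j = K x j + (K y j :: int)"
    "\<forall>i<d. \<forall>j<d. K (e i) j = (if i = j then m else 0)"
    "\<forall>x\<in>?H. (\<forall>j<d. K x j = 0) \<longrightarrow> (\<exists>n::nat. n > 0 \<and> x [^] n = \<one>)"
    using insert.IH[OF Y] by (elim exE conjE) (rule that)
  have m: "m > 0" by (rule IH(1))
  have e: "e j \<in> ?H" if "j < d" for j using IH(2) that by simp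
  have K: "K (x \<otimes> y) j = K x j + K y j" if "x \<in> ?H" "y \<in> ?H" for x y j using IH(3) that by simp
  have Ke: "K (e i) j = (if i = j then m else 0)" if "i < d" "j < d" for i j using IH(4) that by simp
  have Kt: "\<exists>n::nat. n > 0 \<and> x [^] n = \<one>" if "x \<in> ?H" "\<And>j. j < d \<Longrightarrow> K x j = 0" for x
    using IH(5) that by simp
  have H: "subgroup ?H G" using generate_is_subgroup[OF Y] .
  have H': "subgroup ?H' G" using generate_is_subgroup insert.prems by auto
  have HH': "?H \<subseteq> ?H'" by (intro mono_generate) auto
  have Hc: "?H \<subseteq> carrier G" and Hc': "?H' \<subseteq> carrier G"
    using H H' subgroup.subset by auto
  have decomp: "\<exists>s::int. \<exists>u\<in>?H. x = g [^] s \<otimes> u" if "x \<in> ?H'" for x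
  proof (rule generate_insert_normalizing[OF H g])
    have "insert g Y \<subseteq> insert g ?H" by (auto intro: generate.incl)
    then show "x \<in> generate G (insert g ?H)" using that mono_generate by blast
    fix u assume "u \<in> ?H"
    then have "u \<in> carrier G" "u \<in> ?H" using Hc by auto
    moreover from this have "g \<otimes> u \<otimes> inv g = u" "inv g \<otimes> u \<otimes> g = u"
      using g by (simp_all add: m_comm[OF g] m_comm[of "inv g"] m_assoc)
    ultimately show "g \<otimes> u \<otimes> inv g \<in> ?H" "inv g \<otimes> u \<otimes> g \<in> ?H" by simp_all
  qed
  have gH': "g \<in> ?H'" by (auto intro: generate.incl)
  show ?case
  proof (cases "\<exists>k::nat. k > 0 \<and> g [^] k \<in> ?H")
    case True
    then obtain k :: nat where k: "k > 0" "g [^] k \<in> ?H" by auto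
    have pk: "x [^] k \<in> ?H" if x: "x \<in> ?H'" for x
    proof -
      obtain s :: int and u where su: "u \<in> ?H" "x = g [^] s \<otimes> u" using decomp[OF x] by auto
      have "x [^] k = (g [^] s) [^] k \<otimes> u [^] k"
        unfolding su(2) using g su(1) Hc by (intro nat_pow_distrib) auto
      also have "(g [^] s) [^] k = (g [^] k) [^] s"
        using g int_pow_pow[OF g, of s "int k"] int_pow_pow[OF g, of "int k" s]
        by (simp add: int_pow_int mult.commute)
      finally have "x [^] k = (g [^] k) [^] s \<otimes> u [^] int k" by (simp add: int_pow_int)
      then show ?thesis
        using subgroup_int_pow_closed[OF H su(1), of "int k"] subgroup_int_pow_closed[OF H k(2), of s] H
        by (simp only: subgroup.m_closed)
    qed
    have hom: "K ((x \<otimes> y) [^] k) j = K (x [^] k) j + K (y [^] k) j" if "x \<in> ?H'" "y \<in> ?H'" for x y j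
    proof -
      have "(x \<otimes> y) [^] k = x [^] k \<otimes> y [^] k" using that Hc' by (intro nat_pow_distrib) auto
      then show ?thesis using K[OF pk[OF that(1)] pk[OF that(2)]] by simp
    qed
    have pe: "K (e i [^] k) j = int k * K (e i) j" if "i < d" for i j
      by (rule additive_nat_pow[OF H, of "\<lambda>x. K x j"]) (use K e that in auto)
    have tor: "\<exists>n::nat. n > 0 \<and> x [^] n = \<one>" if "x \<in> ?H'" "\<And>j. j < d \<Longrightarrow> K (x [^] k) j = 0" for x
    proof -
      have "\<exists>n::nat. n > 0 \<and> (x [^] k) [^] n = \<one>" by (rule Kt[OF pk[OF that(1)] that(2)])
      then obtain n :: nat where "n > 0" "(x [^] k) [^] n = \<one>" by blast
      then show ?thesis using k that(1) Hc' nat_pow_pow[of x k n] by (intro exI[of _ "k * n"]) auto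
    qed
    show ?thesis
      using m k e HH' hom Ke pe tor
      by (intro exI[of _ d] exI[of _ "int k * m"] exI[of _ e] exI[of _ "\<lambda>x. K (x [^] k)"]) auto
  next
    case False
    have uniq: "s = s' \<and> u = u'"
      if "u \<in> ?H" "u' \<in> ?H" "g [^] (s::int) \<otimes> u = g [^] (s'::int) \<otimes> u'" for s s' u u'
    proof -
      have uc: "u \<in> carrier G" "u' \<in> carrier G" using that Hc by auto
      have ww: "g [^] (s - s') = u' \<otimes> inv u"
      proof -
        have "g [^] (s - s') = inv (g [^] s') \<otimes> (g [^] s \<otimes> u) \<otimes> inv u"
        proof -
          have "inv (g [^] s') \<otimes> (g [^] s \<otimes> u) \<otimes> inv u = inv (g [^] s') \<otimes> g [^] s"
            using g uc by (simp add: m_assoc)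
          also have "\<dots> = g [^] s \<otimes> inv (g [^] s')" using g by (intro m_comm) auto
          finally show ?thesis using g by (simp add: int_pow_diff)
        qed
        then show ?thesis unfolding that(3) using g uc by simp
      qed
      then have w: "g [^] (s - s') \<in> ?H" using that H by (simp add: subgroup.m_closed subgroup.m_inv_closed)
      then have w': "g [^] (s' - s) \<in> ?H"
        using subgroup.m_inv_closed[OF H w] int_pow_neg[OF g, of "s - s'"] by (metis minus_diff_eq)
      have "g [^] (nat \<bar>s - s'\<bar>) \<in> ?H"
      proof (cases "s \<ge> s'")
        case True
        then have "g [^] (nat \<bar>s - s'\<bar>) = g [^] (s - s')" by (metis abs_of_nonneg diff_ge_0_iff_ge int_nat_eq int_pow_int)
        then show ?thesis using w by metis
      next
        case False
        then have "g [^] (nat \<bar>s - s'\<bar>) = g [^] (s' - s)"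
          by (metis abs_minus_commute abs_of_nonneg diff_ge_0_iff_ge int_nat_eq int_pow_int linorder_le_cases)
        then show ?thesis using w' by metis
      qed
      then have "\<not> 0 < nat \<bar>s - s'\<bar>" using False by (metis (full_types))
      then have "s = s'" by simp
      then show ?thesis using that(3) g uc by auto
    qed
    define sg where "sg x = (SOME s::int. \<exists>u\<in>?H. x = g [^] s \<otimes> u)" for x
    define ug where "ug x = (SOME u. u \<in> ?H \<and> x = g [^] sg x \<otimes> u)" for x
    have sgug: "ug x \<in> ?H \<and> x = g [^] sg x \<otimes> ug x" if "x \<in> ?H'" for x
    proof -
      have "\<exists>u\<in>?H. x = g [^] sg x \<otimes> u" unfolding sg_def by (rule someI_ex) (use decomp[OF that] in blast)
      then have "\<exists>u. u \<in> ?H \<and> x = g [^] sg x \<otimes> u" by blast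
      then show ?thesis unfolding ug_def by (rule someI_ex)
    qed
    have val: "sg (g [^] s \<otimes> u) = s \<and> ug (g [^] s \<otimes> u) = u" if "u \<in> ?H" for s u
    proof -
      have "g [^] s \<otimes> u \<in> ?H'"
        using subgroup_int_pow_closed[OF H' gH'] that HH' by (auto intro: generate.eng)
      from sgug[OF this] show ?thesis using uniq[OF _ that] by metis
    qed
    define K' where "K' x j = (if j < d then K (ug x) j else if j = d then m * sg x else 0)" for x j
    have hom: "K' (x \<otimes> y) j = K' x j + K' y j" if "x \<in> ?H'" "y \<in> ?H'" for x y j
    proof -
      note x = sgug[OF that(1)] and y = sgug[OF that(2)]
      have c: "ug x \<in> carrier G" "ug y \<in> carrier G" using x y Hc by auto
      have "x \<otimes> y = (g [^] sg x \<otimes> ug x) \<otimes> (g [^] sg y \<otimes> ug y)" using x y by simp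
      also have "\<dots> = g [^] (sg x + sg y) \<otimes> (ug x \<otimes> ug y)"
        using g c int_pow_closed[OF g, of "sg x"] int_pow_closed[OF g, of "sg y"]
        by (simp add: int_pow_mult m_assoc m_lcomm)
      finally have eq: "x \<otimes> y = g [^] (sg x + sg y) \<otimes> (ug x \<otimes> ug y)" .
      have "ug x \<otimes> ug y \<in> ?H" using x y by (auto intro: generate.eng)
      from val[OF this, of "sg x + sg y"] show ?thesis
        using K[of "ug x" "ug y" j] x y unfolding K'_def eq[symmetric] by (auto simp: algebra_simps)
    qed
    have valH: "sg u = 0 \<and> ug u = u" if "u \<in> ?H" for u
      using val[OF that, of 0] that Hc by auto
    have valg: "sg g = 1 \<and> ug g = \<one>" using val[OF generate.one, of 1] g by auto
    have "K (\<one> \<otimes> \<one>) j = K \<one> j + K \<one> j" for j by (intro K) (auto intro: generate.one)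
    then have K1: "K \<one> j = 0" for j by simp
    have tor: "\<exists>n::nat. n > 0 \<and> x [^] n = \<one>" if "x \<in> ?H'" "\<And>j. j < Suc d \<Longrightarrow> K' x j = 0" for x
    proof -
      have "sg x = 0" using that(2)[of d] m by (simp add: K'_def)
      then have "x = ug x" "ug x \<in> ?H" using sgug[OF that(1)] Hc by auto
      moreover have "K (ug x) j = 0" if "j < d" for j using that \<open>\<And>j. j < Suc d \<Longrightarrow> K' x j = 0\<close>[of j]
        by (simp add: K'_def)
      ultimately show ?thesis using Kt[of "ug x"] by metis
    qed
    have ee: "(e(d := g)) j \<in> ?H'" if "j < Suc d" for j using that e HH' gH' by (auto simp: less_Suc_eq)
    have Kee: "K' ((e(d := g)) i) j = (if i = j then m else 0)" if "i < Suc d" "j < Suc d" for i j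
      using that valg K1 Ke[of i j] valH[OF e, of i] by (auto simp: K'_def less_Suc_eq)
    show ?thesis
      using m ee hom Kee tor
      by (intro exI[of _ "Suc d"] exI[of _ m] exI[of _ "e(d := g)"] exI[of _ K']) blast
  qed
qed

section \<open>Norms on the real tensor product of an abelian group\<close>

context comm_group begin

definition tcoset :: "('a \<times> real \<Rightarrow>\<^sub>0 int) \<Rightarrow> ('a \<times> real \<Rightarrow>\<^sub>0 int) set" where
  "tcoset x = tensor_rels G #>\<^bsub>tensor_free G\<^esub> x"

definition tensor_relators :: "('a \<times> real \<Rightarrow>\<^sub>0 int) set" where
  "tensor_relators = {frag_of (a \<otimes> b, r) - frag_of (a, r) - frag_of (b, r) | a b r.
          a \<in> carrier G \<and> b \<in> carrier G}
      \<union> {frag_of (a, r + s) - frag_of (a, r) - frag_of (a, s) | a r s. a \<in> carrier G}"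

lemma tensor_free_simps [simp]:
  "v \<in> carrier (tensor_free G) \<longleftrightarrow> Poly_Mapping.keys v \<subseteq> carrier G \<times> (UNIV :: real set)"
  "v \<otimes>\<^bsub>tensor_free G\<^esub> u = v + u" "\<one>\<^bsub>tensor_free G\<^esub> = 0"
  by (simp_all add: tensor_free_def)

lemma tensor_free_inv [simp]:
  "Poly_Mapping.keys v \<subseteq> carrier G \<times> (UNIV :: real set) \<Longrightarrow> inv\<^bsub>tensor_free G\<^esub> v = - v"
  by (simp add: tensor_free_def)

lemma tensor_free_comm_group: "comm_group (tensor_free G)"
  by (simp add: tensor_free_def abelian_free_Abelian_group)

lemma keys_frag_of_pair: "(a, r) \<in> P \<Longrightarrow> Poly_Mapping.keys (frag_of (a, r)) \<subseteq> P"
  by simp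

lemma tensor_relators_sub: "tensor_relators \<subseteq> carrier (tensor_free G)"
proof -
  have "Poly_Mapping.keys (u - v - w) \<subseteq> carrier G \<times> (UNIV :: real set)"
    if "Poly_Mapping.keys u \<subseteq> carrier G \<times> (UNIV :: real set)" "Poly_Mapping.keys v \<subseteq> carrier G \<times> (UNIV :: real set)"
      "Poly_Mapping.keys w \<subseteq> carrier G \<times> (UNIV :: real set)" for u v w :: "('a \<times> real) \<Rightarrow>\<^sub>0 int"
    using that keys_diff[of "u - v" w] keys_diff[of u v] by blast
  then show ?thesis unfolding tensor_relators_def by auto
qed

lemma tensor_rels_alt: "tensor_rels G = generate (tensor_free G) tensor_relators"
  unfolding tensor_rels_def tensor_relators_def by simp

lemma tensor_rels_subgroup: "subgroup (tensor_rels G) (tensor_free G)"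
  unfolding tensor_rels_alt
  using group.generate_is_subgroup[OF comm_group.axioms(2)[OF tensor_free_comm_group] tensor_relators_sub] .

lemma tensor_rels_normal: "tensor_rels G \<lhd> tensor_free G"
  using comm_group.subgroup_imp_normal[OF tensor_free_comm_group tensor_rels_subgroup] .

lemma real_tensor_carrier: "carrier (real_tensor G) = tcoset ` carrier (tensor_free G)"
  unfolding real_tensor_def carrier_FactGroup tcoset_def ..

lemma tcoset_in [simp]: "Poly_Mapping.keys v \<subseteq> carrier G \<times> (UNIV :: real set) \<Longrightarrow> tcoset v \<in> carrier (real_tensor G)"
  by (auto simp: real_tensor_carrier)

lemma tcoset_mult:
  "u \<in> carrier (tensor_free G) \<Longrightarrow> v \<in> carrier (tensor_free G) \<Longrightarrow>
    tcoset u \<otimes>\<^bsub>real_tensor G\<^esub> tcoset v = tcoset (u + v)"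
  using normal.rcos_sum[OF tensor_rels_normal, of u v] by (simp add: real_tensor_def tcoset_def)

lemma tcoset_eqI:
  assumes "u \<in> carrier (tensor_free G)" "v - u \<in> tensor_rels G"
  shows "tcoset u = tcoset v"
  unfolding tcoset_def
proof (rule group.repr_independence[OF comm_group.axioms(2)[OF tensor_free_comm_group]])
  show "v \<in> tensor_rels G #>\<^bsub>tensor_free G\<^esub> u"
    using assms unfolding r_coset_def by (auto intro!: bexI[of _ "v - u"])
qed (use assms tensor_rels_subgroup in auto)

lemma zero_in_rels: "0 \<in> tensor_rels G"
  using subgroup.one_closed[OF tensor_rels_subgroup] by simp

lemma rels_uminus: "v \<in> tensor_rels G \<Longrightarrow> - v \<in> tensor_rels G"
  using subgroup.m_inv_closed[OF tensor_rels_subgroup, of v] subgroup.mem_carrier[OF tensor_rels_subgroup, of v]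
  by simp

lemma rels_add: "u \<in> tensor_rels G \<Longrightarrow> v \<in> tensor_rels G \<Longrightarrow> u + v \<in> tensor_rels G"
  using subgroup.m_closed[OF tensor_rels_subgroup, of u v] by simp

lemma one_real_tensor [simp]: "\<one>\<^bsub>real_tensor G\<^esub> = tensor_rels G"
  by (simp add: real_tensor_def)

lemma tcoset_0: "tcoset 0 = tensor_rels G"
  unfolding tcoset_def r_coset_def by auto

lemma tcoset_rels: "u \<in> tensor_rels G \<Longrightarrow> tcoset u = tensor_rels G"
  using tcoset_eqI[of u 0] rels_uminus[of u] subgroup.mem_carrier[OF tensor_rels_subgroup, of u] by (simp add: tcoset_0)

lemma tcoset_eq_rels_iff:
  assumes "u \<in> carrier (tensor_free G)" shows "tcoset u = tensor_rels G \<longleftrightarrow> u \<in> tensor_rels G"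
proof
  assume "tcoset u = tensor_rels G"
  moreover have "u \<in> tcoset u" unfolding tcoset_def r_coset_def using zero_in_rels by force
  ultimately show "u \<in> tensor_rels G" by simp
qed (rule tcoset_rels)

lemma pure_tensor_alt: "pure_tensor G a r = tcoset (frag_of (a, r))"
  by (simp add: pure_tensor_def tcoset_def)

lemma relator_left: "a \<in> carrier G \<Longrightarrow> b \<in> carrier G \<Longrightarrow>
    frag_of (a \<otimes> b, r) - frag_of (a, r) - frag_of (b, r) \<in> tensor_rels G"
  unfolding tensor_rels_alt by (rule generate.incl) (auto simp: tensor_relators_def)

lemma relator_right: "a \<in> carrier G \<Longrightarrow>
    frag_of (a, r + s) - frag_of (a, r) - frag_of (a, s) \<in> tensor_rels G"
  unfolding tensor_rels_alt by (rule generate.incl) (auto simp: tensor_relators_def)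

lemma keys_add_sub: "Poly_Mapping.keys u \<subseteq> P \<Longrightarrow> Poly_Mapping.keys v \<subseteq> P \<Longrightarrow> Poly_Mapping.keys (u + v) \<subseteq> P"
  using keys_add[of u v] by blast

lemma keys_sum_sub: "(\<And>i. i \<in> I \<Longrightarrow> Poly_Mapping.keys (f i) \<subseteq> P) \<Longrightarrow> Poly_Mapping.keys (sum f I) \<subseteq> P"
proof (induction I rule: infinite_finite_induct)
  case (insert i I)
  then show ?case by (simp add: keys_add_sub)
qed auto

text \<open>An additive function on the free group that vanishes on the relators descends.\<close>

lemma rels_induct_additive:
  fixes f :: "('a \<times> real \<Rightarrow>\<^sub>0 int) \<Rightarrow> 'c::ab_group_add"
  assumes add: "\<And>u v. f (u + v) = f u + f v" and B: "\<And>u. u \<in> tensor_relators \<Longrightarrow> f u \<in> B"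
    and B0: "0 \<in> B" and Bm: "\<And>u. u \<in> B \<Longrightarrow> - u \<in> B" and Ba: "\<And>u v. u \<in> B \<Longrightarrow> v \<in> B \<Longrightarrow> u + v \<in> B"
    and u: "u \<in> tensor_rels G"
  shows "f u \<in> B"
proof -
  have f0: "f 0 = 0" using add[of 0 0] by simp
  then have fm: "f (- u) = - f u" for u using add[of u "- u"] by (simp add: eq_neg_iff_add_eq_0 add.commute)
  show ?thesis using u unfolding tensor_rels_alt
  proof induction
    case (inv h)
    then have "inv\<^bsub>tensor_free G\<^esub> h = - h" using tensor_relators_sub by auto
    then show ?case using inv fm B Bm by simp
  qed (use f0 B0 B Ba add in auto)
qed

lemma tensor_lift_tcoset:
  assumes h: "\<And>u. u \<in> tensor_rels G \<Longrightarrow> frag_extend (\<lambda>p. frag_of (\<theta> p)) u \<in> tensor_rels G"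
  shows "tensor_lift G \<theta> (tcoset v) = tcoset (frag_extend (\<lambda>p. frag_of (\<theta> p)) v)"
proof -
  let ?h = "frag_extend (\<lambda>p. frag_of (\<theta> p))"
  have "tensor_lift G \<theta> (tcoset v) = {r + ?h (s + v) | r s. r \<in> tensor_rels G \<and> s \<in> tensor_rels G}"
    unfolding tensor_lift_def tcoset_def set_mult_def r_coset_def by auto
  also have "\<dots> = {r + ?h v | r. r \<in> tensor_rels G}"
  proof safe
    fix r s assume "r \<in> tensor_rels G" "s \<in> tensor_rels G"
    then have "r + ?h s \<in> tensor_rels G" using h rels_add by auto
    moreover have "r + ?h (s + v) = (r + ?h s) + ?h v" by (simp add: frag_extend_add add.assoc)
    ultimately show "\<exists>ra. r + ?h (s + v) = ra + ?h v \<and> ra \<in> tensor_rels G" by metis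
  next
    fix r assume "r \<in> tensor_rels G"
    then show "\<exists>ra s. r + ?h v = ra + ?h (s + v) \<and> ra \<in> tensor_rels G \<and> s \<in> tensor_rels G"
      using zero_in_rels by (intro exI[of _ r] exI[of _ 0]) auto
  qed
  also have "\<dots> = tcoset (?h v)" unfolding tcoset_def r_coset_def by auto
  finally show ?thesis .
qed

lemma tensor_scale_tcoset:
  "tensor_scale G c (tcoset v) = tcoset (frag_extend (\<lambda>p. frag_of ((\<lambda>(a, r). (a, c * r)) p)) v)"
  unfolding tensor_scale_def
proof (rule tensor_lift_tcoset)
  fix u assume "u \<in> tensor_rels G"
  then show "frag_extend (\<lambda>p. frag_of ((\<lambda>(a, r). (a, c * r)) p)) u \<in> tensor_rels G"
  proof (rule rels_induct_additive[rotated -1])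
    fix u assume "u \<in> tensor_relators"
    then show "frag_extend (\<lambda>p. frag_of ((\<lambda>(a, r). (a, c * r)) p)) u \<in> tensor_rels G"
      unfolding tensor_relators_def
      by (auto simp: frag_extend_diff distrib_left intro: relator_left relator_right)
  qed (auto simp: frag_extend_add zero_in_rels rels_add rels_uminus)
qed

lemma tensor_map_tcoset:
  assumes "\<phi> \<in> hom G G"
  shows "tensor_map G \<phi> (tcoset v) = tcoset (frag_extend (\<lambda>p. frag_of ((\<lambda>(a, r). (\<phi> a, r)) p)) v)"
  unfolding tensor_map_def
proof (rule tensor_lift_tcoset)
  fix u assume "u \<in> tensor_rels G"
  then show "frag_extend (\<lambda>p. frag_of ((\<lambda>(a, r). (\<phi> a, r)) p)) u \<in> tensor_rels G"
  proof (rule rels_induct_additive[rotated -1])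
    fix u assume "u \<in> tensor_relators"
    then show "frag_extend (\<lambda>p. frag_of ((\<lambda>(a, r). (\<phi> a, r)) p)) u \<in> tensor_rels G"
      unfolding tensor_relators_def using assms
      by (auto simp: frag_extend_diff hom_def Pi_iff intro!: relator_left relator_right)
  qed (auto simp: frag_extend_add zero_in_rels rels_add rels_uminus)
qed

lemma pure_tensor_in [simp]: "a \<in> carrier G \<Longrightarrow> pure_tensor G a r \<in> carrier (real_tensor G)"
  unfolding pure_tensor_alt by (rule tcoset_in) simp

lemma pure_tensor_mult: "a \<in> carrier G \<Longrightarrow> b \<in> carrier G \<Longrightarrow>
    pure_tensor G (a \<otimes> b) r = pure_tensor G a r \<otimes>\<^bsub>real_tensor G\<^esub> pure_tensor G b r"
  using tcoset_eqI[of "frag_of (a, r) + frag_of (b, r)" "frag_of (a \<otimes> b, r)"] relator_left[of a b r]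
  unfolding pure_tensor_alt by (subst tcoset_mult) (auto simp: keys_add_sub algebra_simps)

lemma pure_tensor_add: "a \<in> carrier G \<Longrightarrow>
    pure_tensor G a (r + s) = pure_tensor G a r \<otimes>\<^bsub>real_tensor G\<^esub> pure_tensor G a s"
  using tcoset_eqI[of "frag_of (a, r) + frag_of (a, s)" "frag_of (a, r + s)"] relator_right[of a r s]
  unfolding pure_tensor_alt by (subst tcoset_mult) (auto simp: keys_add_sub algebra_simps)

lemma pure_tensor_one: "pure_tensor G \<one> r = tensor_rels G"
proof -
  have "- (frag_of (\<one> \<otimes> \<one>, r) - frag_of (\<one>, r) - frag_of (\<one>, r)) \<in> tensor_rels G"
    by (intro rels_uminus relator_left) auto
  then show ?thesis unfolding pure_tensor_alt by (intro tcoset_rels) simp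
qed

lemma pure_tensor_zero: "a \<in> carrier G \<Longrightarrow> pure_tensor G a 0 = tensor_rels G"
proof -
  assume "a \<in> carrier G"
  then have "- (frag_of (a, 0 + 0) - frag_of (a, 0) - frag_of (a, 0)) \<in> tensor_rels G"
    by (intro rels_uminus relator_right)
  then show ?thesis unfolding pure_tensor_alt by (intro tcoset_rels) simp
qed

lemma pure_tensor_scale: "tensor_scale G c (pure_tensor G a r) = pure_tensor G a (c * r)"
  unfolding pure_tensor_alt tensor_scale_tcoset by simp

lemma pure_tensor_map: "\<phi> \<in> hom G G \<Longrightarrow> tensor_map G \<phi> (pure_tensor G a r) = pure_tensor G (\<phi> a) r"
  unfolding pure_tensor_alt by (subst tensor_map_tcoset) simp_all

lemma real_tensor_group: "group (real_tensor G)"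
  unfolding real_tensor_def by (rule normal.factorgroup_is_group[OF tensor_rels_normal])

lemma pure_tensor_pow: "a \<in> carrier G \<Longrightarrow> pure_tensor G (a [^] (n::nat)) r = pure_tensor G a (n * r)"
proof (induction n)
  case (Suc n)
  then have "pure_tensor G (a [^] Suc n) r = pure_tensor G a (n * r) \<otimes>\<^bsub>real_tensor G\<^esub> pure_tensor G a r"
    by (simp add: pure_tensor_mult)
  also have "\<dots> = pure_tensor G a (n * r + r)" using Suc.prems by (simp add: pure_tensor_add)
  finally show ?case by (simp add: algebra_simps)
qed (simp add: pure_tensor_one pure_tensor_zero)

lemma pure_tensor_inv: "a \<in> carrier G \<Longrightarrow> pure_tensor G (inv a) r = pure_tensor G a (- r)"
proof -
  assume a: "a \<in> carrier G"
  have "pure_tensor G (inv a) r = inv\<^bsub>real_tensor G\<^esub> pure_tensor G a r"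
    using a pure_tensor_mult[of "inv a" a r]
    by (intro group.inv_equality[OF real_tensor_group, symmetric]) (auto simp: pure_tensor_one)
  moreover have "pure_tensor G a (- r) = inv\<^bsub>real_tensor G\<^esub> pure_tensor G a r"
    using a pure_tensor_add[of a "- r" r]
    by (intro group.inv_equality[OF real_tensor_group, symmetric]) (auto simp: pure_tensor_zero)
  ultimately show ?thesis by simp
qed

lemma pure_tensor_int_pow: "a \<in> carrier G \<Longrightarrow> pure_tensor G (a [^] (n::int)) r = pure_tensor G a (n * r)"
proof (cases "n < 0")
  case True
  assume a: "a \<in> carrier G"
  have "a [^] n = inv (a [^] nat (- n))" using True unfolding int_pow_def2 by (rule if_P)
  then have "pure_tensor G (a [^] n) r = pure_tensor G (a [^] nat (- n)) (- r)"
    using pure_tensor_inv[OF nat_pow_closed[OF a]] by metis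
  then show ?thesis using pure_tensor_pow[OF a, of "nat (- n)"] True by simp
next
  case False
  assume a: "a \<in> carrier G"
  have "a [^] n = a [^] nat n" using False unfolding int_pow_def2 by (rule if_not_P)
  then show ?thesis using pure_tensor_pow[OF a, of "nat n"] False by simp
qed

end

text \<open>
  On a finite-dimensional space, a norm dominates the coordinates. The induction adds one
  coordinate at a time; a sequence along which the norm of \<open>t\<^sub>n + \<delta>\<^sub>k\<close> tends to zero is Cauchy in
  the first \<open>k\<close> coordinates, so its limit is a nonzero vector of norm zero.
\<close>

lemma norm_dominates_coordinates:
  fixes \<Phi> :: "(nat \<Rightarrow> real) \<Rightarrow> real"
  assumes nn: "\<And>t. \<Phi> t \<ge> 0"
    and tri: "\<And>s t. \<Phi> (\<lambda>j. s j + t j) \<le> \<Phi> s + \<Phi> t"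
    and scale: "\<And>c t. \<Phi> (\<lambda>j. c * t j) = \<bar>c\<bar> * \<Phi> t"
    and pos: "\<And>t. \<forall>j\<ge>d. t j = 0 \<Longrightarrow> \<Phi> t = 0 \<Longrightarrow> t = (\<lambda>_. 0)"
  defines "\<delta> \<equiv> \<lambda>(k::nat) j. if j = k then 1 else (0::real)"
  shows "\<exists>C\<ge>0. \<forall>t. (\<forall>j\<ge>d. t j = 0) \<longrightarrow> \<Phi> t \<le> C * (\<Sum>j<d. \<bar>t j\<bar>)"
    and "\<exists>c>0. \<forall>t. (\<forall>j\<ge>d. t j = 0) \<longrightarrow> c * (\<Sum>j<d. \<bar>t j\<bar>) \<le> \<Phi> t"
proof -
  have \<Phi>0: "\<Phi> (\<lambda>_. 0) = 0" using scale[of 0 "\<lambda>_. 0"] by simp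
  have \<Phi>m: "\<Phi> (\<lambda>j. - t j) = \<Phi> t" for t using scale[of "-1" t] by simp
  define U where "U k = (\<Sum>i<k. \<Phi> (\<delta> i))" for k
  have U0: "U k \<ge> 0" for k unfolding U_def by (intro sum_nonneg nn)
  have upper: "\<Phi> t \<le> (\<Sum>j<k. \<bar>t j\<bar> * \<Phi> (\<delta> j))" if "\<forall>j\<ge>k. t j = 0" for t k
    using that
  proof (induction k arbitrary: t)
    case 0
    then have "t = (\<lambda>_. 0)" by auto
    then show ?case using \<Phi>0 by simp
  next
    case (Suc k)
    define t' where "t' j = (if j = k then 0 else t j)" for j
    have "\<forall>j\<ge>k. t' j = 0" using Suc.prems by (auto simp: t'_def)
    then have "\<Phi> t' \<le> (\<Sum>j<k. \<bar>t' j\<bar> * \<Phi> (\<delta> j))" by (rule Suc.IH)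
    also have "\<dots> = (\<Sum>j<k. \<bar>t j\<bar> * \<Phi> (\<delta> j))" by (intro sum.cong) (auto simp: t'_def)
    finally have 1: "\<Phi> t' \<le> (\<Sum>j<k. \<bar>t j\<bar> * \<Phi> (\<delta> j))" .
    have "t = (\<lambda>j. t' j + t k * \<delta> k j)" by (auto simp: t'_def \<delta>_def)
    then have "\<Phi> t \<le> \<Phi> t' + \<Phi> (\<lambda>j. t k * \<delta> k j)" using tri[of t' "\<lambda>j. t k * \<delta> k j"] by simp
    then show ?case using 1 by (simp add: scale)
  qed
  have upper': "\<Phi> t \<le> U k * (\<Sum>j<k. \<bar>t j\<bar>)" if "\<forall>j\<ge>k. t j = 0" for t k
  proof -
    have "\<Phi> (\<delta> j) \<le> U k" if "j < k" for j unfolding U_def using that nn by (intro member_le_sum) auto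
    then have "(\<Sum>j<k. \<bar>t j\<bar> * \<Phi> (\<delta> j)) \<le> (\<Sum>j<k. \<bar>t j\<bar> * U k)"
      by (intro sum_mono mult_left_mono) auto
    then show ?thesis using upper[OF that] by (simp add: sum_distrib_left mult.commute)
  qed
  then show "\<exists>C\<ge>0. \<forall>t. (\<forall>j\<ge>d. t j = 0) \<longrightarrow> \<Phi> t \<le> C * (\<Sum>j<d. \<bar>t j\<bar>)"
    using U0 by blast
  have "\<exists>c>0. \<forall>t. (\<forall>j\<ge>k. t j = 0) \<longrightarrow> c * (\<Sum>j<k. \<bar>t j\<bar>) \<le> \<Phi> t" if "k \<le> d" for k
    using that
  proof (induction k)
    case 0
    then show ?case using nn by (intro exI[of _ 1]) auto
  next
    case (Suc k)
    then obtain c where c: "c > 0" "\<And>t. \<forall>j\<ge>k. t j = 0 \<Longrightarrow> c * (\<Sum>j<k. \<bar>t j\<bar>) \<le> \<Phi> t" by auto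
    have "\<exists>\<mu>>0. \<forall>t. (\<forall>j\<ge>k. t j = 0) \<longrightarrow> \<mu> \<le> \<Phi> (\<lambda>j. t j + \<delta> k j)"
    proof (rule ccontr)
      assume *: "\<not> ?thesis"
      have "\<exists>t. (\<forall>j\<ge>k. t j = 0) \<and> \<Phi> (\<lambda>j. t j + \<delta> k j) < 1 / (real n + 1)" for n
      proof -
        have "0 < 1 / (real n + 1)" by simp
        then show ?thesis using * by (meson not_le_imp_less)
      qed
      then obtain t where t: "\<And>n j. j \<ge> k \<Longrightarrow> t n j = 0" "\<And>n. \<Phi> (\<lambda>j. t n j + \<delta> k j) < 1 / (real n + 1)"
        by metis
      have diff: "\<Phi> (\<lambda>j. t n j - t m j) \<le> 1 / (real n + 1) + 1 / (real m + 1)" for n m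
      proof -
        have "\<Phi> (\<lambda>j. t n j - t m j) = \<Phi> (\<lambda>j. (t n j + \<delta> k j) + - (t m j + \<delta> k j))" by simp
        also have "\<dots> \<le> \<Phi> (\<lambda>j. t n j + \<delta> k j) + \<Phi> (\<lambda>j. - (t m j + \<delta> k j))" by (rule tri)
        also have "\<Phi> (\<lambda>j. - (t m j + \<delta> k j)) = \<Phi> (\<lambda>j. t m j + \<delta> k j)" by (rule \<Phi>m)
        finally show ?thesis using t(2)[of n] t(2)[of m] by linarith
      qed
      have conv: "convergent (\<lambda>n. t n j)" for j
      proof (cases "j < k")
        case False
        then have "(\<lambda>n. t n j) = (\<lambda>n. 0)" using t(1) by auto
        then show ?thesis by (simp add: convergent_const)
      next
        case True
        have le: "c * \<bar>t n j - t m j\<bar> \<le> 1 / (real n + 1) + 1 / (real m + 1)" for n m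
        proof -
          have "\<bar>t n j - t m j\<bar> \<le> (\<Sum>j<k. \<bar>t n j - t m j\<bar>)"
            using True by (intro member_le_sum) auto
          then have "c * \<bar>t n j - t m j\<bar> \<le> c * (\<Sum>j<k. \<bar>t n j - t m j\<bar>)"
            using c(1) by (intro mult_left_mono) auto
          also have "\<dots> \<le> \<Phi> (\<lambda>j. t n j - t m j)" using t(1) by (intro c(2)) auto
          finally show ?thesis using diff[of n m] by linarith
        qed
        have "Cauchy (\<lambda>n. t n j)"
        proof (rule metric_CauchyI)
          fix e :: real assume e: "e > 0"
          obtain M :: nat where M: "2 / (c * e) < M" using reals_Archimedean2 by blast
          have "Real_Vector_Spaces.dist (t m j) (t n j) < e" if "m \<ge> M" "n \<ge> M" for m n
          proof -
            have "c * \<bar>t m j - t n j\<bar> \<le> 1 / (real M + 1) + 1 / (real M + 1)"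
              using le[of m n] that frac_le[of 1 1 "real M + 1" "real m + 1"] frac_le[of 1 1 "real M + 1" "real n + 1"]
              by auto
            also have "\<dots> < c * e"
            proof -
              have "2 < c * e * M" using M c(1) e by (simp add: field_simps)
              also have "\<dots> \<le> c * e * (M + 1)" using c(1) e by (intro mult_left_mono) auto
              finally show ?thesis by (simp add: field_simps)
            qed
            finally show ?thesis using c(1) by (simp add: dist_real_def)
          qed
          then show "\<exists>M. \<forall>m\<ge>M. \<forall>n\<ge>M. Real_Vector_Spaces.dist (t m j) (t n j) < e" by blast
        qed
        then show ?thesis by (simp add: Cauchy_convergent)
      qed
      define T where "T j = lim (\<lambda>n. t n j)" for j
      have lim: "(\<lambda>n. t n j) \<longlonglongrightarrow> T j" for j
        unfolding T_def using conv[of j] by (simp add: convergent_LIMSEQ_iff)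
      have T0: "T j = 0" if "j \<ge> k" for j
        using that t(1) unfolding T_def by (simp add: limI)
      have bound: "\<Phi> (\<lambda>j. T j + \<delta> k j) \<le> 1 / (real n + 1) + U k * (\<Sum>j<k. \<bar>T j - t n j\<bar>)" for n
      proof -
        have "\<Phi> (\<lambda>j. T j + \<delta> k j) = \<Phi> (\<lambda>j. (t n j + \<delta> k j) + (T j - t n j))"
          by (intro arg_cong[of _ _ \<Phi>]) auto
        also have "\<dots> \<le> \<Phi> (\<lambda>j. t n j + \<delta> k j) + \<Phi> (\<lambda>j. T j - t n j)" by (rule tri)
        also have "\<Phi> (\<lambda>j. T j - t n j) \<le> U k * (\<Sum>j<k. \<bar>T j - t n j\<bar>)"
          using T0 t(1) by (intro upper') auto
        finally show ?thesis using t(2)[of n] by linarith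
      qed
      have "(\<lambda>n. 1 / (real n + 1) + U k * (\<Sum>j<k. \<bar>T j - t n j\<bar>)) \<longlonglongrightarrow> 0 + U k * (\<Sum>j<k. \<bar>T j - T j\<bar>)"
      proof (intro tendsto_intros lim)
        show "(\<lambda>n. 1 / (real n + 1)) \<longlonglongrightarrow> 0"
          using LIMSEQ_inverse_real_of_nat by (simp add: inverse_eq_divide add.commute)
      qed
      then have "\<Phi> (\<lambda>j. T j + \<delta> k j) \<le> 0"
        using bound by (intro LIMSEQ_le_const[where X = "\<lambda>n. 1 / (real n + 1) + U k * (\<Sum>j<k. \<bar>T j - t n j\<bar>)"]) auto
      then have "\<Phi> (\<lambda>j. T j + \<delta> k j) = 0" using nn[of "\<lambda>j. T j + \<delta> k j"] by simp
      then have "(\<lambda>j. T j + \<delta> k j) = (\<lambda>_. 0)"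
        using Suc.prems T0 by (intro pos) (auto simp: \<delta>_def)
      then have "T k + \<delta> k k = 0" by meson
      then show False using T0[of k] by (simp add: \<delta>_def)
    qed
    then obtain \<mu> where \<mu>: "\<mu> > 0" "\<And>t. \<forall>j\<ge>k. t j = 0 \<Longrightarrow> \<mu> \<le> \<Phi> (\<lambda>j. t j + \<delta> k j)" by auto
    define M where "M = \<Phi> (\<delta> k)"
    have M0: "M \<ge> 0" unfolding M_def by (rule nn)
    define A where "A = (1 + M / \<mu>) / c + 1 / \<mu>"
    have A: "A > 0" unfolding A_def using \<mu>(1) c(1) M0 by (simp add: add_pos_nonneg add_nonneg_pos)
    have "1 / A * (\<Sum>j<Suc k. \<bar>t j\<bar>) \<le> \<Phi> t" if t: "\<forall>j\<ge>Suc k. t j = 0" for t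
    proof -
      define t' where "t' j = (if j = k then 0 else t j)" for j
      have t'0: "\<forall>j\<ge>k. t' j = 0" using t by (auto simp: t'_def)
      have s: "\<mu> * \<bar>t k\<bar> \<le> \<Phi> t"
      proof (cases "t k = 0")
        case False
        have "t = (\<lambda>j. t k * (t' j / t k + \<delta> k j))" using False by (auto simp: fun_eq_iff t'_def \<delta>_def)
        then have "\<Phi> t = \<Phi> (\<lambda>j. t k * (t' j / t k + \<delta> k j))" by (rule arg_cong)
        also have "\<dots> = \<bar>t k\<bar> * \<Phi> (\<lambda>j. t' j / t k + \<delta> k j)" by (rule scale)
        finally show ?thesis using mult_right_mono[OF \<mu>(2)[of "\<lambda>j. t' j / t k"], of "\<bar>t k\<bar>"] t'0
          by (simp add: mult.commute)
      qed (use nn in auto)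
      have "c * (\<Sum>j<k. \<bar>t' j\<bar>) \<le> \<Phi> t'" using t'0 by (rule c(2))
      also have "\<Phi> t' = \<Phi> (\<lambda>j. t j + (- t k) * \<delta> k j)" by (auto simp: t'_def \<delta>_def intro!: arg_cong[of _ _ \<Phi>])
      also have "\<dots> \<le> \<Phi> t + \<Phi> (\<lambda>j. (- t k) * \<delta> k j)" by (rule tri)
      also have "\<Phi> (\<lambda>j. (- t k) * \<delta> k j) = \<bar>t k\<bar> * M" unfolding scale M_def by simp
      also have "\<bar>t k\<bar> * M \<le> (\<Phi> t / \<mu>) * M"
        using s \<mu>(1) M0 by (intro mult_right_mono) (auto simp: field_simps)
      finally have "(\<Sum>j<k. \<bar>t' j\<bar>) \<le> \<Phi> t * ((1 + M / \<mu>) / c)" using c(1) by (simp add: field_simps)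
      moreover have "(\<Sum>j<k. \<bar>t' j\<bar>) = (\<Sum>j<k. \<bar>t j\<bar>)" by (intro sum.cong) (auto simp: t'_def)
      moreover have "\<bar>t k\<bar> \<le> \<Phi> t * (1 / \<mu>)" using s \<mu>(1) by (simp add: field_simps)
      ultimately have "(\<Sum>j<Suc k. \<bar>t j\<bar>) \<le> \<Phi> t * A" unfolding A_def by (simp add: distrib_left)
      then show ?thesis using A by (simp add: field_simps)
    qed
    then show ?case using A by (intro exI[of _ "1 / A"]) auto
  qed
  then show "\<exists>c>0. \<forall>t. (\<forall>j\<ge>d. t j = 0) \<longrightarrow> c * (\<Sum>j<d. \<bar>t j\<bar>) \<le> \<Phi> t" by blast
qed


context comm_group begin

definition vec_norm :: "(('a \<times> real \<Rightarrow>\<^sub>0 int) set \<Rightarrow> real) \<Rightarrow> 'a \<Rightarrow> real" where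
  "vec_norm \<Psi> a = \<Psi> (pure_tensor G a 1)"

context
  fixes \<Psi> assumes norm: "tensor_norm G \<Psi>"
begin

lemma tensor_norm_nonneg: "v \<in> carrier (real_tensor G) \<Longrightarrow> \<Psi> v \<ge> 0"
  and tensor_norm_eq_0: "v \<in> carrier (real_tensor G) \<Longrightarrow> \<Psi> v = 0 \<longleftrightarrow> v = tensor_rels G"
  and tensor_norm_scale: "v \<in> carrier (real_tensor G) \<Longrightarrow> \<Psi> (tensor_scale G c v) = \<bar>c\<bar> * \<Psi> v"
  and tensor_norm_triangle: "u \<in> carrier (real_tensor G) \<Longrightarrow> v \<in> carrier (real_tensor G) \<Longrightarrow>
    \<Psi> (u \<otimes>\<^bsub>real_tensor G\<^esub> v) \<le> \<Psi> u + \<Psi> v"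
  using norm unfolding tensor_norm_def by auto

lemma tensor_norm_rels: "\<Psi> (tensor_rels G) = 0"
  using tensor_norm_eq_0[of "tensor_rels G"] tcoset_in[of 0] by (simp add: tcoset_0)

lemma vec_norm_nonneg: "a \<in> carrier G \<Longrightarrow> vec_norm \<Psi> a \<ge> 0"
  unfolding vec_norm_def by (intro tensor_norm_nonneg) simp

lemma vec_norm_mult: "a \<in> carrier G \<Longrightarrow> b \<in> carrier G \<Longrightarrow> vec_norm \<Psi> (a \<otimes> b) \<le> vec_norm \<Psi> a + vec_norm \<Psi> b"
  unfolding vec_norm_def using tensor_norm_triangle by (simp add: pure_tensor_mult)

lemma vec_norm_one: "vec_norm \<Psi> \<one> = 0"
  unfolding vec_norm_def by (simp add: pure_tensor_one tensor_norm_rels)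

lemma vec_norm_int_pow: "a \<in> carrier G \<Longrightarrow> vec_norm \<Psi> (a [^] (n::int)) = \<bar>n\<bar> * vec_norm \<Psi> a"
proof -
  assume a: "a \<in> carrier G"
  have "pure_tensor G (a [^] n) 1 = tensor_scale G n (pure_tensor G a 1)"
    using a by (simp add: pure_tensor_int_pow pure_tensor_scale)
  then show ?thesis unfolding vec_norm_def using a tensor_norm_scale by simp
qed

lemma vec_norm_nat_pow: "a \<in> carrier G \<Longrightarrow> vec_norm \<Psi> (a [^] (n::nat)) = n * vec_norm \<Psi> a"
  using vec_norm_int_pow[of a "int n"] by (simp add: int_pow_int)

lemma vec_norm_inv: "a \<in> carrier G \<Longrightarrow> vec_norm \<Psi> (inv a) = vec_norm \<Psi> a"
  using vec_norm_int_pow[of a "-1"] by (simp add: int_pow_neg)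

lemma vec_norm_torsion: "a \<in> carrier G \<Longrightarrow> n > 0 \<Longrightarrow> a [^] (n::nat) = \<one> \<Longrightarrow> vec_norm \<Psi> a = 0"
  using vec_norm_nat_pow[of a n] by (simp add: vec_norm_one)

lemma vec_norm_equiv_coordinates:
  fixes m :: int and e :: "nat \<Rightarrow> 'a" and K :: "'a \<Rightarrow> nat \<Rightarrow> int"
  assumes m: "m > 0" and e: "\<And>j. j < d \<Longrightarrow> e j \<in> carrier G"
    and K: "\<And>a b j. a \<in> carrier G \<Longrightarrow> b \<in> carrier G \<Longrightarrow> K (a \<otimes> b) j = K a j + K b j"
    and Ke: "\<And>i j. i < d \<Longrightarrow> j < d \<Longrightarrow> K (e i) j = (if i = j then m else 0)"
    and Kt: "\<And>a. a \<in> carrier G \<Longrightarrow> (\<And>j. j < d \<Longrightarrow> K a j = 0) \<Longrightarrow> \<exists>n::nat. n > 0 \<and> a [^] n = \<one>"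
  shows "\<exists>c C. c > (0::real) \<and> C > (0::real) \<and> (\<forall>a\<in>carrier G. c * (\<Sum>j<d. \<bar>K a j\<bar>) \<le> vec_norm \<Psi> a \<and>
    vec_norm \<Psi> a \<le> C * (\<Sum>j<d. \<bar>K a j\<bar>))"
proof -
  define u where "u t = (\<Sum>j<d. frag_of (e j, t j))" for t :: "nat \<Rightarrow> real"
  have uc: "Poly_Mapping.keys (u t) \<subseteq> carrier G \<times> (UNIV :: real set)" for t
    unfolding u_def using e by (intro keys_sum_sub) auto
  have ut: "tcoset (u t) \<in> carrier (real_tensor G)" for t using uc by simp
  define \<Phi> where "\<Phi> t = \<Psi> (tcoset (u t))" for t
  have \<Phi>0: "\<Phi> t \<ge> 0" for t unfolding \<Phi>_def using ut by (rule tensor_norm_nonneg)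
  have \<Phi>add: "\<Phi> (\<lambda>j. s j + t j) \<le> \<Phi> s + \<Phi> t" for s t
  proof -
    have "(\<Sum>j<d. frag_of (e j, s j + t j) - frag_of (e j, s j) - frag_of (e j, t j)) \<in> tensor_rels G"
      if "\<And>j. j < d \<Longrightarrow> e j \<in> carrier G" for d
      using that by (induction d) (auto intro!: rels_add relator_right simp: zero_in_rels)
    then have "u (\<lambda>j. s j + t j) - (u s + u t) \<in> tensor_rels G"
      using e by (simp add: u_def sum_subtractf sum.distrib diff_diff_eq)
    then have "tcoset (u s) \<otimes>\<^bsub>real_tensor G\<^esub> tcoset (u t) = tcoset (u (\<lambda>j. s j + t j))"
      using uc by (subst tcoset_mult) (auto intro!: tcoset_eqI simp: keys_add_sub)
    then show ?thesis unfolding \<Phi>_def using tensor_norm_triangle[OF ut[of s] ut[of t]] by simp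
  qed
  have \<Phi>scale: "\<Phi> (\<lambda>j. c * t j) = \<bar>c\<bar> * \<Phi> t" for c t
  proof -
    have "tensor_scale G c (tcoset (u t)) = tcoset (u (\<lambda>j. c * t j))"
      unfolding tensor_scale_tcoset u_def by (simp add: frag_extend_sum o_def)
    then show ?thesis unfolding \<Phi>_def using tensor_norm_scale[OF ut, of c t] by simp
  qed
  define f where "f j v = (\<Sum>p\<in>Poly_Mapping.keys v. of_int (Poly_Mapping.lookup v p) * (snd p * of_int (K (fst p) j)))"
    for j and v :: "'a \<times> real \<Rightarrow>\<^sub>0 int"
  have f_sup: "f j v = (\<Sum>p\<in>P. of_int (Poly_Mapping.lookup v p) * (snd p * of_int (K (fst p) j)))"
    if "finite P" "Poly_Mapping.keys v \<subseteq> P" for j v P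
    unfolding f_def using that by (intro sum.mono_neutral_left) (auto simp: in_keys_iff)
  have fadd: "f j (v + w) = f j v + f j w" for j v w
  proof -
    let ?P = "Poly_Mapping.keys v \<union> Poly_Mapping.keys w"
    have "f j (v + w) = (\<Sum>p\<in>?P. of_int (Poly_Mapping.lookup (v + w) p) * (snd p * of_int (K (fst p) j)))"
      by (rule f_sup) (use keys_add[of v w] in auto)
    also have "\<dots> = f j v + f j w"
      using f_sup[of ?P v j] f_sup[of ?P w j]
      by (simp add: lookup_add distrib_right sum.distrib)
    finally show ?thesis .
  qed
  have f0: "f j 0 = 0" for j by (simp add: f_def)
  have fneg: "f j (- v) = - f j v" for j v using fadd[of j v "- v"] f0[of j] by simp
  have fdiff: "f j (v - w) = f j v - f j w" for j v w using fadd[of j v "- w"] fneg[of j w] by simp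
  have fof: "f j (frag_of (a, r)) = r * K a j" for j a r by (simp add: f_def)
  have fsum: "f j (sum g I) = (\<Sum>i\<in>I. f j (g i))" for j g and I :: "nat set"
    by (induction I rule: infinite_finite_induct) (auto simp: fadd f0)
  have frels: "f j v = 0" if "v \<in> tensor_rels G" for j v
  proof -
    have "f j v \<in> {0}"
      using fadd _ _ _ _ that
    proof (rule rels_induct_additive)
      fix v assume "v \<in> tensor_relators"
      then consider a b r where "a \<in> carrier G" "b \<in> carrier G" "v = frag_of (a \<otimes> b, r) - frag_of (a, r) - frag_of (b, r)"
        | a r s where "a \<in> carrier G" "v = frag_of (a, r + s) - frag_of (a, r) - frag_of (a, s)"
        unfolding tensor_relators_def by blast
      then show "f j v \<in> {0}"
      proof cases
        case 1 then show ?thesis by (simp only: fdiff fof K) (simp add: algebra_simps)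
      next
        case 2 then show ?thesis by (simp only: fdiff fof) (simp add: algebra_simps)
      qed
    qed auto
    then show ?thesis by simp
  qed
  have fu: "f j (u t) = m * t j" if "j < d" for j and t :: "nat \<Rightarrow> real"
  proof -
    have "f j (u t) = (\<Sum>i<d. t i * K (e i) j)" unfolding u_def by (simp add: fsum fof)
    also have "\<dots> = (\<Sum>i<d. if i = j then m * t j else 0)"
      using that by (intro sum.cong) (auto simp: Ke)
    finally show ?thesis using that by simp
  qed
  have \<Phi>pos: "t = (\<lambda>_. 0)" if t: "\<forall>j\<ge>d. t j = 0" "\<Phi> t = 0" for t :: "nat \<Rightarrow> real"
  proof
    fix j
    have "u t \<in> tensor_rels G"
      using t(2) tensor_norm_eq_0[OF ut[of t]] tcoset_eq_rels_iff[of "u t"] uc unfolding \<Phi>_def by simp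
    then have "m * t j = 0" if "j < d" using frels fu[OF that] by metis
    then show "t j = 0" using t(1) m by (cases "j < d") auto
  qed
  obtain C where C: "C \<ge> 0" "\<And>t. (\<forall>j\<ge>d. t j = 0) \<Longrightarrow> \<Phi> t \<le> C * (\<Sum>j<d. \<bar>t j\<bar>)"
    using norm_dominates_coordinates(1)[of \<Phi> d, OF \<Phi>0 \<Phi>add \<Phi>scale \<Phi>pos] by auto
  obtain c where c: "c > 0" "\<And>t. (\<forall>j\<ge>d. t j = 0) \<Longrightarrow> c * (\<Sum>j<d. \<bar>t j\<bar>) \<le> \<Phi> t"
    using norm_dominates_coordinates(2)[of \<Phi> d, OF \<Phi>0 \<Phi>add \<Phi>scale \<Phi>pos] by auto
  have main: "m * vec_norm \<Psi> a = \<Phi> (\<lambda>j. if j < d then real_of_int (K a j) else 0)" if a: "a \<in> carrier G" for a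
  proof -
    define b where "b n = rec_nat \<one> (\<lambda>i y. y \<otimes> e i [^] K a i) n" for n
    have b0: "b 0 = \<one>" and bS: "b (Suc i) = b i \<otimes> e i [^] K a i" for i by (simp_all add: b_def)
    have bc: "n \<le> d \<Longrightarrow> b n \<in> carrier G" for n by (induction n) (use e in \<open>auto simp: b0 bS\<close>)
    have Kn: "K (x [^] (n::nat)) j = int n * K x j" if "x \<in> carrier G" for x n j
      by (rule additive_nat_pow[OF subgroup_self, of "\<lambda>x. K x j"]) (use K that in auto)
    have K1: "K \<one> j = 0" for j using K[of \<one> \<one> j] by simp
    have Kinv: "K (inv x) j = - K x j" if "x \<in> carrier G" for x j
      using K[of "inv x" x j] that K1[of j] by simp
    have Kp: "K (x [^] (n::int)) j = n * K x j" if "x \<in> carrier G" for x n j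
    proof (cases "n < 0")
      case True
      have "x [^] n = inv (x [^] nat (- n))" using True unfolding int_pow_def2 by (rule if_P)
      then have "K (x [^] n) j = - K (x [^] nat (- n)) j" using Kinv[OF nat_pow_closed[OF that]] by metis
      then show ?thesis using Kn[OF that, of "nat (- n)" j] True by simp
    next
      case False
      have "x [^] n = x [^] nat n" using False unfolding int_pow_def2 by (rule if_not_P)
      then show ?thesis using Kn[OF that, of "nat n" j] False by simp
    qed
    have Kb: "n \<le> d \<Longrightarrow> j < d \<Longrightarrow> K (b n) j = (if j < n then m * K a j else 0)" for n j
    proof (induction n)
      case (Suc n)
      then have "K (b (Suc n)) j = K (b n) j + K a n * K (e n) j"
        using bc[of n] e[of n] unfolding bS by (subst K) (auto simp: Kp)
      then show ?case using Suc Ke[of n j] by (auto simp: less_Suc_eq)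
    qed (simp add: b0 K1)
    have pb: "n \<le> d \<Longrightarrow> pure_tensor G (b n) 1 = tcoset (\<Sum>j<n. frag_of (e j, of_int (K a j)))" for n
    proof (induction n)
      case 0 then show ?case by (simp add: b0 pure_tensor_one tcoset_0)
    next
      case (Suc n)
      have en: "e n \<in> carrier G" using e Suc by simp
      have "pure_tensor G (b (Suc n)) 1 = tcoset (\<Sum>j<n. frag_of (e j, of_int (K a j))) \<otimes>\<^bsub>real_tensor G\<^esub>
          tcoset (frag_of (e n, of_int (K a n)))"
        unfolding bS using bc[of n] en Suc
        by (simp add: pure_tensor_mult pure_tensor_int_pow) (simp add: pure_tensor_alt)
      also have "\<dots> = tcoset (\<Sum>j<Suc n. frag_of (e j, of_int (K a j)))"
        using en e Suc.prems by (subst tcoset_mult) (auto intro!: keys_sum_sub)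
      finally show ?case .
    qed
    have "u (\<lambda>j. if j < d then real_of_int (K a j) else 0) = (\<Sum>j<d. frag_of (e j, of_int (K a j)))"
      unfolding u_def by (intro sum.cong) auto
    then have \<Phi>b: "\<Phi> (\<lambda>j. if j < d then real_of_int (K a j) else 0) = vec_norm \<Psi> (b d)"
      unfolding \<Phi>_def vec_norm_def using pb[of d] by simp
    let ?w = "a [^] m \<otimes> inv (b d)"
    have w: "?w \<in> carrier G" using a bc by simp
    have "K ?w j = 0" if "j < d" for j
      using a bc[of d] Kb[of d j] that by (simp add: K Kp Kinv)
    then obtain n :: nat where "n > 0" "?w [^] n = \<one>" using Kt[OF w] by blast
    then have w0: "vec_norm \<Psi> ?w = 0" using vec_norm_torsion[OF w] by simp
    have "a [^] m = ?w \<otimes> b d" using a bc[of d] by (simp add: m_assoc)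
    then have 1: "vec_norm \<Psi> (a [^] m) \<le> vec_norm \<Psi> (b d)" using vec_norm_mult[OF w bc[of d]] w0 by simp
    have "b d = inv ?w \<otimes> a [^] m" using a bc[of d] by (simp add: inv_mult_group m_assoc)
    then have 2: "vec_norm \<Psi> (b d) \<le> vec_norm \<Psi> (a [^] m)"
      using vec_norm_mult[of "inv ?w" "a [^] m"] w a w0 vec_norm_inv[OF w] by simp
    show ?thesis using 1 2 \<Phi>b vec_norm_int_pow[OF a, of m] m by simp
  qed
  have sums: "(\<Sum>j<d. \<bar>if j < d then real_of_int (K a j) else 0\<bar>) = real_of_int (\<Sum>j<d. \<bar>K a j\<bar>)" for a
    by simp
  show ?thesis
  proof (intro exI conjI ballI)
    show "c / m > 0" using c m by simp
    show "(C + 1) / m > 0" using C m by (simp add: add_nonneg_pos)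
    fix a assume a: "a \<in> carrier G"
    let ?t = "\<lambda>j. if j < d then real_of_int (K a j) else 0"
    have "c * (\<Sum>j<d. \<bar>K a j\<bar>) \<le> \<Phi> ?t" using c(2)[of ?t] sums[of a] by simp
    then show "c / m * (\<Sum>j<d. \<bar>K a j\<bar>) \<le> vec_norm \<Psi> a"
      using main[OF a] m by (simp add: field_simps)
    have "\<Phi> ?t \<le> C * (\<Sum>j<d. \<bar>K a j\<bar>)" using C(2)[of ?t] sums[of a] by simp
    also have "\<dots> \<le> (C + 1) * (\<Sum>j<d. \<bar>K a j\<bar>)" by (intro mult_right_mono) (auto intro: sum_nonneg)
    finally show "vec_norm \<Psi> a \<le> (C + 1) / m * (\<Sum>j<d. \<bar>K a j\<bar>)"
      using main[OF a] m by (simp add: field_simps)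
  qed
qed

end
end

section \<open>The seminorm on the lattice and its comparison with word length\<close>

locale lattice_seminorm = cayley_normal +
  fixes \<psi> :: "'a \<Rightarrow> real" and K :: "'a \<Rightarrow> nat \<Rightarrow> int" and d :: nat and m0 :: nat
    and e :: "nat \<Rightarrow> 'a" and c1 c2 :: real and cl :: nat
  assumes \<psi>_mult: "\<And>x y. x \<in> N \<Longrightarrow> y \<in> N \<Longrightarrow> \<psi> (x \<otimes> y) \<le> \<psi> x + \<psi> y"
    and \<psi>_pow: "\<And>x n. x \<in> N \<Longrightarrow> \<psi> (x [^] (n::nat)) = n * \<psi> x"
    and \<psi>_inv [simp]: "\<And>x. x \<in> N \<Longrightarrow> \<psi> (inv x) = \<psi> x"
    and \<psi>_conj: "\<And>x g. x \<in> N \<Longrightarrow> g \<in> carrier G \<Longrightarrow> \<psi> (inv g \<otimes> x \<otimes> g) = \<psi> x"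
    and K_mult: "\<And>x y j. x \<in> N \<Longrightarrow> y \<in> N \<Longrightarrow> K (x \<otimes> y) j = K x j + K y j"
    and m0: "m0 > 0" and e_N: "\<And>j. j < d \<Longrightarrow> e j \<in> N"
    and K_e: "\<And>i j. i < d \<Longrightarrow> j < d \<Longrightarrow> K (e i) j = (if i = j then int m0 else 0)"
    and c1: "c1 > 0" and c2: "c2 > 0"
    and c1_le: "\<And>x. x \<in> N \<Longrightarrow> c1 * (\<Sum>j<d. \<bar>K x j\<bar>) \<le> \<psi> x"
    and c2_ge: "\<And>x. x \<in> N \<Longrightarrow> \<psi> x \<le> c2 * (\<Sum>j<d. \<bar>K x j\<bar>)"
    and nilpotent_N: "lower_central (G\<lparr>carrier := N\<rparr>) cl = {\<one>}"
begin

definition Kabs :: "'a \<Rightarrow> real" where "Kabs x = real_of_int (\<Sum>j<d. \<bar>K x j\<bar>)"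

lemma Kabs_nonneg: "Kabs x \<ge> 0"
  unfolding Kabs_def by (simp add: sum_nonneg)

lemma \<psi>_nonneg: "x \<in> N \<Longrightarrow> \<psi> x \<ge> 0"
  using c1_le[of x] c1 Kabs_nonneg[of x] unfolding Kabs_def
  by (meson mult_nonneg_nonneg less_imp_le order_trans)

lemma \<psi>_one [simp]: "\<psi> \<one> = 0"
  using \<psi>_pow[of \<one> 0] by simp

lemma K_one [simp]: "K \<one> j = 0"
  using K_mult[of \<one> \<one> j] by simp

lemma K_inv [simp]: "x \<in> N \<Longrightarrow> K (inv x) j = - K x j"
  using K_mult[of "inv x" x j] by simp

lemma K_pow: "x \<in> N \<Longrightarrow> K (x [^] (n::nat)) j = int n * K x j"
  by (induction n) (auto simp: K_mult algebra_simps)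

lemma K_int_pow: "x \<in> N \<Longrightarrow> K (x [^] (n::int)) j = n * K x j"
proof (cases "n < 0")
  case True
  assume x: "x \<in> N"
  have "x [^] n = inv (x [^] nat (- n))" using True unfolding int_pow_def2 by (rule if_P)
  then have "K (x [^] n) j = - K (x [^] nat (- n)) j" using K_inv[OF N_pow[OF x]] by metis
  then show ?thesis using K_pow[OF x, of "nat (- n)" j] True by simp
next
  case False
  assume x: "x \<in> N"
  have "x [^] n = x [^] nat n" using False unfolding int_pow_def2 by (rule if_not_P)
  then show ?thesis using K_pow[OF x, of "nat n" j] False by simp
qed

lemma \<psi>_conj': "x \<in> N \<Longrightarrow> g \<in> carrier G \<Longrightarrow> \<psi> (g \<otimes> x \<otimes> inv g) = \<psi> x"
  using \<psi>_conj[of x "inv g"] by simp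

lemma \<psi>_eq_0_iff: "x \<in> N \<Longrightarrow> \<psi> x = 0 \<longleftrightarrow> (\<forall>j<d. K x j = 0)"
proof
  assume x: "x \<in> N" and "\<psi> x = 0"
  then have "c1 * real_of_int (\<Sum>j<d. \<bar>K x j\<bar>) \<le> 0" using c1_le by force
  then have "real_of_int (\<Sum>j<d. \<bar>K x j\<bar>) \<le> 0" using c1 by (simp add: mult_le_0_iff)
  then have "(\<Sum>j<d. \<bar>K x j\<bar>) = 0" using sum_nonneg[of "{..<d}" "\<lambda>j. \<bar>K x j\<bar>"] by linarith
  then show "\<forall>j<d. K x j = 0" by (subst (asm) sum_nonneg_eq_0_iff) auto
next
  assume x: "x \<in> N" and "\<forall>j<d. K x j = 0"
  then show "\<psi> x = 0" using c2_ge[OF x] \<psi>_nonneg[OF x] by simp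
qed

definition same_K where "same_K x y \<longleftrightarrow> (\<forall>j<d. K x j = K y j)"

lemma same_K_iff: "x \<in> N \<Longrightarrow> y \<in> N \<Longrightarrow> same_K x y \<longleftrightarrow> \<psi> (x \<otimes> inv y) = 0"
  unfolding same_K_def by (subst \<psi>_eq_0_iff) (auto simp: K_mult)

lemma same_K_\<psi>: "x \<in> N \<Longrightarrow> y \<in> N \<Longrightarrow> same_K x y \<Longrightarrow> \<psi> x = \<psi> y"
proof -
  assume x: "x \<in> N" and y: "y \<in> N" and s: "same_K x y"
  have 0: "\<psi> (x \<otimes> inv y) = 0" using s same_K_iff x y by simp
  have "\<psi> x \<le> \<psi> (x \<otimes> inv y) + \<psi> y" using \<psi>_mult[of "x \<otimes> inv y" y] x y by (simp add: m_assoc)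
  moreover have "\<psi> y \<le> \<psi> (y \<otimes> inv x) + \<psi> x" using \<psi>_mult[of "y \<otimes> inv x" x] x y by (simp add: m_assoc)
  moreover have "\<psi> (y \<otimes> inv x) = \<psi> (x \<otimes> inv y)"
    using \<psi>_inv[of "x \<otimes> inv y"] x y by (simp add: inv_mult_group)
  ultimately show ?thesis using 0 by simp
qed

lemma same_K_conj:
  assumes "x \<in> N" "y \<in> N" "g \<in> carrier G" "same_K x y"
  shows "same_K (g \<otimes> x \<otimes> inv g) (g \<otimes> y \<otimes> inv g)"
proof -
  have "(g \<otimes> x \<otimes> inv g) \<otimes> inv (g \<otimes> y \<otimes> inv g) = g \<otimes> (x \<otimes> inv y) \<otimes> inv g"
    using assms by (simp add: m_assoc inv_mult_group)
  then have "\<psi> ((g \<otimes> x \<otimes> inv g) \<otimes> inv (g \<otimes> y \<otimes> inv g)) = 0"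
    using assms same_K_iff[of x y] \<psi>_conj'[of "x \<otimes> inv y" g] by simp
  then show ?thesis using assms by (subst same_K_iff) (auto intro: N_conj)
qed

lemma Kabs_mult: "x \<in> N \<Longrightarrow> y \<in> N \<Longrightarrow> Kabs (x \<otimes> y) \<le> Kabs x + Kabs y"
  unfolding Kabs_def by (simp add: K_mult sum.distrib[symmetric] abs_triangle_ineq sum_mono flip: of_int_add)

lemma \<psi>_le_Kabs: "x \<in> N \<Longrightarrow> \<psi> x \<le> c2 * Kabs x"
  using c2_ge unfolding Kabs_def .

lemma Kabs_le_\<psi>: "x \<in> N \<Longrightarrow> c1 * Kabs x \<le> \<psi> x"
  using c1_le unfolding Kabs_def .

text \<open>
  A subadditive function on the whole group that agrees with \<open>\<psi>\<close> on \<open>N\<close> up to a constant.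
\<close>

definition "defects = {t \<otimes> t' \<otimes> inv t'' | t t' t''. t \<in> rep ` carrier G \<and> t' \<in> rep ` carrier G \<and> t'' \<in> rep ` carrier G} \<inter> N"

definition C0 :: real where "C0 = Max (insert 0 (\<psi> ` defects))"

definition p :: "'a \<Rightarrow> real" where "p g = \<psi> (g \<otimes> inv (rep g)) + C0"

definition P :: real where "P = Max (insert 1 (p ` letters))"

lemma finite_defects: "finite defects"
proof -
  have "defects \<subseteq> (\<lambda>(t, t', t''). t \<otimes> t' \<otimes> inv t'') ` (rep ` carrier G \<times> rep ` carrier G \<times> rep ` carrier G)"
    unfolding defects_def by force
  then show ?thesis using finite_rep by (meson finite_SigmaI finite_imageI finite_subset)
qed

lemma C0_nonneg: "C0 \<ge> 0"
  unfolding C0_def using finite_defects by (intro Max_ge) auto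

lemma defect_le: "x \<in> defects \<Longrightarrow> \<psi> x \<le> C0"
  unfolding C0_def using finite_defects by (intro Max_ge) auto

lemma p_nonneg: "g \<in> carrier G \<Longrightarrow> p g \<ge> 0"
  unfolding p_def using C0_nonneg \<psi>_nonneg[OF rep_N] by (simp add: add_nonneg_nonneg)

lemma p_N: "x \<in> N \<Longrightarrow> p x = \<psi> x + C0"
  by (simp add: p_def)

lemma p_one: "p \<one> = C0"
  by (simp add: p_N)

lemma p_mult:
  assumes g: "g \<in> carrier G" and h: "h \<in> carrier G"
  shows "p (g \<otimes> h) \<le> p g + p h"
proof -
  define n n' t t' t'' where "n = g \<otimes> inv (rep g)" and "n' = h \<otimes> inv (rep h)"
    and "t = rep g" and "t' = rep h" and "t'' = rep (g \<otimes> h)"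
  have N: "n \<in> N" "n' \<in> N" using g h rep_N by (auto simp: n_def n'_def)
  have c [simp]: "t \<in> carrier G" "t' \<in> carrier G" "t'' \<in> carrier G"
    using g h by (auto simp: t_def t'_def t''_def)
  have gh: "g = n \<otimes> t" "h = n' \<otimes> t'" using g h by (auto simp: n_def n'_def t_def t'_def m_assoc)
  have eq: "g \<otimes> h \<otimes> inv t'' = n \<otimes> ((t \<otimes> n' \<otimes> inv t) \<otimes> (t \<otimes> t' \<otimes> inv t''))"
    using N by (simp add: gh m_assoc)
  have tn: "t \<otimes> n' \<otimes> inv t \<in> N" using N by (auto intro: N_conj)
  have def: "t \<otimes> t' \<otimes> inv t'' \<in> N"
  proof -
    have "t \<otimes> t' \<otimes> inv t'' = inv (n \<otimes> (t \<otimes> n' \<otimes> inv t)) \<otimes> (g \<otimes> h \<otimes> inv t'')"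
      unfolding eq using N by (simp add: m_assoc inv_mult_group)
    moreover have "g \<otimes> h \<otimes> inv t'' \<in> N" unfolding t''_def using g h by (intro rep_N) auto
    ultimately show ?thesis using N tn by simp
  qed
  then have "t \<otimes> t' \<otimes> inv t'' \<in> defects" unfolding defects_def t_def t'_def t''_def using g h by blast
  from defect_le[OF this] have "\<psi> (g \<otimes> h \<otimes> inv t'') \<le> \<psi> n + (\<psi> n' + C0)"
    unfolding eq using \<psi>_mult[OF N(1) N_mult[OF tn def]] \<psi>_mult[OF tn def] \<psi>_conj'[OF N(2), of t] by simp
  then show ?thesis by (simp add: p_def n_def n'_def t''_def)
qed

lemma P_ge_1: "P \<ge> 1"
  unfolding P_def using finite_letters by (intro Max_ge) auto

lemma p_letter: "s \<in> letters \<Longrightarrow> p s \<le> P"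
  unfolding P_def using finite_letters by (intro Max_ge) auto

lemma p_le: "g \<in> carrier G \<Longrightarrow> p g \<le> P * len g + C0"
  using subadditive_le_len(1)[of p P g] p_mult p_letter p_one by auto

lemma p_le': "g \<in> carrier G \<Longrightarrow> g \<noteq> \<one> \<Longrightarrow> p g \<le> P * len g"
  using subadditive_le_len(2)[of p P g] p_mult p_letter by auto

lemma \<psi>_le_len: "x \<in> N \<Longrightarrow> \<psi> x \<le> P * len x"
  using p_le[of x] p_N[of x] by simp

lemma slow_conjugation:
  assumes x: "x \<in> N" and g: "g \<in> N" and \<epsilon>: "\<epsilon> > 0"
  shows "\<exists>C. \<forall>n. len (inv (x [^] (n::nat)) \<otimes> g \<otimes> x [^] n) \<le> \<epsilon> * real n + C"
proof -
  let ?N = "G\<lparr>carrier := N\<rparr>"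
  interpret N: group ?N using subgroup.subgroup_is_group[OF N_subgroup is_group] .
  have inv_N: "inv\<^bsub>?N\<^esub> y = inv y" if "y \<in> N" for y
    using m_inv_consistent[OF N_subgroup that] .
  have pow_N: "y [^]\<^bsub>?N\<^esub> (n::nat) = y [^] n" for y n
    by (induction n) auto
  have len': "real (len \<one>) = 0" by simp
  have nil: "lower_central ?N cl = {\<one>\<^bsub>?N\<^esub>}" using nilpotent_N by simp
  have "\<exists>C. \<forall>n. real (len (inv x [^]\<^bsub>?N\<^esub> (n::nat) \<otimes>\<^bsub>?N\<^esub> g \<otimes>\<^bsub>?N\<^esub> inv\<^bsub>?N\<^esub> (inv x [^]\<^bsub>?N\<^esub> n))) \<le> \<epsilon> * real n + C"
  proof (rule N.nilpotent_conjugation_sublinear[OF nil])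
    show "real (len (g \<otimes>\<^bsub>?N\<^esub> h)) \<le> real (len g) + real (len h)" if "g \<in> carrier ?N" "h \<in> carrier ?N" for g h
      using len_mult[of g h] that by simp
  qed (use x g \<epsilon> inv_N in auto)
  moreover have "inv x [^]\<^bsub>?N\<^esub> n \<otimes>\<^bsub>?N\<^esub> g \<otimes>\<^bsub>?N\<^esub> inv\<^bsub>?N\<^esub> (inv x [^]\<^bsub>?N\<^esub> n) = inv (x [^] n) \<otimes> g \<otimes> x [^] n" for n :: nat
    using x inv_N[of "inv x [^] n"] by (simp add: pow_N nat_pow_inv)
  ultimately show ?thesis by simp
qed

subsection \<open>Stable length\<close>

definition scaled :: "'a \<Rightarrow> int \<Rightarrow> 'a \<Rightarrow> bool" where
  "scaled x m z \<longleftrightarrow> (\<forall>j<d. K x j = m * K z j)"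

definition ell :: "'a \<Rightarrow> real" where
  "ell z = Inf {len x / m | x m. x \<in> N \<and> m \<ge> (1::nat) \<and> scaled x m z}"

lemma scaled_same_K: "z \<in> N \<Longrightarrow> scaled x (int m) z \<longleftrightarrow> same_K x (z [^] m)"
  unfolding scaled_def same_K_def by (simp add: K_pow)

lemma scaled_\<psi>: "x \<in> N \<Longrightarrow> z \<in> N \<Longrightarrow> scaled x (int m) z \<Longrightarrow> \<psi> x = m * \<psi> z"
  using same_K_\<psi>[of x "z [^] m"] by (simp add: scaled_same_K \<psi>_pow)

lemma ell_le: "x \<in> N \<Longrightarrow> m \<ge> (1::nat) \<Longrightarrow> scaled x m z \<Longrightarrow> m * ell z \<le> len x"
proof -
  assume *: "x \<in> N" "m \<ge> 1" "scaled x m z"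
  have "ell z \<le> len x / m" unfolding ell_def
    using * by (intro cInf_lower bdd_belowI[of _ 0]) auto
  then show ?thesis using *(2) by (simp add: field_simps)
qed

lemma ell_ge:
  fixes b :: real
  shows "z \<in> N \<Longrightarrow> (\<And>x m. x \<in> N \<Longrightarrow> m \<ge> (1::nat) \<Longrightarrow> scaled x m z \<Longrightarrow> b * real m \<le> real (len x)) \<Longrightarrow> b \<le> ell z"
  unfolding ell_def
proof (rule cInf_greatest)
  assume z: "z \<in> N"
  show "{real (len x) / m | x m. x \<in> N \<and> m \<ge> (1::nat) \<and> scaled x m z} \<noteq> {}"
    using z by (auto simp: scaled_def intro!: exI[of _ z] exI[of _ 1])
qed (force simp: field_simps)

lemma ell_approx:
  assumes z: "z \<in> N" and \<epsilon>: "\<epsilon> > 0"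
  shows "\<exists>x m. x \<in> N \<and> m \<ge> (1::nat) \<and> scaled x m z \<and> len x \<le> m * (ell z + \<epsilon>)"
proof (rule ccontr)
  assume *: "\<not> ?thesis"
  have "ell z + \<epsilon> \<le> ell z"
  proof (rule ell_ge[OF z])
    fix x and m :: nat assume "x \<in> N" "m \<ge> 1" "scaled x m z"
    then have "m * (ell z + \<epsilon>) < len x" using * by (meson not_le)
    then show "(ell z + \<epsilon>) * m \<le> len x" by (simp add: mult.commute)
  qed
  then show False using \<epsilon> by simp
qed

lemma ell_nonneg: "z \<in> N \<Longrightarrow> ell z \<ge> 0"
  by (rule ell_ge) auto

lemma \<psi>_le_ell: "z \<in> N \<Longrightarrow> \<psi> z \<le> P * ell z"
proof -
  assume z: "z \<in> N"
  have "\<psi> z / P \<le> ell z"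
  proof (rule ell_ge[OF z])
    fix x and m :: nat assume x: "x \<in> N" "m \<ge> 1" "scaled x m z"
    then have "m * \<psi> z \<le> P * len x" using \<psi>_le_len[of x] scaled_\<psi>[of x z m] z by simp
    then show "\<psi> z / P * m \<le> len x" using P_ge_1 by (simp add: field_simps)
  qed
  then show ?thesis using P_ge_1 by (simp add: field_simps)
qed

lemma ell_pos: "z \<in> N \<Longrightarrow> \<psi> z > 0 \<Longrightarrow> ell z > 0"
  using \<psi>_le_ell[of z] P_ge_1 by (smt (verit) mult_nonneg_nonpos)

definition elen :: nat where "elen = (\<Sum>j<d. len (e j))"

lemma lift_exists:
  fixes k :: "nat \<Rightarrow> int"
  shows "\<exists>x\<in>N. (\<forall>j<d. K x j = m0 * k j) \<and> real (len x) \<le> elen * real_of_int (\<Sum>j<d. \<bar>k j\<bar>)"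
proof -
  have "n \<le> d \<Longrightarrow> \<exists>x\<in>N. (\<forall>j<d. K x j = (if j < n then m0 * k j else 0)) \<and> real (len x) \<le> elen * real_of_int (\<Sum>j<n. \<bar>k j\<bar>)" for n
  proof (induction n)
    case 0 then show ?case by (intro bexI[of _ \<one>]) auto
  next
    case (Suc n)
    then obtain x where x: "x \<in> N" "\<forall>j<d. K x j = (if j < n then m0 * k j else 0)"
      "real (len x) \<le> elen * real_of_int (\<Sum>j<n. \<bar>k j\<bar>)" by auto
    let ?y = "x \<otimes> e n [^] k n"
    have en: "e n \<in> N" using Suc e_N by simp
    have "\<forall>j<d. K ?y j = (if j < Suc n then m0 * k j else 0)"
      using x en Suc.prems K_e[of n] by (auto simp: K_mult K_int_pow less_Suc_eq)
    moreover have "real (len ?y) \<le> elen * real_of_int (\<Sum>j<Suc n. \<bar>k j\<bar>)"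
    proof -
      have "len (e n) \<le> elen" unfolding elen_def using Suc.prems by (intro member_le_sum) auto
      then have "real (nat \<bar>k n\<bar> * len (e n)) \<le> real_of_int \<bar>k n\<bar> * elen"
        by (simp add: mult_left_mono)
      moreover have "real (len ?y) \<le> real (len x) + real (nat \<bar>k n\<bar> * len (e n))"
      proof -
        have "len ?y \<le> len x + len (e n [^] k n)" using x en by (intro len_mult) auto
        also have "\<dots> \<le> len x + nat \<bar>k n\<bar> * len (e n)"
          using en by (intro add_left_mono len_int_pow) auto
        finally show ?thesis by (simp only: of_nat_add[symmetric] of_nat_le_iff)
      qed
      ultimately show ?thesis using x(3) by (simp add: algebra_simps)
    qed
    ultimately show ?case using x en by (intro bexI[of _ ?y]) auto
  qed
  from this[of d] show ?thesis by auto
qed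

definition kappa :: real where "kappa = (real elen + 1) / (m0 * c1)"

lemma kappa_pos: "kappa > 0"
  unfolding kappa_def using m0 c1 by (intro divide_pos_pos) auto

lemma ell_le_\<psi>: "z \<in> N \<Longrightarrow> ell z \<le> kappa * \<psi> z"
proof -
  assume z: "z \<in> N"
  obtain x where x: "x \<in> N" "\<forall>j<d. K x j = m0 * K z j" "real (len x) \<le> elen * Kabs z"
    using lift_exists[of "K z"] unfolding Kabs_def by auto
  have "m0 * ell z \<le> len x" using x m0 by (intro ell_le) (auto simp: scaled_def)
  also have "\<dots> \<le> elen * (\<psi> z / c1)"
    using x(3) Kabs_le_\<psi>[OF z] c1 by (smt (verit) mult_left_mono of_nat_0_le_iff pos_le_divide_eq mult.commute)
  also have "\<dots> \<le> (elen + 1) * (\<psi> z / c1)" using \<psi>_nonneg[OF z] c1 by (intro mult_right_mono) auto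
  finally show ?thesis unfolding kappa_def using m0 c1 by (simp add: field_simps)
qed

lemma ell_conj_ge:
  assumes z: "z \<in> N" and t: "t \<in> carrier G"
  shows "ell z \<le> ell (inv t \<otimes> z \<otimes> t)"
proof (rule ell_ge)
  show zt: "inv t \<otimes> z \<otimes> t \<in> N" using z t by (rule N_conj'[rotated])
  fix x and m :: nat assume x: "x \<in> N" "m \<ge> 1" "scaled x m (inv t \<otimes> z \<otimes> t)"
  have tz: "t \<otimes> (inv t \<otimes> z \<otimes> t) [^] k \<otimes> inv t = z [^] k" for k :: nat
  proof (induction k)
    case (Suc k)
    have "t \<otimes> (inv t \<otimes> z \<otimes> t) [^] Suc k \<otimes> inv t = (t \<otimes> (inv t \<otimes> z \<otimes> t) [^] k \<otimes> inv t) \<otimes> z"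
      using z t by (simp add: m_assoc)
    then show ?case using Suc by simp
  qed (use t in simp)
  have le: "n * (m * ell z) \<le> n * len x + 2 * len t" if n: "n \<ge> 1" for n :: nat
  proof -
    have "same_K (x [^] n) ((inv t \<otimes> z \<otimes> t) [^] (m * n))"
      using x zt by (simp add: same_K_def K_pow scaled_def)
    then have "same_K (t \<otimes> x [^] n \<otimes> inv t) (t \<otimes> (inv t \<otimes> z \<otimes> t) [^] (m * n) \<otimes> inv t)"
      using x zt t by (intro same_K_conj) auto
    then have "scaled (t \<otimes> x [^] n \<otimes> inv t) (int (m * n)) z"
      unfolding scaled_same_K[OF z] tz .
    then have "(m * n) * ell z \<le> len (t \<otimes> x [^] n \<otimes> inv t)"
      using x t n N_conj[OF t, of "x [^] n"] by (intro ell_le) auto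
    also have "\<dots> \<le> len t + len (x [^] n) + len t" using len_mult3[of t "x [^] n" "inv t"] t x by simp
    also have "\<dots> \<le> n * len x + 2 * len t" using of_nat_mono[OF len_pow[of x n], where 'a = real] x by simp
    finally show ?thesis by (simp add: mult.commute mult.left_commute)
  qed
  show "ell z * m \<le> len x"
  proof (rule ccontr)
    assume "\<not> ?thesis"
    then have pos: "m * ell z - len x > 0" by (simp add: mult.commute)
    obtain n :: nat where "2 * len t / (m * ell z - len x) < n" using reals_Archimedean2 by blast
    then have "2 * len t < n * (m * ell z - len x)" using pos by (simp add: field_simps)
    then have "2 * real (len t) < Suc n * (m * ell z - len x)" using pos by (simp add: algebra_simps)
    then show False using le[of "Suc n"] by (simp add: algebra_simps)
  qed
qed

lemma ell_conj: "z \<in> N \<Longrightarrow> t \<in> carrier G \<Longrightarrow> ell (inv t \<otimes> z \<otimes> t) = ell z"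
  using ell_conj_ge[of z t] ell_conj_ge[of "inv t \<otimes> z \<otimes> t" "inv t"] N_conj'[of t z]
  by (simp add: m_assoc)

lemma ell_scaled:
  assumes z: "z \<in> N" "z' \<in> N" and m: "m \<ge> (1::nat)" and s: "scaled z' m z"
  shows "m * ell z \<le> ell z'"
proof (rule ell_ge[OF z(2)])
  fix x and n :: nat assume x: "x \<in> N" "n \<ge> 1" "scaled x n z'"
  then have "scaled x (int (n * m)) z" using s by (simp add: scaled_def)
  then have "(n * m) * ell z \<le> len x" using x m by (intro ell_le) auto
  then show "m * ell z * n \<le> len x" by (simp add: mult.commute mult.left_commute)
qed

end

section \<open>Passage times\<close>

context cayley begin

abbreviation E where "E \<equiv> cayley_edges G S"

abbreviation T where "T \<equiv> passage_time E"

lemma edge_letter: "s \<in> letters \<Longrightarrow> x \<in> carrier G \<Longrightarrow> {x, x \<otimes> s} \<in> E"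
proof -
  assume s: "s \<in> letters" and x: "x \<in> carrier G"
  then consider "s \<in> S" | t where "t \<in> S" "s = inv t" unfolding letters_def by auto
  then show ?thesis
  proof cases
    case 1 then show ?thesis using x unfolding cayley_edges_def by auto
  next
    case 2
    then have t: "t \<in> carrier G" using S_sub by auto
    have "{x, x \<otimes> s} = {x \<otimes> inv t, (x \<otimes> inv t) \<otimes> t}" using 2 t x by (auto simp: m_assoc)
    moreover have "{x \<otimes> inv t, (x \<otimes> inv t) \<otimes> t} \<in> E"
      unfolding cayley_edges_def using 2 t x by (intro CollectI exI[of _ "x \<otimes> inv t"] exI[of _ t]) auto
    ultimately show ?thesis by simp
  qed
qed

lemma edgeD: "{x, z} \<in> E \<Longrightarrow> x \<in> carrier G \<and> z \<in> carrier G \<and> inv x \<otimes> z \<in> letters"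
proof -
  assume "{x, z} \<in> E"
  then obtain g s where gs: "g \<in> carrier G" "s \<in> S" "{x, z} = {g, g \<otimes> s}"
    unfolding cayley_edges_def by auto
  have s: "s \<in> carrier G" using gs S_sub by auto
  from gs(3) consider "x = g" "z = g \<otimes> s" | "x = g \<otimes> s" "z = g" by (auto simp: doubleton_eq_iff)
  then show ?thesis
  proof cases
    case 1 then show ?thesis using gs s by (auto simp: letters_def)
  next
    case 2 then show ?thesis using gs s by (auto simp: letters_def inv_mult_group m_assoc)
  qed
qed

lemma edge_sub: "f \<in> E \<Longrightarrow> f \<subseteq> carrier G"
  unfolding cayley_edges_def using S_sub by auto

lemma edge_shift: "f \<in> E \<Longrightarrow> g \<in> carrier G \<Longrightarrow> g <# f \<in> E"
proof -
  assume "f \<in> E" and g: "g \<in> carrier G"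
  then obtain x s where xs: "x \<in> carrier G" "s \<in> S" "f = {x, x \<otimes> s}"
    unfolding cayley_edges_def by auto
  then have "s \<in> carrier G" using S_sub by auto
  then have "g <# f = {g \<otimes> x, (g \<otimes> x) \<otimes> s}" using xs g by (simp add: l_coset_def m_assoc insert_commute)
  then show ?thesis using xs g unfolding cayley_edges_def by auto
qed

lemma l_coset_pair: "g <# {x, z} = {g \<otimes> x, g \<otimes> z}"
  by (auto simp: l_coset_def)

lemma edge_path_carrier: "edge_path E x fs y \<Longrightarrow> x \<in> carrier G \<Longrightarrow> y \<in> carrier G"
  by (induction fs arbitrary: x) (auto dest: edgeD)

lemma edge_path_append: "edge_path E x fs y \<Longrightarrow> edge_path E y fs' z \<Longrightarrow> edge_path E x (fs @ fs') z"
  by (induction fs arbitrary: x) auto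

lemma edge_path_edges: "edge_path E x fs y \<Longrightarrow> set fs \<subseteq> E"
  by (induction fs arbitrary: x) auto

fun wpath where
  "wpath x [] = []"
| "wpath x (s # ss) = {x, x \<otimes> s} # wpath (x \<otimes> s) ss"

lemma wpath_edge_path: "x \<in> carrier G \<Longrightarrow> set ss \<subseteq> letters \<Longrightarrow> edge_path E x (wpath x ss) (x \<otimes> wprod ss)"
proof (induction ss arbitrary: x)
  case (Cons s ss)
  have s: "s \<in> letters" using Cons by auto
  have "edge_path E (x \<otimes> s) (wpath (x \<otimes> s) ss) (x \<otimes> s \<otimes> wprod ss)" using Cons by (intro Cons.IH) auto
  then show ?case using edge_letter[OF s, of x] Cons.prems by (auto simp: m_assoc)
qed simp

lemma length_wpath [simp]: "length (wpath x ss) = length ss"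
  by (induction ss arbitrary: x) auto

lemma path_exists:
  assumes "x \<in> carrier G" "y \<in> carrier G"
  obtains fs where "edge_path E x fs y" "length fs = dist x y"
proof -
  obtain ss where "set ss \<subseteq> letters" "wprod ss = inv x \<otimes> y" "length ss = dist x y"
    using len_word[of "inv x \<otimes> y"] assms by auto
  then show ?thesis using that[of "wpath x ss"] wpath_edge_path[of x ss] assms by simp
qed

lemma dist_le_path: "edge_path E x fs y \<Longrightarrow> x \<in> carrier G \<Longrightarrow> dist x y \<le> length fs"
proof (induction fs arbitrary: x)
  case (Cons f fs)
  then obtain z where z: "f = {x, z}" "{x, z} \<in> E" "edge_path E z fs y" by auto
  have zc: "z \<in> carrier G" "dist x z \<le> 1" using edgeD[OF z(2)] len_letter by auto
  have "y \<in> carrier G" using edge_path_carrier z zc by auto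
  then have "dist x y \<le> dist x z + dist z y" using zc Cons.prems by (intro dist_triangle) auto
  then show ?case using Cons.IH[OF z(3) zc(1)] zc by simp
qed simp

lemma T_bdd_below:
  fixes w :: "'a set \<Rightarrow> real"
  assumes "\<And>f. f \<in> E \<Longrightarrow> w f \<ge> 0"
  shows "bdd_below ((\<lambda>fs. sum_list (map w fs)) ` {fs. edge_path E x fs y})"
proof (rule bdd_belowI[of _ 0])
  fix c assume "c \<in> (\<lambda>fs. sum_list (map w fs)) ` {fs. edge_path E x fs y}"
  then obtain fs where fs: "edge_path E x fs y" "c = sum_list (map w fs)" by auto
  then show "0 \<le> c" using subsetD[OF edge_path_edges[OF fs(1)]] assms by (auto intro!: sum_list_nonneg)
qed

lemma T_le: "(\<And>f. f \<in> E \<Longrightarrow> w f \<ge> 0) \<Longrightarrow> edge_path E x fs y \<Longrightarrow> T w x y \<le> sum_list (map w fs)"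
  unfolding passage_time_def using T_bdd_below[of w x y] by (intro cINF_lower) auto

lemma T_ge:
  assumes "x \<in> carrier G" "y \<in> carrier G" "\<And>fs. edge_path E x fs y \<Longrightarrow> b \<le> sum_list (map w fs)"
  shows "b \<le> T w x y"
  unfolding passage_time_def
proof (rule cINF_greatest)
  obtain fs where "edge_path E x fs y" using path_exists[OF assms(1,2)] .
  then show "{fs. edge_path E x fs y} \<noteq> {}" by blast
  fix fs assume "fs \<in> {fs. edge_path E x fs y}"
  then show "b \<le> sum_list (map w fs)" using assms(3) by simp
qed

lemma T_nonneg: "(\<And>f. f \<in> E \<Longrightarrow> w f \<ge> 0) \<Longrightarrow> x \<in> carrier G \<Longrightarrow> y \<in> carrier G \<Longrightarrow> 0 \<le> T w x y"
proof (rule T_ge)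
  fix fs assume w: "\<And>f. f \<in> E \<Longrightarrow> w f \<ge> 0" and "edge_path E x fs y"
  then show "0 \<le> sum_list (map w fs)" using subsetD[OF edge_path_edges[of x fs y]] by (auto intro!: sum_list_nonneg)
qed

lemma T_approx:
  assumes "x \<in> carrier G" "y \<in> carrier G" "\<epsilon> > 0"
  obtains fs where "edge_path E x fs y" "sum_list (map w fs) < T w x y + \<epsilon>"
proof (rule ccontr)
  assume "\<not> thesis"
  have "T w x y + \<epsilon> \<le> T w x y"
  proof (rule T_ge[OF assms(1,2)])
    fix fs assume "edge_path E x fs y"
    then show "T w x y + \<epsilon> \<le> sum_list (map w fs)" using that \<open>\<not> thesis\<close> by (meson not_le)
  qed
  then show False using assms by simp
qed

lemma T_triangle:
  assumes w: "\<And>f. f \<in> E \<Longrightarrow> w f \<ge> 0" and c: "x \<in> carrier G" "y \<in> carrier G" "z \<in> carrier G"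
  shows "T w x z \<le> T w x y + T w y z"
proof (rule field_le_epsilon)
  fix \<epsilon> :: real assume "\<epsilon> > 0"
  then have \<epsilon>: "\<epsilon> / 2 > 0" by simp
  obtain fs where fs: "edge_path E x fs y" "sum_list (map w fs) < T w x y + \<epsilon> / 2"
    using T_approx[OF c(1,2) \<epsilon>] by auto
  obtain fs' where fs': "edge_path E y fs' z" "sum_list (map w fs') < T w y z + \<epsilon> / 2"
    using T_approx[OF c(2,3) \<epsilon>] by auto
  have "T w x z \<le> sum_list (map w (fs @ fs'))" by (intro T_le w edge_path_append[OF fs(1) fs'(1)])
  then show "T w x z \<le> T w x y + T w y z + \<epsilon>" using fs fs' by simp
qed

lemma sum_list_le_length: "(\<And>f. f \<in> set fs \<Longrightarrow> w f \<le> (b::real)) \<Longrightarrow> sum_list (map w fs) \<le> b * length fs"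
  by (induction fs) (auto simp: algebra_simps add_mono)

lemma sum_list_ge_length: "(\<And>f. f \<in> set fs \<Longrightarrow> (b::real) \<le> w f) \<Longrightarrow> b * length fs \<le> sum_list (map w fs)"
  by (induction fs) (auto simp: algebra_simps add_mono)

lemma T_le_dist:
  fixes b :: real
  assumes w: "\<And>f. f \<in> E \<Longrightarrow> w f \<ge> 0" "\<And>f. f \<in> E \<Longrightarrow> w f \<le> b" and c: "x \<in> carrier G" "y \<in> carrier G"
  shows "T w x y \<le> b * dist x y"
proof -
  obtain fs where fs: "edge_path E x fs y" "length fs = dist x y" using path_exists[OF c] .
  have "T w x y \<le> sum_list (map w fs)" by (rule T_le[OF w(1) fs(1)])
  also have "\<dots> \<le> b * length fs" using edge_path_edges[OF fs(1)] w(2) by (intro sum_list_le_length) auto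
  finally show ?thesis using fs by simp
qed

lemma T_ge_dist:
  fixes b :: real
  assumes w: "\<And>f. f \<in> E \<Longrightarrow> b \<le> w f" and b: "b \<ge> 0" and c: "x \<in> carrier G" "y \<in> carrier G"
  shows "b * dist x y \<le> T w x y"
proof (rule T_ge[OF c])
  fix fs assume fs: "edge_path E x fs y"
  have "b * dist x y \<le> b * length fs" using dist_le_path[OF fs c(1)] b by (intro mult_left_mono) auto
  also have "\<dots> \<le> sum_list (map w fs)" using edge_path_edges[OF fs] w by (intro sum_list_ge_length) auto
  finally show "b * dist x y \<le> sum_list (map w fs)" .
qed

lemma edge_path_shift:
  "edge_path E x fs y \<Longrightarrow> g \<in> carrier G \<Longrightarrow> edge_path E (g \<otimes> x) (map (\<lambda>f. g <# f) fs) (g \<otimes> y)"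
  by (induction fs arbitrary: x) (use l_coset_pair edge_shift in \<open>auto\<close>)

lemma T_shift_le:
  assumes w: "\<And>f. f \<in> E \<Longrightarrow> w' (g <# f) = w f" and w0: "\<And>f. f \<in> E \<Longrightarrow> w' f \<ge> 0"
    and g: "g \<in> carrier G" and c: "x \<in> carrier G" "y \<in> carrier G"
  shows "T w' (g \<otimes> x) (g \<otimes> y) \<le> T w x y"
proof (rule T_ge[OF c])
  fix fs assume fs: "edge_path E x fs y"
  have "T w' (g \<otimes> x) (g \<otimes> y) \<le> sum_list (map w' (map (\<lambda>f. g <# f) fs))"
    by (rule T_le[OF w0 edge_path_shift[OF fs g]])
  also have "map w' (map (\<lambda>f. g <# f) fs) = map w fs" using edge_path_edges[OF fs] w by auto
  finally show "T w' (g \<otimes> x) (g \<otimes> y) \<le> sum_list (map w fs)" .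
qed

lemma l_coset_inv_cancel: "g \<in> carrier G \<Longrightarrow> H \<subseteq> carrier G \<Longrightarrow> g <# (inv g <# H) = H"
  and l_coset_inv_cancel': "g \<in> carrier G \<Longrightarrow> H \<subseteq> carrier G \<Longrightarrow> inv g <# (g <# H) = H"
  by (simp_all add: lcos_m_assoc lcos_mult_one)

lemma T_shift:
  assumes w: "\<And>f. f \<in> E \<Longrightarrow> w' (g <# f) = w f" and w0: "\<And>f. f \<in> E \<Longrightarrow> w' f \<ge> 0" "\<And>f. f \<in> E \<Longrightarrow> w f \<ge> 0"
    and g: "g \<in> carrier G" and c: "x \<in> carrier G" "y \<in> carrier G"
  shows "T w' (g \<otimes> x) (g \<otimes> y) = T w x y"
proof (rule antisym)
  show "T w' (g \<otimes> x) (g \<otimes> y) \<le> T w x y" by (rule T_shift_le[where w = w and w' = w']) (fact w w0(1) g c)+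
  have "w (inv g <# f) = w' f" if "f \<in> E" for f
    using w[of "inv g <# f"] edge_shift[OF that, of "inv g"] g l_coset_inv_cancel[OF g edge_sub[OF that]] by simp
  then have "T w (inv g \<otimes> (g \<otimes> x)) (inv g \<otimes> (g \<otimes> y)) \<le> T w' (g \<otimes> x) (g \<otimes> y)"
    by (rule T_shift_le[where w = w' and w' = w]) (use w0 g c in auto)
  then show "T w x y \<le> T w' (g \<otimes> x) (g \<otimes> y)" using g c by simp
qed

end

section \<open>Far apart roads cannot beat the seminorm\<close>

context lattice_seminorm begin

text \<open>
  Each road \<open>r\<close> may save at most \<open>C r\<close> against the subadditive function \<open>p\<close>. A path that goes from
  one road to another pays for it, since each off-road edge costs at least \<open>1\<close> more than
  \<open>p\<close> requires and a road \<open>r\<close> is at distance at least \<open>C r\<close> from the other roads. So only a road close to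
  the starting point can contribute. In the induction over the path, the second claim accounts for
  a path that has entered the road \<open>r\<close> at \<open>u\<close>, has last left it at \<open>v\<close>, and has not yet met
  another road.
\<close>

lemma path_cost_lower_bound:
  fixes V :: "'r \<Rightarrow> 'a set" and a :: "'r \<Rightarrow> real" and C :: "'r \<Rightarrow> real" and w :: "'a set \<Rightarrow> real"
  assumes K2: "K2 \<ge> P + 1" and a: "\<And>r. 0 \<le> a r \<and> a r \<le> K2" and C: "\<And>r. C r \<ge> 0"
    and V: "\<And>r. V r \<subseteq> carrier G"
    and same: "\<And>r u v. u \<in> V r \<Longrightarrow> v \<in> V r \<Longrightarrow> p (inv u \<otimes> v) - C r \<le> a r * dist u v"
    and far: "\<And>r r' u v. r \<noteq> r' \<Longrightarrow> u \<in> V r \<Longrightarrow> v \<in> V r' \<Longrightarrow> C r' \<le> dist u v \<and> 1 \<le> dist u v"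
    and edges: "\<And>x z. {x, z} \<in> E \<Longrightarrow> w {x, z} = K2 \<or> (\<exists>r. x \<in> V r \<and> z \<in> V r \<and> w {x, z} = a r)"
    and path: "edge_path E x fs y" and x: "x \<in> carrier G"
  shows "(\<forall>B\<ge>0. (\<forall>r. \<forall>v\<in>V r. C r - dist x v \<le> B) \<longrightarrow> p (inv x \<otimes> y) - C0 - B \<le> sum_list (map w fs)) \<and>
    (\<forall>r. \<forall>u\<in>V r. \<forall>v\<in>V r. p (inv u \<otimes> y) - C0 - C r \<le> sum_list (map w fs) + a r * dist u v + K2 * dist v x)"
  using path x
proof (induction fs arbitrary: x)
  case Nil
  then have y: "y = x" "x \<in> carrier G" by auto
  have "p (inv u \<otimes> x) - C0 - C r \<le> a r * dist u v + K2 * dist v x" if uv: "u \<in> V r" "v \<in> V r" for r u v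
  proof -
    have c: "u \<in> carrier G" "v \<in> carrier G" using uv V by auto
    have "p (inv u \<otimes> x) \<le> p (inv u \<otimes> v) + p (inv v \<otimes> x)"
      using p_mult[of "inv u \<otimes> v" "inv v \<otimes> x"] c y by (simp add: m_assoc)
    moreover have "p (inv v \<otimes> x) \<le> K2 * dist v x + C0"
      using p_le[of "inv v \<otimes> x"] c y K2 mult_right_mono[of P K2 "dist v x"] by simp
    ultimately show ?thesis using same[OF uv] by linarith
  qed
  then show ?case using y by (auto simp: p_one)
next
  case (Cons f fs)
  then obtain z where f: "f = {x, z}" "{x, z} \<in> E" and rest: "edge_path E z fs y" by auto
  have x: "x \<in> carrier G" and z: "z \<in> carrier G" and s: "inv x \<otimes> z \<in> letters" using edgeD[OF f(2)] by auto
  have y: "y \<in> carrier G" using edge_path_carrier[OF rest z] .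
  have xz: "dist x z \<le> 1" using len_letter[OF s] .
  note IH = Cons.IH[OF rest z]
  let ?c = "sum_list (map w fs)"
  have cost: "sum_list (map w (f # fs)) = w {x, z} + ?c" using f by simp
  show ?case
  proof (cases "w {x, z} = K2")
    case True
    have "p (inv x \<otimes> y) - C0 - B \<le> K2 + ?c" if B: "B \<ge> 0" "\<forall>r. \<forall>v\<in>V r. C r - dist x v \<le> B" for B
    proof -
      have "C r - dist z v \<le> B + 1" if v: "v \<in> V r" for r v
      proof -
        have "v \<in> carrier G" using v V by auto
        then have "real (dist x v) \<le> 1 + dist z v" using dist_triangle[of x z v] x z xz by linarith
        then show ?thesis using B(2) v by force
      qed
      then have "p (inv z \<otimes> y) - C0 - (B + 1) \<le> ?c" using IH B(1) by simp
      moreover have "p (inv x \<otimes> y) \<le> P + p (inv z \<otimes> y)"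
        using p_mult[of "inv x \<otimes> z" "inv z \<otimes> y"] p_letter[OF s] x y z by (simp add: m_assoc)
      ultimately show ?thesis using K2 by linarith
    qed
    moreover have "p (inv u \<otimes> y) - C0 - C r \<le> K2 + ?c + a r * dist u v + K2 * dist v x"
      if uv: "u \<in> V r" "v \<in> V r" for r u v
    proof -
      have "v \<in> carrier G" using uv V by auto
      then have "real (dist v z) \<le> dist v x + 1" using dist_triangle[of v x z] x z xz by linarith
      then have "K2 * dist v z \<le> K2 * (dist v x + 1)" using K2 P_ge_1 by (intro mult_left_mono) auto
      moreover have "p (inv u \<otimes> y) - C0 - C r \<le> ?c + a r * dist u v + K2 * dist v z" using IH uv by blast
      ultimately show ?thesis by (simp add: algebra_simps)
    qed
    ultimately show ?thesis unfolding cost True by blast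
  next
    case False
    then obtain r where r: "x \<in> V r" "z \<in> V r" "w {x, z} = a r" using edges[OF f(2)] by auto
    have 1: "p (inv u \<otimes> y) - C0 - C r \<le> a r + ?c + a r * dist u v + K2 * dist v x"
      if uv: "u \<in> V r" "v \<in> V r" for u v
    proof -
      have c: "u \<in> carrier G" "v \<in> carrier G" using uv V by auto
      have "dist u z \<le> dist u v + (dist v x + 1)"
        using dist_triangle[of u v z] dist_triangle[of v x z] c x z xz by linarith
      then have "a r * dist u z \<le> a r * (dist u v + (dist v x + 1))"
        using a[of r] by (intro mult_left_mono) (auto simp flip: of_nat_add of_nat_Suc)
      moreover have "a r * dist v x \<le> K2 * dist v x" using a[of r] by (intro mult_right_mono) auto
      moreover have "p (inv u \<otimes> y) - C0 - C r \<le> ?c + a r * dist u z + K2 * dist z z" using IH uv r by blast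
      ultimately show ?thesis using z by (simp add: algebra_simps)
    qed
    have 2: "p (inv x \<otimes> y) - C0 - B \<le> a r + ?c" if B: "B \<ge> 0" "\<forall>r. \<forall>v\<in>V r. C r - dist x v \<le> B" for B
      using 1[OF r(1) r(1)] B(2)[rule_format, OF r(1)] x by simp
    have 3: "p (inv u \<otimes> y) - C0 - C r' \<le> a r + ?c + a r' * dist u v + K2 * dist v x"
      if uv: "u \<in> V r'" "v \<in> V r'" and ne: "r' \<noteq> r" for r' u v
    proof -
      have c: "u \<in> carrier G" "v \<in> carrier G" using uv V by auto
      have d: "C r \<le> dist v x" "1 \<le> dist v x" using far[OF ne uv(2) r(1)] by auto
      have "C r'' - dist x v'' \<le> C r" if "v'' \<in> V r''" for r'' v''
        using far[of r r'' x v''] r(1) that C[of r] C[of r''] by (cases "r'' = r") auto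
      then have A: "p (inv x \<otimes> y) - C0 - C r \<le> a r + ?c" using 2[of "C r"] C[of r] by blast
      have "v \<noteq> x" using d x by auto
      then have "inv v \<otimes> x \<noteq> \<one>" using c x by (metis inv_closed inv_equality inv_inv)
      then have "p (inv v \<otimes> x) \<le> P * dist v x" using c x by (intro p_le') auto
      moreover have "p (inv u \<otimes> y) \<le> p (inv u \<otimes> v) + p (inv v \<otimes> x) + p (inv x \<otimes> y)"
        using p_mult[of "inv u \<otimes> v" "inv v \<otimes> y"] p_mult[of "inv v \<otimes> x" "inv x \<otimes> y"] c x y by (simp add: m_assoc)
      moreover have "K2 * dist v x \<ge> P * dist v x + C r"
        using d(1) mult_right_mono[OF K2, of "dist v x"] by (simp add: algebra_simps)
      ultimately show ?thesis using A same[OF uv] by linarith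
    qed
    show ?thesis unfolding cost r(3) using 1 2 3 by blast
  qed
qed

end

section \<open>The ergodic action on a profinite completion\<close>

locale subgroup_chain = group G for G (structure) +
  fixes D :: "nat \<Rightarrow> 'a set"
  assumes D_subgroup: "\<And>i. subgroup (D i) G" and D_Suc: "\<And>i. D (Suc i) \<subseteq> D i"
    and D_finite: "\<And>i. finite (left_cosets G (D i))"
begin

abbreviation level where "level i \<equiv> left_cosets G (D i)"

definition "cosets = (\<Union>i. level i)"

lemma D_anti: "i \<le> j \<Longrightarrow> D j \<subseteq> D i"
  using D_Suc by (rule lift_Suc_antimono_le)

lemma D_carrier: "D i \<subseteq> carrier G"
  using subgroup.subset[OF D_subgroup] .

lemma levelI: "g \<in> carrier G \<Longrightarrow> g <# D i \<in> level i"
  unfolding left_cosets_def by auto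

lemma level_eq: "C \<in> level i \<Longrightarrow> x \<in> C \<Longrightarrow> x \<in> carrier G \<and> C = x <# D i"
proof -
  assume "C \<in> level i" and x: "x \<in> C"
  then obtain g where g: "g \<in> carrier G" "C = g <# D i" unfolding left_cosets_def by auto
  then have xc: "x \<in> carrier G" using x D_carrier[of i] by (auto simp: l_coset_def)
  moreover have "g <# D i = x <# D i" using g x by (intro l_repr_independence D_subgroup) auto
  ultimately show ?thesis using g by simp
qed

lemma self_in: "g \<in> carrier G \<Longrightarrow> g \<in> g <# D i"
  using subgroup.one_closed[OF D_subgroup[of i]] by (force simp: l_coset_def)

lemma level_nonempty: "C \<in> level i \<Longrightarrow> C \<noteq> {}"
  unfolding left_cosets_def using self_in by auto

lemma level_carrier: "C \<in> level i \<Longrightarrow> C \<subseteq> carrier G"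
  using level_eq by blast

lemma level_sub: "i \<le> j \<Longrightarrow> C \<in> level i \<Longrightarrow> C' \<in> level j \<Longrightarrow> x \<in> C \<Longrightarrow> x \<in> C' \<Longrightarrow> C' \<subseteq> C"
proof -
  assume "i \<le> j" "C \<in> level i" "C' \<in> level j" "x \<in> C" "x \<in> C'"
  then have "C = x <# D i" "C' = x <# D j" using level_eq by blast+
  then show ?thesis using D_anti[OF \<open>i \<le> j\<close>] by (auto simp: l_coset_def)
qed

lemma level_disjoint: "C \<in> level i \<Longrightarrow> C' \<in> level i \<Longrightarrow> x \<in> C \<Longrightarrow> x \<in> C' \<Longrightarrow> C = C'"
  using level_eq by blast

lemma level_shift: "g \<in> carrier G \<Longrightarrow> C \<in> level i \<Longrightarrow> g <# C \<in> level i"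
proof -
  assume g: "g \<in> carrier G" and "C \<in> level i"
  then obtain x where "x \<in> carrier G" "C = x <# D i" unfolding left_cosets_def by auto
  then show ?thesis using g D_carrier levelI[of "g \<otimes> x" i] by (simp add: lcos_m_assoc)
qed

lemma cosets_shift: "g \<in> carrier G \<Longrightarrow> C \<in> cosets \<Longrightarrow> g <# C \<in> cosets"
  unfolding cosets_def using level_shift by blast

lemma cosets_carrier: "C \<in> cosets \<Longrightarrow> C \<subseteq> carrier G"
  unfolding cosets_def using level_carrier by blast

lemma shift_inv: "g \<in> carrier G \<Longrightarrow> C \<subseteq> carrier G \<Longrightarrow> g <# (inv g <# C) = C"
  and shift_inv': "g \<in> carrier G \<Longrightarrow> C \<subseteq> carrier G \<Longrightarrow> inv g <# (g <# C) = C"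
  by (simp_all add: lcos_m_assoc lcos_mult_one)

lemma shift_mono: "A \<subseteq> B \<Longrightarrow> g <# A \<subseteq> g <# B"
  by (auto simp: l_coset_def)

text \<open>
  Points of the inverse limit of the finite sets \<open>level i\<close>, as indicator functions of the coherent
  chains of cosets.
\<close>

definition Om :: "('a set \<Rightarrow> real) set" where
  "Om = {\<omega>. (\<forall>C. \<omega> C \<in> {0, 1}) \<and> (\<forall>C. C \<notin> cosets \<longrightarrow> \<omega> C = 0) \<and>
     (\<forall>i. \<exists>C\<in>level i. \<omega> C = 1) \<and> (\<forall>C C'. \<omega> C = 1 \<longrightarrow> \<omega> C' = 1 \<longrightarrow> C \<subseteq> C' \<or> C' \<subseteq> C)}"

lemma Om_unique: "\<omega> \<in> Om \<Longrightarrow> C \<in> level i \<Longrightarrow> C' \<in> level i \<Longrightarrow> \<omega> C = 1 \<Longrightarrow> \<omega> C' = 1 \<Longrightarrow> C = C'"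
proof -
  assume *: "\<omega> \<in> Om" "C \<in> level i" "C' \<in> level i" "\<omega> C = 1" "\<omega> C' = 1"
  then have "C \<subseteq> C' \<or> C' \<subseteq> C" unfolding Om_def by blast
  then show ?thesis using level_disjoint[OF *(2,3)] level_nonempty[OF *(2)] level_nonempty[OF *(3)] by blast
qed

lemma Om_ex: "\<omega> \<in> Om \<Longrightarrow> \<exists>C\<in>level i. \<omega> C = 1"
  unfolding Om_def by blast

lemma Om_nested: "\<omega> \<in> Om \<Longrightarrow> i \<le> j \<Longrightarrow> C \<in> level i \<Longrightarrow> C' \<in> level j \<Longrightarrow> \<omega> C = 1 \<Longrightarrow> \<omega> C' = 1 \<Longrightarrow> C' \<subseteq> C"
proof -
  assume *: "\<omega> \<in> Om" "i \<le> j" "C \<in> level i" "C' \<in> level j" "\<omega> C = 1" "\<omega> C' = 1"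
  then have "C \<subseteq> C' \<or> C' \<subseteq> C" unfolding Om_def by blast
  then show ?thesis using level_sub[OF *(2-4)] level_nonempty[OF *(3)] level_nonempty[OF *(4)] by blast
qed

definition "cyl C = {\<omega> \<in> Om. \<omega> C = 1}"

definition "gens = insert Om (insert {} (cyl ` cosets))"

lemma gens_Pow: "gens \<subseteq> Pow Om"
  unfolding gens_def cyl_def by auto

lemma cyl_disjoint: "C \<in> level i \<Longrightarrow> C' \<in> level i \<Longrightarrow> C \<noteq> C' \<Longrightarrow> cyl C \<inter> cyl C' = {}"
  unfolding cyl_def using Om_unique by blast

lemma cyl_Union: "(\<Union>C\<in>level i. cyl C) = Om"
  unfolding cyl_def using Om_ex by blast

lemma cyl_Int:
  assumes "C \<in> level i" "C' \<in> level j" "i \<le> j"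
  shows "cyl C \<inter> cyl C' = (if C' \<subseteq> C then cyl C' else {})"
proof (cases "C' \<subseteq> C")
  case True
  have "cyl C' \<subseteq> cyl C"
  proof
    fix \<omega> assume w: "\<omega> \<in> cyl C'"
    then have \<omega>: "\<omega> \<in> Om" "\<omega> C' = 1" by (auto simp: cyl_def)
    obtain C'' where C'': "C'' \<in> level i" "\<omega> C'' = 1" using Om_ex \<omega> by blast
    have "C' \<subseteq> C''" using Om_nested[OF \<omega>(1) assms(3) C''(1) assms(2) C''(2) \<omega>(2)] .
    then have "C'' = C" using True level_disjoint[OF C''(1) assms(1)] level_nonempty[OF assms(2)] by blast
    then show "\<omega> \<in> cyl C" using \<omega> C'' by (simp add: cyl_def)
  qed
  then show ?thesis using True by auto
next
  case False
  then show ?thesis using Om_nested[OF _ assms(3) assms(1,2)] unfolding cyl_def by auto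
qed

lemma gens_Int_stable: "Int_stable gens"
proof (rule Int_stableI)
  fix a b assume ab: "a \<in> gens" "b \<in> gens"
  have cc: "cyl C \<inter> cyl C' \<in> gens" if c: "C \<in> cosets" "C' \<in> cosets" for C C'
  proof -
    obtain i j where ij: "C \<in> level i" "C' \<in> level j" using c unfolding cosets_def by blast
    show ?thesis
    proof (cases "i \<le> j")
      case True then show ?thesis using cyl_Int[OF ij] c by (auto simp: gens_def)
    next
      case False
      then have "cyl C' \<inter> cyl C \<in> gens" using cyl_Int[OF ij(2,1)] c by (auto simp: gens_def)
      then show ?thesis by (simp add: Int_commute)
    qed
  qed
  have sub: "a \<inter> Om = a" "b \<inter> Om = b" "Om \<inter> b = b" using gens_Pow ab by auto
  have e: "{} \<in> gens" by (simp add: gens_def)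
  consider "a = Om" | "a = {}" | "b = Om" | "b = {}" | C C' where "C \<in> cosets" "C' \<in> cosets" "a = cyl C" "b = cyl C'"
    using ab unfolding gens_def by blast
  then show "a \<inter> b \<in> gens" using ab sub cc e by cases simp_all
qed

subsection \<open>Random digits\<close>

definition pick :: "'a set \<Rightarrow> 'a" where "pick C = (SOME x. x \<in> C)"

lemma pick_in: "C \<noteq> {} \<Longrightarrow> pick C \<in> C"
  unfolding pick_def by (simp add: some_in_eq)

definition parent :: "nat \<Rightarrow> 'a set" where "parent i = (case i of 0 \<Rightarrow> carrier G | Suc j \<Rightarrow> D j)"

definition digits :: "nat \<Rightarrow> 'a set" where "digits i = pick ` {C \<in> level i. C \<subseteq> parent i}"

lemma finite_digits: "finite (digits i)"
  unfolding digits_def using D_finite[of i] by simp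

lemma D_parent: "D i \<subseteq> parent i"
  unfolding parent_def using D_carrier D_Suc by (auto split: nat.split)

lemma parent_subgroup: "subgroup (parent i) G"
  unfolding parent_def using D_subgroup subgroup_self by (auto split: nat.split)

lemma digits_nonempty: "digits i \<noteq> {}"
proof -
  have "\<one> <# D i = D i" using D_carrier by (simp add: lcos_mult_one)
  then have "D i \<in> {C \<in> level i. C \<subseteq> parent i}" using levelI[of \<one> i] D_parent by auto
  then show ?thesis unfolding digits_def by blast
qed

lemma digits_parent: "x \<in> digits i \<Longrightarrow> x \<in> parent i"
proof -
  assume "x \<in> digits i"
  then obtain C where "C \<in> level i" "C \<subseteq> parent i" "x = pick C" unfolding digits_def by blast
  then show ?thesis using pick_in[OF level_nonempty] by blast
qed

lemma digits_carrier: "x \<in> digits i \<Longrightarrow> x \<in> carrier G"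
  using digits_parent subgroup.subset[OF parent_subgroup] by blast

lemma digit_unique:
  assumes y: "y \<in> parent i" and x: "x \<in> digits i"
  shows "x <# D i = y <# D i \<longleftrightarrow> x = pick (y <# D i)"
proof (rule iffI)
  obtain C where C: "C \<in> level i" "x = pick C" using x unfolding digits_def by auto
  have "x \<in> C" using C pick_in level_nonempty by blast
  then have CC: "C = x <# D i" using level_eq[OF C(1)] by blast
  have yc: "y \<in> carrier G" using y subgroup.subset[OF parent_subgroup] by blast
  show "x = pick (y <# D i)" if "x <# D i = y <# D i" using CC C(2) that by metis
  show "x <# D i = y <# D i" if "x = pick (y <# D i)"
  proof -
    have "x \<in> y <# D i" using that pick_in[of "y <# D i"] self_in[OF yc, of i] by blast
    then show ?thesis using l_repr_independence[OF _ yc D_subgroup] by metis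
  qed
qed

lemma pick_digits: "y \<in> parent i \<Longrightarrow> pick (y <# D i) \<in> digits i"
proof -
  assume y: "y \<in> parent i"
  then have yc: "y \<in> carrier G" using subgroup.subset[OF parent_subgroup] by blast
  have "y <# D i \<subseteq> parent i"
    using y D_parent[of i] subgroup.m_closed[OF parent_subgroup] by (auto simp: l_coset_def)
  then show ?thesis unfolding digits_def using levelI[OF yc] by blast
qed

primrec head :: "(nat \<Rightarrow> 'a) \<Rightarrow> nat \<Rightarrow> 'a" where
  "head \<delta> 0 = \<delta> 0"
| "head \<delta> (Suc i) = head \<delta> i \<otimes> \<delta> (Suc i)"

definition "chain \<delta> i = head \<delta> i <# D i"

definition "Dig = PiM UNIV (\<lambda>i. uniform_count_measure (digits i))"

lemma space_Dig: "space Dig = {\<delta>. \<forall>i. \<delta> i \<in> digits i}"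
  unfolding Dig_def by (auto simp: space_PiM space_uniform_count_measure PiE_def)

sublocale Dig: product_prob_space "\<lambda>i. uniform_count_measure (digits i)" UNIV
  unfolding product_prob_space_def product_prob_space_axioms_def product_sigma_finite_def
  using prob_space_uniform_count_measure[OF finite_digits digits_nonempty] prob_space_imp_sigma_finite
  by blast

lemma prob_space_Dig: "prob_space Dig"
  unfolding Dig_def by (rule Dig.P.prob_space_axioms)

lemma head_carrier: "\<delta> \<in> space Dig \<Longrightarrow> head \<delta> i \<in> carrier G"
proof (induction i)
  case 0 then show ?case using digits_carrier[of "\<delta> 0" 0] by (simp add: space_Dig)
next
  case (Suc i) then show ?case using digits_carrier[of "\<delta> (Suc i)" "Suc i"] by (simp add: space_Dig)
qed

lemma chain_Suc: "\<delta> \<in> space Dig \<Longrightarrow> chain \<delta> (Suc i) \<subseteq> chain \<delta> i"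
proof -
  assume \<delta>: "\<delta> \<in> space Dig"
  have x: "\<delta> (Suc i) \<in> D i" using \<delta> digits_parent[of "\<delta> (Suc i)" "Suc i"] by (simp add: space_Dig parent_def)
  show ?thesis
  proof
    fix y assume "y \<in> chain \<delta> (Suc i)"
    then obtain z where z: "z \<in> D (Suc i)" "y = head \<delta> i \<otimes> \<delta> (Suc i) \<otimes> z" by (auto simp: chain_def l_coset_def)
    have "\<delta> (Suc i) \<otimes> z \<in> D i" using x z D_Suc subgroup.m_closed[OF D_subgroup] by blast
    moreover have "y = head \<delta> i \<otimes> (\<delta> (Suc i) \<otimes> z)"
      using z(2) m_assoc[OF head_carrier[OF \<delta>] subsetD[OF D_carrier x] subsetD[OF D_carrier z(1)]] by simp
    ultimately show "y \<in> chain \<delta> i" by (auto simp: chain_def l_coset_def)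
  qed
qed

lemma chain_anti: "\<delta> \<in> space Dig \<Longrightarrow> i \<le> j \<Longrightarrow> chain \<delta> j \<subseteq> chain \<delta> i"
  using chain_Suc by (rule lift_Suc_antimono_le)

lemma chain_level: "\<delta> \<in> space Dig \<Longrightarrow> chain \<delta> i \<in> level i"
  unfolding chain_def using head_carrier levelI by blast

lemma chain_event:
  "C \<in> level i \<Longrightarrow> \<exists>\<tau>. (\<forall>j. \<tau> j \<in> digits j) \<and> {\<delta> \<in> space Dig. chain \<delta> i = C} = {\<delta> \<in> space Dig. \<forall>j\<in>{..i}. \<delta> j \<in> {\<tau> j}}"
proof (induction i arbitrary: C)
  case 0
  obtain \<tau>0 where \<tau>0: "\<And>j. \<tau>0 j \<in> digits j" using choice[of "\<lambda>j x. x \<in> digits j"] digits_nonempty by blast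
  obtain y where y: "y \<in> carrier G" "C = y <# D 0" using 0 unfolding left_cosets_def by auto
  then have yp: "y \<in> parent 0" by (simp add: parent_def)
  have "chain \<delta> 0 = C \<longleftrightarrow> \<delta> 0 = pick C" if "\<delta> \<in> space Dig" for \<delta>
    using digit_unique[OF yp, of "\<delta> 0"] that y by (simp add: chain_def space_Dig)
  then show ?case using \<tau>0 pick_digits[OF yp] y
    by (intro exI[of _ "\<tau>0(0 := pick C)"]) auto
next
  case (Suc i)
  obtain y where y: "y \<in> carrier G" "C = y <# D (Suc i)" using Suc.prems unfolding left_cosets_def by auto
  obtain \<tau> where \<tau>: "\<And>j. \<tau> j \<in> digits j"
    "{\<delta> \<in> space Dig. chain \<delta> i = y <# D i} = {\<delta> \<in> space Dig. \<forall>j\<in>{..i}. \<delta> j \<in> {\<tau> j}}"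
    using Suc.IH[OF levelI[OF y(1)]] by blast
  have \<tau>s: "\<tau> \<in> space Dig" using \<tau>(1) by (simp add: space_Dig)
  have "\<tau> \<in> {\<delta> \<in> space Dig. \<forall>j\<in>{..i}. \<delta> j \<in> {\<tau> j}}" using \<tau>s by simp
  then have "chain \<tau> i = y <# D i" using \<tau>(2) by blast
  then have "y \<in> head \<tau> i <# D i" using self_in[OF y(1), of i] by (simp add: chain_def)
  then obtain z where z: "z \<in> D i" "y = head \<tau> i \<otimes> z" by (auto simp: l_coset_def)
  define t where "t = pick (z <# D (Suc i))"
  have zp: "z \<in> parent (Suc i)" using z by (simp add: parent_def)
  have zc: "z \<in> carrier G" using z D_carrier by blast
  have hc: "head \<tau> i \<in> carrier G" using head_carrier[OF \<tau>s] .
  have head_eq: "head \<delta> i = head \<tau> i" if "\<forall>j\<in>{..i}. \<delta> j = \<tau> j" for \<delta>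
    using that by (induction i) auto
  have "chain \<delta> (Suc i) = C \<longleftrightarrow> (\<forall>j\<in>{..Suc i}. \<delta> j \<in> {(\<tau>(Suc i := t)) j})" if \<delta>: "\<delta> \<in> space Dig" for \<delta>
  proof -
    have dig: "\<delta> (Suc i) \<in> digits (Suc i)" using \<delta> by (simp add: space_Dig)
    have dc: "\<delta> (Suc i) \<in> carrier G" using digits_carrier[OF dig] .
    have 1: "chain \<delta> (Suc i) = C \<Longrightarrow> chain \<delta> i = y <# D i"
    proof -
      assume "chain \<delta> (Suc i) = C"
      then have "y \<in> chain \<delta> i" using chain_Suc[OF \<delta>, of i] y self_in[OF y(1), of "Suc i"] by auto
      then show ?thesis using level_eq[OF chain_level[OF \<delta>]] by blast
    qed
    have 2: "chain \<delta> i = y <# D i \<longleftrightarrow> (\<forall>j\<in>{..i}. \<delta> j = \<tau> j)" using \<tau>(2) \<delta> by blast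
    have 3: "chain \<delta> (Suc i) = C \<longleftrightarrow> \<delta> (Suc i) = t" if "\<forall>j\<in>{..i}. \<delta> j = \<tau> j"
    proof -
      have "chain \<delta> (Suc i) = head \<tau> i <# (\<delta> (Suc i) <# D (Suc i))"
        using head_eq[OF that] hc dc D_carrier by (simp add: chain_def lcos_m_assoc)
      moreover have "C = head \<tau> i <# (z <# D (Suc i))"
        using y z hc zc D_carrier by (simp add: lcos_m_assoc)
      moreover have "\<delta> (Suc i) <# D (Suc i) \<subseteq> carrier G" "z <# D (Suc i) \<subseteq> carrier G"
        using dc zc D_carrier l_coset_subset_G by auto
      ultimately have "chain \<delta> (Suc i) = C \<longleftrightarrow> \<delta> (Suc i) <# D (Suc i) = z <# D (Suc i)"
        using hc shift_inv' by metis
      then show ?thesis using digit_unique[OF zp dig] by (simp add: t_def)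
    qed
    have "(\<forall>j\<in>{..Suc i}. \<delta> j \<in> {(\<tau>(Suc i := t)) j}) \<longleftrightarrow> (\<forall>j\<in>{..i}. \<delta> j = \<tau> j) \<and> \<delta> (Suc i) = t"
      by (auto simp: atMost_Suc)
    then show ?thesis using 1 2 3 by blast
  qed
  then have "{\<delta> \<in> space Dig. chain \<delta> (Suc i) = C} = {\<delta> \<in> space Dig. \<forall>j\<in>{..Suc i}. \<delta> j \<in> {(\<tau>(Suc i := t)) j}}"
    by blast
  moreover have "\<forall>j. (\<tau>(Suc i := t)) j \<in> digits j" using \<tau>(1) pick_digits[OF zp] by (simp add: t_def)
  ultimately show ?case by blast
qed

lemma chain_event_prob:
  assumes C: "C \<in> level i"
  shows "{\<delta> \<in> space Dig. chain \<delta> i = C} \<in> sets Dig"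
    and "measure Dig {\<delta> \<in> space Dig. chain \<delta> i = C} = (\<Prod>j\<in>{..i}. 1 / card (digits j))"
proof -
  obtain \<tau> where \<tau>: "\<And>j. \<tau> j \<in> digits j"
    "{\<delta> \<in> space Dig. chain \<delta> i = C} = {\<delta> \<in> space Dig. \<forall>j\<in>{..i}. \<delta> j \<in> {\<tau> j}}"
    using chain_event[OF C] by auto
  have eq: "{\<delta> \<in> space Dig. \<forall>j\<in>{..i}. \<delta> j \<in> {\<tau> j}} =
      Dig.emb UNIV {..i} (Pi\<^sub>E {..i} (\<lambda>j. {\<tau> j}))"
    unfolding prod_emb_def by (auto simp: Dig_def space_PiM Pi_iff)
  have s: "{\<tau> j} \<in> sets (uniform_count_measure (digits j))" for j
    using \<tau>(1) by (simp add: sets_uniform_count_measure)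
  have "Dig.emb UNIV {..i} (Pi\<^sub>E {..i} (\<lambda>j. {\<tau> j})) \<in> sets Dig"
    unfolding Dig_def using s by (intro sets_PiM_I) auto
  then show "{\<delta> \<in> space Dig. chain \<delta> i = C} \<in> sets Dig" by (simp only: \<tau>(2) eq)
  have "measure (uniform_count_measure (digits j)) {\<tau> j} = 1 / card (digits j)" for j
    using \<tau>(1)[of j] finite_digits[of j] by (simp add: measure_uniform_count_measure)
  then have "measure Dig (Dig.emb UNIV {..i} (Pi\<^sub>E {..i} (\<lambda>j. {\<tau> j}))) = (\<Prod>j\<in>{..i}. 1 / card (digits j))"
    unfolding Dig_def using s by (subst Dig.measure_PiM_emb) auto
  then show "measure Dig {\<delta> \<in> space Dig. chain \<delta> i = C} = (\<Prod>j\<in>{..i}. 1 / card (digits j))"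
    by (simp only: \<tau>(2) eq)
qed

definition point :: "(nat \<Rightarrow> 'a) \<Rightarrow> 'a set \<Rightarrow> real" where
  "point \<delta> C = (if \<exists>i. C = chain \<delta> i then 1 else 0)"

lemma point_1_iff:
  assumes \<delta>: "\<delta> \<in> space Dig" and C: "C \<in> level i"
  shows "point \<delta> C = 1 \<longleftrightarrow> chain \<delta> i = C"
proof
  assume "point \<delta> C = 1"
  then obtain j where j: "C = chain \<delta> j" by (auto simp: point_def split: if_splits)
  have "chain \<delta> j \<subseteq> chain \<delta> i \<or> chain \<delta> i \<subseteq> chain \<delta> j" using chain_anti[OF \<delta>] by (meson nat_le_linear)
  then show "chain \<delta> i = C"
    using level_disjoint[OF C chain_level[OF \<delta>, of i]] level_nonempty[OF C] level_nonempty[OF chain_level[OF \<delta>, of i]] j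
    by blast
qed (auto simp: point_def)

lemma point_Om: "\<delta> \<in> space Dig \<Longrightarrow> point \<delta> \<in> Om"
proof -
  assume \<delta>: "\<delta> \<in> space Dig"
  have "\<exists>C\<in>level i. point \<delta> C = 1" for i
    using chain_level[OF \<delta>, of i] by (intro bexI[of _ "chain \<delta> i"]) (auto simp: point_def)
  moreover have "C \<subseteq> C' \<or> C' \<subseteq> C" if "point \<delta> C = 1" "point \<delta> C' = 1" for C C'
    using that chain_anti[OF \<delta>] by (auto simp: point_def split: if_splits) (meson nat_le_linear subsetD)+
  moreover have "point \<delta> C = 0" if "C \<notin> cosets" for C
    using that chain_level[OF \<delta>] by (auto simp: point_def cosets_def)
  ultimately show ?thesis unfolding Om_def by (auto simp: point_def)
qed

definition M :: "('a set \<Rightarrow> real) measure" where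
  "M = distr Dig (sigma Om gens) point"

lemma space_M: "space M = Om"
  unfolding M_def using gens_Pow by (simp add: space_measure_of)

lemma sets_M: "sets M = sigma_sets Om gens"
  unfolding M_def using gens_Pow by (simp add: sets_measure_of)

lemma point_preimage: "C \<in> level i \<Longrightarrow> point -` cyl C \<inter> space Dig = {\<delta> \<in> space Dig. chain \<delta> i = C}"
  unfolding cyl_def using point_1_iff point_Om by auto

lemma point_measurable: "point \<in> measurable Dig (sigma Om gens)"
proof (rule measurable_measure_of[OF gens_Pow])
  show "point \<in> space Dig \<rightarrow> Om" using point_Om by auto
  fix A assume "A \<in> gens"
  then consider "A = Om" | "A = {}" | C i where "A = cyl C" "C \<in> level i"
    unfolding gens_def cosets_def by blast
  then show "point -` A \<inter> space Dig \<in> sets Dig"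
  proof cases
    case 1
    then have "point -` A \<inter> space Dig = space Dig" using point_Om by auto
    then show ?thesis by simp
  next
    case 3 then show ?thesis using point_preimage chain_event_prob(1) by simp
  qed auto
qed

lemma prob_space_M: "prob_space M"
  unfolding M_def using point_measurable by (rule prob_space.prob_space_distr[OF prob_space_Dig])

lemma cyl_sets: "C \<in> cosets \<Longrightarrow> cyl C \<in> sets M"
  unfolding sets_M gens_def by (rule sigma_sets.Basic) auto

lemma cyl_prob: "C \<in> level i \<Longrightarrow> measure M (cyl C) = 1 / card (level i)"
proof -
  interpret prob_space M by (rule prob_space_M)
  let ?q = "\<Prod>j\<in>{..i}. 1 / real (card (digits j))"
  have q: "measure M (cyl C) = ?q" if C: "C \<in> level i" for C
  proof -
    have "cyl C \<in> sets (sigma Om gens)" using cyl_sets[of C] C unfolding cosets_def M_def by auto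
    then show ?thesis unfolding M_def
      using point_measurable chain_event_prob(2)[OF C] point_preimage[OF C] by (simp add: measure_distr)
  qed
  assume C: "C \<in> level i"
  have "measure M (\<Union>C\<in>level i. cyl C) = (\<Sum>C\<in>level i. measure M (cyl C))"
    using cyl_sets cyl_disjoint unfolding cosets_def
    by (intro finite_measure_finite_Union D_finite) (auto simp: disjoint_family_on_def)
  then have "1 = (\<Sum>C\<in>level i. ?q)" using q prob_space cyl_Union[of i] by (simp add: space_M)
  then have "1 = card (level i) * ?q" by simp
  moreover have "card (level i) \<noteq> 0" using C D_finite[of i] by auto
  ultimately show ?thesis using q[OF C] by (simp only: eq_divide_eq mult.commute of_nat_eq_0_iff) simp
qed

definition act :: "'a \<Rightarrow> ('a set \<Rightarrow> real) \<Rightarrow> 'a set \<Rightarrow> real" where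
  "act g = (\<lambda>\<omega>\<in>Om. \<lambda>C. if C \<in> cosets then \<omega> (inv g <# C) else 0)"

lemma act_apply: "\<omega> \<in> Om \<Longrightarrow> C \<in> cosets \<Longrightarrow> act g \<omega> C = \<omega> (inv g <# C)"
  by (simp add: act_def)

lemma act_Om: "g \<in> carrier G \<Longrightarrow> \<omega> \<in> Om \<Longrightarrow> act g \<omega> \<in> Om"
proof -
  assume g: "g \<in> carrier G" and \<omega>: "\<omega> \<in> Om"
  have "\<exists>C\<in>level i. act g \<omega> C = 1" for i
  proof -
    obtain C where C: "C \<in> level i" "\<omega> C = 1" using Om_ex[OF \<omega>] by blast
    then have "g <# C \<in> level i" "inv g <# (g <# C) = C" using level_shift[OF g C(1)] shift_inv'[OF g level_carrier[OF C(1)]] by auto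
    then show ?thesis using \<omega> C by (intro bexI[of _ "g <# C"]) (auto simp: act_def cosets_def)
  qed
  moreover have "C \<subseteq> C' \<or> C' \<subseteq> C" if "act g \<omega> C = 1" "act g \<omega> C' = 1" for C C'
  proof -
    have c: "C \<in> cosets" "C' \<in> cosets" "\<omega> (inv g <# C) = 1" "\<omega> (inv g <# C') = 1"
      using that \<omega> by (auto simp: act_def split: if_splits)
    then have "inv g <# C \<subseteq> inv g <# C' \<or> inv g <# C' \<subseteq> inv g <# C" using \<omega> unfolding Om_def by blast
    then show ?thesis using shift_mono[of _ _ g] shift_inv[OF g cosets_carrier] c by metis
  qed
  moreover have "act g \<omega> C \<in> {0, 1}" for C
    using \<omega> by (cases "C \<in> cosets") (auto simp: act_def Om_def)
  moreover have "act g \<omega> C = 0" if "C \<notin> cosets" for C using \<omega> that by (simp add: act_def)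
  ultimately show ?thesis unfolding Om_def by blast
qed

lemma act_one: "\<omega> \<in> Om \<Longrightarrow> act \<one> \<omega> = \<omega>"
  using cosets_carrier by (auto simp: act_def lcos_mult_one Om_def fun_eq_iff)

lemma act_mult: "g \<in> carrier G \<Longrightarrow> h \<in> carrier G \<Longrightarrow> \<omega> \<in> Om \<Longrightarrow> act (g \<otimes> h) \<omega> = act g (act h \<omega>)"
proof
  fix C assume *: "g \<in> carrier G" "h \<in> carrier G" "\<omega> \<in> Om"
  show "act (g \<otimes> h) \<omega> C = act g (act h \<omega>) C"
  proof (cases "C \<in> cosets")
    case True
    have "inv (g \<otimes> h) <# C = inv h <# (inv g <# C)"
      using * cosets_carrier[OF True] by (simp add: inv_mult_group lcos_m_assoc)
    then show ?thesis using * True act_Om[of h \<omega>] cosets_shift[of "inv g" C] by (simp add: act_apply)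
  qed (use * act_Om in \<open>auto simp: act_def\<close>)
qed

lemma act_bij: "g \<in> carrier G \<Longrightarrow> bij_betw (act g) Om Om"
proof (rule bij_betw_byWitness[where f' = "act (inv g)"])
  assume g: "g \<in> carrier G"
  show "\<forall>a\<in>Om. act (inv g) (act g a) = a" using g act_mult[of "inv g" g] act_one by simp
  show "\<forall>a'\<in>Om. act g (act (inv g) a') = a'" using g act_mult[of g "inv g"] act_one by simp
qed (use act_Om in auto)

lemma act_group_action: "group_action G Om act"
proof (unfold group_action_def, rule group_hom.intro)
  show "group_hom_axioms G (BijGroup Om) act"
  proof (rule group_hom_axioms.intro, rule homI)
    fix g assume g: "g \<in> carrier G"
    show "act g \<in> carrier (BijGroup Om)"
      using act_bij[OF g] by (auto simp: BijGroup_def Bij_def act_def)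
  next
    fix g h assume gh: "g \<in> carrier G" "h \<in> carrier G"
    have "act g \<in> Bij Om" "act h \<in> Bij Om" using act_bij gh by (auto simp: Bij_def act_def)
    then show "act (g \<otimes> h) = act g \<otimes>\<^bsub>BijGroup Om\<^esub> act h"
      using act_mult[OF gh] by (auto simp: BijGroup_def compose_def fun_eq_iff) (auto simp: act_def)
  qed
qed (auto intro: is_group group_BijGroup)

lemma act_cyl: "g \<in> carrier G \<Longrightarrow> C \<in> cosets \<Longrightarrow> act g -` cyl C \<inter> Om = cyl (inv g <# C)"
  unfolding cyl_def using act_Om act_apply by auto

lemma act_measurable: "g \<in> carrier G \<Longrightarrow> act g \<in> measurable M M"
proof -
  assume g: "g \<in> carrier G"
  have "act g \<in> measurable M (sigma Om gens)"
  proof (rule measurable_measure_of[OF gens_Pow])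
    show "act g \<in> space M \<rightarrow> Om" using act_Om[OF g] by (auto simp: space_M)
    fix A assume "A \<in> gens"
    then consider "A = Om" | "A = {}" | C where "A = cyl C" "C \<in> cosets"
      unfolding gens_def by blast
    then show "act g -` A \<inter> space M \<in> sets M"
    proof cases
      case 1
      then have "act g -` A \<inter> space M = space M" using act_Om[OF g] by (auto simp: space_M)
      then show ?thesis by simp
    next
      case 3 then show ?thesis using act_cyl[OF g] cyl_sets[OF cosets_shift[of "inv g"]] g by (simp add: space_M)
    qed auto
  qed
  then show ?thesis by (simp add: M_def)
qed

lemma measure_eqI_cyl:
  assumes "finite_measure M1" and sets: "sets M1 = sets M" "sets M2 = sets M"
    and Om: "emeasure M1 Om = emeasure M2 Om"
    and cyl: "\<And>i C. C \<in> level i \<Longrightarrow> emeasure M1 (cyl C) = emeasure M2 (cyl C)"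
  shows "M1 = M2"
proof (rule measure_eqI_generator_eq[OF gens_Int_stable gens_Pow])
  show "sets M1 = sigma_sets Om gens" "sets M2 = sigma_sets Om gens" using sets sets_M by auto
  fix A assume "A \<in> gens"
  then show "emeasure M1 A = emeasure M2 A" using Om cyl unfolding gens_def cosets_def by auto
next
  show "range (\<lambda>i::nat. Om) \<subseteq> gens" by (auto simp: gens_def)
  show "emeasure M1 Om \<noteq> \<infinity>" using finite_measure.emeasure_finite[OF assms(1)] by simp
qed auto

lemma act_preserves: "g \<in> carrier G \<Longrightarrow> distr M M (act g) = M"
proof (rule measure_eqI_cyl)
  interpret prob_space M by (rule prob_space_M)
  assume g: "g \<in> carrier G"
  interpret d: prob_space "distr M M (act g)" by (rule prob_space_distr[OF act_measurable[OF g]])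
  show "finite_measure (distr M M (act g))" by (rule d.finite_measure_axioms)
  show "emeasure (distr M M (act g)) Om = emeasure M Om"
    using d.emeasure_space_1 emeasure_space_1 by (simp add: space_M)
  fix i C assume C: "C \<in> level i"
  then have Cc: "C \<in> cosets" by (auto simp: cosets_def)
  have "emeasure (distr M M (act g)) (cyl C) = emeasure M (cyl (inv g <# C))"
    using act_measurable[OF g] cyl_sets[OF Cc] act_cyl[OF g Cc] by (simp add: emeasure_distr space_M)
  also have "\<dots> = emeasure M (cyl C)"
    using cyl_prob[OF C] cyl_prob[OF level_shift[of "inv g", OF _ C]] g by (simp add: emeasure_eq_measure)
  finally show "emeasure (distr M M (act g)) (cyl C) = emeasure M (cyl C)" .
qed auto

text \<open>
  An invariant event meets all cylinders of the same level in equal measure, so it is independent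
  of every cylinder, hence of itself.
\<close>

lemma act_ergodic:
  assumes A: "A \<in> sets M" and inv: "\<And>g. g \<in> carrier G \<Longrightarrow> act g ` A = A"
  shows "measure M A = 0 \<or> measure M A = 1"
proof -
  interpret prob_space M by (rule prob_space_M)
  have AO: "A \<subseteq> Om" using sets.sets_into_space[OF A] by (simp add: space_M)
  have eq: "measure M (A \<inter> cyl C) = measure M (A \<inter> cyl C')" if C: "C \<in> level i" "C' \<in> level i" for C C' i
  proof -
    obtain x y where xy: "x \<in> carrier G" "C = x <# D i" "y \<in> carrier G" "C' = y <# D i"
      using C unfolding left_cosets_def by auto
    define g where "g = x \<otimes> inv y"
    have g: "g \<in> carrier G" using xy by (simp add: g_def)
    have C'c: "inv g <# C = C'" using xy D_carrier by (simp add: g_def lcos_m_assoc inv_mult_group m_assoc)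
    have Cc: "C \<in> cosets" using C by (auto simp: cosets_def)
    have "act g -` (A \<inter> cyl C) \<inter> space M = A \<inter> cyl C'"
    proof -
      have "act g -` A \<inter> Om = A"
      proof
        show "act g -` A \<inter> Om \<subseteq> A"
        proof
          fix \<omega> assume "\<omega> \<in> act g -` A \<inter> Om"
          then have "\<omega> \<in> Om" "act g \<omega> \<in> act g ` A" unfolding inv[OF g] by auto
          then show "\<omega> \<in> A" using inj_on_image_mem_iff[OF bij_betw_imp_inj_on[OF act_bij[OF g]] _ AO] by blast
        qed
        show "A \<subseteq> act g -` A \<inter> Om" using inv[OF g] AO by auto
      qed
      then show ?thesis using act_cyl[OF g Cc] C'c by (auto simp: space_M)
    qed
    moreover have "measure (distr M M (act g)) (A \<inter> cyl C) = measure M (act g -` (A \<inter> cyl C) \<inter> space M)"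
      by (rule measure_distr[OF act_measurable[OF g] sets.Int[OF A cyl_sets[OF Cc]]])
    ultimately show ?thesis unfolding act_preserves[OF g] by metis
  qed
  have indep: "measure M (A \<inter> cyl C) = measure M A * measure M (cyl C)" if C: "C \<in> level i" for C i
  proof -
    have "measure M (\<Union>C\<in>level i. A \<inter> cyl C) = (\<Sum>C\<in>level i. measure M (A \<inter> cyl C))"
    proof (intro finite_measure_finite_Union D_finite)
      show "(\<lambda>C. A \<inter> cyl C) ` level i \<subseteq> sets M" using cyl_sets A unfolding cosets_def by auto
      show "disjoint_family_on (\<lambda>C. A \<inter> cyl C) (level i)"
        unfolding disjoint_family_on_def using cyl_disjoint[of _ i] by blast
    qed
    moreover have "(\<Union>C\<in>level i. A \<inter> cyl C) = A" using cyl_Union[of i] AO by blast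
    moreover have "(\<Sum>C'\<in>level i. measure M (A \<inter> cyl C')) = (\<Sum>C'\<in>level i. measure M (A \<inter> cyl C))"
      using eq[OF _ C] by (intro sum.cong) auto
    ultimately have "measure M A = card (level i) * measure M (A \<inter> cyl C)" by simp
    then show ?thesis using cyl_prob[OF C] C D_finite[of i] by (auto simp: field_simps card_gt_0_iff)
  qed
  have "density M (indicator A) = scale_measure (emeasure M A) M"
  proof (rule measure_eqI_cyl)
    have Oms: "Om \<in> sets M" using sets.top[of M] by (simp add: space_M)
    have de: "emeasure (density M (indicator A)) B = emeasure M (A \<inter> B)" if "B \<in> sets M" for B
      using A that by (simp add: emeasure_density flip: indicator_inter_arith)
    show "emeasure (density M (indicator A)) Om = emeasure (scale_measure (emeasure M A) M) Om"
      using de[OF Oms] AO emeasure_space_1 by (simp add: space_M Int_absorb2)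
    show "finite_measure (density M (indicator A))"
      using de[OF Oms] by (intro finite_measureI) (simp add: space_M)
    fix i C assume C: "C \<in> level i"
    then have Cs: "cyl C \<in> sets M" using cyl_sets by (auto simp: cosets_def)
    show "emeasure (density M (indicator A)) (cyl C) = emeasure (scale_measure (emeasure M A) M) (cyl C)"
      using de[OF Cs] indep[OF C] by (simp add: emeasure_eq_measure ennreal_mult)
  qed auto
  then have "emeasure (density M (indicator A)) A = emeasure (scale_measure (emeasure M A) M) A" by simp
  moreover have "emeasure (density M (indicator A)) A = emeasure M A"
    using A by (simp add: emeasure_density flip: indicator_inter_arith)
  ultimately have "measure M A = measure M A * measure M A"
    by (simp add: emeasure_eq_measure flip: ennreal_mult)
  then show ?thesis by (metis mult_cancel_left1)
qed

end

section \<open>Periodic families of roads in one direction\<close>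

lemma (in group) finite_left_cosetsI:
  assumes P: "subgroup P G" and fin: "finite (f ` carrier G)"
    and f: "\<And>g h. g \<in> carrier G \<Longrightarrow> h \<in> carrier G \<Longrightarrow> f g = f h \<Longrightarrow> inv g \<otimes> h \<in> P"
  shows "finite (left_cosets G P)"
proof -
  have same: "g <# P = h <# P" if "g \<in> carrier G" "h \<in> carrier G" "f g = f h" for g h
  proof (rule l_repr_independence[OF _ that(1) P])
    have "h = g \<otimes> (inv g \<otimes> h)" using that by simp
    then show "h \<in> g <# P" using f[OF that] by (auto simp: l_coset_def)
  qed
  define F where "F b = (SOME g. g \<in> carrier G \<and> f g = b)" for b
  have "left_cosets G P \<subseteq> (\<lambda>b. F b <# P) ` f ` carrier G"
  proof
    fix C assume "C \<in> left_cosets G P"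
    then obtain g where g: "g \<in> carrier G" "C = g <# P" unfolding left_cosets_def by auto
    have "F (f g) \<in> carrier G \<and> f (F (f g)) = f g" unfolding F_def by (rule someI[of _ g]) (use g in simp)
    then have "C = F (f g) <# P" using same[of g "F (f g)"] g by simp
    then show "C \<in> (\<lambda>b. F b <# P) ` f ` carrier G" using g by blast
  qed
  then show ?thesis using fin by (meson finite_imageI finite_subset)
qed

lemma int_dvd_small: "(a::int) dvd b \<Longrightarrow> \<bar>b\<bar> < a \<Longrightarrow> b = 0"
  using dvd_imp_le_int[of b a] by auto

lemma (in group) l_coset_eq_iff:
  assumes "subgroup P G" "x \<in> carrier G" "y \<in> carrier G"
  shows "x <# P = y <# P \<longleftrightarrow> inv x \<otimes> y \<in> P"
proof
  assume "x <# P = y <# P"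
  moreover have "y \<in> y <# P" using subgroup.one_closed[OF assms(1)] assms(3) by (force simp: l_coset_def)
  ultimately obtain h where "h \<in> P" "y = x \<otimes> h" by (auto simp: l_coset_def)
  then show "inv x \<otimes> y \<in> P" using assms subgroup.mem_carrier[OF assms(1)] by simp
next
  assume *: "inv x \<otimes> y \<in> P"
  have "y = x \<otimes> (inv x \<otimes> y)" using assms by simp
  then have "y \<in> x <# P" using * by (auto simp: l_coset_def)
  then show "x <# P = y <# P" using assms by (intro l_repr_independence) auto
qed

context lattice_seminorm begin

definition congruence_subgroup :: "nat \<Rightarrow> 'a set" where
  "congruence_subgroup m = {x \<in> N. \<forall>j<d. int m dvd K x j}"

lemma congruence_subgroup_subgroup: "subgroup (congruence_subgroup m) G"
proof (rule subgroupI)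
  show "congruence_subgroup m \<subseteq> carrier G" using N_carrier by (auto simp: congruence_subgroup_def)
  have "\<one> \<in> congruence_subgroup m" by (simp add: congruence_subgroup_def)
  then show "congruence_subgroup m \<noteq> {}" by blast
next
  fix a assume "a \<in> congruence_subgroup m"
  then have a: "a \<in> N" "\<And>j. j < d \<Longrightarrow> int m dvd K a j" by (auto simp: congruence_subgroup_def)
  show "inv a \<in> congruence_subgroup m"
    unfolding congruence_subgroup_def using a N_inv[OF a(1)] K_inv[OF a(1)] by simp
  fix b assume "b \<in> congruence_subgroup m"
  then have b: "b \<in> N" "\<And>j. j < d \<Longrightarrow> int m dvd K b j" by (auto simp: congruence_subgroup_def)
  show "a \<otimes> b \<in> congruence_subgroup m"
    unfolding congruence_subgroup_def using a b N_mult[OF a(1) b(1)] K_mult[OF a(1) b(1)] by simp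
qed

lemma finite_congruence_cosets: "m \<ge> 1 \<Longrightarrow> finite (left_cosets G (congruence_subgroup m))"
proof (rule finite_left_cosetsI[OF congruence_subgroup_subgroup])
  assume m: "m \<ge> 1"
  define f where "f g = (rep (inv g), \<lambda>j\<in>{..<d}. K (inv g \<otimes> inv (rep (inv g))) j mod int m)" for g
  have "f g \<in> rep ` carrier G \<times> (PiE {..<d} (\<lambda>_. {0..<int m}))" if "g \<in> carrier G" for g
  proof -
    have "rep (inv g) \<in> rep ` carrier G" using that by (intro imageI) simp
    moreover have "(\<lambda>j\<in>{..<d}. K (inv g \<otimes> inv (rep (inv g))) j mod int m) \<in> PiE {..<d} (\<lambda>_. {0..<int m})"
      using m unfolding restrict_PiE_iff by simp
    ultimately show ?thesis unfolding f_def by blast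
  qed
  then have "f ` carrier G \<subseteq> rep ` carrier G \<times> (PiE {..<d} (\<lambda>_. {0..<int m}))" by blast
  moreover have "finite (rep ` carrier G \<times> (PiE {..<d} (\<lambda>_. {0..<int m})))"
    using finite_rep by (intro finite_cartesian_product finite_PiE) simp_all
  ultimately show "finite (f ` carrier G)" by (rule finite_subset)
  fix g h assume gh: "g \<in> carrier G" "h \<in> carrier G" "f g = f h"
  define t x y where "t = rep (inv g)" and "x = inv g \<otimes> inv t" and "y = inv h \<otimes> inv t"
  have t: "t = rep (inv h)" "t \<in> carrier G" using gh by (auto simp: t_def f_def)
  have xN: "x \<in> N" using rep_N[of "inv g"] gh by (simp add: x_def t_def)
  have yN: "y \<in> N" using rep_N[of "inv h"] gh t(1) by (simp add: y_def)
  have eq: "inv g \<otimes> h = x \<otimes> inv y" using gh t by (simp add: x_def y_def inv_mult_group m_assoc)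
  have "int m dvd K x j - K y j" if "j < d" for j
  proof -
    have "K x j mod int m = K y j mod int m"
      using gh(3) that t(1) unfolding f_def x_def y_def t_def by (auto dest!: fun_cong[of _ _ j])
    then show ?thesis by (simp add: mod_eq_dvd_iff)
  qed
  then show "inv g \<otimes> h \<in> congruence_subgroup m"
    unfolding eq congruence_subgroup_def using xN yN by (simp add: K_mult)
qed

lemma finite_cosets_above:
  assumes "subgroup Q G" "congruence_subgroup m \<subseteq> Q" "m \<ge> 1"
  shows "finite (left_cosets G Q)"
proof (rule finite_left_cosetsI[OF assms(1)])
  let ?f = "\<lambda>g. g <# congruence_subgroup m"
  have "?f ` carrier G = left_cosets G (congruence_subgroup m)" by (auto simp: left_cosets_def)
  then show "finite (?f ` carrier G)" using finite_congruence_cosets[OF assms(3)] by simp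
  fix g h assume "g \<in> carrier G" "h \<in> carrier G" "?f g = ?f h"
  then show "inv g \<otimes> h \<in> Q" using l_coset_eq_iff[OF congruence_subgroup_subgroup] assms(2) by blast
qed

definition word :: "'a \<Rightarrow> 'a list" where
  "word z = (SOME ss. set ss \<subseteq> letters \<and> wprod ss = z \<and> length ss = len z)"

lemma word: "z \<in> carrier G \<Longrightarrow> set (word z) \<subseteq> letters \<and> wprod (word z) = z \<and> length (word z) = len z"
proof -
  assume "z \<in> carrier G"
  then obtain ss where "set ss \<subseteq> letters" "wprod ss = z" "length ss = len z" by (rule len_word)
  then have "\<exists>ss. set ss \<subseteq> letters \<and> wprod ss = z \<and> length ss = len z" by blast
  then show ?thesis unfolding word_def by (rule someI_ex)
qed

definition pre :: "'a \<Rightarrow> nat \<Rightarrow> 'a" where "pre z t = wprod (take t (word z))"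

lemma pre_carrier [simp]: "z \<in> carrier G \<Longrightarrow> pre z t \<in> carrier G"
  unfolding pre_def using word[of z] set_take_subset[of t "word z"] by (intro wprod_closed) auto

lemma len_pre: "z \<in> carrier G \<Longrightarrow> len (pre z t) \<le> len z"
proof -
  assume z: "z \<in> carrier G"
  have "len (pre z t) \<le> length (take t (word z))"
    unfolding pre_def using word[OF z] set_take_subset[of t "word z"] by (intro len_le) auto
  then show ?thesis using word[OF z] by simp
qed

lemma pre_0 [simp]: "pre z 0 = \<one>"
  by (simp add: pre_def)

lemma pre_len [simp]: "z \<in> carrier G \<Longrightarrow> pre z (len z) = z"
  unfolding pre_def using word[of z] by simp

lemma pre_Suc: "z \<in> carrier G \<Longrightarrow> t < len z \<Longrightarrow> \<exists>s\<in>letters. pre z (Suc t) = pre z t \<otimes> s"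
proof -
  assume z: "z \<in> carrier G" and t: "t < len z"
  have tl: "t < length (word z)" using word[OF z] t by simp
  have "word z ! t \<in> letters" using word[OF z] nth_mem[OF tl] by blast
  moreover have "take (Suc t) (word z) = take t (word z) @ [word z ! t]" using tl by (rule take_Suc_conv_app_nth)
  moreover have "set (take t (word z)) \<subseteq> letters" using word[OF z] set_take_subset[of t "word z"] by auto
  ultimately show ?thesis unfolding pre_def by (intro bexI[of _ "word z ! t"]) (simp_all add: wprod_append)
qed

definition road :: "'a \<Rightarrow> nat \<Rightarrow> 'a set" where
  "road z n = {z [^] q \<otimes> pre z t | q t. q < n \<and> t \<le> len z}"

definition road_edges :: "'a \<Rightarrow> nat \<Rightarrow> ('a \<times> 'a) set" where
  "road_edges z n = {(z [^] q \<otimes> pre z t, z [^] q \<otimes> pre z (Suc t)) | q t. q < n \<and> t < len z}"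

lemma road_carrier: "z \<in> carrier G \<Longrightarrow> road z n \<subseteq> carrier G"
  unfolding road_def by auto

lemma road_image: "road z n = (\<lambda>(q, t). z [^] q \<otimes> pre z t) ` ({..<n} \<times> {..len z})"
  unfolding road_def by auto

lemma finite_road: "finite (road z n)"
  unfolding road_image by simp

lemma card_road: "card (road z n) \<le> n * (len z + 1)"
  unfolding road_image using card_image_le[of "{..<n} \<times> {..len z}" "\<lambda>(q, t). z [^] q \<otimes> pre z t"] by simp

definition "wball c = {g \<in> carrier G. len g \<le> c}"

lemma finite_wball: "finite (wball c)"
  unfolding wball_def by (rule finite_ball)

text \<open>
  The base points of the roads form a coset of a finite-index subgroup \<open>Q\<close>. In coordinates \<open>Q\<close> is
  spanned by \<open>(n + r) z\<close> and the vectors \<open>r v\<close> with vanishing coordinate \<open>j\<^sub>0\<close>, so the roads of length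
  \<open>n\<close> leave gaps of length \<open>r\<close> along the direction of \<open>z\<close> and are at distance of order \<open>r\<close> transversally.
  The number \<open>r\<close> is chosen first, to make the roads sparse; it determines the finite set \<open>F\<close> of
  connections from an arbitrary point to a road, and then \<open>m\<close> such that moving by \<open>z\<^sup>m\<close> keeps these
  connections short, and finally \<open>n\<close> much larger than \<open>m\<close> and \<open>r\<close>.
\<close>

lemma road_family_exists:
  assumes z: "z \<in> N" and zpos: "\<psi> z > 0" and d2: "d \<ge> 2" and M: "M \<ge> (1::nat)"
    and \<eta>: "\<eta> > (0::real)" and \<epsilon>: "\<epsilon> > (0::real)"
  shows "\<exists>Q M' n m F. subgroup Q G \<and> Q \<subseteq> congruence_subgroup M \<and> congruence_subgroup M' \<subseteq> Q \<and> M' \<ge> 1 \<and>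
    (\<forall>u\<in>road z n. \<forall>v\<in>road z n. \<forall>q\<in>Q. dist u (q \<otimes> v) \<le> c \<longrightarrow> \<psi> q = 0) \<and>
    real (card (wball c) * card (road z n)) \<le> \<eta> * card (left_cosets G Q) \<and>
    finite F \<and> F \<subseteq> N \<and> (1::nat) \<le> m \<and> m \<le> n \<and>
    (\<forall>g\<in>F. real (len g + len (inv (z [^] m) \<otimes> inv g \<otimes> z [^] m)) \<le> \<epsilon> * m) \<and>
    real (card {C \<in> left_cosets G Q. C \<subseteq> N \<and> \<not> (\<exists>g\<in>F. \<exists>k\<le>n - m. C = (g \<otimes> inv (z [^] k)) <# Q)})
      \<le> \<epsilon> * card (left_cosets G Q)"
proof -
  have zc: "z \<in> carrier G" using z by simp
  obtain j0 where j0: "j0 < d" "K z j0 \<noteq> 0" using zpos \<psi>_eq_0_iff[OF z] by auto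
  obtain j1 where j1: "j1 < d" "j1 \<noteq> j0"
    using d2 that[of "if j0 = 0 then 1 else 0"] by (auto split: if_splits)
  define B' where "B' = (\<lambda>(t, t', b). pre z t \<otimes> b \<otimes> inv (pre z t')) ` ({..len z} \<times> {..len z} \<times> wball c) \<inter> N"
  have finB: "finite B'" unfolding B'_def using finite_wball by auto
  define bd where "bd = (\<Sum>b\<in>B'. (\<Sum>j<d. \<bar>K b j\<bar>) * (1 + (\<Sum>j<d. \<bar>K z j\<bar>)))"
  have bd: "\<bar>K b j\<bar> + \<bar>K b j0\<bar> * \<bar>K z j\<bar> \<le> bd" if b: "b \<in> B'" and j: "j < d" for b j
  proof -
    let ?s = "\<Sum>j<d. \<bar>K b j\<bar>"
    have 1: "\<bar>K b i\<bar> \<le> ?s" "\<bar>K z i\<bar> \<le> (\<Sum>j<d. \<bar>K z j\<bar>)" if "i < d" for i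
      using that member_le_sum[of i "{..<d}" "\<lambda>j. \<bar>K b j\<bar>"] member_le_sum[of i "{..<d}" "\<lambda>j. \<bar>K z j\<bar>"] by simp_all
    have "\<bar>K b j\<bar> \<le> ?s" "\<bar>K b j0\<bar> \<le> ?s" "\<bar>K z j\<bar> \<le> (\<Sum>j<d. \<bar>K z j\<bar>)"
      using 1[OF j] 1[OF j0(1)] by simp_all
    then have "\<bar>K b j\<bar> + \<bar>K b j0\<bar> * \<bar>K z j\<bar> \<le> ?s + ?s * (\<Sum>j<d. \<bar>K z j\<bar>)"
      by (intro add_mono mult_mono) (simp_all add: sum_nonneg)
    also have "\<dots> = ?s * (1 + (\<Sum>j<d. \<bar>K z j\<bar>))" by (simp add: algebra_simps)
    also have "\<dots> \<le> bd" unfolding bd_def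
      using b finB by (intro member_le_sum[of b B' "\<lambda>b. (\<Sum>j<d. \<bar>K b j\<bar>) * (1 + (\<Sum>j<d. \<bar>K z j\<bar>))"])
        (simp_all add: sum_nonneg)
    finally show ?thesis by simp
  qed
  obtain R :: nat where R: "bd < int R" "real (card (wball c) * (len z + 1)) \<le> \<eta> * R"
  proof -
    define R1 where "R1 = nat bd + 1"
    have R1: "bd < int R1" by (simp add: R1_def)
    obtain R2 :: nat where "real (card (wball c) * (len z + 1)) / \<eta> < R2" using reals_Archimedean2 by blast
    then have R2: "real (card (wball c) * (len z + 1)) \<le> \<eta> * R2" using \<eta> by (simp add: field_simps)
    have "\<eta> * R2 \<le> \<eta> * real (R1 + R2)" using \<eta> by (intro mult_left_mono) auto
    then show ?thesis using that[of "R1 + R2"] R1 R2 by simp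
  qed
  define r where "r = M * m0 * (R + 1)"
  have rR: "int R < int r"
  proof -
    have "1 * 1 * (R + 1) \<le> M * m0 * (R + 1)" using M m0 by (intro mult_le_mono) auto
    then have "Suc R \<le> r" unfolding r_def by (simp only: mult_1 Suc_eq_plus1)
    then have "R < r" by simp
    then show ?thesis by (simp only: of_nat_less_iff)
  qed
  have r1: "r \<ge> 1" using rR by simp
  define H where "H = {x \<in> N. \<exists>k. K x j0 = k * K z j0 \<and> (\<forall>j<d. int r dvd K x j - k * K z j)}"
  define \<xi> where "\<xi> x = K x j0 div K z j0" for x
  have H_iff: "x \<in> H \<longleftrightarrow> K x j0 = \<xi> x * K z j0 \<and> (\<forall>j<d. int r dvd K x j - \<xi> x * K z j)" if "x \<in> N" for x
    using that j0(2) unfolding H_def \<xi>_def by auto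
  have \<xi>_eq: "\<xi> x = k" if "K x j0 = k * K z j0" for x k using that j0(2) unfolding \<xi>_def by simp
  have \<xi>_mult: "x \<otimes> y \<in> H \<and> \<xi> (x \<otimes> y) = \<xi> x + \<xi> y" if "x \<in> H" "y \<in> H" for x y
  proof -
    have N: "x \<in> N" "y \<in> N" using that by (auto simp: H_def)
    have 1: "K (x \<otimes> y) j0 = (\<xi> x + \<xi> y) * K z j0" using that N by (simp add: H_iff K_mult distrib_right)
    have "int r dvd K (x \<otimes> y) j - (\<xi> x + \<xi> y) * K z j" if "j < d" for j
    proof -
      have "int r dvd (K x j - \<xi> x * K z j) + (K y j - \<xi> y * K z j)"
        using \<open>x \<in> H\<close> \<open>y \<in> H\<close> N that by (intro dvd_add) (auto simp: H_iff)
      then show ?thesis using N by (simp add: K_mult algebra_simps)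
    qed
    then show ?thesis using 1 \<xi>_eq[OF 1] N by (simp add: H_iff)
  qed
  have \<xi>_inv: "inv x \<in> H \<and> \<xi> (inv x) = - \<xi> x" if "x \<in> H" for x
  proof -
    have N: "x \<in> N" using that by (auto simp: H_def)
    have 1: "K (inv x) j0 = (- \<xi> x) * K z j0" using that N by (simp add: H_iff)
    have "int r dvd K (inv x) j - (- \<xi> x) * K z j" if "j < d" for j
    proof -
      have "int r dvd - (K x j - \<xi> x * K z j)" using \<open>x \<in> H\<close> N that by (subst dvd_minus_iff) (simp add: H_iff)
      then show ?thesis using N by (simp add: algebra_simps)
    qed
    then show ?thesis using 1 \<xi>_eq[OF 1] N by (simp add: H_iff)
  qed
  have HN: "H \<subseteq> N" by (auto simp: H_def)
  have H1: "\<one> \<in> H" "\<xi> \<one> = 0" using \<xi>_eq[of \<one> 0] by (auto simp: H_def)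
  have zk: "z [^] (k::int) \<in> H \<and> \<xi> (z [^] k) = k" for k
  proof -
    have 1: "K (z [^] k) j0 = k * K z j0" using z by (simp add: K_int_pow)
    show ?thesis using \<xi>_eq[OF 1] z by (simp add: H_iff K_int_pow)
  qed
  have zq: "z [^] (q::nat) \<in> H \<and> \<xi> (z [^] q) = int q" for q using zk[of "int q"] by (simp add: int_pow_int)
  have H_sub: "subgroup H G" using HN N_carrier \<xi>_mult \<xi>_inv H1 by (intro subgroupI) auto
  define Hc where "Hc = {g <# H | g. g \<in> N}"
  have Q_H: "congruence_subgroup (r * nat \<bar>K z j0\<bar>) \<subseteq> H"
  proof
    fix x assume "x \<in> congruence_subgroup (r * nat \<bar>K z j0\<bar>)"
    then have x: "x \<in> N" "\<And>j. j < d \<Longrightarrow> int r * \<bar>K z j0\<bar> dvd K x j" by (auto simp: congruence_subgroup_def)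
    obtain l where l: "K x j0 = int r * \<bar>K z j0\<bar> * l" using x(2)[OF j0(1)] by (auto elim: dvdE)
    then have 1: "K x j0 = (int r * (sgn (K z j0) * l)) * K z j0" by (simp add: abs_sgn mult.commute mult.left_commute)
    have "int r dvd K x j - (int r * (sgn (K z j0) * l)) * K z j" if "j < d" for j
      using x(2)[OF that] by (intro dvd_diff) (auto intro: dvd_mult_left simp: mult.assoc)
    then show "x \<in> H" unfolding H_def using x(1) 1 by blast
  qed
  have r0: "r * nat \<bar>K z j0\<bar> \<ge> 1" using r1 j0(2) by (simp add: Suc_le_eq)
  have fin_Hc: "finite Hc"
  proof -
    have "Hc \<subseteq> left_cosets G H" unfolding Hc_def left_cosets_def using N_carrier by blast
    then show ?thesis using finite_cosets_above[OF H_sub Q_H r0] finite_subset by blast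
  qed
  define pk where "pk C = (SOME g. g \<in> N \<and> C = g <# H)" for C :: "'a set"
  have pk: "pk C \<in> N \<and> C = pk C <# H" if "C \<in> Hc" for C
    unfolding pk_def by (rule someI_ex) (use that in \<open>auto simp: Hc_def\<close>)
  define F where "F = pk ` Hc"
  have finF: "finite F" and FN: "F \<subseteq> N" using fin_Hc pk by (auto simp: F_def)
  have F_ex: "\<exists>g\<in>F. inv g \<otimes> x \<in> H" if "x \<in> N" for x
  proof -
    have C: "x <# H \<in> Hc" using that by (auto simp: Hc_def)
    have "pk (x <# H) <# H = x <# H" using pk[OF C] by simp
    then have "inv (pk (x <# H)) \<otimes> x \<in> H" using l_coset_eq_iff[OF H_sub, of "pk (x <# H)" x] pk[OF C] that by simp
    then show ?thesis using C by (auto simp: F_def)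
  qed
  have F_inj: "g = g'" if "g \<in> F" "g' \<in> F" "inv g \<otimes> g' \<in> H" for g g'
  proof -
    obtain C C' where C: "C \<in> Hc" "g = pk C" "C' \<in> Hc" "g' = pk C'" using \<open>g \<in> F\<close> \<open>g' \<in> F\<close> unfolding F_def by blast
    have "g <# H = g' <# H" using l_coset_eq_iff[OF H_sub, of g g'] that FN N_carrier by blast
    then have "C = C'" using pk[OF C(1)] pk[OF C(3)] C(2,4) by metis
    then show ?thesis using C by simp
  qed
  have cardF: "R \<le> card F"
  proof -
    define f where "f i = e j1 [^] (i::nat) <# H" for i
    have e1: "e j1 \<in> N" using e_N j1 by simp
    have "inj_on f {..<R + 1}"
    proof (rule inj_onI)
      fix i i' assume i: "i \<in> {..<R + 1}" "i' \<in> {..<R + 1}" "f i = f i'"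
      let ?x = "inv (e j1 [^] i) \<otimes> e j1 [^] i'"
      have x: "?x \<in> H" using l_coset_eq_iff[OF H_sub, of "e j1 [^] i" "e j1 [^] i'"] i(3) e1 by (simp add: f_def)
      have xN: "?x \<in> N" using e1 by simp
      have Kx: "K ?x j = (int i' - int i) * K (e j1) j" for j
        using e1 by (simp add: K_mult K_pow algebra_simps)
      have "\<xi> ?x = 0" using Kx[of j0] K_e[OF j1(1) j0(1)] j1(2) by (intro \<xi>_eq) simp
      then have "int r dvd K ?x j1" using x H_iff[OF xN] j1(1) by auto
      then have "int r dvd (int i' - int i) * int m0" using Kx[of j1] K_e[OF j1(1) j1(1)] by simp
      then have "int m0 * int (R + 1) dvd int m0 * (int i' - int i)"
        unfolding r_def by (metis dvd_mult_right mult.assoc mult.commute of_nat_mult)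
      then have "int (R + 1) dvd int i' - int i" using m0 by (subst (asm) dvd_mult_cancel_left) auto
      moreover have "\<bar>int i' - int i\<bar> < int (R + 1)" using i(1,2) by auto
      ultimately have "int i' - int i = 0" by (rule int_dvd_small)
      then show "i = i'" by simp
    qed
    moreover have "f ` {..<R + 1} \<subseteq> Hc" unfolding f_def Hc_def using e1 by auto
    ultimately have "R + 1 \<le> card Hc" using card_inj_on_le[of f "{..<R + 1}" Hc] fin_Hc by simp
    moreover have "inj_on pk Hc" using pk by (metis inj_onI)
    ultimately show ?thesis unfolding F_def by (simp add: card_image)
  qed
  have \<epsilon>2: "\<epsilon> / 2 > 0" using \<epsilon> by simp
  have "\<exists>C. \<forall>g\<in>F. \<forall>n. len (inv (z [^] (n::nat)) \<otimes> inv g \<otimes> z [^] n) \<le> \<epsilon> / 2 * real n + C g"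
    using slow_conjugation[OF z _ \<epsilon>2] FN by (intro bchoice) auto
  then obtain C where C: "\<And>g n. g \<in> F \<Longrightarrow> len (inv (z [^] (n::nat)) \<otimes> inv g \<otimes> z [^] n) \<le> \<epsilon> / 2 * real n + C g" by blast
  obtain m :: nat where m: "m \<ge> 1" "(\<Sum>g\<in>F. len g + \<bar>C g\<bar>) \<le> \<epsilon> / 2 * m"
  proof -
    obtain m :: nat where "(\<Sum>g\<in>F. len g + \<bar>C g\<bar>) / (\<epsilon> / 2) < m" using reals_Archimedean2 by blast
    then have "(\<Sum>g\<in>F. len g + \<bar>C g\<bar>) \<le> \<epsilon> / 2 * Suc m" using \<epsilon> by (simp add: field_simps)
    then show ?thesis using that[of "Suc m"] by simp
  qed
  have slow: "real (len g + len (inv (z [^] m) \<otimes> inv g \<otimes> z [^] m)) \<le> \<epsilon> * m" if g: "g \<in> F" for g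
  proof -
    have "len g + \<bar>C g\<bar> \<le> (\<Sum>g\<in>F. len g + \<bar>C g\<bar>)" using g finF by (intro member_le_sum) auto
    then show ?thesis using C[OF g, of m] m(2) by (simp add: field_simps)
  qed
  obtain n0 :: nat where n0: "r + m \<le> \<epsilon> * n0" using reals_Archimedean2[of "(r + m) / \<epsilon>"] \<epsilon> by (auto simp: field_simps intro: less_imp_le)
  define n where "n = M * (n0 + m)"
  have "1 * (n0 + m) \<le> n" unfolding n_def using M by (rule mult_le_mono1)
  then have nm: "m \<le> n" and nn0: "n0 \<le> n" by simp_all
  have nr: "r + m \<le> \<epsilon> * n" 
  proof -
    have "\<epsilon> * n0 \<le> \<epsilon> * n" using nn0 \<epsilon> by (intro mult_left_mono) auto
    then show ?thesis using n0 by linarith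
  qed
  define s where "s = n + r"
  define P' where "P' = {x \<in> H. int s dvd \<xi> x}"
  have P_sub: "subgroup P' G"
    using H_sub \<xi>_mult \<xi>_inv H1 HN N_carrier unfolding P'_def by (intro subgroupI) auto
  have PN: "P' \<subseteq> N" using HN by (auto simp: P'_def)
  have PQ: "P' \<subseteq> congruence_subgroup M"
  proof
    fix x assume x: "x \<in> P'"
    then have xN: "x \<in> N" using PN by auto
    have Mr: "int M dvd int r" and Ms: "int M dvd int s" unfolding s_def n_def r_def by (simp_all add: algebra_simps)
    have "int M dvd K x j" if "j < d" for j
    proof -
      have "int r dvd K x j - \<xi> x * K z j" "int s dvd \<xi> x" using x H_iff[OF xN] that by (auto simp: P'_def)
      then have "int M dvd K x j - \<xi> x * K z j" "int M dvd \<xi> x * K z j"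
        using Mr Ms dvd_trans by (blast, metis dvd_mult2 dvd_trans)
      then have "int M dvd (K x j - \<xi> x * K z j) + \<xi> x * K z j" by (rule dvd_add)
      then show ?thesis by simp
    qed
    then show "x \<in> congruence_subgroup M" using xN by (simp add: congruence_subgroup_def)
  qed
  define M' where "M' = (r * nat \<bar>K z j0\<bar>) * s"
  have s1: "s \<ge> 1" using r1 by (simp add: s_def)
  have M'1: "M' \<ge> 1" unfolding M'_def using r0 s1 by (metis One_nat_def Suc_le_eq nat_0_less_mult_iff)
  have QP: "congruence_subgroup M' \<subseteq> P'"
  proof
    fix x assume x: "x \<in> congruence_subgroup M'"
    then have "x \<in> congruence_subgroup (r * nat \<bar>K z j0\<bar>)"
      unfolding congruence_subgroup_def M'_def by (auto intro: dvd_mult_left)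
    then have xH: "x \<in> H" using Q_H by blast
    then have xN: "x \<in> N" using HN by auto
    have "int s * K z j0 dvd K x j0"
    proof -
      have "int M' dvd K x j0" using x j0(1) by (simp add: congruence_subgroup_def)
      moreover have "int s * K z j0 dvd int M'" unfolding M'_def
        by (simp add: mult.commute mult.left_commute)
      ultimately show ?thesis by (rule dvd_trans[rotated])
    qed
    then have "int s * K z j0 dvd \<xi> x * K z j0" using xH H_iff[OF xN] by simp
    then show "x \<in> P'" using xH j0(2) by (simp add: P'_def)
  qed
  have sep: "\<psi> q = 0" if uv: "u \<in> road z n" "v \<in> road z n" and q: "q \<in> P'" and dq: "dist u (q \<otimes> v) \<le> c" for u v q
  proof -
    obtain a t where u: "u = z [^] a \<otimes> pre z t" "a < n" "t \<le> len z" using uv(1) unfolding road_def by auto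
    obtain a' t' where v: "v = z [^] a' \<otimes> pre z t'" "a' < n" "t' \<le> len z" using uv(2) unfolding road_def by auto
    have qN: "q \<in> N" "q \<in> H" using q PN by (auto simp: P'_def)
    define b where "b = inv u \<otimes> (q \<otimes> v)"
    have bc: "b \<in> carrier G" "b \<in> wball c" using dq u v zc qN unfolding b_def wball_def by auto
    define b' where "b' = pre z t \<otimes> b \<otimes> inv (pre z t')"
    have b'q: "b' = inv (z [^] a) \<otimes> (q \<otimes> z [^] a')"
      unfolding b'_def b_def u v using zc qN by (simp add: m_assoc inv_mult_group)
    then have b'H: "b' \<in> H \<and> \<xi> b' = \<xi> q - int a + int a'"
      using \<xi>_mult[OF qN(2), of "z [^] a'"] zq[of a'] \<xi>_inv[of "z [^] a"] zq[of a]
        \<xi>_mult[of "inv (z [^] a)" "q \<otimes> z [^] a'"] by simp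
    then have b'N: "b' \<in> N" using HN by auto
    have b'B: "b' \<in> B'" unfolding B'_def using b'N bc u v
      by (auto simp: b'_def intro!: image_eqI[of _ _ "(t, t', b)"])
    have Kb0: "K b' j0 = \<xi> b' * K z j0" using conjunct1[OF b'H] H_iff[OF b'N] by blast
    then have \<xi>b: "\<bar>\<xi> b'\<bar> \<le> \<bar>K b' j0\<bar>" using j0(2) mult_left_mono[of 1 "\<bar>K z j0\<bar>" "\<bar>\<xi> b'\<bar>"] by (simp add: abs_mult)
    have "0 \<le> \<bar>K b' j0\<bar> * \<bar>K z j0\<bar>" by simp
    then have "\<bar>K b' j0\<bar> \<le> bd" using bd[OF b'B j0(1)] by linarith
    then have "\<bar>\<xi> b'\<bar> < int r" using \<xi>b R(1) rR by linarith
    then have "\<bar>\<xi> q\<bar> < int s" using b'H u(2) v(2) unfolding s_def by linarith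
    moreover have "int s dvd \<xi> q" using q by (simp add: P'_def)
    ultimately have \<xi>q: "\<xi> q = 0" using int_dvd_small by blast
    have "K q j = 0" if j: "j < d" for j
    proof -
      have "int r dvd K b' j - \<xi> b' * K z j" using conjunct1[OF b'H] H_iff[OF b'N] j by blast
      moreover have "\<bar>K b' j - \<xi> b' * K z j\<bar> < int r"
      proof -
        have "\<bar>K b' j - \<xi> b' * K z j\<bar> \<le> \<bar>K b' j\<bar> + \<bar>\<xi> b'\<bar> * \<bar>K z j\<bar>"
          using abs_triangle_ineq4[of "K b' j" "\<xi> b' * K z j"] by (simp add: abs_mult)
        moreover have "\<bar>\<xi> b'\<bar> * \<bar>K z j\<bar> \<le> \<bar>K b' j0\<bar> * \<bar>K z j\<bar>" using \<xi>b by (intro mult_right_mono) auto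
        ultimately show ?thesis using bd[OF b'B j] R(1) rR by linarith
      qed
      ultimately have "K b' j - \<xi> b' * K z j = 0" by (rule int_dvd_small)
      then have "K b' j = \<xi> b' * K z j" by simp
      moreover have "K b' j = - (int a * K z j) + (K q j + int a' * K z j)"
        unfolding b'q using qN z by (simp add: K_mult K_pow)
      ultimately show ?thesis using b'H \<xi>q by (simp add: algebra_simps)
    qed
    then show ?thesis using \<psi>_eq_0_iff[OF qN(1)] by simp
  qed
  define cs where "cs = (\<lambda>(g, k). (g \<otimes> inv (z [^] (k::nat))) <# P')"
  have cs_inj: "inj_on cs (F \<times> {..<s})"
  proof (rule inj_onI)
    fix b b' assume bb: "b \<in> F \<times> {..<s}" "b' \<in> F \<times> {..<s}" "cs b = cs b'"
    then obtain g k g' k' where gk': "b = (g, k)" "b' = (g', k')" by (cases b, cases b') blast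
    have gk: "g \<in> F" "k \<in> {..<s}" "g' \<in> F" "k' \<in> {..<s}" "cs (g, k) = cs (g', k')"
      using bb gk' by auto
    have gN: "g \<in> N" "g' \<in> N" using gk FN by auto
    have "inv (g \<otimes> inv (z [^] k)) \<otimes> (g' \<otimes> inv (z [^] k')) \<in> P'"
      using gk(5) l_coset_eq_iff[OF P_sub, of "g \<otimes> inv (z [^] k)" "g' \<otimes> inv (z [^] k')"] gN zc by (simp add: cs_def)
    then have w: "z [^] k \<otimes> (inv g \<otimes> g') \<otimes> inv (z [^] k') \<in> P'"
      using gN zc by (simp add: inv_mult_group m_assoc)
    then have "inv (z [^] k) \<otimes> (z [^] k \<otimes> (inv g \<otimes> g') \<otimes> inv (z [^] k')) \<otimes> z [^] k' \<in> H"
    proof -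
      have wH: "z [^] k \<otimes> (inv g \<otimes> g') \<otimes> inv (z [^] k') \<in> H" using w by (simp only: P'_def mem_Collect_eq)
      show ?thesis
        by (rule subgroup.m_closed[OF H_sub subgroup.m_closed[OF H_sub subgroup.m_inv_closed[OF H_sub
          conjunct1[OF zq]] wH] conjunct1[OF zq]])
    qed
    then have "inv g \<otimes> g' \<in> H" using gN zc by (simp add: m_assoc)
    then have gg: "g = g'" using F_inj gk by blast
    then have "z [^] k \<otimes> inv (z [^] k') \<in> P'" using w gN zc by (simp add: m_assoc)
    moreover have "\<xi> (z [^] k \<otimes> inv (z [^] k')) = int k - int k'"
      using \<xi>_mult[of "z [^] k" "inv (z [^] k')"] \<xi>_inv zq by simp
    ultimately have "int s dvd int k - int k'" by (simp add: P'_def)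
    moreover have "\<bar>int k - int k'\<bar> < int s" using gk by auto
    ultimately have "int k - int k' = 0" by (rule int_dvd_small)
    then show "b = b'" using gg gk' by simp
  qed
  have cs_in: "cs ` (F \<times> {..<s}) \<subseteq> left_cosets G P'"
  proof clarify
    fix g and k :: nat assume "g \<in> F"
    then have "g \<in> carrier G" using FN N_carrier by blast
    then have "g \<otimes> inv (z [^] k) \<in> carrier G" using zc by (intro m_closed inv_closed nat_pow_closed)
    then show "cs (g, k) \<in> left_cosets G P'" unfolding cs_def left_cosets_def by blast
  qed
  have finL: "finite (left_cosets G P')" by (rule finite_cosets_above[OF P_sub QP M'1])
  have cardL: "card F * s \<le> card (left_cosets G P')"
    using card_inj_on_le[OF cs_inj cs_in finL] by (simp add: card_cartesian_product)
  have cs_all: "\<exists>g\<in>F. \<exists>k<s. D = cs (g, k)" if D: "D \<in> left_cosets G P'" "D \<subseteq> N" for D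
  proof -
    obtain x where x: "x \<in> carrier G" "D = x <# P'" using D(1) unfolding left_cosets_def by auto
    have "x \<in> D" using x subgroup.one_closed[OF P_sub] by (force simp: l_coset_def)
    then have xN: "x \<in> N" using D(2) by blast
    obtain g where g: "g \<in> F" "inv g \<otimes> x \<in> H" using F_ex[OF xN] by blast
    have gN: "g \<in> N" using g FN by auto
    define k where "k = nat ((- \<xi> (inv g \<otimes> x)) mod int s)"
    have k: "int k = (- \<xi> (inv g \<otimes> x)) mod int s" "k < s" using s1 by (simp_all add: k_def nat_less_iff)
    have w: "z [^] k \<otimes> (inv g \<otimes> x) \<in> H \<and> \<xi> (z [^] k \<otimes> (inv g \<otimes> x)) = int k + \<xi> (inv g \<otimes> x)"
      using \<xi>_mult[of "z [^] k"] zq[of k] g(2) by simp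
    have "int s dvd int k + \<xi> (inv g \<otimes> x)"
      unfolding k(1) using mod_eq_dvd_iff[of "- \<xi> (inv g \<otimes> x) mod int s" "int s" "- \<xi> (inv g \<otimes> x)"] by fastforce
    then have "z [^] k \<otimes> (inv g \<otimes> x) \<in> P'" using w by (simp add: P'_def)
    then have "inv (g \<otimes> inv (z [^] k)) \<otimes> x \<in> P'" using gN zc xN by (simp add: inv_mult_group m_assoc)
    then have "(g \<otimes> inv (z [^] k)) <# P' = x <# P'"
      using l_coset_eq_iff[OF P_sub, of "g \<otimes> inv (z [^] k)" x] gN zc xN by simp
    then show ?thesis using g k x by (auto simp: cs_def)
  qed
  have dens: "real (card (wball c) * card (road z n)) \<le> \<eta> * card (left_cosets G P')"
  proof -
    have "real (card (wball c) * card (road z n)) \<le> real (card (wball c) * (n * (len z + 1)))"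
      using card_road[of z n] by (simp only: of_nat_le_iff mult_le_mono2)
    also have "\<dots> = real (card (wball c) * (len z + 1)) * n" by (simp add: algebra_simps)
    also have "\<dots> \<le> \<eta> * R * n" using R(2) by (intro mult_right_mono) auto
    also have "\<dots> \<le> \<eta> * (card F * s)"
    proof -
      have "R * n \<le> card F * s" using cardF by (intro mult_le_mono) (simp_all add: s_def)
      then have "real (R * n) \<le> real (card F * s)" by (simp only: of_nat_le_iff)
      then show ?thesis using mult_left_mono[of "real (R * n)" "real (card F * s)" \<eta>] \<eta> by (simp add: mult.assoc)
    qed
    also have "\<dots> \<le> \<eta> * card (left_cosets G P')" 
      by (rule mult_left_mono[OF of_nat_mono[OF cardL] less_imp_le[OF \<eta>]])
    finally show ?thesis .
  qed
  have cover: "real (card {C \<in> left_cosets G P'. C \<subseteq> N \<and> \<not> (\<exists>g\<in>F. \<exists>k\<le>n - m. C = (g \<otimes> inv (z [^] k)) <# P')})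
      \<le> \<epsilon> * card (left_cosets G P')"
  proof -
    let ?bad = "{C \<in> left_cosets G P'. C \<subseteq> N \<and> \<not> (\<exists>g\<in>F. \<exists>k\<le>n - m. C = (g \<otimes> inv (z [^] k)) <# P')}"
    have "?bad \<subseteq> cs ` (F \<times> {n - m<..<s})"
    proof
      fix D assume D: "D \<in> ?bad"
      then obtain g k where gk: "g \<in> F" "k < s" "D = cs (g, k)" using cs_all by blast
      then have "\<not> k \<le> n - m" using D by (auto simp: cs_def)
      then show "D \<in> cs ` (F \<times> {n - m<..<s})" using gk by auto
    qed
    then have "card ?bad \<le> card (F \<times> {n - m<..<s})"
    proof -
      have fin: "finite (F \<times> {n - m<..<s})" using finF by simp
      have "card ?bad \<le> card (cs ` (F \<times> {n - m<..<s}))" using \<open>?bad \<subseteq> _\<close> fin by (intro card_mono finite_imageI)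
      also have "\<dots> \<le> card (F \<times> {n - m<..<s})" using fin by (rule card_image_le)
      finally show ?thesis .
    qed
    also have "\<dots> \<le> card F * (r + m)" using nm by (simp add: card_cartesian_product s_def)
    finally have "real (card ?bad) \<le> real (card F * (r + m))" by (simp only: of_nat_le_iff)
    then have "real (card ?bad) \<le> real (card F) * (r + m)" by simp
    also have "\<dots> \<le> real (card F) * (\<epsilon> * n)" using nr by (intro mult_left_mono) auto
    also have "\<dots> \<le> \<epsilon> * (card F * s)" using \<epsilon> 
    proof -
      have "real n \<le> real s" by (simp add: s_def)
      then have "\<epsilon> * real (card F) * n \<le> \<epsilon> * real (card F) * s" using \<epsilon> by (intro mult_left_mono) auto
      then show ?thesis by (simp add: algebra_simps)
    qed
    also have "\<dots> \<le> \<epsilon> * card (left_cosets G P')" 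
      by (rule mult_left_mono[OF of_nat_mono[OF cardL] less_imp_le[OF \<epsilon>]])
    finally show ?thesis .
  qed
  show ?thesis
    by (intro exI[of _ P'] exI[of _ M'] exI[of _ n] exI[of _ m] exI[of _ F] conjI)
       (use P_sub PQ QP M'1 sep dens finF FN m(1) nm slow cover in blast)+
qed

end

section \<open>Equivariant random weights and their mean passage times\<close>

locale random_metric = lattice_seminorm G S N \<psi> K d m0 e c1 c2 cl + subgroup_chain G D
  for G (structure) and S N \<psi> K d m0 e c1 c2 cl D +
  fixes w :: "('a set \<Rightarrow> real) \<Rightarrow> 'a set \<Rightarrow> real" and k0 K2 :: real
  assumes w_meas: "\<And>f. f \<in> E \<Longrightarrow> (\<lambda>\<omega>. w \<omega> f) \<in> borel_measurable M"
    and k0: "k0 > 0"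
    and w_ge: "\<And>\<omega> f. \<omega> \<in> Om \<Longrightarrow> f \<in> E \<Longrightarrow> k0 \<le> w \<omega> f"
    and w_le: "\<And>\<omega> f. \<omega> \<in> Om \<Longrightarrow> f \<in> E \<Longrightarrow> w \<omega> f \<le> K2"
    and w_act: "\<And>g \<omega> f. g \<in> carrier G \<Longrightarrow> \<omega> \<in> Om \<Longrightarrow> f \<in> E \<Longrightarrow> w (act g \<omega>) f = w \<omega> (inv g <# f)"
    and K2_pos: "K2 > 0"
begin

sublocale prob_space M by (rule prob_space_M)

lemma w_nonneg: "\<omega> \<in> Om \<Longrightarrow> f \<in> E \<Longrightarrow> 0 \<le> w \<omega> f"
  using w_ge[of \<omega> f] k0 by simp

lemma random_weights: "random_weights E M w"
  unfolding random_weights_def using prob_space_M w_meas w_nonneg by (simp add: space_M)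

lemma weights_stationary: "stationary_weights G E M w"
  unfolding stationary_weights_def
proof (intro allI ballI impI)
  fix k :: nat and f :: "nat \<Rightarrow> 'a set" and g
  assume g: "g \<in> carrier G" and f: "\<forall>i<k. f i \<in> E"
  define Y where "Y = (\<lambda>\<omega>. \<lambda>i\<in>{..<k}. w \<omega> (f i))"
  let ?B = "PiM {..<k} (\<lambda>_. borel :: real measure)"
  have Y: "Y \<in> measurable M ?B"
    unfolding Y_def using f w_meas by (intro measurable_restrict) auto
  have "distr M ?B (\<lambda>\<omega>. \<lambda>i\<in>{..<k}. w \<omega> (inv g <# f i)) = distr M ?B (\<lambda>\<omega>. Y (act g \<omega>))"
    using f w_act[OF g] by (intro distr_cong) (auto simp: Y_def space_M)
  also have "\<dots> = distr (distr M M (act g)) ?B Y"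
    by (subst distr_distr[OF Y act_measurable[OF g]]) (simp add: comp_def)
  also have "\<dots> = distr M ?B Y" by (simp add: act_preserves[OF g])
  finally show "distr M ?B (\<lambda>\<omega>. \<lambda>i\<in>{..<k}. w \<omega> (f i)) =
      distr M ?B (\<lambda>\<omega>. \<lambda>i\<in>{..<k}. w \<omega> (inv g <# f i))"
    unfolding Y_def by (rule sym)
qed

lemma weights_ergodic: "ergodic_weights G E M act w"
  unfolding ergodic_weights_def space_M
proof (intro conjI ballI impI)
  show "group_action G Om act" by (rule act_group_action)
  show "act g \<in> measurable M M" if "g \<in> carrier G" for g by (rule act_measurable[OF that])
  show "distr M M (act g) = M" if "g \<in> carrier G" for g by (rule act_preserves[OF that])
  show "w (act g \<omega>) f = w \<omega> (inv g <# f)" if "g \<in> carrier G" "\<omega> \<in> Om" "f \<in> E" for g \<omega> f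
    by (rule w_act[OF that])
  show "measure M A = 0 \<or> measure M A = 1" if "A \<in> sets M" "\<forall>g\<in>carrier G. act g ` A = A" for A
    using act_ergodic that by simp
qed

lemma bi_lipschitz:
  "\<exists>k K. 0 < k \<and> k < K \<and> (AE \<omega> in M. \<forall>x\<in>carrier G. \<forall>y\<in>carrier G.
     k * real (word_dist G S x y) \<le> T (w \<omega>) x y \<and> T (w \<omega>) x y \<le> K * real (word_dist G S x y))"
proof (intro exI conjI)
  show "0 < k0" by (rule k0)
  show "k0 < max k0 K2 + 1" by simp
  show "AE \<omega> in M. \<forall>x\<in>carrier G. \<forall>y\<in>carrier G.
     k0 * real (word_dist G S x y) \<le> T (w \<omega>) x y \<and> T (w \<omega>) x y \<le> (max k0 K2 + 1) * real (word_dist G S x y)"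
  proof (rule AE_I2, intro ballI conjI)
    fix \<omega> x y assume \<omega>: "\<omega> \<in> space M" and c: "x \<in> carrier G" "y \<in> carrier G"
    have \<omega>O: "\<omega> \<in> Om" using \<omega> by (simp add: space_M)
    show "k0 * real (word_dist G S x y) \<le> T (w \<omega>) x y"
      unfolding word_dist_def using w_ge[OF \<omega>O] k0 c by (intro T_ge_dist) auto
    have le: "w \<omega> f \<le> max k0 K2 + 1" if "f \<in> E" for f using w_le[OF \<omega>O that] by simp
    show "T (w \<omega>) x y \<le> (max k0 K2 + 1) * real (word_dist G S x y)"
      unfolding word_dist_def by (rule T_le_dist[OF w_nonneg[OF \<omega>O] le c])
  qed
qed

lemma T_act:
  assumes "g \<in> carrier G" "\<omega> \<in> Om" "x \<in> carrier G" "y \<in> carrier G"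
  shows "T (w (act g \<omega>)) (g \<otimes> x) (g \<otimes> y) = T (w \<omega>) x y"
proof (rule T_shift)
  fix f assume f: "f \<in> E"
  show "w (act g \<omega>) (g <# f) = w \<omega> f"
    using w_act[OF assms(1,2) edge_shift[OF f assms(1)]] l_coset_inv_cancel'[OF assms(1) edge_sub[OF f]] by simp
  show "0 \<le> w (act g \<omega>) f" by (rule w_nonneg[OF act_Om[OF assms(1,2)] f])
  show "0 \<le> w \<omega> f" by (rule w_nonneg[OF assms(2) f])
qed (use assms in auto)

lemma countable_E: "countable E"
proof -
  have "E \<subseteq> (\<lambda>(g, s). {g, g \<otimes> s}) ` (carrier G \<times> S)" unfolding cayley_edges_def by auto
  moreover have "countable (carrier G \<times> S)" using countable_carrier countable_finite[OF fin_S] by simp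
  ultimately show ?thesis by (meson countable_image countable_subset)
qed

lemma T_measurable:
  assumes "x \<in> carrier G" "y \<in> carrier G" shows "(\<lambda>\<omega>. T (w \<omega>) x y) \<in> borel_measurable M"
  unfolding passage_time_def
proof (rule borel_measurable_cINF)
  have "{fs. edge_path E x fs y} \<subseteq> lists E" using edge_path_edges by (auto simp: lists_eq_set)
  then show "countable {fs. edge_path E x fs y}" using countable_lists[OF countable_E] countable_subset by blast
  fix fs assume "fs \<in> {fs. edge_path E x fs y}"
  then have "set fs \<subseteq> E" using edge_path_edges by blast
  then show "(\<lambda>\<omega>. sum_list (map (w \<omega>) fs)) \<in> borel_measurable M"
    by (induction fs) (auto intro!: borel_measurable_add w_meas)
next
  fix \<omega> assume "\<omega> \<in> space M"
  then show "bdd_below ((\<lambda>fs. sum_list (map (w \<omega>) fs)) ` {fs. edge_path E x fs y})"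
    using w_nonneg by (intro T_bdd_below) (auto simp: space_M)
qed

lemma T_bound: "\<omega> \<in> Om \<Longrightarrow> x \<in> carrier G \<Longrightarrow> y \<in> carrier G \<Longrightarrow> 0 \<le> T (w \<omega>) x y \<and> T (w \<omega>) x y \<le> K2 * dist x y"
  using T_nonneg[of "w \<omega>" x y] T_le_dist[of "w \<omega>" K2 x y] w_nonneg w_le by blast

lemma T_integrable:
  assumes "x \<in> carrier G" "y \<in> carrier G" shows "integrable M (\<lambda>\<omega>. T (w \<omega>) x y)"
proof (rule integrable_const_bound[OF _ T_measurable[OF assms]])
  show "AE \<omega> in M. norm (T (w \<omega>) x y) \<le> K2 * dist x y"
    using T_bound[OF _ assms] by (intro AE_I2) (auto simp: space_M)
qed

lemma T_triangle_w: "\<omega> \<in> Om \<Longrightarrow> x \<in> carrier G \<Longrightarrow> y \<in> carrier G \<Longrightarrow> z \<in> carrier G \<Longrightarrow>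
    T (w \<omega>) x z \<le> T (w \<omega>) x y + T (w \<omega>) y z"
  using T_triangle[of "w \<omega>" x y z] w_nonneg by blast

lemma integral_act:
  fixes h :: "('a set \<Rightarrow> real) \<Rightarrow> real"
  assumes "g \<in> carrier G" "h \<in> borel_measurable M" shows "(\<integral>\<omega>. h (act g \<omega>) \<partial>M) = (\<integral>\<omega>. h \<omega> \<partial>M)"
  using integral_distr[OF act_measurable[OF assms(1)], of h] assms act_preserves[OF assms(1)] by simp

definition ET :: "'a \<Rightarrow> real" where "ET x = (\<integral>\<omega>. T (w \<omega>) \<one> x \<partial>M)"

lemma ET_nonneg: "x \<in> carrier G \<Longrightarrow> 0 \<le> ET x"
  unfolding ET_def using T_bound[of _ \<one> x] by (intro integral_nonneg_AE AE_I2) (auto simp: space_M)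

lemma ET_le: "x \<in> carrier G \<Longrightarrow> ET x \<le> K2 * len x"
  unfolding ET_def using T_bound[of _ \<one> x] T_integrable[of \<one> x]
  by (intro integral_le_const AE_I2) (auto simp: space_M)

lemma ET_shift: "x \<in> carrier G \<Longrightarrow> y \<in> carrier G \<Longrightarrow> (\<integral>\<omega>. T (w \<omega>) x (x \<otimes> y) \<partial>M) = ET y"
proof -
  assume c: "x \<in> carrier G" "y \<in> carrier G"
  have "ET y = (\<integral>\<omega>. T (w (act x \<omega>)) x (x \<otimes> y) \<partial>M)"
    unfolding ET_def using T_act[of x _ \<one> y] c by (intro Bochner_Integration.integral_cong) (auto simp: space_M)
  also have "\<dots> = (\<integral>\<omega>. T (w \<omega>) x (x \<otimes> y) \<partial>M)"
    using c by (intro integral_act[of x "\<lambda>\<omega>. T (w \<omega>) x (x \<otimes> y)"] T_measurable) auto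
  finally show ?thesis ..
qed

lemma ET_mult: "x \<in> carrier G \<Longrightarrow> y \<in> carrier G \<Longrightarrow> ET (x \<otimes> y) \<le> ET x + ET y"
proof -
  assume c: "x \<in> carrier G" "y \<in> carrier G"
  have "ET (x \<otimes> y) \<le> (\<integral>\<omega>. T (w \<omega>) \<one> x + T (w \<omega>) x (x \<otimes> y) \<partial>M)"
    unfolding ET_def using c T_triangle_w by (intro integral_mono T_integrable Bochner_Integration.integrable_add) (auto simp: space_M)
  also have "\<dots> = ET x + ET y"
    using c ET_shift[OF c] by (subst Bochner_Integration.integral_add) (auto intro: T_integrable simp: ET_def)
  finally show ?thesis .
qed

lemma ET_pow: "x \<in> carrier G \<Longrightarrow> ET (x [^] (n::nat)) \<le> n * ET x"
proof (induction n)
  case 0 then show ?case using ET_le[of \<one>] by simp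
next
  case (Suc n) then show ?case using ET_mult[of "x [^] n" x] by (simp add: algebra_simps)
qed

section \<open>From subadditivity to the asymptotic statement\<close>

definition Tt :: "'a \<Rightarrow> real" where "Tt x = (INF x'\<in>{x' \<in> N. same_K x' x}. ET x')"

lemma same_K_refl [simp]: "same_K x x"
  by (simp add: same_K_def)

lemma Tt_le: "x' \<in> N \<Longrightarrow> same_K x' x \<Longrightarrow> Tt x \<le> ET x'"
  unfolding Tt_def using ET_nonneg by (intro cINF_lower) (auto intro!: bdd_belowI[of _ 0])

lemma Tt_ge: "x \<in> N \<Longrightarrow> (\<And>x'. x' \<in> N \<Longrightarrow> same_K x' x \<Longrightarrow> b \<le> ET x') \<Longrightarrow> b \<le> Tt x"
  unfolding Tt_def
proof (rule cINF_greatest)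
  assume "x \<in> N"
  then show "{x' \<in> N. same_K x' x} \<noteq> {}" by (auto intro: exI[of _ x])
qed blast

lemma Tt_mult: "x \<in> N \<Longrightarrow> y \<in> N \<Longrightarrow> Tt (x \<otimes> y) \<le> Tt x + Tt y"
proof -
  assume x: "x \<in> N" and y: "y \<in> N"
  have "Tt (x \<otimes> y) - Tt y \<le> Tt x"
  proof (rule Tt_ge[OF x])
    fix x' assume x': "x' \<in> N" "same_K x' x"
    have "Tt (x \<otimes> y) - ET x' \<le> Tt y"
    proof (rule Tt_ge[OF y])
      fix y' assume y': "y' \<in> N" "same_K y' y"
      have "same_K (x' \<otimes> y') (x \<otimes> y)" using x y x' y' by (simp add: same_K_def K_mult)
      then have "Tt (x \<otimes> y) \<le> ET (x' \<otimes> y')" using x' y' by (intro Tt_le) auto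
      also have "\<dots> \<le> ET x' + ET y'" using x' y' by (intro ET_mult) auto
      finally show "Tt (x \<otimes> y) - ET x' \<le> ET y'" by simp
    qed
    then show "Tt (x \<otimes> y) - Tt y \<le> ET x'" by simp
  qed
  then show ?thesis by simp
qed

lemma Tt_linear_bound: "\<exists>C\<ge>0. \<forall>x\<in>N. Tt x \<le> C * Kabs x + C"
proof -
  define f where "f x = (\<lambda>j\<in>{..<d}. K x j mod int m0)" for x
  have "f x \<in> PiE {..<d} (\<lambda>_. {0..<int m0})" for x
    using m0 unfolding f_def restrict_PiE_iff by simp
  then have "f ` N \<subseteq> PiE {..<d} (\<lambda>_. {0..<int m0})" by blast
  then have fin: "finite (f ` N)" by (rule finite_subset) (simp add: finite_PiE)
  define Y where "Y v = (SOME y. y \<in> N \<and> f y = v)" for v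
  have Y: "Y (f x) \<in> N \<and> f (Y (f x)) = f x" if "x \<in> N" for x
    unfolding Y_def by (rule someI[of _ x]) (use that in simp)
  define B where "B = (\<Sum>v\<in>f ` N. elen * Kabs (Y v) + len (Y v))"
  have B: "elen * Kabs (Y (f x)) + len (Y (f x)) \<le> B" if "x \<in> N" for x
    unfolding B_def using fin that Kabs_nonneg
    by (intro member_le_sum[of "f x" _ "\<lambda>v. elen * Kabs (Y v) + len (Y v)"]) auto
  have B0: "B \<ge> 0" unfolding B_def using Kabs_nonneg by (intro sum_nonneg) auto
  have "Tt x \<le> K2 * (elen + B) * Kabs x + K2 * (elen + B)" if x: "x \<in> N" for x
  proof -
    define y where "y = Y (f x)"
    have y: "y \<in> N" "f y = f x" using Y[OF x] by (auto simp: y_def)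
    define k where "k j = (K x j - K y j) div int m0" for j
    have k: "int m0 * k j = K x j - K y j" if "j < d" for j
    proof -
      have "K x j mod int m0 = K y j mod int m0" using fun_cong[OF y(2), of j] that by (simp add: f_def)
      then have "int m0 dvd K x j - K y j" by (simp add: mod_eq_dvd_iff)
      then show ?thesis by (simp add: k_def)
    qed
    obtain l where l: "l \<in> N" "\<forall>j<d. K l j = m0 * k j" "real (len l) \<le> elen * real_of_int (\<Sum>j<d. \<bar>k j\<bar>)"
      using lift_exists[of k] by auto
    have "\<bar>k j\<bar> \<le> \<bar>K x j\<bar> + \<bar>K y j\<bar>" if "j < d" for j
    proof -
      have "1 * \<bar>k j\<bar> \<le> int m0 * \<bar>k j\<bar>" using m0 by (intro mult_right_mono) auto
      then show ?thesis using k[OF that] abs_mult[of "int m0" "k j"] by simp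
    qed
    then have "(\<Sum>j<d. \<bar>k j\<bar>) \<le> (\<Sum>j<d. \<bar>K x j\<bar> + \<bar>K y j\<bar>)" by (intro sum_mono) auto
    then have "real_of_int (\<Sum>j<d. \<bar>k j\<bar>) \<le> Kabs x + Kabs y"
      unfolding Kabs_def sum.distrib of_int_add[symmetric] of_int_le_iff .
    then have "real (len l) \<le> elen * (Kabs x + Kabs y)"
      using l(3) by (meson mult_left_mono of_nat_0_le_iff order_trans)
    moreover have "real (len (l \<otimes> y)) \<le> len l + len y" using len_mult[of l y] l y by simp
    ultimately have le: "real (len (l \<otimes> y)) \<le> elen * Kabs x + B"
      using B[OF x] unfolding y_def[symmetric] by (simp add: algebra_simps)
    have "same_K (l \<otimes> y) x" using l y k by (auto simp: same_K_def K_mult)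
    then have "Tt x \<le> ET (l \<otimes> y)" using l y by (intro Tt_le) auto
    also have "\<dots> \<le> K2 * len (l \<otimes> y)" using l y by (intro ET_le) auto
    also have "\<dots> \<le> K2 * (elen * Kabs x + B)" using le K2_pos by (intro mult_left_mono) auto
    also have "\<dots> \<le> K2 * ((elen + B) * Kabs x + (elen + B))"
      using B0 Kabs_nonneg[of x] K2_pos by (intro mult_left_mono add_mono mult_right_mono) auto
    finally show ?thesis by (simp add: algebra_simps)
  qed
  then show ?thesis using B0 K2_pos by (intro exI[of _ "K2 * (elen + B)"]) auto
qed

text \<open>
  By subadditivity it is enough to control \<open>Tt\<close> along multiples of finitely many vectors \<open>z\<close>: a
  vector \<open>x\<close> of size \<open>R\<close> differs from \<open>l z\<close>, for some \<open>z\<close> of size about \<open>q\<close> and \<open>l \<le> R / q + 1\<close>,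
  by a vector of size at most a constant times \<open>l\<close>, which is small compared to \<open>R\<close> when \<open>q\<close> is large.
\<close>

theorem Tt_asymptotic:
  assumes lower: "\<And>x. x \<in> N \<Longrightarrow> \<psi> x - C \<le> ET x"
    and upper: "\<And>z \<epsilon>. z \<in> N \<Longrightarrow> \<psi> z > 0 \<Longrightarrow> \<epsilon> > 0 \<Longrightarrow>
      \<exists>m\<ge>(1::nat). \<exists>x\<in>N. scaled x (int m) z \<and> ET x \<le> real m * (\<psi> z + \<epsilon>)"
    and \<epsilon>: "\<epsilon> > (0::real)"
  shows "\<exists>C'. \<forall>x\<in>N. \<bar>Tt x - \<psi> x\<bar> \<le> \<epsilon> * Kabs x + C'"
proof -
  obtain C1 where C1: "C1 \<ge> 0" "\<And>x. x \<in> N \<Longrightarrow> Tt x \<le> C1 * Kabs x + C1" using Tt_linear_bound by blast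
  define \<Lambda> where "\<Lambda> = 1 + (C1 + c2) * (d * m0)"
  have \<Lambda>: "\<Lambda> \<ge> 1" unfolding \<Lambda>_def using C1(1) c2 by simp
  obtain q :: nat where q: "\<Lambda> / \<epsilon> < q" using reals_Archimedean2 by blast
  then have q\<epsilon>: "\<Lambda> \<le> \<epsilon> * q" and q0: "q > 0" using \<epsilon> \<Lambda> by (auto simp: field_simps intro!: gr0I)
  have powers: "\<exists>B\<ge>0. \<forall>l. Tt (z [^] (l::nat)) \<le> real l * (\<psi> z + 1) + B" if z: "z \<in> N" for z
  proof (cases "\<psi> z > 0")
    case False
    then have z0: "\<psi> z = 0" using \<psi>_nonneg[OF z] by simp
    have "Tt (z [^] l) \<le> real l * (\<psi> z + 1) + 0" for l :: nat
    proof -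
      have "same_K \<one> (z [^] l)" using z0 \<psi>_eq_0_iff[OF z] z by (simp add: same_K_def K_pow)
      then have "Tt (z [^] l) \<le> ET \<one>" by (intro Tt_le) auto
      also have "\<dots> \<le> 0" using ET_le[of \<one>] by simp
      finally show ?thesis using z0 by simp
    qed
    then show ?thesis by (intro exI[of _ 0] conjI allI) simp_all
  next
    case True
    then obtain m x where mx: "m \<ge> (1::nat)" "x \<in> N" "scaled x (int m) z" "ET x \<le> real m * (\<psi> z + 1)"
      using upper[OF z, of 1] by auto
    have "Tt (z [^] l) \<le> real l * (\<psi> z + 1) + K2 * (m * len z)" for l :: nat
    proof -
      define s s' where "s = l div m" and "s' = l mod m"
      have l: "l = m * s + s'" and s': "s' \<le> m" using mx(1) by (auto simp: s_def s'_def less_imp_le)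
      have "same_K (x [^] s \<otimes> z [^] s') (z [^] l)"
        using mx z unfolding l by (auto simp: same_K_def scaled_def K_mult K_pow algebra_simps)
      then have "Tt (z [^] l) \<le> ET (x [^] s \<otimes> z [^] s')" using mx z by (intro Tt_le) auto
      also have "\<dots> \<le> ET (x [^] s) + ET (z [^] s')" using mx z by (intro ET_mult) auto
      also have "\<dots> \<le> real s * (real m * (\<psi> z + 1)) + K2 * (m * len z)"
      proof (rule add_mono)
        have "ET (x [^] s) \<le> s * ET x" using mx by (intro ET_pow) auto
        also have "\<dots> \<le> s * (real m * (\<psi> z + 1))" using mx(4) by (intro mult_left_mono) auto
        finally show "ET (x [^] s) \<le> real s * (real m * (\<psi> z + 1))" .
        have "ET (z [^] s') \<le> K2 * len (z [^] s')" using z by (intro ET_le) auto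
        also have "\<dots> \<le> K2 * (m * len z)"
        proof -
          have "len (z [^] s') \<le> s' * len z" using z by (intro len_pow) auto
          also have "\<dots> \<le> m * len z" using s' by (rule mult_le_mono1)
          finally have "real (len (z [^] s')) \<le> real (m * len z)" by (simp only: of_nat_le_iff)
          then show ?thesis using K2_pos by (intro mult_left_mono) auto
        qed
        finally show "ET (z [^] s') \<le> K2 * (m * len z)" .
      qed
      also have "real s * (real m * (\<psi> z + 1)) \<le> real l * (\<psi> z + 1)"
      proof -
        have "real s * (real m * (\<psi> z + 1)) = real (m * s) * (\<psi> z + 1)" by (simp add: algebra_simps)
        also have "\<dots> \<le> real l * (\<psi> z + 1)" using True unfolding l by (intro mult_right_mono) auto
        finally show ?thesis .
      qed
      finally show ?thesis by simp
    qed
    then show ?thesis using K2_pos by (intro exI[of _ "K2 * (m * len z)"]) auto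
  qed
  define Z where "Z u = (SOME z. z \<in> N \<and> (\<forall>j<d. K z j = int m0 * u j))" for u
  have Z: "Z u \<in> N \<and> (\<forall>j<d. K (Z u) j = int m0 * u j)" for u
    unfolding Z_def by (rule someI_ex) (use lift_exists[of u] in blast)
  let ?U = "PiE {..<d} (\<lambda>_. {- int (q + 1)..int (q + 1)})"
  have finU: "finite ?U" by (simp add: finite_PiE)
  define Bf where "Bf u = (SOME B. B \<ge> 0 \<and> (\<forall>l. Tt (Z u [^] (l::nat)) \<le> real l * (\<psi> (Z u) + 1) + B))" for u
  have "Bf u \<ge> 0 \<and> (\<forall>l. Tt (Z u [^] (l::nat)) \<le> real l * (\<psi> (Z u) + 1) + Bf u)" for u
    unfolding Bf_def by (rule someI_ex) (use powers[of "Z u"] Z[of u] in simp)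
  then have Bf: "\<And>u. Bf u \<ge> (0::real)" "\<And>u l. Tt (Z u [^] (l::nat)) \<le> real l * (\<psi> (Z u) + 1) + Bf u" by simp_all
  define B where "B = (\<Sum>u\<in>?U. Bf u)"
  have up: "Tt x \<le> \<psi> x + (\<epsilon> * Kabs x + (\<Lambda> + B + C1))" if x: "x \<in> N" for x
  proof -
    define R where "R = Kabs x"
    have R0: "R \<ge> 0" unfolding R_def by (rule Kabs_nonneg)
    define l where "l = nat \<lfloor>R / q\<rfloor> + 1"
    have l: "real l \<le> R / q + 1" "R / q \<le> real l" "l \<ge> 1" unfolding l_def using R0 q0 by (auto, linarith+)
    define u where "u = (\<lambda>j\<in>{..<d}. K x j div (int m0 * int l))"
    have ml: "int m0 * int l > 0" using m0 l by simp
    have uU: "u \<in> ?U"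
      unfolding u_def restrict_PiE_iff
    proof
      fix j assume j: "j \<in> {..<d}"
      have "\<bar>K x j\<bar> \<le> (\<Sum>j<d. \<bar>K x j\<bar>)" using j by (intro member_le_sum) auto
      then have "real_of_int \<bar>K x j\<bar> \<le> R" unfolding R_def Kabs_def of_int_le_iff .
      also have "R \<le> l * q" using l(2) q0 by (simp add: field_simps)
      finally have "\<bar>K x j\<bar> \<le> int (l * q)" by (metis of_int_le_iff of_int_of_nat_eq of_nat_mult)
      also have "int (l * q) \<le> int m0 * int l * int q"
      proof -
        have "1 * (l * q) \<le> m0 * (l * q)" using m0 by (intro mult_le_mono1) auto
        then have "int (1 * (l * q)) \<le> int (m0 * (l * q))" by (simp only: of_nat_le_iff)
        then show ?thesis by (simp add: algebra_simps)
      qed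
      finally have b: "\<bar>K x j\<bar> \<le> int m0 * int l * int q" by simp
      have "K x j div (int m0 * int l) \<le> (int m0 * int l * int q) div (int m0 * int l)"
        using b ml by (intro zdiv_mono1) auto
      moreover have "(int m0 * int l * (- int q)) div (int m0 * int l) \<le> K x j div (int m0 * int l)"
        using b ml by (intro zdiv_mono1) auto
      moreover have "(int m0 * int l * int q) div (int m0 * int l) = int q" "(int m0 * int l * (- int q)) div (int m0 * int l) = - int q"
        using ml by (simp_all only: nonzero_mult_div_cancel_left less_imp_neq[symmetric] not_False_eq_True)
      ultimately show "K x j div (int m0 * int l) \<in> {- int (q + 1)..int (q + 1)}" by simp
    qed
    define z where "z = Z u"
    have z: "z \<in> N" "\<And>j. j < d \<Longrightarrow> K z j = int m0 * u j" using Z[of u] by (auto simp: z_def)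
    define t where "t = inv (z [^] l) \<otimes> x"
    have t: "t \<in> N" "x = z [^] l \<otimes> t" using z x by (auto simp: t_def)
    have Kt: "\<bar>K t j\<bar> \<le> int m0 * int l" if j: "j < d" for j
    proof -
      have "K t j = K x j - int l * K z j" using z x by (simp add: t_def K_mult K_pow)
      also have "int l * K z j = (int m0 * int l) * (K x j div (int m0 * int l))"
        using z(2)[OF j] j by (simp add: u_def)
      also have "K x j - (int m0 * int l) * (K x j div (int m0 * int l)) = K x j mod (int m0 * int l)"
        by (rule minus_mult_div_eq_mod)
      finally show ?thesis using pos_mod_bound[OF ml, of "K x j"] pos_mod_sign[OF ml, of "K x j"] by linarith
    qed
    have "(\<Sum>j<d. \<bar>K t j\<bar>) \<le> (\<Sum>j<d. int m0 * int l)" using Kt by (intro sum_mono) auto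
    then have "Kabs t \<le> real_of_int (\<Sum>j<d. int m0 * int l)" unfolding Kabs_def of_int_le_iff .
    then have Kt: "Kabs t \<le> (d * m0) * real l" by (simp add: algebra_simps)
    have "Bf u \<le> B" unfolding B_def using uU finU Bf(1) by (intro member_le_sum) auto
    then have Tz: "Tt (z [^] l) \<le> real l * (\<psi> z + 1) + B" using Bf(2)[of u l] unfolding z_def by linarith
    have Tt': "Tt t \<le> C1 * ((d * m0) * real l) + C1" using C1(2)[OF t(1)] mult_left_mono[OF Kt C1(1)] by linarith
    have "real l * \<psi> z = \<psi> (z [^] l)" using z by (simp add: \<psi>_pow)
    also have "\<dots> = \<psi> (x \<otimes> inv t)" using t z by (simp add: m_assoc)
    also have "\<dots> \<le> \<psi> x + \<psi> t" using \<psi>_mult[of x "inv t"] x t by simp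
    also have "\<psi> t \<le> c2 * ((d * m0) * real l)" using \<psi>_le_Kabs[OF t(1)] mult_left_mono[OF Kt, of c2] c2 by linarith
    finally have "real l * \<psi> z \<le> \<psi> x + c2 * ((d * m0) * real l)" by simp
    moreover have "Tt x \<le> Tt (z [^] l) + Tt t" using Tt_mult[of "z [^] l" t] z t by simp
    ultimately have "Tt x \<le> \<psi> x + \<Lambda> * real l + (B + C1)"
      using Tz Tt' unfolding \<Lambda>_def by (simp add: algebra_simps)
    also have "\<Lambda> * real l \<le> \<Lambda> * (R / q + 1)" using l(1) \<Lambda> by (intro mult_left_mono) auto
    also have "\<Lambda> * (R / q + 1) \<le> \<epsilon> * R + \<Lambda>"
    proof -
      have "\<Lambda> * (R / q) \<le> (\<epsilon> * q) * (R / q)" using q\<epsilon> R0 by (intro mult_right_mono) auto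
      then show ?thesis using q0 by (simp add: distrib_left)
    qed
    finally show ?thesis unfolding R_def by simp
  qed
  have lo: "\<psi> x - C \<le> Tt x" if x: "x \<in> N" for x
  proof (rule Tt_ge[OF x])
    fix x' assume "x' \<in> N" "same_K x' x"
    then show "\<psi> x - C \<le> ET x'" using lower[of x'] same_K_\<psi>[of x' x] x by simp
  qed
  show ?thesis
  proof (intro exI ballI)
    fix x assume x: "x \<in> N"
    have "0 \<le> \<epsilon> * Kabs x" using \<epsilon> Kabs_nonneg by simp
    then show "\<bar>Tt x - \<psi> x\<bar> \<le> \<epsilon> * Kabs x + (\<bar>C\<bar> + \<bar>\<Lambda> + B + C1\<bar>)" using up[OF x] lo[OF x] by linarith
  qed
qed

end

section \<open>Weights from a hierarchy of sparse roads\<close>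

locale road_system = lattice_seminorm G S N \<psi> K d m0 e c1 c2 cl + subgroup_chain G D
  for G (structure) and S N \<psi> K d m0 e c1 c2 cl D +
  fixes zs :: "nat \<Rightarrow> 'a" and reach ns ms :: "nat \<Rightarrow> nat" and Fs :: "nat \<Rightarrow> 'a set"
  assumes zs_N: "\<And>i. zs i \<in> N" and zs_pos: "\<And>i. \<psi> (zs i) > 0"
    and zs_recur: "\<And>z I. z \<in> N \<Longrightarrow> \<psi> z > 0 \<Longrightarrow> \<exists>i\<ge>I. zs i = z"
    and D_N: "\<And>i. D i \<subseteq> N"
    and reach_mono: "\<And>i j. i \<le> j \<Longrightarrow> reach i \<le> reach j"
    and reach_ge: "\<And>i. 3 * C0 + 4 * P * len (zs i) \<le> reach i"
    and separation: "\<And>i u v q. u \<in> road (zs i) (ns i) \<Longrightarrow> v \<in> road (zs i) (ns i) \<Longrightarrow> q \<in> D i \<Longrightarrow>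
      dist u (q \<otimes> v) \<le> reach i \<Longrightarrow> \<psi> q = 0"
    and density: "\<And>i. (reach i + 1) * real (card (wball (reach i)) * card (road (zs i) (ns i)))
      \<le> (1/2)^i * card (left_cosets G (D i))"
    and cross_density: "\<And>i j. i < j \<Longrightarrow>
      real (card (Fs i) * (ns i + 1) * card (road (zs i) (ns i)) * (len (zs i) + 1)) *
      real (card (wball (reach j)) * card (road (zs j) (ns j)))
      \<le> (1/2)^j * card (left_cosets G (D j))"
    and Fs_finite: "\<And>i. finite (Fs i)" and Fs_N: "\<And>i. Fs i \<subseteq> N"
    and ms: "\<And>i. 1 \<le> ms i" "\<And>i. ms i \<le> ns i"
    and Fs_slow: "\<And>i g. g \<in> Fs i \<Longrightarrow>
      real (len g + len (inv (zs i [^] ms i) \<otimes> inv g \<otimes> zs i [^] ms i)) * ((i + 1) * (len (zs i) + 1)) \<le> ms i"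
    and Fs_cover: "\<And>i. real (card {C \<in> left_cosets G (D i). C \<subseteq> N \<and>
        \<not> (\<exists>g\<in>Fs i. \<exists>k\<le>ns i - ms i. C = (g \<otimes> inv (zs i [^] k)) <# D i)}) * ((i + 1) * (len (zs i) + 1))
      \<le> card (left_cosets G (D i))"
begin

abbreviation R where "R i \<equiv> road (zs i) (ns i)"

abbreviation R_edges where "R_edges i \<equiv> road_edges (zs i) (ns i)"

lemma zs_carrier [simp]: "zs i \<in> carrier G"
  using zs_N by simp

lemma R_carrier: "u \<in> R i \<Longrightarrow> u \<in> carrier G"
  using road_carrier[OF zs_carrier] by blast

lemma R_edges_R: "(u, v) \<in> R_edges i \<Longrightarrow> u \<in> R i \<and> v \<in> R i"
proof -
  assume "(u, v) \<in> R_edges i"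
  then obtain q t where qt: "u = zs i [^] q \<otimes> pre (zs i) t" "v = zs i [^] q \<otimes> pre (zs i) (Suc t)"
    "q < ns i" "t < len (zs i)" unfolding road_edges_def by auto
  have "u \<in> R i" unfolding road_def using qt by (intro CollectI exI[of _ q] exI[of _ t]) auto
  moreover have "v \<in> R i" unfolding road_def using qt by (intro CollectI exI[of _ q] exI[of _ "Suc t"]) auto
  ultimately show ?thesis ..
qed

definition base :: "('a set \<Rightarrow> real) \<Rightarrow> nat \<Rightarrow> 'a set" where
  "base \<omega> i = {b \<in> carrier G. \<omega> (b <# D i) = 1}"

definition alive :: "('a set \<Rightarrow> real) \<Rightarrow> nat \<Rightarrow> 'a set" where
  "alive \<omega> i = {b \<in> base \<omega> i. \<forall>j>i. \<forall>b'\<in>base \<omega> j. \<forall>u\<in>R i. \<forall>v\<in>R j. dist (b \<otimes> u) (b' \<otimes> v) > reach j}"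

definition on_road :: "('a set \<Rightarrow> real) \<Rightarrow> nat \<Rightarrow> 'a set \<Rightarrow> bool" where
  "on_road \<omega> i f \<longleftrightarrow> (\<exists>b\<in>alive \<omega> i. \<exists>(u, v)\<in>R_edges i. f = {b \<otimes> u, b \<otimes> v})"

definition speed :: "nat \<Rightarrow> real" where "speed i = \<psi> (zs i) / ell (zs i)"

definition weight :: "('a set \<Rightarrow> real) \<Rightarrow> 'a set \<Rightarrow> real" where
  "weight \<omega> f = (if \<exists>i. on_road \<omega> i f then speed (LEAST i. on_road \<omega> i f) else P + 1)"

lemma speed_le: "speed i \<le> P"
  unfolding speed_def using \<psi>_le_ell[OF zs_N] ell_pos[OF zs_N zs_pos] by (simp add: divide_le_eq)

lemma speed_ge: "1 / kappa \<le> speed i"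
  unfolding speed_def using ell_le_\<psi>[OF zs_N, of i] ell_pos[OF zs_N zs_pos, of i] kappa_pos
  by (simp add: field_simps)

lemma base_carrier: "b \<in> base \<omega> i \<Longrightarrow> b \<in> carrier G"
  by (simp add: base_def)

lemma base_quotient: "\<omega> \<in> Om \<Longrightarrow> b \<in> base \<omega> i \<Longrightarrow> b' \<in> base \<omega> i \<Longrightarrow> inv b \<otimes> b' \<in> D i"
  unfolding base_def using Om_unique[of \<omega> "b <# D i" i "b' <# D i"] levelI
  by (simp add: l_coset_eq_iff[OF D_subgroup])

lemma base_anti: "\<omega> \<in> Om \<Longrightarrow> i \<le> j \<Longrightarrow> base \<omega> j \<subseteq> base \<omega> i"
proof
  fix b assume \<omega>: "\<omega> \<in> Om" and ij: "i \<le> j" and b: "b \<in> base \<omega> j"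
  then have bc: "b \<in> carrier G" by (simp add: base_def)
  obtain C where C: "C \<in> level i" "\<omega> C = 1" using Om_ex[OF \<omega>] by blast
  have "b <# D j \<subseteq> C" using b C bc by (intro Om_nested[OF \<omega> ij]) (auto simp: base_def levelI)
  then have "b \<in> C" using self_in[OF bc, of j] by blast
  then have "C = b <# D i" using level_eq[OF C(1)] by blast
  then show "b \<in> base \<omega> i" using C bc by (simp add: base_def)
qed

lemma base_nonempty: "\<omega> \<in> Om \<Longrightarrow> \<exists>b. b \<in> base \<omega> i"
proof -
  assume \<omega>: "\<omega> \<in> Om"
  then obtain C where "C \<in> level i" "\<omega> C = 1" using Om_ex by blast
  then show ?thesis unfolding left_cosets_def base_def by blast
qed

lemma alive_base: "b \<in> alive \<omega> i \<Longrightarrow> b \<in> base \<omega> i"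
  by (simp add: alive_def)

lemma alive_far: "b \<in> alive \<omega> i \<Longrightarrow> i < j \<Longrightarrow> b' \<in> base \<omega> j \<Longrightarrow> u \<in> R i \<Longrightarrow> v \<in> R j \<Longrightarrow>
    reach j < dist (b \<otimes> u) (b' \<otimes> v)"
  by (simp add: alive_def)

subsection \<open>Measurability and equivariance\<close>

lemma base_act: "g \<in> carrier G \<Longrightarrow> \<omega> \<in> Om \<Longrightarrow> b \<in> base (act g \<omega>) i \<longleftrightarrow> b \<in> carrier G \<and> inv g \<otimes> b \<in> base \<omega> i"
proof (cases "b \<in> carrier G")
  case True
  assume g: "g \<in> carrier G" and \<omega>: "\<omega> \<in> Om"
  have "b <# D i \<in> cosets" unfolding cosets_def using levelI[OF True] by blast
  then have "act g \<omega> (b <# D i) = \<omega> ((inv g \<otimes> b) <# D i)"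
    using act_apply[OF \<omega>] lcos_m_assoc[OF D_carrier, of "inv g" b i] g True by simp
  then show ?thesis using True g by (simp add: base_def)
qed (simp add: base_def)

lemma alive_act:
  assumes g: "g \<in> carrier G" and \<omega>: "\<omega> \<in> Om" and b: "b \<in> alive \<omega> i"
  shows "g \<otimes> b \<in> alive (act g \<omega>) i"
  unfolding alive_def
proof (intro CollectI conjI allI impI ballI)
  have bc: "b \<in> carrier G" using alive_base[OF b] base_carrier by blast
  then show "g \<otimes> b \<in> base (act g \<omega>) i" using alive_base[OF b] g \<omega> by (simp add: base_act)
  fix j b' u v assume j: "i < j" and b': "b' \<in> base (act g \<omega>) j" and uv: "u \<in> R i" "v \<in> R j"
  have c: "b' \<in> carrier G" "u \<in> carrier G" "v \<in> carrier G" using base_carrier[OF b'] R_carrier uv by auto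
  have "inv g \<otimes> b' \<in> base \<omega> j" using b' g \<omega> by (simp add: base_act)
  then have "reach j < dist (b \<otimes> u) (inv g \<otimes> b' \<otimes> v)" using alive_far[OF b j _ uv] by simp
  also have "inv (b \<otimes> u) \<otimes> (inv g \<otimes> b' \<otimes> v) = inv (g \<otimes> b \<otimes> u) \<otimes> (b' \<otimes> v)"
    using g bc c by (simp add: m_assoc inv_mult_group)
  finally show "reach j < dist (g \<otimes> b \<otimes> u) (b' \<otimes> v)" .
qed

lemma on_road_act:
  assumes g: "g \<in> carrier G" and \<omega>: "\<omega> \<in> Om" and f: "on_road \<omega> i f"
  shows "on_road (act g \<omega>) i (g <# f)"
proof -
  obtain b u v where b: "b \<in> alive \<omega> i" "(u, v) \<in> R_edges i" "f = {b \<otimes> u, b \<otimes> v}"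
    using f unfolding on_road_def by blast
  have c: "b \<in> carrier G" "u \<in> carrier G" "v \<in> carrier G"
    using base_carrier[OF alive_base[OF b(1)]] R_edges_R[OF b(2)] R_carrier by auto
  have "g <# f = {g \<otimes> b \<otimes> u, g \<otimes> b \<otimes> v}" unfolding b(3) l_coset_pair using g c by (simp add: m_assoc)
  then show ?thesis unfolding on_road_def using alive_act[OF g \<omega> b(1)] b(2) by blast
qed

lemma on_road_act_iff:
  assumes g: "g \<in> carrier G" and \<omega>: "\<omega> \<in> Om" and f: "f \<subseteq> carrier G"
  shows "on_road (act g \<omega>) i f \<longleftrightarrow> on_road \<omega> i (inv g <# f)"
proof
  assume "on_road (act g \<omega>) i f"
  then have "on_road (act (inv g) (act g \<omega>)) i (inv g <# f)"
    by (rule on_road_act[OF inv_closed[OF g] act_Om[OF g \<omega>]])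
  moreover have "act (inv g) (act g \<omega>) = \<omega>" using act_mult[of "inv g" g \<omega>] act_one[OF \<omega>] g \<omega> by simp
  ultimately show "on_road \<omega> i (inv g <# f)" by simp
next
  assume "on_road \<omega> i (inv g <# f)"
  from on_road_act[OF g \<omega> this] show "on_road (act g \<omega>) i f" by (simp only: l_coset_inv_cancel[OF g f])
qed

lemma weight_act: "g \<in> carrier G \<Longrightarrow> \<omega> \<in> Om \<Longrightarrow> f \<in> E \<Longrightarrow> weight (act g \<omega>) f = weight \<omega> (inv g <# f)"
  unfolding weight_def using on_road_act_iff[OF _ _ edge_sub] by simp

lemma pred_base: "b \<in> carrier G \<Longrightarrow> Measurable.pred M (\<lambda>\<omega>. b \<in> base \<omega> i)"
proof -
  assume b: "b \<in> carrier G"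
  have "cyl (b <# D i) \<in> sets M" using levelI[OF b] by (intro cyl_sets) (auto simp: cosets_def)
  moreover have "{\<omega> \<in> space M. b \<in> base \<omega> i} = cyl (b <# D i)" using b by (auto simp: base_def cyl_def space_M)
  ultimately show ?thesis by (simp add: pred_def)
qed

lemma countable_sub: "A \<subseteq> carrier G \<Longrightarrow> countable A"
  using countable_carrier countable_subset by blast

lemma pred_carrier:
  assumes "\<And>g. g \<in> carrier G \<Longrightarrow> Measurable.pred M (Q g)"
  shows "Measurable.pred M (\<lambda>\<omega>. \<forall>g\<in>carrier G. Q g \<omega>)" "Measurable.pred M (\<lambda>\<omega>. \<exists>g\<in>carrier G. Q g \<omega>)"
  using assms countable_carrier unfolding pred_def
  by (auto intro: sets.sets_Collect_countable_Ball sets.sets_Collect_countable_Bex)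

lemma pred_alive: "b \<in> carrier G \<Longrightarrow> Measurable.pred M (\<lambda>\<omega>. b \<in> alive \<omega> i)"
proof -
  assume b: "b \<in> carrier G"
  have "b \<in> alive \<omega> i \<longleftrightarrow> b \<in> base \<omega> i \<and> (\<forall>j\<in>{i<..}. \<forall>b'\<in>carrier G. b' \<in> base \<omega> j \<longrightarrow>
      (\<forall>u\<in>R i. \<forall>v\<in>R j. dist (b \<otimes> u) (b' \<otimes> v) > reach j))" for \<omega>
    unfolding alive_def using base_carrier by auto
  moreover have "Measurable.pred M (\<lambda>\<omega>. \<forall>j\<in>{i<..}. \<forall>b'\<in>carrier G. b' \<in> base \<omega> j \<longrightarrow>
      (\<forall>u\<in>R i. \<forall>v\<in>R j. dist (b \<otimes> u) (b' \<otimes> v) > reach j))"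
  proof (rule pred_intros_countable_bounded(3))
    fix j assume "j \<in> {i<..}"
    show "Measurable.pred M (\<lambda>\<omega>. \<forall>b'\<in>carrier G. b' \<in> base \<omega> j \<longrightarrow>
      (\<forall>u\<in>R i. \<forall>v\<in>R j. dist (b \<otimes> u) (b' \<otimes> v) > reach j))"
      by (rule pred_carrier(1)) (auto intro!: pred_intros_logic pred_base)
  qed
  then have "Measurable.pred M (\<lambda>\<omega>. b \<in> base \<omega> i \<and> (\<forall>j\<in>{i<..}. \<forall>b'\<in>carrier G. b' \<in> base \<omega> j \<longrightarrow>
      (\<forall>u\<in>R i. \<forall>v\<in>R j. dist (b \<otimes> u) (b' \<otimes> v) > reach j)))"
    by (rule pred_intros_logic(3)[OF pred_base[OF b]])
  ultimately show ?thesis by (simp only:)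
qed

lemma pred_on_road: "Measurable.pred M (\<lambda>\<omega>. on_road \<omega> i f)"
proof -
  have "on_road \<omega> i f \<longleftrightarrow> (\<exists>b\<in>carrier G. b \<in> alive \<omega> i \<and> (\<exists>(u, v)\<in>R_edges i. f = {b \<otimes> u, b \<otimes> v}))" for \<omega>
    unfolding on_road_def using base_carrier alive_base by blast
  moreover have "Measurable.pred M (\<lambda>\<omega>. \<exists>b\<in>carrier G. b \<in> alive \<omega> i \<and> (\<exists>(u, v)\<in>R_edges i. f = {b \<otimes> u, b \<otimes> v}))"
    by (rule pred_carrier(2)) (auto intro!: pred_intros_logic pred_alive)
  ultimately show ?thesis by (simp only:)
qed

lemma weight_measurable: "(\<lambda>\<omega>. weight \<omega> f) \<in> borel_measurable M"
proof -
  have "(\<lambda>\<omega>. LEAST i. on_road \<omega> i f) \<in> measurable M (count_space UNIV)"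
    by (rule measurable_Least) (rule pred_on_road)
  then have "(\<lambda>\<omega>. speed (LEAST i. on_road \<omega> i f)) \<in> borel_measurable M"
    by (rule measurable_compose) simp
  moreover have "Measurable.pred M (\<lambda>\<omega>. \<exists>i. on_road \<omega> i f)"
    by (intro pred_intros_countable pred_on_road)
  ultimately show ?thesis unfolding weight_def by (intro measurable_If) (auto simp: pred_def)
qed

sublocale random_metric G S N \<psi> K d m0 e c1 c2 cl D weight "min (1 / kappa) (P + 1)" "P + 1"
proof unfold_locales
  show "(\<lambda>\<omega>. weight \<omega> f) \<in> borel_measurable M" for f by (rule weight_measurable)
  show "0 < min (1 / kappa) (P + 1)" using kappa_pos P_ge_1 by simp
  show "min (1 / kappa) (P + 1) \<le> weight \<omega> f" for \<omega> f
    unfolding weight_def using speed_ge by (simp add: min.coboundedI1)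
  show "weight \<omega> f \<le> P + 1" for \<omega> f
    unfolding weight_def using order_trans[OF speed_le, of "P + 1"] by simp
  show "weight (act g \<omega>) f = weight \<omega> (inv g <# f)" if "g \<in> carrier G" "\<omega> \<in> Om" "f \<in> E" for g \<omega> f
    by (rule weight_act[OF that])
  show "0 < P + 1" using P_ge_1 by simp
qed

subsection \<open>The mean passage time dominates the norm\<close>

lemma road_chord:
  assumes u: "u \<in> R i" and v: "v \<in> R i" and k: "k \<in> N" "\<psi> k = 0"
  shows "p (inv u \<otimes> (k \<otimes> v)) - reach i \<le> speed i * dist u (k \<otimes> v)"
proof -
  let ?z = "zs i"
  obtain q t q' t' where u': "u = ?z [^] (q::nat) \<otimes> pre ?z t" and v': "v = ?z [^] (q'::nat) \<otimes> pre ?z t'"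
    using u v unfolding road_def by blast
  define y where "y = inv (?z [^] q) \<otimes> k \<otimes> ?z [^] q'"
  have zN: "?z \<in> N" by (rule zs_N)
  have kc: "k \<in> carrier G" using k by simp
  have y: "y \<in> N" unfolding y_def using zN k by simp
  define h where "h = inv u \<otimes> (k \<otimes> v)"
  have hc: "h \<in> carrier G" unfolding h_def using R_carrier[OF u] R_carrier[OF v] kc by simp
  have h: "h = inv (pre ?z t) \<otimes> y \<otimes> pre ?z t'"
    unfolding h_def u' v' y_def using kc by (simp add: m_assoc inv_mult_group)
  have yh: "y = pre ?z t \<otimes> h \<otimes> inv (pre ?z t')"
    unfolding h using y by (simp add: m_assoc)
  have lp: "len (pre ?z s) \<le> len ?z" for s by (rule len_pre) simp
  have Ky: "K y j = (int q' - int q) * K ?z j" if "j < d" for j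
    using k zN \<psi>_eq_0_iff[OF k(1)] that unfolding y_def by (simp add: K_mult K_pow algebra_simps)
  have \<psi>y: "\<psi> y = \<bar>int q' - int q\<bar> * \<psi> ?z" and ly: "\<bar>int q' - int q\<bar> * ell ?z \<le> len y"
  proof -
    define s where "s = nat \<bar>int q' - int q\<bar>"
    define y' where "y' = (if q' \<ge> q then y else inv y)"
    have y': "y' \<in> N" "\<psi> y' = \<psi> y" "len y' = len y" unfolding y'_def using y by auto
    have sc: "scaled y' (int s) ?z"
      unfolding scaled_def
    proof (intro allI impI)
      fix j assume j: "j < d"
      show "K y' j = int s * K ?z j"
      proof (cases "q' \<ge> q")
        case True then show ?thesis using Ky[OF j] by (simp add: y'_def s_def)
      next
        case False
        then have s': "int s = int q - int q'" by (simp add: s_def)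
        moreover have "K y' j = - K y j" using False y by (simp add: y'_def)
        ultimately show ?thesis using Ky[OF j] unfolding s' by (simp add: left_diff_distrib)
      qed
    qed
    have si: "real_of_int \<bar>int q' - int q\<bar> = real s" unfolding s_def by simp
    show "\<psi> y = \<bar>int q' - int q\<bar> * \<psi> ?z" unfolding si using scaled_\<psi>[OF y'(1) zN sc] y' by simp
    show "\<bar>int q' - int q\<bar> * ell ?z \<le> len y"
    proof (cases "s = 0")
      case False
      then show ?thesis unfolding si using ell_le[OF y'(1) _ sc] y' by simp
    next
      case True then show ?thesis unfolding si by simp
    qed
  qed
  define a where "a = speed i"
  have a: "0 \<le> a" "a \<le> P" "a * ell ?z = \<psi> ?z"
    unfolding a_def using speed_le[of i] ell_pos[OF zN zs_pos] zs_pos[of i] by (auto simp: speed_def less_imp_le)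
  have "\<psi> y = a * (\<bar>int q' - int q\<bar> * ell ?z)" unfolding \<psi>y using a(3) by (simp add: algebra_simps)
  also have "\<dots> \<le> a * len y" using ly a(1) by (rule mult_left_mono)
  also have "\<dots> \<le> a * real (len h + 2 * len ?z)"
  proof -
    have "len y \<le> len (pre ?z t) + len h + len (pre ?z t')"
      using len_mult3[of "pre ?z t" h "inv (pre ?z t')"] hc unfolding yh[symmetric] by simp
    then have "len y \<le> len h + 2 * len ?z" using lp[of t] lp[of t'] by linarith
    then show ?thesis using a(1) by (intro mult_left_mono) (simp_all only: of_nat_le_iff)
  qed
  also have "\<dots> \<le> a * len h + 2 * P * len ?z"
    using mult_right_mono[OF a(2), of "2 * len ?z"] by (simp add: algebra_simps)
  finally have 1: "\<psi> y \<le> a * len h + 2 * P * len ?z" .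
  have pp: "p g \<le> P * len ?z + C0" if "g \<in> carrier G" "len g \<le> len ?z" for g
  proof -
    have "P * real (len g) \<le> P * real (len ?z)" using that(2) P_ge_1 by (intro mult_left_mono) auto
    then show ?thesis using p_le[OF that(1)] by linarith
  qed
  have "p h \<le> p (inv (pre ?z t)) + p y + p (pre ?z t')"
    unfolding h using p_mult[of "inv (pre ?z t) \<otimes> y" "pre ?z t'"] p_mult[of "inv (pre ?z t)" y] y by simp
  also have "\<dots> \<le> (P * len ?z + C0) + (\<psi> y + C0) + (P * len ?z + C0)"
    using pp[of "inv (pre ?z t)"] pp[of "pre ?z t'"] lp p_N[OF y] by simp
  finally show ?thesis using 1 reach_ge[of i] unfolding a_def h_def by simp
qed

definition ker where "ker = {x \<in> N. \<psi> x = 0}"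

lemma ker_subgroup: "subgroup ker G"
proof (rule subgroupI)
  show "ker \<subseteq> carrier G" unfolding ker_def using N_carrier by blast
  show "ker \<noteq> {}" unfolding ker_def using \<psi>_one N_one by blast
  show "inv a \<in> ker" if "a \<in> ker" for a using that unfolding ker_def by simp
  show "a \<otimes> b \<in> ker" if "a \<in> ker" "b \<in> ker" for a b
    using that \<psi>_mult[of a b] \<psi>_nonneg[of "a \<otimes> b"] unfolding ker_def by simp
qed

definition strip :: "('a set \<Rightarrow> real) \<Rightarrow> nat \<times> 'a set \<Rightarrow> 'a set" where
  "strip \<omega> r = {b \<otimes> u | b u. b \<in> alive \<omega> (fst r) \<and> b <# ker = snd r \<and> u \<in> R (fst r)}"

lemma T_lower:
  assumes \<omega>: "\<omega> \<in> Om" and x: "x \<in> carrier G" and B: "B \<ge> 0"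
    and near: "\<And>i b u. b \<in> base \<omega> i \<Longrightarrow> u \<in> R i \<Longrightarrow> reach i - real (len (b \<otimes> u)) \<le> B"
  shows "p x - C0 - B \<le> T (weight \<omega>) \<one> x"
proof (rule T_ge)
  fix fs assume path: "edge_path E \<one> fs x"
  let ?V = "strip \<omega>" and ?a = "\<lambda>r :: nat \<times> 'a set. speed (fst r)" and ?C = "\<lambda>r :: nat \<times> 'a set. real (reach (fst r))"
  have ac: "b \<in> carrier G" if "b \<in> alive \<omega> i" for b i using base_carrier[OF alive_base[OF that]] .
  have "(\<forall>B\<ge>0. (\<forall>r. \<forall>v\<in>?V r. ?C r - dist \<one> v \<le> B) \<longrightarrow> p (inv \<one> \<otimes> x) - C0 - B \<le> sum_list (map (weight \<omega>) fs)) \<and>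
    (\<forall>r. \<forall>u\<in>?V r. \<forall>v\<in>?V r. p (inv u \<otimes> x) - C0 - ?C r \<le> sum_list (map (weight \<omega>) fs) + ?a r * dist u v + (P + 1) * dist v \<one>)"
  proof (rule path_cost_lower_bound[OF _ _ _ _ _ _ _ path])
    show "P + 1 \<le> P + 1" ..
    show "0 \<le> ?a r \<and> ?a r \<le> P + 1" for r
      using speed_le[of "fst r"] speed_ge[of "fst r"] kappa_pos by (auto intro: order_trans[of _ "1 / kappa"])
    show "0 \<le> ?C r" for r by simp
    show "?V r \<subseteq> carrier G" for r unfolding strip_def using ac R_carrier by auto
    show "\<one> \<in> carrier G" by simp
  next
    fix r u v assume u: "u \<in> ?V r" and v: "v \<in> ?V r"
    obtain b u0 where u0: "u = b \<otimes> u0" "b \<in> alive \<omega> (fst r)" "b <# ker = snd r" "u0 \<in> R (fst r)"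
      using u unfolding strip_def by blast
    obtain b' v0 where v0: "v = b' \<otimes> v0" "b' \<in> alive \<omega> (fst r)" "b' <# ker = snd r" "v0 \<in> R (fst r)"
      using v unfolding strip_def by blast
    have c: "b \<in> carrier G" "b' \<in> carrier G" "u0 \<in> carrier G" "v0 \<in> carrier G"
      using ac[OF u0(2)] ac[OF v0(2)] R_carrier[OF u0(4)] R_carrier[OF v0(4)] by auto
    have "b <# ker = b' <# ker" using u0(3) v0(3) by simp
    then have "inv b \<otimes> b' \<in> ker" using l_coset_eq_iff[OF ker_subgroup c(1,2)] by simp
    then have k: "inv b \<otimes> b' \<in> N" "\<psi> (inv b \<otimes> b') = 0" by (auto simp: ker_def)
    have "inv u \<otimes> v = inv u0 \<otimes> (inv b \<otimes> b' \<otimes> v0)" unfolding u0(1) v0(1) using c by (simp add: m_assoc inv_mult_group)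
    then show "p (inv u \<otimes> v) - ?C r \<le> ?a r * dist u v" using road_chord[OF u0(4) v0(4) k] by simp
  next
    fix r r' u v assume rr: "r \<noteq> r'" and u: "u \<in> ?V r" and v: "v \<in> ?V r'"
    obtain b u0 where u0: "u = b \<otimes> u0" "b \<in> alive \<omega> (fst r)" "b <# ker = snd r" "u0 \<in> R (fst r)"
      using u unfolding strip_def by blast
    obtain b' v0 where v0: "v = b' \<otimes> v0" "b' \<in> alive \<omega> (fst r')" "b' <# ker = snd r'" "v0 \<in> R (fst r')"
      using v unfolding strip_def by blast
    have c: "b \<in> carrier G" "b' \<in> carrier G" "u0 \<in> carrier G" "v0 \<in> carrier G"
      using ac[OF u0(2)] ac[OF v0(2)] R_carrier[OF u0(4)] R_carrier[OF v0(4)] by auto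
    have "reach (fst r') < dist u v"
    proof (rule linorder_cases[of "fst r" "fst r'"])
      assume "fst r < fst r'"
      then show ?thesis unfolding u0(1) v0(1) using alive_far[OF u0(2) _ alive_base[OF v0(2)] u0(4) v0(4)] by simp
    next
      assume l: "fst r' < fst r"
      have "reach (fst r) < dist v u" unfolding u0(1) v0(1) using alive_far[OF v0(2) l alive_base[OF u0(2)] v0(4) u0(4)] .
      moreover have "dist v u = dist u v" unfolding u0(1) v0(1) using c by (intro dist_sym) auto
      moreover have "reach (fst r') \<le> reach (fst r)" using l by (intro reach_mono) simp
      ultimately show ?thesis by linarith
    next
      assume eq: "fst r = fst r'"
      define q where "q = inv b \<otimes> b'"
      have q: "q \<in> D (fst r)" unfolding q_def using base_quotient[OF \<omega> alive_base[OF u0(2)]] alive_base[OF v0(2)] eq by simp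
      have "b <# ker \<noteq> b' <# ker" using rr eq u0(3) v0(3) by (metis prod_eqI)
      then have "q \<notin> ker" unfolding q_def using l_coset_eq_iff[OF ker_subgroup c(1,2)] by simp
      then have "\<psi> q \<noteq> 0" using q D_N unfolding ker_def by blast
      then have "\<not> dist u0 (q \<otimes> v0) \<le> reach (fst r)" using separation[OF u0(4) _ q] v0(4) eq by auto
      moreover have "inv u \<otimes> v = inv u0 \<otimes> (q \<otimes> v0)"
        unfolding u0(1) v0(1) q_def using c by (simp add: m_assoc inv_mult_group)
      ultimately show ?thesis using eq by simp
    qed
    then show "?C r' \<le> dist u v \<and> 1 \<le> dist u v" by simp
  next
    fix y z assume "{y, z} \<in> E"
    show "weight \<omega> {y, z} = P + 1 \<or> (\<exists>r. y \<in> ?V r \<and> z \<in> ?V r \<and> weight \<omega> {y, z} = ?a r)"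
    proof (cases "\<exists>i. on_road \<omega> i {y, z}")
      case True
      define i where "i = (LEAST i. on_road \<omega> i {y, z})"
      have "on_road \<omega> i {y, z}" unfolding i_def using True by (rule LeastI_ex)
      then obtain b u v where b: "b \<in> alive \<omega> i" "(u, v) \<in> R_edges i" "{y, z} = {b \<otimes> u, b \<otimes> v}"
        unfolding on_road_def by blast
      have uv: "u \<in> R i" "v \<in> R i" using R_edges_R[OF b(2)] by auto
      have "b \<otimes> u \<in> ?V (i, b <# ker)" "b \<otimes> v \<in> ?V (i, b <# ker)" unfolding strip_def using b(1) uv by auto
      then have "y \<in> ?V (i, b <# ker) \<and> z \<in> ?V (i, b <# ker)" using b(3) by (auto simp: doubleton_eq_iff)
      moreover have "weight \<omega> {y, z} = ?a (i, b <# ker)" unfolding weight_def i_def using True by simp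
      ultimately show ?thesis by blast
    qed (simp add: weight_def)
  qed
  then have "(\<forall>r. \<forall>v\<in>?V r. ?C r - dist \<one> v \<le> B) \<longrightarrow> p (inv \<one> \<otimes> x) - C0 - B \<le> sum_list (map (weight \<omega>) fs)"
    using B by blast
  moreover have "?C r - dist \<one> v \<le> B" if "v \<in> ?V r" for r v
  proof -
    obtain b u where b: "v = b \<otimes> u" "b \<in> alive \<omega> (fst r)" "u \<in> R (fst r)" using \<open>v \<in> ?V r\<close> unfolding strip_def by blast
    show ?thesis unfolding b(1) using near[OF alive_base[OF b(2)] b(3)] ac[OF b(2)] R_carrier[OF b(3)] by simp
  qed
  ultimately have "p (inv \<one> \<otimes> x) - C0 - B \<le> sum_list (map (weight \<omega>) fs)" by blast
  then show "p x - C0 - B \<le> sum_list (map (weight \<omega>) fs)" using x by simp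
qed (use x in auto)

definition density_at :: "nat \<Rightarrow> real" where
  "density_at i = real (card (wball (reach i)) * card (R i)) / card (level i)"

lemma card_level_pos: "card (level i) > 0"
  using D_finite[of i] levelI[of \<one> i] by (auto simp: card_gt_0_iff)

lemma density_at_nonneg: "density_at i \<ge> 0"
  unfolding density_at_def by simp

lemma density_at_le: "(reach i + 1) * density_at i \<le> (1/2)^i"
  unfolding density_at_def using density[of i] card_level_pos[of i] by (simp add: divide_le_eq)

lemma density_at_le': "density_at i \<le> (1/2)^i"
  using density_at_le[of i] density_at_nonneg[of i] mult_right_mono[of 1 "real (reach i + 1)" "density_at i"] by simp

lemma union_cyl_prob:
  assumes "finite Y" "Y \<subseteq> carrier G" "real (card Y) \<le> b"
  shows "(\<Union>y\<in>Y. cyl (y <# D j)) \<in> sets M" and "measure M (\<Union>y\<in>Y. cyl (y <# D j)) \<le> b / card (level j)"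
proof -
  have s: "cyl (y <# D j) \<in> sets M" if "y \<in> Y" for y
    using levelI[of y j] that assms(2) by (intro cyl_sets) (auto simp: cosets_def)
  then show "(\<Union>y\<in>Y. cyl (y <# D j)) \<in> sets M" using assms(1) by (intro sets.finite_UN) auto
  have "measure M (\<Union>y\<in>Y. cyl (y <# D j)) \<le> (\<Sum>y\<in>Y. measure M (cyl (y <# D j)))"
    using assms(1) s by (intro finite_measure_subadditive_finite) auto
  also have "\<dots> = (\<Sum>y\<in>Y. 1 / card (level j))"
    using assms(2) levelI by (intro sum.cong refl cyl_prob) auto
  also have "\<dots> = real (card Y) / card (level j)" by simp
  also have "\<dots> \<le> b / card (level j)" using assms(3) by (intro divide_right_mono) auto
  finally show "measure M (\<Union>y\<in>Y. cyl (y <# D j)) \<le> b / card (level j)" .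
qed

definition near_event :: "nat \<Rightarrow> ('a set \<Rightarrow> real) set" where
  "near_event i = (\<Union>y\<in>(\<lambda>(\<beta>, u). \<beta> \<otimes> inv u) ` (wball (reach i) \<times> R i). cyl (y <# D i))"

lemma near_event: "near_event i \<in> sets M" "measure M (near_event i) \<le> density_at i"
proof -
  let ?Y = "(\<lambda>(\<beta>, u). \<beta> \<otimes> inv u) ` (wball (reach i) \<times> R i)"
  have f: "finite (wball (reach i) \<times> R i)" using finite_wball finite_road by blast
  have 1: "finite ?Y" using f by blast
  have 2: "?Y \<subseteq> carrier G" using R_carrier by (auto simp: wball_def)
  have 3: "real (card ?Y) \<le> real (card (wball (reach i)) * card (R i))"
    using card_image_le[OF f, of "\<lambda>(\<beta>, u). \<beta> \<otimes> inv u"] by (simp add: card_cartesian_product flip: of_nat_mult)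
  show "near_event i \<in> sets M" "measure M (near_event i) \<le> density_at i"
    using union_cyl_prob[OF 1 2 3, of i] unfolding near_event_def density_at_def by auto
qed

lemma near_eventI:
  assumes \<omega>: "\<omega> \<in> Om" and b: "b \<in> base \<omega> i" and u: "u \<in> R i" and len: "len (b \<otimes> u) \<le> reach i"
  shows "\<omega> \<in> near_event i"
proof -
  have c: "b \<in> carrier G" "u \<in> carrier G" using base_carrier[OF b] R_carrier[OF u] by auto
  have "b \<in> (\<lambda>(\<beta>, u). \<beta> \<otimes> inv u) ` (wball (reach i) \<times> R i)"
    using c u len by (intro image_eqI[of _ _ "(b \<otimes> u, u)"]) (auto simp: wball_def m_assoc)
  moreover have "\<omega> \<in> cyl (b <# D i)" using \<omega> b by (simp add: cyl_def base_def)
  ultimately show ?thesis unfolding near_event_def by blast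
qed

lemma geometric_tail: "(\<lambda>i. (1/2::real) ^ (i + k)) sums (2 * (1/2) ^ k)"
  using sums_mult[OF geometric_sums[of "1/2::real"], of "(1/2)^k"] by (simp add: power_add mult.commute)

lemma measure_tail_union:
  assumes s: "\<And>i. A i \<in> sets M" and b: "\<And>i. measure M (A i) \<le> b * (1/2) ^ (i + k)"
  shows "measure M (\<Union>i. A i) \<le> b * (2 * (1/2) ^ k)"
proof -
  have sums: "(\<lambda>i. b * (1/2) ^ (i + k)) sums (b * (2 * (1/2) ^ k))" by (rule sums_mult[OF geometric_tail])
  have sm: "summable (\<lambda>i. measure M (A i))"
    using b by (intro summable_comparison_test'[OF sums_summable[OF sums]]) auto
  have "measure M (\<Union>i. A i) \<le> suminf (\<lambda>i. measure M (A i))"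
    using s by (intro finite_measure_subadditive_countably sm) auto
  also have "\<dots> \<le> suminf (\<lambda>i. b * (1/2) ^ (i + k))" by (rule suminf_le[OF b sm sums_summable[OF sums]])
  also have "\<dots> = b * (2 * (1/2) ^ k)" using sums by (rule sums_unique[symmetric])
  finally show ?thesis .
qed

lemma ET_lower:
  assumes x: "x \<in> N"
  shows "\<psi> x - 3 \<le> ET x"
proof -
  have xc: "x \<in> carrier G" using x by simp
  have px: "p x \<ge> 0" by (rule p_nonneg[OF xc])
  obtain I where I: "2 * p x < 2 ^ I" using real_arch_pow[of 2 "2 * p x"] by auto
  define Z where "Z = (\<Union>i. near_event (i + I))"
  have Zs: "Z \<in> sets M" unfolding Z_def using near_event(1) by auto
  have "measure M Z \<le> 1 * (2 * (1/2) ^ I)" unfolding Z_def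
    using near_event density_at_le' by (intro measure_tail_union) (auto intro: order_trans)
  then have "p x * measure M Z \<le> p x * (2 * (1/2) ^ I)" using px by (intro mult_left_mono) auto
  also have "\<dots> \<le> 1" using I by (simp add: power_one_over field_simps)
  finally have Z: "p x * measure M Z \<le> 1" .
  let ?S = "\<lambda>\<omega>. \<Sum>i<I. reach i * indicat_real (near_event i) \<omega>"
  have low: "p x - C0 \<le> T (weight \<omega>) \<one> x + ?S \<omega> + p x * indicat_real Z \<omega>" if \<omega>: "\<omega> \<in> Om" for \<omega>
  proof (cases "\<omega> \<in> Z")
    case True
    have "0 \<le> T (weight \<omega>) \<one> x" using T_bound[OF \<omega>, of \<one> x] xc by simp
    moreover have "0 \<le> ?S \<omega>" by (intro sum_nonneg) auto
    ultimately show ?thesis using True C0_nonneg by simp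
  next
    case False
    have "p x - C0 - ?S \<omega> \<le> T (weight \<omega>) \<one> x"
    proof (rule T_lower[OF \<omega> xc])
      show S0: "0 \<le> ?S \<omega>" by (intro sum_nonneg) auto
      fix i b u assume b: "b \<in> base \<omega> i" and u: "u \<in> R i"
      show "reach i - real (len (b \<otimes> u)) \<le> ?S \<omega>"
      proof (cases "len (b \<otimes> u) \<le> reach i")
        case True
        then have n: "\<omega> \<in> near_event i" by (rule near_eventI[OF \<omega> b u])
        have "i < I"
        proof (rule ccontr)
          assume "\<not> i < I"
          then have "i = (i - I) + I" by simp
          then show False using n False unfolding Z_def by (metis UN_I UNIV_I)
        qed
        then have "reach i * indicat_real (near_event i) \<omega> \<le> ?S \<omega>"
          by (intro member_le_sum[of i "{..<I}" "\<lambda>i. reach i * indicat_real (near_event i) \<omega>"]) auto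
        then show ?thesis using n by simp
      qed (use S0 in simp)
    qed
    then show ?thesis using False by simp
  qed
  have int: "integrable M (\<lambda>\<omega>. T (weight \<omega>) \<one> x)" using xc by (intro T_integrable) auto
  have intS: "integrable M ?S" 
    using near_event(1) by (intro Bochner_Integration.integrable_sum integrable_mult_right integrable_real_indicator) (auto simp: emeasure_eq_measure)
  have intZ: "integrable M (\<lambda>\<omega>. p x * indicat_real Z \<omega>)"
    using Zs by (intro integrable_mult_right integrable_real_indicator) (auto simp: emeasure_eq_measure)
  have "p x - C0 = (\<integral>\<omega>. p x - C0 \<partial>M)" by (simp add: prob_space)
  also have "\<dots> \<le> (\<integral>\<omega>. T (weight \<omega>) \<one> x + ?S \<omega> + p x * indicat_real Z \<omega> \<partial>M)"
    using low by (intro integral_mono Bochner_Integration.integrable_add int intS intZ) (auto simp: space_M)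
  also have "\<dots> = ET x + (\<integral>\<omega>. ?S \<omega> \<partial>M) + (\<integral>\<omega>. p x * indicat_real Z \<omega> \<partial>M)"
    unfolding ET_def using int intS intZ
    by (subst Bochner_Integration.integral_add, auto)+
  also have "(\<integral>\<omega>. p x * indicat_real Z \<omega> \<partial>M) = p x * measure M Z" using Zs by simp
  also have "(\<integral>\<omega>. ?S \<omega> \<partial>M) = (\<Sum>i<I. reach i * measure M (near_event i))"
    
    using near_event(1) by (subst Bochner_Integration.integral_sum)
      (auto intro!: integrable_mult_right integrable_real_indicator simp: emeasure_eq_measure)
  finally have main: "p x - C0 \<le> ET x + (\<Sum>i<I. reach i * measure M (near_event i)) + p x * measure M Z" .
  have "(\<Sum>i<I. reach i * measure M (near_event i)) \<le> (\<Sum>i<I. (1/2)^i)"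
  proof (rule sum_mono)
    fix i
    have "reach i * measure M (near_event i) \<le> reach i * density_at i"
      using near_event(2) by (intro mult_left_mono) auto
    then show "reach i * measure M (near_event i) \<le> (1/2)^i"
      using density_at_le[of i] density_at_nonneg[of i] by (simp add: distrib_right)
  qed
  also have "\<dots> \<le> suminf (\<lambda>i. (1/2::real)^i)" by (intro sum_le_suminf) auto
  also have "\<dots> = 2" by (simp add: suminf_geometric)
  finally show ?thesis using main Z p_N[OF x] by simp
qed

end

section \<open>The roads realise the norm\<close>

context road_system
begin

lemma weight_alive:
  assumes \<omega>: "\<omega> \<in> Om" and b: "b \<in> alive \<omega> i" and uv: "(u, v) \<in> R_edges i"
  shows "weight \<omega> {b \<otimes> u, b \<otimes> v} = speed i"
proof -
  let ?f = "{b \<otimes> u, b \<otimes> v}"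
  have on: "on_road \<omega> i ?f" unfolding on_road_def using b uv by blast
  have "(LEAST i. on_road \<omega> i ?f) = i"
  proof (rule Least_equality)
    show "on_road \<omega> i ?f" by (rule on)
  next
    fix j assume "on_road \<omega> j ?f"
    then obtain b' u' v' where b': "b' \<in> alive \<omega> j" "(u', v') \<in> R_edges j" "?f = {b' \<otimes> u', b' \<otimes> v'}"
      unfolding on_road_def by blast
    obtain y where y: "y \<in> R j" "b \<otimes> u = b' \<otimes> y" using b'(3) R_edges_R[OF b'(2)] by blast
    have c: "b \<otimes> u \<in> carrier G"
      using base_carrier[OF alive_base[OF b]] R_carrier[of u i] R_edges_R[OF uv] by simp
    show "i \<le> j"
    proof (rule ccontr)
      assume "\<not> i \<le> j"
      then have "reach i < dist (b' \<otimes> y) (b \<otimes> u)"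
        using alive_far[OF b'(1) _ alive_base[OF b] y(1)] R_edges_R[OF uv] by simp
      then show False unfolding y(2)[symmetric] using c by simp
    qed
  qed
  then show ?thesis unfolding weight_def using on by auto
qed

lemma T_self: "\<omega> \<in> Om \<Longrightarrow> x \<in> carrier G \<Longrightarrow> T (weight \<omega>) x x \<le> 0"
  using T_bound[of \<omega> x x] by simp

lemma T_edge: "\<omega> \<in> Om \<Longrightarrow> {x, y} \<in> E \<Longrightarrow> T (weight \<omega>) x y \<le> weight \<omega> {x, y}"
  using T_le[of "weight \<omega>" x "[{x, y}]" y] w_nonneg by auto

lemma T_along_generator:
  assumes \<omega>: "\<omega> \<in> Om" and b: "b \<in> alive \<omega> i" and q: "q < ns i" and t: "t \<le> len (zs i)"
  shows "T (weight \<omega>) (b \<otimes> zs i [^] (q::nat)) (b \<otimes> (zs i [^] q \<otimes> pre (zs i) t)) \<le> t * speed i"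
  using t
proof (induction t)
  case 0
  show ?case using T_self[OF \<omega>, of "b \<otimes> zs i [^] q"] base_carrier[OF alive_base[OF b]] by simp
next
  case (Suc t)
  let ?z = "zs i"
  have bc: "b \<in> carrier G" by (rule base_carrier[OF alive_base[OF b]])
  let ?u = "?z [^] q \<otimes> pre ?z t" and ?v = "?z [^] q \<otimes> pre ?z (Suc t)"
  have uv: "(?u, ?v) \<in> R_edges i" unfolding road_edges_def using q Suc.prems by (intro CollectI exI[of _ q] exI[of _ t]) auto
  obtain s where s: "s \<in> letters" "pre ?z (Suc t) = pre ?z t \<otimes> s" using pre_Suc[of ?z t] Suc.prems by auto
  have sc: "s \<in> carrier G" using s(1) letters_carrier by simp
  have "b \<otimes> ?v = b \<otimes> ?u \<otimes> s" unfolding s(2) using bc sc by (simp add: m_assoc)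
  then have "{b \<otimes> ?u, b \<otimes> ?v} \<in> E" using edge_letter[OF s(1), of "b \<otimes> ?u"] bc by simp
  then have "T (weight \<omega>) (b \<otimes> ?u) (b \<otimes> ?v) \<le> speed i"
    using T_edge[OF \<omega>] weight_alive[OF \<omega> b uv] by metis
  moreover have "T (weight \<omega>) (b \<otimes> ?z [^] q) (b \<otimes> ?v) \<le>
      T (weight \<omega>) (b \<otimes> ?z [^] q) (b \<otimes> ?u) + T (weight \<omega>) (b \<otimes> ?u) (b \<otimes> ?v)"
    using bc by (intro T_triangle_w[OF \<omega>]) auto
  ultimately show ?case using Suc.IH Suc.prems by (simp add: algebra_simps)
qed

lemma T_along_road:
  assumes \<omega>: "\<omega> \<in> Om" and b: "b \<in> alive \<omega> i"
  shows "k + m \<le> ns i \<Longrightarrow>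
    T (weight \<omega>) (b \<otimes> zs i [^] k) (b \<otimes> zs i [^] (k + m)) \<le> real m * (speed i * len (zs i))"
proof (induction m)
  case 0
  show ?case using T_self[OF \<omega>, of "b \<otimes> zs i [^] k"] base_carrier[OF alive_base[OF b]] by simp
next
  case (Suc m)
  let ?z = "zs i"
  have bc: "b \<in> carrier G" by (rule base_carrier[OF alive_base[OF b]])
  have "T (weight \<omega>) (b \<otimes> ?z [^] (k + m)) (b \<otimes> ?z [^] (k + Suc m)) \<le> len ?z * speed i"
    using T_along_generator[OF \<omega> b, of "k + m" "len ?z"] Suc.prems by simp
  moreover have "T (weight \<omega>) (b \<otimes> ?z [^] k) (b \<otimes> ?z [^] (k + Suc m)) \<le>
      T (weight \<omega>) (b \<otimes> ?z [^] k) (b \<otimes> ?z [^] (k + m)) + T (weight \<omega>) (b \<otimes> ?z [^] (k + m)) (b \<otimes> ?z [^] (k + Suc m))"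
    using bc by (intro T_triangle_w[OF \<omega>]) auto
  ultimately show ?case using Suc.IH Suc.prems by (simp add: algebra_simps)
qed

subsection \<open>Restriction to configurations inside the subgroup\<close>

definition inside :: "('a set \<Rightarrow> real) set" where "inside = {\<omega> \<in> Om. base \<omega> 0 \<subseteq> N}"

lemma inside_iff: "\<omega> \<in> Om \<Longrightarrow> b \<in> base \<omega> 0 \<Longrightarrow> \<omega> \<in> inside \<longleftrightarrow> b \<in> N"
proof
  assume \<omega>: "\<omega> \<in> Om" and b: "b \<in> base \<omega> 0" and bN: "b \<in> N"
  have "b' \<in> N" if b': "b' \<in> base \<omega> 0" for b'
  proof -
    have "inv b \<otimes> b' \<in> N" using base_quotient[OF \<omega> b b'] D_N by blast
    then have "b \<otimes> (inv b \<otimes> b') \<in> N" using bN by simp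
    then show ?thesis using base_carrier[OF b] base_carrier[OF b'] by simp
  qed
  then show "\<omega> \<in> inside" using \<omega> by (auto simp: inside_def)
qed (auto simp: inside_def)

lemma inside_sets [measurable]: "inside \<in> sets M"
proof -
  have "Measurable.pred M (\<lambda>\<omega>. \<forall>b\<in>carrier G. b \<in> base \<omega> 0 \<longrightarrow> b \<in> N)"
    by (rule pred_carrier(1)) (auto intro!: pred_intros_logic pred_base)
  moreover have "inside = {\<omega> \<in> space M. \<forall>b\<in>carrier G. b \<in> base \<omega> 0 \<longrightarrow> b \<in> N}"
    unfolding inside_def space_M using base_carrier by auto
  ultimately show ?thesis by (simp add: pred_def)
qed

lemma inside_act:
  assumes "g \<in> carrier G" "\<omega> \<in> Om" "b \<in> base \<omega> 0"
  shows "act g \<omega> \<in> inside \<longleftrightarrow> g \<otimes> b \<in> N"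
proof -
  have "g \<otimes> b \<in> base (act g \<omega>) 0" using assms base_carrier[OF assms(3)] by (simp add: base_act)
  then show ?thesis by (rule inside_iff[OF act_Om[OF assms(1,2)]])
qed

lemma inside_act_N: "g \<in> N \<Longrightarrow> \<omega> \<in> Om \<Longrightarrow> act g \<omega> \<in> inside \<longleftrightarrow> \<omega> \<in> inside"
proof -
  assume g: "g \<in> N" and \<omega>: "\<omega> \<in> Om"
  obtain b where b: "b \<in> base \<omega> 0" using base_nonempty[OF \<omega>] by blast
  have bc: "b \<in> carrier G" by (rule base_carrier[OF b])
  have "g \<otimes> b \<in> N \<longleftrightarrow> b \<in> N"
  proof
    assume "g \<otimes> b \<in> N"
    then have "inv g \<otimes> (g \<otimes> b) \<in> N" by (rule N_mult[OF N_inv[OF g]])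
    then show "b \<in> N" using g bc by simp
  qed (use g in simp)
  then show ?thesis using inside_act[OF _ \<omega> b, of g] inside_iff[OF \<omega> b] g by simp
qed

definition transversal :: "'a set" where "transversal = rep ` carrier G"

lemma transversal_carrier: "t \<in> transversal \<Longrightarrow> t \<in> carrier G"
  unfolding transversal_def by auto

lemma finite_transversal: "finite transversal"
  unfolding transversal_def by (rule finite_rep)

lemma transversal_unique:
  assumes t: "t \<in> transversal" and b: "b \<in> carrier G" and n: "inv t \<otimes> b \<in> N"
  shows "rep b = t"
proof -
  obtain g where g: "g \<in> carrier G" "t = rep g" using t unfolding transversal_def by blast
  have tc: "t \<in> carrier G" using transversal_carrier[OF t] .
  have "rep (g \<otimes> inv (rep g) \<otimes> rep g) = rep (rep g)" using g by (intro rep_mult rep_N) auto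
  then have rt: "rep t = t" using g by (simp add: m_assoc)
  have "rep (t \<otimes> (inv t \<otimes> b) \<otimes> inv t \<otimes> t) = rep t" using tc n by (intro rep_mult N_conj) auto
  then show ?thesis using rt tc b by (simp add: m_assoc)
qed

lemma transversal_exists: "b \<in> carrier G \<Longrightarrow> rep b \<in> transversal \<and> inv (rep b) \<otimes> b \<in> N"
proof -
  assume b: "b \<in> carrier G"
  have "inv (rep b) \<otimes> (b \<otimes> inv (rep b)) \<otimes> rep b \<in> N" using b by (intro N_conj' rep_N) auto
  then show ?thesis using b by (simp add: transversal_def m_assoc)
qed

lemma card_transversal_inside: "card transversal * prob inside \<le> 1"
proof -
  let ?A = "\<lambda>t. act (inv t) -` inside \<inter> space M"
  have As: "?A t \<in> sets M" if "t \<in> transversal" for t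
    using transversal_carrier[OF that] by (intro measurable_sets[OF act_measurable]) auto
  have p: "prob (?A t) = prob inside" if "t \<in> transversal" for t
    using measure_distr[OF act_measurable[of "inv t"] inside_sets] act_preserves[of "inv t"] transversal_carrier[OF that] by simp
  have dis: "disjoint_family_on ?A transversal"
    unfolding disjoint_family_on_def
  proof (intro ballI impI equals0I)
    fix t t' \<omega> assume tt: "t \<in> transversal" "t' \<in> transversal" "t \<noteq> t'" and "\<omega> \<in> ?A t \<inter> ?A t'"
    then have \<omega>: "\<omega> \<in> Om" "act (inv t) \<omega> \<in> inside" "act (inv t') \<omega> \<in> inside" by (auto simp: space_M)
    obtain b where b: "b \<in> base \<omega> 0" using base_nonempty[OF \<omega>(1)] by blast
    have bc: "b \<in> carrier G" by (rule base_carrier[OF b])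
    have "inv t \<otimes> b \<in> N" "inv t' \<otimes> b \<in> N"
      using inside_act[OF _ \<omega>(1) b, of "inv t"] inside_act[OF _ \<omega>(1) b, of "inv t'"] \<omega> tt transversal_carrier by auto
    then have "t = t'" using transversal_unique[OF tt(1) bc] transversal_unique[OF tt(2) bc] by simp
    then show False using tt by simp
  qed
  have "card transversal * prob inside = (\<Sum>t\<in>transversal. prob (?A t))" using p by simp
  also have "\<dots> = prob (\<Union>t\<in>transversal. ?A t)"
    using As by (intro finite_measure_finite_Union[symmetric] finite_transversal dis) blast
  also have "\<dots> \<le> 1" by (rule prob_le_1)
  finally show ?thesis .
qed

definition inside_time :: "'a \<Rightarrow> real" where
  "inside_time x = (\<integral>\<omega>. T (weight \<omega>) \<one> x * indicat_real inside \<omega> \<partial>M)"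

lemma T_inside_integrable:
  "x \<in> carrier G \<Longrightarrow> y \<in> carrier G \<Longrightarrow> integrable M (\<lambda>\<omega>. T (weight \<omega>) x y * indicat_real inside \<omega>)"
  by (intro integrable_real_mult_indicator T_integrable inside_sets)

lemma inside_integral_act:
  assumes g: "g \<in> carrier G" and c: "x \<in> carrier G" "y \<in> carrier G"
  shows "(\<integral>\<omega>. T (weight \<omega>) x y * indicat_real inside (act g \<omega>) \<partial>M) =
    (\<integral>\<omega>. T (weight \<omega>) (g \<otimes> x) (g \<otimes> y) * indicat_real inside \<omega> \<partial>M)"
proof -
  have "(\<integral>\<omega>. T (weight \<omega>) x y * indicat_real inside (act g \<omega>) \<partial>M) =
      (\<integral>\<omega>. T (weight (act g \<omega>)) (g \<otimes> x) (g \<otimes> y) * indicat_real inside (act g \<omega>) \<partial>M)"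
    using T_act[OF g] c by (intro Bochner_Integration.integral_cong) (auto simp: space_M)
  also have "\<dots> = (\<integral>\<omega>. T (weight \<omega>) (g \<otimes> x) (g \<otimes> y) * indicat_real inside \<omega> \<partial>M)"
    using g c by (intro integral_act[of g "\<lambda>\<omega>. T (weight \<omega>) (g \<otimes> x) (g \<otimes> y) * indicat_real inside \<omega>"]
      borel_measurable_times T_measurable borel_measurable_indicator inside_sets) auto
  finally show ?thesis .
qed

lemma inside_time_mult:
  assumes x: "x \<in> N" and y: "y \<in> N"
  shows "inside_time (x \<otimes> y) \<le> inside_time x + inside_time y"
proof -
  have c: "x \<in> carrier G" "y \<in> carrier G" using x y by auto
  let ?I = "indicat_real inside"
  have "inside_time (x \<otimes> y) \<le> (\<integral>\<omega>. T (weight \<omega>) \<one> x * ?I \<omega> + T (weight \<omega>) x (x \<otimes> y) * ?I \<omega> \<partial>M)"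
    unfolding inside_time_def
  proof (rule integral_mono)
    show "T (weight \<omega>) \<one> (x \<otimes> y) * ?I \<omega> \<le> T (weight \<omega>) \<one> x * ?I \<omega> + T (weight \<omega>) x (x \<otimes> y) * ?I \<omega>"
      if "\<omega> \<in> space M" for \<omega>
      using T_triangle_w[of \<omega> \<one> x "x \<otimes> y"] that c by (auto simp: space_M indicator_def)
  qed (use c in \<open>auto intro!: T_inside_integrable\<close>)
  also have "\<dots> = inside_time x + (\<integral>\<omega>. T (weight \<omega>) x (x \<otimes> y) * ?I \<omega> \<partial>M)"
    unfolding inside_time_def using c by (intro Bochner_Integration.integral_add T_inside_integrable) auto
  also have "(\<integral>\<omega>. T (weight \<omega>) x (x \<otimes> y) * ?I \<omega> \<partial>M) = (\<integral>\<omega>. T (weight \<omega>) \<one> y * ?I (act x \<omega>) \<partial>M)"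
    using inside_integral_act[of x \<one> y] c by simp
  also have "\<dots> = inside_time y"
    unfolding inside_time_def using inside_act_N[OF x]
    by (intro Bochner_Integration.integral_cong) (auto simp: space_M indicator_def)
  finally show ?thesis by simp
qed

lemma inside_time_pow: "x \<in> N \<Longrightarrow> inside_time (x [^] (k::nat)) \<le> k * inside_time x"
proof (induction k)
  case 0
  have "inside_time \<one> \<le> (\<integral>\<omega>. 0 \<partial>M)" unfolding inside_time_def
    by (rule integral_mono) (auto intro!: T_inside_integrable mult_nonpos_nonneg T_self simp: space_M)
  then show ?case by simp
next
  case (Suc k)
  then show ?case using inside_time_mult[of "x [^] k" x] by (simp add: algebra_simps)
qed

lemma ET_le_inside_time:
  assumes x: "x \<in> N"
  shows "ET x \<le> (\<Sum>t\<in>transversal. inside_time (inv t \<otimes> x \<otimes> t) + 2 * (P + 1) * len t)"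
proof -
  have xc: "x \<in> carrier G" using x by simp
  let ?I = "indicat_real inside"
  have int: "integrable M (\<lambda>\<omega>. T (weight \<omega>) \<one> x * ?I (act (inv t) \<omega>))" if t: "t \<in> transversal" for t
  proof -
    have "act (inv t) -` inside \<inter> space M \<in> sets M"
      using transversal_carrier[OF t] by (intro measurable_sets[OF act_measurable]) auto
    then have "integrable M (\<lambda>\<omega>. T (weight \<omega>) \<one> x * indicat_real (act (inv t) -` inside \<inter> space M) \<omega>)"
      using xc by (intro integrable_real_mult_indicator T_integrable) auto
    moreover have "?thesis \<longleftrightarrow> integrable M (\<lambda>\<omega>. T (weight \<omega>) \<one> x * indicat_real (act (inv t) -` inside \<inter> space M) \<omega>)"
      by (intro Bochner_Integration.integrable_cong) (auto simp: indicator_def)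
    ultimately show ?thesis by simp
  qed
  have "ET x \<le> (\<integral>\<omega>. (\<Sum>t\<in>transversal. T (weight \<omega>) \<one> x * ?I (act (inv t) \<omega>)) \<partial>M)"
    unfolding ET_def
  proof (rule integral_mono)
    fix \<omega> assume "\<omega> \<in> space M"
    then have \<omega>: "\<omega> \<in> Om" by (simp add: space_M)
    obtain b where b: "b \<in> base \<omega> 0" using base_nonempty[OF \<omega>] by blast
    have bc: "b \<in> carrier G" by (rule base_carrier[OF b])
    have "act (inv (rep b)) \<omega> \<in> inside"
      using inside_act[OF _ \<omega> b, of "inv (rep b)"] transversal_exists[OF bc] bc by simp
    then have eq: "T (weight \<omega>) \<one> x = T (weight \<omega>) \<one> x * ?I (act (inv (rep b)) \<omega>)" by simp
    have 0: "0 \<le> T (weight \<omega>) \<one> x" using T_bound[OF \<omega>, of \<one> x] xc by simp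
    show "T (weight \<omega>) \<one> x \<le> (\<Sum>t\<in>transversal. T (weight \<omega>) \<one> x * ?I (act (inv t) \<omega>))"
      by (subst eq, rule member_le_sum[of "rep b" transversal "\<lambda>t. T (weight \<omega>) \<one> x * ?I (act (inv t) \<omega>)"])
        (use transversal_exists[OF bc] finite_transversal 0 in auto)
  qed (use xc int in \<open>auto intro!: T_integrable Bochner_Integration.integrable_sum\<close>)
  also have "\<dots> = (\<Sum>t\<in>transversal. \<integral>\<omega>. T (weight \<omega>) \<one> x * ?I (act (inv t) \<omega>) \<partial>M)"
    using int by (intro Bochner_Integration.integral_sum) auto
  also have "\<dots> \<le> (\<Sum>t\<in>transversal. inside_time (inv t \<otimes> x \<otimes> t) + 2 * (P + 1) * len t)"
  proof (rule sum_mono)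
    fix t assume t: "t \<in> transversal"
    have tc: "t \<in> carrier G" by (rule transversal_carrier[OF t])
    let ?y = "inv t \<otimes> x \<otimes> t"
    have "(\<integral>\<omega>. T (weight \<omega>) \<one> x * ?I (act (inv t) \<omega>) \<partial>M) = (\<integral>\<omega>. T (weight \<omega>) (inv t) (inv t \<otimes> x) * ?I \<omega> \<partial>M)"
      using inside_integral_act[of "inv t" \<one> x] tc xc by simp
    also have "\<dots> \<le> (\<integral>\<omega>. T (weight \<omega>) \<one> ?y * ?I \<omega> + 2 * (P + 1) * len t \<partial>M)"
    proof (rule integral_mono)
      fix \<omega> assume "\<omega> \<in> space M"
      then have \<omega>: "\<omega> \<in> Om" by (simp add: space_M)
      have "T (weight \<omega>) (inv t) (inv t \<otimes> x) \<le> T (weight \<omega>) (inv t) ?y + T (weight \<omega>) ?y (inv t \<otimes> x)"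
        using tc xc by (intro T_triangle_w[OF \<omega>]) auto
      moreover have "T (weight \<omega>) (inv t) ?y \<le> T (weight \<omega>) (inv t) \<one> + T (weight \<omega>) \<one> ?y"
        using tc xc by (intro T_triangle_w[OF \<omega>]) auto
      moreover have "T (weight \<omega>) (inv t) \<one> \<le> (P + 1) * len t"
        using T_bound[OF \<omega>, of "inv t" \<one>] tc by simp
      moreover have "inv ?y \<otimes> (inv t \<otimes> x) = inv t" using tc xc by (simp add: m_assoc inv_mult_group)
      then have "T (weight \<omega>) ?y (inv t \<otimes> x) \<le> (P + 1) * len t"
        using T_bound[OF \<omega>, of ?y "inv t \<otimes> x"] tc xc by simp
      moreover have "0 \<le> 2 * (P + 1) * len t" using P_ge_1 by simp
      ultimately have "T (weight \<omega>) (inv t) (inv t \<otimes> x) \<le> T (weight \<omega>) \<one> ?y + 2 * (P + 1) * len t"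
        "0 \<le> 2 * (P + 1) * len t" by (simp_all add: algebra_simps)
      then show "T (weight \<omega>) (inv t) (inv t \<otimes> x) * ?I \<omega> \<le> T (weight \<omega>) \<one> ?y * ?I \<omega> + 2 * (P + 1) * len t"
        by (cases "\<omega> \<in> inside") auto
    qed (use tc xc in \<open>auto intro!: T_inside_integrable\<close>)
    also have "\<dots> = inside_time ?y + 2 * (P + 1) * len t"
      unfolding inside_time_def using tc xc by (subst Bochner_Integration.integral_add) (auto intro!: T_inside_integrable simp: prob_space)
    finally show "(\<integral>\<omega>. T (weight \<omega>) \<one> x * ?I (act (inv t) \<omega>) \<partial>M) \<le> inside_time ?y + 2 * (P + 1) * len t" .
  qed
  finally show ?thesis .
qed

subsection \<open>Most configurations provide a road\<close>

lemma Fs_carrier: "g \<in> Fs i \<Longrightarrow> g \<in> carrier G"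
  using Fs_N[of i] N_carrier by blast

definition killed_at :: "nat \<Rightarrow> nat \<Rightarrow> ('a set \<Rightarrow> real) set" where
  "killed_at i j = (\<Union>y\<in>(\<lambda>(g, k, u, \<beta>, v). g \<otimes> inv (zs i [^] k) \<otimes> u \<otimes> \<beta> \<otimes> inv v) `
      (Fs i \<times> {..ns i} \<times> R i \<times> wball (reach j) \<times> R j). cyl (y <# D j))"

definition killed :: "nat \<Rightarrow> ('a set \<Rightarrow> real) set" where
  "killed i = (\<Union>l. killed_at i (l + (i + 1)))"

lemma killed_at:
  assumes ij: "i < j"
  shows "killed_at i j \<in> sets M" "measure M (killed_at i j) \<le> 1 / (len (zs i) + 1) * (1/2) ^ j"
proof -
  let ?I = "Fs i \<times> {..ns i} \<times> R i \<times> wball (reach j) \<times> R j"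
  let ?f = "\<lambda>(g, k, u, \<beta>, v). g \<otimes> inv (zs i [^] (k::nat)) \<otimes> u \<otimes> \<beta> \<otimes> inv v"
  define W where "W = card (Fs i) * (ns i + 1) * card (R i)"
  define V where "V = card (wball (reach j)) * card (R j)"
  have f: "finite ?I" using finite_wball finite_road Fs_finite by (intro finite_cartesian_product) auto
  have 1: "finite (?f ` ?I)" using f by blast
  have 2: "?f ` ?I \<subseteq> carrier G"
    using R_carrier by (auto simp: wball_def Fs_carrier)
  have "card (?f ` ?I) \<le> card ?I" by (rule card_image_le[OF f])
  also have "\<dots> = W * V" unfolding W_def V_def by (simp add: card_cartesian_product algebra_simps)
  finally have 3: "real (card (?f ` ?I)) \<le> real (W * V)" by (simp only: of_nat_le_iff)
  show "killed_at i j \<in> sets M" unfolding killed_at_def by (rule union_cyl_prob(1)[OF 1 2 3])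
  have "measure M (killed_at i j) \<le> real (W * V) / card (level j)"
    unfolding killed_at_def by (rule union_cyl_prob(2)[OF 1 2 3])
  also have "\<dots> \<le> 1 / (len (zs i) + 1) * (1/2) ^ j"
  proof -
    have "real (W * (len (zs i) + 1)) * real V \<le> (1/2)^j * card (level j)"
      using cross_density[OF ij] unfolding W_def V_def .
    moreover have "(0::real) < real (len (zs i) + 1)" by linarith
    ultimately have "real (W * V) \<le> (1/2)^j * card (level j) / real (len (zs i) + 1)"
      by (subst pos_le_divide_eq) (simp_all only: of_nat_mult mult_ac)
    then show ?thesis using card_level_pos[of j] by (simp add: divide_le_eq mult_ac)
  qed
  finally show "measure M (killed_at i j) \<le> 1 / (len (zs i) + 1) * (1/2) ^ j" .
qed

lemma killed: "killed i \<in> sets M" "measure M (killed i) \<le> (1/2) ^ i / (len (zs i) + 1)"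
proof -
  show "killed i \<in> sets M" unfolding killed_def using killed_at(1)[of i] by (intro sets.countable_UN) auto
  have "measure M (killed i) \<le> 1 / (len (zs i) + 1) * (2 * (1/2) ^ (i + 1))"
    unfolding killed_def
  proof (rule measure_tail_union)
    show "killed_at i (l + (i + 1)) \<in> sets M" for l by (rule killed_at(1)) simp
    show "measure M (killed_at i (l + (i + 1))) \<le> 1 / (len (zs i) + 1) * (1/2) ^ (l + (i + 1))" for l
      by (rule killed_at(2)) simp
  qed
  then show "measure M (killed i) \<le> (1/2) ^ i / (len (zs i) + 1)" by simp
qed

definition missed_cosets :: "nat \<Rightarrow> 'a set set" where
  "missed_cosets i = {C \<in> level i. C \<subseteq> N \<and>
     \<not> (\<exists>g\<in>Fs i. \<exists>k\<le>ns i - ms i. C = (g \<otimes> inv (zs i [^] k)) <# D i)}"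

definition missed :: "nat \<Rightarrow> ('a set \<Rightarrow> real) set" where "missed i = (\<Union>C\<in>missed_cosets i. cyl C)"

lemma missed: "missed i \<in> sets M" "measure M (missed i) \<le> 1 / ((i + 1) * (len (zs i) + 1))"
proof -
  have f: "finite (missed_cosets i)" using D_finite[of i] by (simp add: missed_cosets_def)
  have l: "C \<in> level i" if "C \<in> missed_cosets i" for C using that by (simp add: missed_cosets_def)
  have s: "cyl C \<in> sets M" if "C \<in> missed_cosets i" for C
    using l[OF that] by (intro cyl_sets) (auto simp: cosets_def)
  show "missed i \<in> sets M" unfolding missed_def using f s by (intro sets.finite_UN) auto
  have "measure M (missed i) \<le> (\<Sum>C\<in>missed_cosets i. measure M (cyl C))"
    unfolding missed_def using f s by (intro finite_measure_subadditive_finite) auto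
  also have "\<dots> = (\<Sum>C\<in>missed_cosets i. 1 / card (level i))"
    using l by (intro sum.cong refl cyl_prob) auto
  also have "\<dots> = real (card (missed_cosets i)) / card (level i)" by simp
  also have "\<dots> \<le> 1 / ((i + 1) * (len (zs i) + 1))"
  proof -
    have "real (card (missed_cosets i)) * ((i + 1) * (len (zs i) + 1)) \<le> card (level i)"
      using Fs_cover[of i] unfolding missed_cosets_def .
    moreover have "(0::real) < real ((i + 1) * (len (zs i) + 1))" by (simp only: of_nat_0_less_iff) simp
    ultimately show ?thesis using card_level_pos[of i] by (simp only: divide_le_eq pos_le_divide_eq) (simp add: field_simps)
  qed
  finally show "measure M (missed i) \<le> 1 / ((i + 1) * (len (zs i) + 1))" .
qed

lemma T_on_good_event:
  assumes \<omega>: "\<omega> \<in> inside" and good: "\<omega> \<notin> missed i" "\<omega> \<notin> killed i"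
  shows "T (weight \<omega>) \<one> (zs i [^] ms i) \<le>
    ms i * (speed i * len (zs i)) + (P + 1) * (ms i / ((i + 1) * (len (zs i) + 1)))"
proof -
  let ?z = "zs i" and ?m = "ms i"
  have \<omega>O: "\<omega> \<in> Om" using \<omega> by (simp add: inside_def)
  obtain b0 where b0: "b0 \<in> base \<omega> i" using base_nonempty[OF \<omega>O] by blast
  have b0c: "b0 \<in> carrier G" by (rule base_carrier[OF b0])
  have b0N: "b0 \<in> N" using base_anti[OF \<omega>O, of 0 i] b0 \<omega> by (auto simp: inside_def)
  define C where "C = b0 <# D i"
  have C: "C \<in> level i" "\<omega> \<in> cyl C" using b0 \<omega>O levelI[OF b0c] by (auto simp: C_def cyl_def base_def)
  have "C \<subseteq> N" unfolding C_def l_coset_def using D_N[of i] b0N by auto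
  then obtain g k where g: "g \<in> Fs i" and k: "k \<le> ns i - ?m" and Ck: "C = (g \<otimes> inv (?z [^] k)) <# D i"
    using good(1) C unfolding missed_def missed_cosets_def by blast
  have gc: "g \<in> carrier G" using g by (rule Fs_carrier)
  define b where "b = g \<otimes> inv (?z [^] k)"
  have bc: "b \<in> carrier G" unfolding b_def using gc by simp
  have b: "b \<in> base \<omega> i" using C(2) bc unfolding Ck b_def[symmetric] by (simp add: base_def cyl_def)
  have "b \<in> alive \<omega> i"
    unfolding alive_def
  proof (intro CollectI conjI b allI impI ballI, rule ccontr)
    fix j b' u v assume j: "i < j" and b': "b' \<in> base \<omega> j" and u: "u \<in> R i" and v: "v \<in> R j"
      and "\<not> reach j < dist (b \<otimes> u) (b' \<otimes> v)"
    then have d: "dist (b \<otimes> u) (b' \<otimes> v) \<le> reach j" by simp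
    have c: "b' \<in> carrier G" "u \<in> carrier G" "v \<in> carrier G" using base_carrier[OF b'] R_carrier[OF u] R_carrier[OF v] by auto
    have "b' = b \<otimes> u \<otimes> (inv (b \<otimes> u) \<otimes> (b' \<otimes> v)) \<otimes> inv v" using bc c by (simp add: m_assoc inv_mult_group)
    then have "b' \<in> (\<lambda>(g, k, u, \<beta>, v). g \<otimes> inv (?z [^] k) \<otimes> u \<otimes> \<beta> \<otimes> inv v) `
        (Fs i \<times> {..ns i} \<times> R i \<times> wball (reach j) \<times> R j)"
      using g k u v d bc c unfolding b_def
      by (intro image_eqI[of _ _ "(g, k, u, inv (g \<otimes> inv (?z [^] k) \<otimes> u) \<otimes> (b' \<otimes> v), v)"]) (auto simp: wball_def)
    moreover have "\<omega> \<in> cyl (b' <# D j)" using \<omega>O b' by (simp add: cyl_def base_def)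
    ultimately have "\<omega> \<in> killed_at i j" unfolding killed_at_def by (rule UN_I)
    moreover have "j = (j - (i + 1)) + (i + 1)" using j by simp
    ultimately show False using good(2) unfolding killed_def by (metis UN_I UNIV_I)
  qed
  note al = this
  have "T (weight \<omega>) (b \<otimes> ?z [^] k) (b \<otimes> ?z [^] (k + ?m)) \<le> real ?m * (speed i * len ?z)"
    using k ms(2)[of i] by (intro T_along_road[OF \<omega>O al]) linarith
  moreover have "b \<otimes> ?z [^] k = g" "b \<otimes> ?z [^] (k + ?m) = g \<otimes> ?z [^] ?m"
    unfolding b_def using gc by (simp_all add: m_assoc nat_pow_mult[symmetric])
  ultimately have T1: "T (weight \<omega>) g (g \<otimes> ?z [^] ?m) \<le> real ?m * (speed i * len ?z)" by simp
  have T2: "T (weight \<omega>) \<one> g \<le> (P + 1) * len g" using T_bound[OF \<omega>O, of \<one> g] gc by simp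
  have "inv (g \<otimes> ?z [^] ?m) \<otimes> ?z [^] ?m = inv (?z [^] ?m) \<otimes> inv g \<otimes> ?z [^] ?m"
    using gc by (simp add: inv_mult_group)
  then have T3: "T (weight \<omega>) (g \<otimes> ?z [^] ?m) (?z [^] ?m) \<le> (P + 1) * len (inv (?z [^] ?m) \<otimes> inv g \<otimes> ?z [^] ?m)"
    using T_bound[OF \<omega>O, of "g \<otimes> ?z [^] ?m" "?z [^] ?m"] gc by simp
  have "T (weight \<omega>) \<one> (?z [^] ?m) \<le> T (weight \<omega>) \<one> g + T (weight \<omega>) g (?z [^] ?m)"
    using gc by (intro T_triangle_w[OF \<omega>O]) auto
  also have "T (weight \<omega>) g (?z [^] ?m) \<le> T (weight \<omega>) g (g \<otimes> ?z [^] ?m) + T (weight \<omega>) (g \<otimes> ?z [^] ?m) (?z [^] ?m)"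
    using gc by (intro T_triangle_w[OF \<omega>O]) auto
  finally have "T (weight \<omega>) \<one> (?z [^] ?m) \<le> real ?m * (speed i * len ?z) +
      (P + 1) * real (len g + len (inv (?z [^] ?m) \<otimes> inv g \<otimes> ?z [^] ?m))"
    using T1 T2 T3 by (simp add: distrib_left)
  also have "(P + 1) * real (len g + len (inv (?z [^] ?m) \<otimes> inv g \<otimes> ?z [^] ?m)) \<le> (P + 1) * (?m / ((i + 1) * (len ?z + 1)))"
  proof (rule mult_left_mono)
    have "(0::real) < real ((i + 1) * (len ?z + 1))" by (simp only: of_nat_0_less_iff) simp
    then show "real (len g + len (inv (?z [^] ?m) \<otimes> inv g \<otimes> ?z [^] ?m)) \<le> ?m / ((i + 1) * (len ?z + 1))"
      using Fs_slow[OF g] by (simp only: pos_le_divide_eq)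
  qed (use P_ge_1 in simp)
  finally show ?thesis by simp
qed

lemma inside_time_road:
  "inside_time (zs i [^] ms i) \<le> ms i * (prob inside * (speed i * len (zs i)) + 2 * (P + 1) / (i + 1))"
proof -
  let ?z = "zs i" and ?m = "ms i"
  let ?I = "indicat_real"
  define \<delta> where "\<delta> = 1 / real ((i + 1) * (len ?z + 1))"
  have ne: "real (len ?z + 1) \<noteq> 0" by linarith
  have \<delta>: "\<delta> \<ge> 0" "\<delta> * real (len ?z + 1) = 1 / real (i + 1)"
    unfolding \<delta>_def of_nat_mult times_divide_eq_left mult_1_left
    using nonzero_divide_mult_cancel_right[OF ne] by (simp_all only: divide_nonneg_nonneg of_nat_0_le_iff mult_nonneg_nonneg zero_le_one simp_thms)
  define a where "a = speed i * len ?z"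
  have P1: "P + 1 \<ge> 0" using P_ge_1 by simp
  have pt: "T (weight \<omega>) \<one> (?z [^] ?m) * ?I inside \<omega> \<le>
      (?m * a) * ?I inside \<omega> + ((P + 1) * ?m * \<delta> +
      (((P + 1) * ?m * len ?z) * ?I (missed i) \<omega> + ((P + 1) * ?m * len ?z) * ?I (killed i) \<omega>))"
    if "\<omega> \<in> Om" for \<omega>
  proof (cases "\<omega> \<in> inside")
    case True
    have a0: "?m * a \<ge> 0" unfolding a_def using speed_ge[of i] kappa_pos by (simp add: order_trans[of 0 "1 / kappa"])
    have m0: "(P + 1) * ?m * \<delta> \<ge> 0" "(P + 1) * ?m * len ?z \<ge> 0" using P1 \<delta> by auto
    show ?thesis
    proof (cases "\<omega> \<in> missed i \<or> \<omega> \<in> killed i")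
      case True
      have "T (weight \<omega>) \<one> (?z [^] ?m) \<le> (P + 1) * len (?z [^] ?m)"
        using T_bound[OF that, of \<one> "?z [^] ?m"] by simp
      also have "\<dots> \<le> (P + 1) * (?m * len ?z)"
        using len_pow[of ?z ?m] P1 by (intro mult_left_mono) (simp_all only: of_nat_mult[symmetric] of_nat_le_iff zs_carrier)
      finally have "T (weight \<omega>) \<one> (?z [^] ?m) \<le> (P + 1) * ?m * len ?z" by (simp add: mult.assoc)
      moreover define q where "q = (P + 1) * ?m * len ?z"
      ultimately have q: "T (weight \<omega>) \<one> (?z [^] ?m) \<le> q" "q \<ge> 0" using m0 by auto
      show ?thesis unfolding q_def[symmetric] using True \<open>\<omega> \<in> inside\<close> q a0 m0(1)
        by (cases "\<omega> \<in> missed i"; cases "\<omega> \<in> killed i") simp_all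
    next
      case False
      then show ?thesis using T_on_good_event[OF \<open>\<omega> \<in> inside\<close>, of i] \<open>\<omega> \<in> inside\<close>
        by (simp add: \<delta>_def a_def mult.assoc)
    qed
  next
    case False
    then show ?thesis using P1 \<delta>(1) by simp
  qed
  have i1: "integrable M (\<lambda>\<omega>. c * ?I A \<omega>)" if "A \<in> sets M" for A and c :: real
    using that by (intro integrable_mult_right integrable_real_indicator) (auto simp: emeasure_eq_measure)
  have i2: "(\<integral>\<omega>. c * ?I A \<omega> \<partial>M) = c * prob A" if "A \<in> sets M" for A and c :: real
    using that sets.Int_space_eq2[OF that] by simp
  note s = inside_sets missed(1)[of i] killed(1)[of i]
  have "inside_time (?z [^] ?m) \<le> (\<integral>\<omega>. (?m * a) * ?I inside \<omega> + ((P + 1) * ?m * \<delta> +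
      (((P + 1) * ?m * len ?z) * ?I (missed i) \<omega> + ((P + 1) * ?m * len ?z) * ?I (killed i) \<omega>)) \<partial>M)"
    unfolding inside_time_def using pt
    by (intro integral_mono T_inside_integrable Bochner_Integration.integrable_add i1 s) (auto simp: space_M)
  also have "\<dots> = (?m * a) * prob inside + ((P + 1) * ?m * \<delta> +
      (((P + 1) * ?m * len ?z) * prob (missed i) + ((P + 1) * ?m * len ?z) * prob (killed i)))"
    unfolding Bochner_Integration.integral_add[OF i1[OF s(1)] Bochner_Integration.integrable_add[OF integrable_const
        Bochner_Integration.integrable_add[OF i1[OF s(2)] i1[OF s(3)]]]]
      Bochner_Integration.integral_add[OF integrable_const Bochner_Integration.integrable_add[OF i1[OF s(2)] i1[OF s(3)]]]
      Bochner_Integration.integral_add[OF i1[OF s(2)] i1[OF s(3)]] i2[OF s(1)] i2[OF s(2)] i2[OF s(3)]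
    by (simp add: prob_space)
  also have "\<dots> \<le> (?m * a) * prob inside + (P + 1) * ?m * (2 / (i + 1))"
  proof -
    have "len ?z * prob (missed i) \<le> len ?z * \<delta>" unfolding \<delta>_def using missed(2)[of i] by (intro mult_left_mono) auto
    moreover have "len ?z * prob (killed i) \<le> 1 / (i + 1)"
    proof -
      have "len ?z * prob (killed i) \<le> len ?z * ((1/2) ^ i / (len ?z + 1))" using killed(2) by (intro mult_left_mono) auto
      also have "\<dots> = (1/2) ^ i * (len ?z / (len ?z + 1))" by simp
      also have "\<dots> \<le> (1/2) ^ i * 1" by (intro mult_left_mono) (auto simp: divide_le_eq)
      also have "\<dots> = (1/2) ^ i" by simp
      also have "\<dots> \<le> 1 / (i + 1)"
      proof -
        have "i + 1 \<le> 2 ^ i" using less_exp[of i] by (simp add: Suc_le_eq)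
        then have "real (i + 1) \<le> 2 ^ i" by (metis of_nat_le_iff of_nat_numeral of_nat_power)
        then show ?thesis by (simp add: power_one_over field_simps)
      qed
      finally show ?thesis .
    qed
    ultimately have "\<delta> + (len ?z * prob (missed i) + len ?z * prob (killed i)) \<le> 2 / (i + 1)"
      using \<delta>(2) by (simp add: algebra_simps)
    then have "(P + 1) * ?m * (\<delta> + (len ?z * prob (missed i) + len ?z * prob (killed i))) \<le> (P + 1) * ?m * (2 / (i + 1))"
      using P1 by (intro mult_left_mono) auto
    then show ?thesis by (simp add: algebra_simps)
  qed
  finally show ?thesis unfolding a_def by (simp add: algebra_simps add_divide_distrib)
qed

lemma ET_upper:
  assumes z: "z \<in> N" and pos: "\<psi> z > 0" and \<epsilon>: "\<epsilon> > 0"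
  shows "\<exists>m\<ge>(1::nat). \<exists>x\<in>N. scaled x (int m) z \<and> ET x \<le> m * (\<psi> z + \<epsilon>)"
proof -
  define \<eta> where "\<eta> = \<epsilon> / (2 * P + 1 + 2 * (P + 1))"
  have \<eta>: "\<eta> > 0" "(2 * P + 1 + 2 * (P + 1)) * \<eta> = \<epsilon>" unfolding \<eta>_def using \<epsilon> P_ge_1 by auto
  define L where "L = (\<Sum>t\<in>transversal. len t)"
  have L: "len t \<le> L" if "t \<in> transversal" for t
    unfolding L_def using that finite_transversal by (intro member_le_sum) auto
  obtain x0 M0 where x0: "x0 \<in> N" "M0 \<ge> (1::nat)" "scaled x0 M0 z" "len x0 \<le> M0 * (ell z + \<eta>)"
    using ell_approx[OF z \<eta>(1)] by auto
  obtain s0 :: nat where s0: "2 * L / \<eta> < s0" using reals_Archimedean2 by blast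
  define s where "s = s0 + 1"
  have s: "s \<ge> 1" "2 * L \<le> \<eta> * s" using s0 \<eta>(1) by (auto simp: s_def field_simps)
  define z' where "z' = x0 [^] s"
  define m' where "m' = s * M0"
  have m': "m' \<ge> 1" "2 * L \<le> \<eta> * m'"
  proof -
    show "m' \<ge> 1" using s x0 by (simp add: m'_def)
    have "\<eta> * s \<le> \<eta> * m'" 
    proof (rule mult_left_mono)
      have "s \<le> m'" using x0(2) unfolding m'_def by simp
      then show "real s \<le> real m'" by simp
    qed (use \<eta> in simp)
    then show "2 * L \<le> \<eta> * m'" using s by simp
  qed
  have z'N: "z' \<in> N" unfolding z'_def using x0 by simp
  have z's: "scaled z' (int m') z" using x0 unfolding z'_def m'_def scaled_def by (simp add: K_pow)
  have z'l: "len z' \<le> m' * (ell z + \<eta>)"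
  proof -
    have "real (len z') \<le> real (s * len x0)" unfolding z'_def using len_pow[of x0 s] x0 by (simp only: of_nat_le_iff N_in_carrier)
    also have "\<dots> \<le> s * (M0 * (ell z + \<eta>))" using x0(4) by (simp add: mult_left_mono)
    finally show ?thesis unfolding m'_def by simp
  qed
  have z'\<psi>: "\<psi> z' = m' * \<psi> z" by (rule scaled_\<psi>[OF z'N z z's])
  have z'ell: "m' * ell z \<le> ell z'" by (rule ell_scaled[OF z z'N m'(1) z's])
  have ellz: "ell z > 0" by (rule ell_pos[OF z pos])
  define zt where "zt t = inv t \<otimes> z' \<otimes> t" for t
  obtain I where I: "real (card transversal) * (2 * (P + 1)) / \<eta> < real I" using reals_Archimedean2 by blast
  have "\<exists>i. I \<le> i \<and> zs i = zt t" if t: "t \<in> transversal" for t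
  proof -
    have tc: "t \<in> carrier G" by (rule transversal_carrier[OF t])
    have "zt t \<in> N" unfolding zt_def using tc z'N by (rule N_conj')
    moreover have "\<psi> (zt t) > 0" unfolding zt_def using \<psi>_conj[OF z'N tc] z'\<psi> pos m' by simp
    ultimately show ?thesis using zs_recur[of "zt t" I] by blast
  qed
  then obtain idx where idx: "\<And>t. t \<in> transversal \<Longrightarrow> I \<le> idx t" "\<And>t. t \<in> transversal \<Longrightarrow> zs (idx t) = zt t"
    by metis
  define m where "m = (\<Prod>t\<in>transversal. ms (idx t))"
  have m1: "m \<ge> 1" unfolding m_def using ms(1) by (intro prod_ge_1)
  have dvd: "ms (idx t) dvd m" if "t \<in> transversal" for t
    unfolding m_def using that finite_transversal by (rule dvd_prodI[rotated])
  define x where "x = z' [^] m"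
  have xN: "x \<in> N" unfolding x_def using z'N by simp
  have xs: "scaled x (int (m * m')) z" using z's z'N unfolding x_def scaled_def by (simp add: K_pow)
  define b where "b = m' * (\<psi> z + 2 * P * \<eta>)"
  have b0: "b \<ge> 0" unfolding b_def using pos P_ge_1 \<eta> by simp
  have part: "inside_time (inv t \<otimes> x \<otimes> t) + 2 * (P + 1) * len t \<le>
      m * (prob inside * b + 2 * (P + 1) / (I + 1)) + 2 * (P + 1) * len t" if t: "t \<in> transversal" for t
  proof -
    have tc: "t \<in> carrier G" by (rule transversal_carrier[OF t])
    let ?i = "idx t"
    have zi: "zs ?i = zt t" by (rule idx(2)[OF t])
    obtain r where r: "m = ms ?i * r" using dvd[OF t] by (auto simp: dvd_def)
    have conj: "inv t \<otimes> x \<otimes> t = zt t [^] m"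
    proof -
      have "inv t \<otimes> z' [^] k \<otimes> t = (inv t \<otimes> z' \<otimes> t) [^] k" for k :: nat
      proof (induction k)
        case (Suc k)
        have "inv t \<otimes> z' [^] Suc k \<otimes> t = (inv t \<otimes> z' [^] k \<otimes> t) \<otimes> (inv t \<otimes> z' \<otimes> t)"
          using tc z'N by (simp add: m_assoc)
        then show ?case using Suc by simp
      qed (use tc in simp)
      then show ?thesis unfolding x_def zt_def .
    qed
    have sp: "speed ?i * len (zs ?i) \<le> b"
    proof -
      have e: "ell (zs ?i) = ell z'" "\<psi> (zs ?i) = m' * \<psi> z"
        unfolding zi zt_def using ell_conj[OF z'N tc] \<psi>_conj[OF z'N tc] z'\<psi> by simp_all
      have l: "len (zs ?i) \<le> len z' + 2 * L"
        using len_mult3[of "inv t" z' t] tc z'N L[OF t] unfolding zi zt_def by simp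
      have "real (len (zs ?i)) \<le> real (len z' + 2 * L)" using l by (simp only: of_nat_le_iff)
      also have "\<dots> \<le> m' * (ell z + 2 * \<eta>)" using z'l m'(2) by (simp add: algebra_simps)
      finally have l': "len (zs ?i) \<le> m' * (ell z + 2 * \<eta>)" .
      have "0 < m' * ell z" using ellz m' by simp
      then have "ell z' > 0" using z'ell by linarith
      then have "speed ?i \<le> m' * \<psi> z / (m' * ell z)"
        unfolding speed_def e using z'ell ellz m' pos by (intro divide_left_mono mult_pos_pos) auto
      also have "\<dots> = \<psi> z / ell z" using m' by simp
      finally have sp': "speed ?i \<le> \<psi> z / ell z" .
      have "speed ?i * len (zs ?i) \<le> \<psi> z / ell z * (m' * (ell z + 2 * \<eta>))"
        using sp' l' pos ellz by (intro mult_mono) auto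
      also have "\<dots> = m' * (\<psi> z + 2 * (\<psi> z / ell z) * \<eta>)" using ellz by (simp add: field_simps)
      also have "\<dots> \<le> m' * (\<psi> z + 2 * P * \<eta>)"
        using \<psi>_le_ell[OF z] ellz \<eta>(1) by (intro mult_left_mono add_left_mono mult_right_mono) (auto simp: divide_le_eq)
      finally show ?thesis unfolding b_def .
    qed
    have "inside_time (inv t \<otimes> x \<otimes> t) = inside_time ((zs ?i [^] ms ?i) [^] r)"
      unfolding conj zi[symmetric] r by (simp add: nat_pow_pow)
    also have "\<dots> \<le> r * inside_time (zs ?i [^] ms ?i)" by (rule inside_time_pow) (simp add: zs_N)
    also have "\<dots> \<le> r * (ms ?i * (prob inside * (speed ?i * len (zs ?i)) + 2 * (P + 1) / (?i + 1)))"
      using inside_time_road[of ?i] by (intro mult_left_mono) (simp_all add: add.commute)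
    also have "\<dots> = m * (prob inside * (speed ?i * len (zs ?i)) + 2 * (P + 1) / (?i + 1))" unfolding r by simp
    also have "\<dots> \<le> m * (prob inside * b + 2 * (P + 1) / (I + 1))"
    proof (intro mult_left_mono add_mono)
      show "speed ?i * len (zs ?i) \<le> b" by (rule sp)
      show "2 * (P + 1) / (?i + 1) \<le> 2 * (P + 1) / (I + 1)"
        using idx(1)[OF t] P_ge_1 by (intro divide_left_mono) auto
    qed auto
    finally show ?thesis by simp
  qed
  have cI: "card transversal * (2 * (P + 1) / (I + 1)) \<le> \<eta>"
  proof -
    have "card transversal * (2 * (P + 1)) \<le> \<eta> * I" using I \<eta>(1) by (simp add: field_simps)
    also have "\<dots> \<le> \<eta> * (I + 1)" using \<eta>(1) by simp
    finally show ?thesis by (simp add: divide_le_eq)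
  qed
  have "ET x \<le> (\<Sum>t\<in>transversal. m * (prob inside * b + 2 * (P + 1) / (I + 1)) + 2 * (P + 1) * len t)"
    using part by (intro order_trans[OF ET_le_inside_time[OF xN]] sum_mono)
  also have "\<dots> = m * ((card transversal * prob inside) * b + card transversal * (2 * (P + 1) / (I + 1))) + 2 * (P + 1) * L"
    unfolding L_def by (simp add: sum.distrib sum_distrib_left algebra_simps)
  also have "\<dots> \<le> m * (1 * b + \<eta>) + 2 * (P + 1) * L"
    using card_transversal_inside cI b0 by (intro add_right_mono mult_left_mono add_mono mult_right_mono) auto
  also have "\<dots> \<le> m * (b + m' * \<eta>) + m * (m' * (2 * (P + 1) * \<eta>))"
  proof (rule add_mono)
    have "1 * \<eta> \<le> m' * \<eta>" using m'(1) \<eta>(1) by (intro mult_right_mono) auto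
    then have "1 * b + \<eta> \<le> b + m' * \<eta>" by simp
    then show "m * (1 * b + \<eta>) \<le> m * (b + m' * \<eta>)" by (rule mult_left_mono) simp
    have "real L \<le> m' * \<eta>" using m'(2) by (simp add: mult.commute)
    then have "2 * (P + 1) * real L \<le> 2 * (P + 1) * (m' * \<eta>)" using P_ge_1 by (intro mult_left_mono) auto
    also have "\<dots> = 1 * (m' * (2 * (P + 1) * \<eta>))" by simp
    also have "\<dots> \<le> m * (m' * (2 * (P + 1) * \<eta>))"
      using m1 P_ge_1 \<eta>(1) by (intro mult_right_mono) auto
    finally show "2 * (P + 1) * real L \<le> m * (m' * (2 * (P + 1) * \<eta>))" .
  qed
  also have "\<dots> = real (m * m') * (\<psi> z + (2 * P + 1 + 2 * (P + 1)) * \<eta>)" unfolding b_def by (simp add: algebra_simps)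
  finally have "ET x \<le> real (m * m') * (\<psi> z + \<epsilon>)" unfolding \<eta>(2) .
  moreover have "m * m' \<ge> 1" using m1 m'(1) by simp
  ultimately show ?thesis using xN xs by blast
qed

theorem Tt_road_asymptotic: "\<epsilon> > 0 \<Longrightarrow> \<exists>C'. \<forall>x\<in>N. \<bar>Tt x - \<psi> x\<bar> \<le> \<epsilon> * Kabs x + C'"
  by (rule Tt_asymptotic[OF ET_lower ET_upper])

end

section \<open>Existence of the weights\<close>

context random_metric
begin

lemma weights_realise:
  assumes lower: "\<And>x. x \<in> N \<Longrightarrow> \<psi> x - C \<le> ET x"
    and upper: "\<And>z \<epsilon>. z \<in> N \<Longrightarrow> \<psi> z > 0 \<Longrightarrow> \<epsilon> > 0 \<Longrightarrow>
      \<exists>m\<ge>(1::nat). \<exists>x\<in>N. scaled x (int m) z \<and> ET x \<le> real m * (\<psi> z + \<epsilon>)"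
  shows "\<exists>(M :: ('a set \<Rightarrow> real) measure) act w.
    random_weights E M w \<and> stationary_weights G E M w \<and> ergodic_weights G E M act w \<and>
    (\<exists>k K. 0 < k \<and> k < K \<and> (AE \<omega> in M. \<forall>x\<in>carrier G. \<forall>y\<in>carrier G.
       k * real (word_dist G S x y) \<le> T (w \<omega>) x y \<and> T (w \<omega>) x y \<le> K * real (word_dist G S x y))) \<and>
    (\<forall>\<epsilon>>0. \<exists>C'. \<forall>x\<in>N. \<bar>(INF x'\<in>{x' \<in> N. same_K x' x}. \<integral>\<omega>. T (w \<omega>) \<one> x' \<partial>M) - \<psi> x\<bar> \<le> \<epsilon> * Kabs x + C')"
proof (rule exI[of _ M], rule exI[of _ act], rule exI[of _ w], intro conjI)
  show "random_weights E M w" by (rule random_weights)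
  show "stationary_weights G E M w" by (rule weights_stationary)
  show "ergodic_weights G E M act w" by (rule weights_ergodic)
  show "\<exists>k K. 0 < k \<and> k < K \<and> (AE \<omega> in M. \<forall>x\<in>carrier G. \<forall>y\<in>carrier G.
       k * real (word_dist G S x y) \<le> T (w \<omega>) x y \<and> T (w \<omega>) x y \<le> K * real (word_dist G S x y))"
    by (rule bi_lipschitz)
  show "\<forall>\<epsilon>>0. \<exists>C'. \<forall>x\<in>N. \<bar>(INF x'\<in>{x' \<in> N. same_K x' x}. \<integral>\<omega>. T (w \<omega>) \<one> x' \<partial>M) - \<psi> x\<bar> \<le> \<epsilon> * Kabs x + C'"
    using Tt_asymptotic[OF lower upper] unfolding Tt_def ET_def by blast
qed

end

context lattice_seminorm
begin

definition realisable :: bool where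
  "realisable \<longleftrightarrow> (\<exists>(M :: ('a set \<Rightarrow> real) measure) act w.
    random_weights E M w \<and> stationary_weights G E M w \<and> ergodic_weights G E M act w \<and>
    (\<exists>k K. 0 < k \<and> k < K \<and> (AE \<omega> in M. \<forall>x\<in>carrier G. \<forall>y\<in>carrier G.
       k * real (word_dist G S x y) \<le> T (w \<omega>) x y \<and> T (w \<omega>) x y \<le> K * real (word_dist G S x y))) \<and>
    (\<forall>\<epsilon>>0. \<exists>C'. \<forall>x\<in>N. \<bar>(INF x'\<in>{x' \<in> N. same_K x' x}. \<integral>\<omega>. T (w \<omega>) \<one> x' \<partial>M) - \<psi> x\<bar> \<le> \<epsilon> * Kabs x + C'))"

subsection \<open>Rank at least two\<close>

lemma recurrent_enumeration:
  assumes "d \<ge> 1"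
  shows "\<exists>zs :: nat \<Rightarrow> 'a. (\<forall>i. zs i \<in> N \<and> \<psi> (zs i) > 0) \<and> (\<forall>z\<in>N. \<psi> z > 0 \<longrightarrow> (\<forall>I. \<exists>i\<ge>I. zs i = z))"
proof -
  define A where "A = {z \<in> N. \<psi> z > 0}"
  have "K (e 0) 0 \<noteq> 0" using K_e[of 0 0] assms m0 by simp
  then have "\<psi> (e 0) \<noteq> 0" using \<psi>_eq_0_iff[OF e_N[of 0]] assms by auto
  then have ne: "A \<noteq> {}" using e_N[of 0] \<psi>_nonneg[OF e_N[of 0]] assms unfolding A_def by (auto simp: less_le)
  have cnt: "countable A" 
    by (rule countable_subset[OF _ countable_carrier]) (auto simp: A_def)
  define zs where "zs i = from_nat_into A (fst (prod_decode i))" for i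
  have "zs i \<in> A" for i unfolding zs_def by (rule from_nat_into[OF ne])
  moreover have "\<exists>i\<ge>I. zs i = z" if z: "z \<in> A" for z I
  proof -
    obtain k where k: "from_nat_into A k = z" using from_nat_into_surj[OF cnt z] by blast
    have "I \<le> prod_encode (k, I)" by (rule le_prod_encode_2)
    moreover have "zs (prod_encode (k, I)) = z" unfolding zs_def using k by simp
    ultimately show ?thesis by blast
  qed
  ultimately show ?thesis unfolding A_def by blast
qed

definition road_scale :: "nat \<Rightarrow> 'a \<Rightarrow> nat \<Rightarrow> nat \<times> 'a set \<times> nat \<times> nat \<times> nat \<times> 'a set \<Rightarrow> bool" where
  "road_scale i z c = (\<lambda>(H, Q, M', n, m, F).
    subgroup Q G \<and> Q \<subseteq> N \<and> congruence_subgroup M' \<subseteq> Q \<and> M' \<ge> 1 \<and>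
    (\<forall>u\<in>road z n. \<forall>v\<in>road z n. \<forall>q\<in>Q. dist u (q \<otimes> v) \<le> c \<longrightarrow> \<psi> q = 0) \<and>
    real (c + 1) * real (card (wball c) * card (road z n)) \<le> (1/2)^i * real (card (left_cosets G Q)) \<and>
    finite F \<and> F \<subseteq> N \<and> 1 \<le> m \<and> m \<le> n \<and>
    (\<forall>g\<in>F. real (len g + len (inv (z [^] m) \<otimes> inv g \<otimes> z [^] m)) * ((i + 1) * (len z + 1)) \<le> m) \<and>
    real (card {C \<in> left_cosets G Q. C \<subseteq> N \<and> \<not> (\<exists>g\<in>F. \<exists>k\<le>n - m. C = (g \<otimes> inv (z [^] k)) <# Q)}
      * ((i + 1) * (len z + 1))) \<le> card (left_cosets G Q) \<and>
    card F * (n + 1) * card (road z n) * (len z + 1) \<le> H)"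

definition finer :: "nat \<Rightarrow> 'a \<Rightarrow> nat \<Rightarrow> nat \<times> 'a set \<times> nat \<times> nat \<times> nat \<times> 'a set \<Rightarrow> nat \<times> 'a set \<times> nat \<times> nat \<times> nat \<times> 'a set \<Rightarrow> bool" where
  "finer i z c = (\<lambda>(H, Q, _) (H', Q', _, n', _). H \<le> H' \<and> Q' \<subseteq> Q \<and>
    real H * real (card (wball c) * card (road z n')) \<le> (1/2)^i * card (left_cosets G Q'))"

lemma next_scale:
  assumes d2: "d \<ge> 2" and z: "z \<in> N" "\<psi> z > 0" and Q: "congruence_subgroup M0 \<subseteq> Q" and M0: "M0 \<ge> (1::nat)"
  shows "\<exists>s. road_scale i z c s \<and> finer i z c (H, Q, t) s"
proof -
  define \<eta> where "\<eta> = (1/2::real)^i / (real H + c + 1)"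
  define \<epsilon> where "\<epsilon> = 1 / real ((i + 1) * (len z + 1))"
  have pos: "(0::real) < real ((i + 1) * (len z + 1))" by (simp only: of_nat_0_less_iff) simp
  have "\<eta> > 0" "\<epsilon> > 0" unfolding \<eta>_def \<epsilon>_def using pos by (simp_all only: zero_less_divide_1_iff) (simp add: add_nonneg_pos)
  from road_family_exists[OF z d2 M0 this, of c]
  obtain Q' M' n m F where F: "subgroup Q' G" "Q' \<subseteq> congruence_subgroup M0" "congruence_subgroup M' \<subseteq> Q'" "M' \<ge> 1"
    "\<forall>u\<in>road z n. \<forall>v\<in>road z n. \<forall>q\<in>Q'. dist u (q \<otimes> v) \<le> c \<longrightarrow> \<psi> q = 0"
    "real (card (wball c) * card (road z n)) \<le> \<eta> * card (left_cosets G Q')"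
    "finite F" "F \<subseteq> N" "(1::nat) \<le> m" "m \<le> n"
    "\<forall>g\<in>F. real (len g + len (inv (z [^] m) \<otimes> inv g \<otimes> z [^] m)) \<le> \<epsilon> * m"
    "real (card {C \<in> left_cosets G Q'. C \<subseteq> N \<and> \<not> (\<exists>g\<in>F. \<exists>k\<le>n - m. C = (g \<otimes> inv (z [^] k)) <# Q')})
      \<le> \<epsilon> * card (left_cosets G Q')" by (elim exE conjE)
  let ?V = "real (card (wball c) * card (road z n))" and ?L = "real (card (left_cosets G Q'))"
  define H' where "H' = H + card F * (n + 1) * card (road z n) * (len z + 1)"
  have dens: "b * ?V \<le> (1/2)^i * ?L" if b: "0 \<le> b" "b \<le> real H + c + 1" for b :: real
  proof -
    have "b * ?V \<le> b * (\<eta> * ?L)" using F(6) b(1) by (rule mult_left_mono)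
    also have "\<dots> \<le> (real H + c + 1) * (\<eta> * ?L)" using b(2) \<open>\<eta> > 0\<close> by (intro mult_right_mono) auto
    also have "\<dots> = (1/2)^i * ?L" unfolding \<eta>_def by (simp add: add_nonneg_eq_0_iff)
    finally show ?thesis .
  qed
  have scale: "real a * ((i + 1) * (len z + 1)) \<le> b" if "real a \<le> \<epsilon> * b" for a :: nat and b :: real
  proof -
    have "real a * real ((i + 1) * (len z + 1)) \<le> (\<epsilon> * b) * real ((i + 1) * (len z + 1))"
      using that pos by (intro mult_right_mono) auto
    also have "\<dots> = b" unfolding \<epsilon>_def using pos by (simp del: of_nat_mult)
    finally show ?thesis by simp
  qed
  have "road_scale i z c (H', Q', M', n, m, F)"
    unfolding road_scale_def prod.case
  proof (intro conjI)
    show "Q' \<subseteq> N" using F(2) by (auto simp: congruence_subgroup_def)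
    show "real (c + 1) * ?V \<le> (1/2)^i * ?L" by (rule dens) simp_all
    show "\<forall>g\<in>F. real (len g + len (inv (z [^] m) \<otimes> inv g \<otimes> z [^] m)) * ((i + 1) * (len z + 1)) \<le> m"
      using F(11) scale by blast
    show "real (card {C \<in> left_cosets G Q'. C \<subseteq> N \<and> \<not> (\<exists>g\<in>F. \<exists>k\<le>n - m. C = (g \<otimes> inv (z [^] k)) <# Q')}
      * ((i + 1) * (len z + 1))) \<le> card (left_cosets G Q')"
      using scale[OF F(12)] by (simp only: of_nat_mult of_nat_add of_nat_1)
    show "card F * (n + 1) * card (road z n) * (len z + 1) \<le> H'" by (simp add: H'_def)
  qed (fact F)+
  moreover have "finer i z c (H, Q, t) (H', Q', M', n, m, F)"
    unfolding finer_def prod.case using F(2) Q dens[of H] by (auto simp: H'_def)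
  ultimately show ?thesis by blast
qed

lemma road_system_exists:
  assumes d2: "d \<ge> 2"
  shows "\<exists>D zs reach ns ms Fs. road_system G S N \<psi> K d m0 e c1 c2 cl D zs reach ns ms Fs"
proof -
  obtain zs :: "nat \<Rightarrow> 'a" where zs: "\<And>i. zs i \<in> N" "\<And>i. \<psi> (zs i) > 0"
    "\<And>z I. z \<in> N \<Longrightarrow> \<psi> z > 0 \<Longrightarrow> \<exists>i\<ge>I. zs i = z"
    using recurrent_enumeration d2 by (metis One_nat_def Suc_1 Suc_leD)
  define r where "r i = nat \<lceil>3 * C0 + 4 * P * len (zs i)\<rceil>" for i
  define c where "c i = (\<Sum>l\<le>i. r l)" for i
  have c_mono: "c i \<le> c j" if "i \<le> j" for i j
    unfolding c_def using that by (intro sum_mono2) auto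
  have c_ge: "3 * C0 + 4 * P * len (zs i) \<le> c i" for i
  proof -
    have "r i \<le> c i" unfolding c_def by (intro member_le_sum) auto
    moreover have "3 * C0 + 4 * P * len (zs i) \<le> r i" unfolding r_def by linarith
    ultimately show ?thesis by linarith
  qed
  have "\<exists>f. \<forall>i. road_scale i (zs i) (c i) (f i) \<and> finer (Suc i) (zs (Suc i)) (c (Suc i)) (f i) (f (Suc i))"
  proof (rule dependent_nat_choice)
    show "\<exists>s. road_scale 0 (zs 0) (c 0) s" using next_scale[OF d2 zs(1,2) order_refl, of 1 0 0] by blast
  next
    fix s i assume s: "road_scale i (zs i) (c i) s"
    obtain H Q M' n m F where s': "s = (H, Q, M', n, m, F)" by (cases s)
    have "congruence_subgroup M' \<subseteq> Q" "M' \<ge> 1" using s unfolding s' road_scale_def by simp_all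
    then show "\<exists>s'. road_scale (Suc i) (zs (Suc i)) (c (Suc i)) s' \<and> finer (Suc i) (zs (Suc i)) (c (Suc i)) s s'"
      unfolding s' using zs by (intro next_scale d2) auto
  qed
  then obtain f where f: "\<And>i. road_scale i (zs i) (c i) (f i)"
    "\<And>i. finer (Suc i) (zs (Suc i)) (c (Suc i)) (f i) (f (Suc i))" by blast
  define H where "H i = fst (f i)" for i
  define D where "D i = fst (snd (f i))" for i
  define M' where "M' i = fst (snd (snd (f i)))" for i
  define ns where "ns i = fst (snd (snd (snd (f i))))" for i
  define ms where "ms i = fst (snd (snd (snd (snd (f i)))))" for i
  define Fs where "Fs i = snd (snd (snd (snd (snd (f i)))))" for i
  have fi: "f i = (H i, D i, M' i, ns i, ms i, Fs i)" for i
    unfolding H_def D_def M'_def ns_def ms_def Fs_def by simp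
  note scale = f(1)[unfolded fi road_scale_def prod.case]
  note fine = f(2)[unfolded fi finer_def prod.case]
  have H_mono: "H i \<le> H j" if "i \<le> j" for i j 
  proof (rule lift_Suc_mono_le[OF _ that])
    show "H i \<le> H (Suc i)" for i using fine[of i] by blast
  qed
  have "road_system G S N \<psi> K d m0 e c1 c2 cl D zs c ns ms Fs"
  proof (intro road_system.intro road_system_axioms.intro subgroup_chain.intro subgroup_chain_axioms.intro)
    show "lattice_seminorm G S N \<psi> K d m0 e c1 c2 cl" by (rule lattice_seminorm_axioms)
    show "group G" by (rule is_group)
  next
    fix i
    show "subgroup (D i) G" "D i \<subseteq> N" "finite (Fs i)" "Fs i \<subseteq> N" "1 \<le> ms i" "ms i \<le> ns i" using scale[of i] by simp_all
    show "D (Suc i) \<subseteq> D i" using fine[of i] by simp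
    show "finite (left_cosets G (D i))" using scale[of i] by (intro finite_cosets_above[of _ "M' i"]) simp_all
    show "zs i \<in> N" "\<psi> (zs i) > 0" by (rule zs)+
    show "\<exists>i\<ge>I. zs i = z" if "z \<in> N" "\<psi> z > 0" for z I using zs(3)[OF that] .
    show "c i \<le> c j" if "i \<le> j" for j by (rule c_mono[OF that])
    show "3 * C0 + 4 * P * len (zs i) \<le> c i" by (rule c_ge)
    show "\<psi> q = 0" if "u \<in> road (zs i) (ns i)" "v \<in> road (zs i) (ns i)" "q \<in> D i" "dist u (q \<otimes> v) \<le> c i" for u v q
      using scale[of i] that by blast
    show "(c i + 1) * real (card (wball (c i)) * card (road (zs i) (ns i))) \<le> (1/2)^i * card (left_cosets G (D i))"
      using scale[of i] by simp
    show "real (len g + len (inv (zs i [^] ms i) \<otimes> inv g \<otimes> zs i [^] ms i)) * ((i + 1) * (len (zs i) + 1)) \<le> ms i"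
      if "g \<in> Fs i" for g using scale[of i] that by blast
    show "real (card {C \<in> left_cosets G (D i). C \<subseteq> N \<and>
        \<not> (\<exists>g\<in>Fs i. \<exists>k\<le>ns i - ms i. C = (g \<otimes> inv (zs i [^] k)) <# D i)}) * ((i + 1) * (len (zs i) + 1))
      \<le> card (left_cosets G (D i))" using scale[of i] unfolding of_nat_mult by blast
  next
    fix i j :: nat assume ij: "i < j"
    then obtain j' where j': "j = Suc j'" by (cases j) auto
    let ?W = "card (Fs i) * (ns i + 1) * card (road (zs i) (ns i)) * (len (zs i) + 1)"
    let ?V = "real (card (wball (c j)) * card (road (zs j) (ns j)))"
    have "?W \<le> H i" using scale[of i] by blast
    also have "H i \<le> H j'" using ij j' by (intro H_mono) simp
    finally have "real ?W \<le> real (H j')" by (simp only: of_nat_le_iff)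
    then have "real ?W * ?V \<le> real (H j') * ?V" by (rule mult_right_mono) simp
    also have "\<dots> \<le> (1/2)^j * card (left_cosets G (D j))" using fine[of j'] unfolding j' by blast
    finally show "real ?W * ?V \<le> (1/2)^j * card (left_cosets G (D j))" .
  qed
  then show ?thesis by blast
qed

subsection \<open>Rank at most one\<close>

lemma realisable_constant:
  fixes a :: real
  assumes a: "a > 0" and lower: "\<And>x. x \<in> N \<Longrightarrow> \<psi> x \<le> a * len x"
    and upper: "\<And>z \<epsilon>. z \<in> N \<Longrightarrow> \<psi> z > 0 \<Longrightarrow> \<epsilon> > 0 \<Longrightarrow>
      \<exists>m\<ge>(1::nat). \<exists>x\<in>N. scaled x (int m) z \<and> a * len x \<le> real m * (\<psi> z + \<epsilon>)"
  shows realisable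
proof -
  have fin: "finite (left_cosets G N)"
  proof (rule finite_left_cosetsI[OF N_subgroup, of "\<lambda>g. rep (inv g)"])
    have "(\<lambda>g. rep (inv g)) ` carrier G \<subseteq> rep ` carrier G" by auto
    then show "finite ((\<lambda>g. rep (inv g)) ` carrier G)" using finite_rep finite_subset by blast
    fix g h assume gh: "g \<in> carrier G" "h \<in> carrier G" "rep (inv g) = rep (inv h)"
    have "(inv g \<otimes> inv (rep (inv g))) \<otimes> inv (inv h \<otimes> inv (rep (inv h))) \<in> N"
      by (rule N_mult[OF rep_N N_inv[OF rep_N]]) (use gh in auto)
    then show "inv g \<otimes> h \<in> N" using gh by (simp add: inv_mult_group m_assoc)
  qed
  interpret C: random_metric G S N \<psi> K d m0 e c1 c2 cl "\<lambda>_. N" "\<lambda>_ _. a" a a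
    by unfold_locales (use a fin N_subgroup in auto)
  have T: "T (\<lambda>_. a) \<one> x = a * len x" if "x \<in> carrier G" for x
    using T_le_dist[of "\<lambda>_. a" a \<one> x] T_ge_dist[of a "\<lambda>_. a" \<one> x] a that by simp
  have ET: "C.ET x = a * len x" if "x \<in> carrier G" for x
    unfolding C.ET_def using T[OF that] by (simp add: C.prob_space)
  show ?thesis unfolding realisable_def
  proof (rule C.weights_realise[of 0])
    show "\<psi> x - 0 \<le> C.ET x" if "x \<in> N" for x using lower[OF that] ET that by simp
    show "\<exists>m\<ge>(1::nat). \<exists>x\<in>N. scaled x (int m) z \<and> C.ET x \<le> real m * (\<psi> z + \<epsilon>)"
      if "z \<in> N" "\<psi> z > 0" "\<epsilon> > 0" for z \<epsilon>
      using upper[OF that] ET by (metis N_in_carrier)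
  qed
qed

lemma realisable_rank_one:
  assumes d1: "d = 1"
  shows realisable
proof -
  define e0 where "e0 = e 0"
  have e0: "e0 \<in> N" "K e0 0 = int m0" unfolding e0_def using e_N[of 0] K_e[of 0 0] d1 by simp_all
  have pos: "\<psi> e0 > 0"
  proof -
    have "\<psi> e0 \<noteq> 0"
    proof
      assume "\<psi> e0 = 0"
      then have "\<forall>j<d. K e0 j = 0" using \<psi>_eq_0_iff[OF e0(1)] by (rule iffD1[rotated])
      then have "K e0 0 = 0" unfolding d1 by simp
      then show False using e0(2) m0 by simp
    qed
    then show ?thesis using \<psi>_nonneg[OF e0(1)] by linarith
  qed
  have el: "ell e0 > 0" by (rule ell_pos[OF e0(1) pos])
  define a where "a = \<psi> e0 / ell e0"
  have a: "a > 0" "a * ell e0 = \<psi> e0" unfolding a_def using pos el by simp_all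
  have key: "m0 * \<psi> x = \<bar>K x 0\<bar> * \<psi> e0 \<and> \<bar>K x 0\<bar> * ell e0 \<le> m0 * len x" if x: "x \<in> N" for x
  proof -
    define k where "k = nat \<bar>K x 0\<bar>"
    define y where "y = (if K x 0 \<ge> 0 then x else inv x)"
    have y: "y \<in> N" "\<psi> y = \<psi> x" "len y = len x" "K y 0 = int k"
      using x by (cases "K x 0 \<ge> 0"; simp add: y_def k_def)+
    have k: "real_of_int \<bar>K x 0\<bar> = real k" unfolding k_def by simp
    have sc: "scaled (y [^] m0) (int k) e0" unfolding scaled_def using d1 y e0 by (simp add: K_pow)
    have ym: "y [^] m0 \<in> N" using y by simp
    have "m0 * \<psi> x = k * \<psi> e0" using scaled_\<psi>[OF ym e0(1) sc] \<psi>_pow[OF y(1)] y(2) by simp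
    moreover have "k * ell e0 \<le> m0 * len x"
    proof (cases "k = 0")
      case False
      then have "k * ell e0 \<le> len (y [^] m0)" using ell_le[OF ym _ sc] by simp
      also have "real (len (y [^] m0)) \<le> real (m0 * len y)" using len_pow[of y m0] y(1) by (simp only: of_nat_le_iff N_in_carrier)
      finally show ?thesis using y(3) by simp
    qed simp
    ultimately show ?thesis unfolding k by simp
  qed
  show ?thesis
  proof (rule realisable_constant[OF a(1)])
    fix x assume x: "x \<in> N"
    have "m0 * \<psi> x = a * (\<bar>K x 0\<bar> * ell e0)" using key[OF x] a(2) by (simp add: mult_ac)
    also have "\<dots> \<le> a * (m0 * len x)" using key[OF x] a(1) by (intro mult_left_mono) auto
    finally have "m0 * \<psi> x \<le> m0 * (a * len x)" by (simp add: mult_ac)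
    then show "\<psi> x \<le> a * len x" using m0 by simp
  next
    fix z \<epsilon> assume z: "z \<in> N" "\<psi> z > 0" and \<epsilon>: "\<epsilon> > (0::real)"
    define k where "k = K z 0"
    have k0: "k \<noteq> 0" using key[OF z(1)] z(2) m0 unfolding k_def by auto
    define \<eta> where "\<eta> = \<epsilon> / (\<bar>real_of_int k\<bar> * a)"
    have \<eta>: "\<eta> > 0" "\<bar>real_of_int k\<bar> * a * \<eta> = \<epsilon>" unfolding \<eta>_def using \<epsilon> k0 a(1) by simp_all
    obtain x0 m where x0: "x0 \<in> N" "m \<ge> (1::nat)" "scaled x0 m e0" "len x0 \<le> m * (ell e0 + \<eta>)"
      using ell_approx[OF e0(1) \<eta>(1)] by auto
    let ?x = "x0 [^] k"
    have "scaled ?x (int (m * m0)) z"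
    proof -
      have "K x0 0 = int m * int m0" using x0(3) e0(2) d1 unfolding scaled_def by simp
      then show ?thesis using x0(1) d1 unfolding scaled_def by (simp add: K_int_pow k_def)
    qed
    moreover have "a * len ?x \<le> real (m * m0) * (\<psi> z + \<epsilon>)"
    proof -
      have "real (len ?x) \<le> real (nat \<bar>k\<bar> * len x0)" using len_int_pow[of x0 k] x0(1) by (simp only: of_nat_le_iff N_in_carrier)
      also have "\<dots> = \<bar>real_of_int k\<bar> * len x0" by simp
      also have "\<dots> \<le> \<bar>real_of_int k\<bar> * (m * (ell e0 + \<eta>))" using x0(4) by (rule mult_left_mono) simp
      finally have "a * len ?x \<le> a * (\<bar>real_of_int k\<bar> * (m * (ell e0 + \<eta>)))" using a(1) by (intro mult_left_mono) auto
      also have "\<dots> = m * (\<bar>real_of_int k\<bar> * (a * ell e0) + \<bar>real_of_int k\<bar> * a * \<eta>)" by (simp add: algebra_simps)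
      also have "\<dots> = m * (m0 * \<psi> z + \<epsilon>)" unfolding \<eta>(2) a(2) using key[OF z(1)] by (simp add: k_def)
      also have "\<dots> \<le> m * (m0 * \<psi> z + m0 * \<epsilon>)" using m0 \<epsilon> by (intro mult_left_mono add_left_mono) auto
      finally show ?thesis by (simp add: algebra_simps)
    qed
    moreover have "m * m0 \<ge> 1" using x0(2) m0 by simp
    ultimately show "\<exists>m\<ge>(1::nat). \<exists>x\<in>N. scaled x (int m) z \<and> a * len x \<le> real m * (\<psi> z + \<epsilon>)"
      using x0(1) by (intro exI[of _ "m * m0"] conjI bexI[of _ ?x]) auto
  qed
qed

theorem realisable: realisable
proof -
  consider "d = 0" | "d = 1" | "d \<ge> 2" by linarith
  then show ?thesis
  proof cases
    case 1
    then have "\<psi> x = 0" if "x \<in> N" for x using \<psi>_eq_0_iff[OF that] by simp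
    then show ?thesis by (intro realisable_constant[of 1]) auto
  next
    case 2 then show ?thesis by (rule realisable_rank_one)
  next
    case 3
    then obtain D zs reach ns ms Fs where "road_system G S N \<psi> K d m0 e c1 c2 cl D zs reach ns ms Fs"
      using road_system_exists by blast
    then interpret Z: road_system G S N \<psi> K d m0 e c1 c2 cl D zs reach ns ms Fs .
    show ?thesis unfolding realisable_def by (rule Z.weights_realise[OF Z.ET_lower Z.ET_upper])
  qed
qed

end

section \<open>The lattice of the abelianization\<close>

context cayley_normal
begin

abbreviation "NG \<equiv> G\<lparr>carrier := N\<rparr>"

abbreviation "Ab \<equiv> abelianization NG"

abbreviation "proj \<equiv> ab_map NG"

abbreviation "commutators \<equiv> derived G N"

lemma NG_group: "group NG"
  by (rule subgroup_imp_group[OF N_subgroup])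

lemma commutators_NG: "derived NG N = commutators"
  using derived_consistent[OF order_refl N_subgroup] by simp

lemma commutators_normal: "commutators \<lhd> G"
  by (rule derived_is_normal[OF normal_N])

lemma commutators_N: "commutators \<subseteq> N"
proof -
  have "derived NG (carrier NG) \<subseteq> carrier NG" by (rule group.derived_in_carrier[OF NG_group order_refl])
  then show ?thesis by (simp add: commutators_NG)
qed

lemma Ab_comm_group: "comm_group Ab"
  unfolding abelianization_def using group.derived_quot_is_comm_group[OF NG_group] by simp

lemma proj_alt: "proj x = commutators #> x"
  by (simp add: ab_map_def commutators_NG r_coset_def)

lemma proj_hom: "proj \<in> hom NG Ab"
  unfolding ab_map_def[abs_def] abelianization_def
  by (rule normal.r_coset_hom_Mod[OF group.derived_self_is_normal[OF NG_group]])

lemma proj_mult: "x \<in> N \<Longrightarrow> y \<in> N \<Longrightarrow> proj (x \<otimes> y) = proj x \<otimes>\<^bsub>Ab\<^esub> proj y"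
  using proj_hom by (auto simp: hom_def)

lemma Ab_carrier: "carrier Ab = proj ` N"
  by (simp add: abelianization_def carrier_FactGroup ab_map_def[abs_def])

lemma proj_in [simp]: "x \<in> N \<Longrightarrow> proj x \<in> carrier Ab"
  by (simp add: Ab_carrier)

lemma proj_group_hom: "group_hom NG Ab proj"
  using NG_group comm_group.axioms(2)[OF Ab_comm_group] proj_hom
  by (simp add: group_hom_def group_hom_axioms_def)

lemma NG_inv: "x \<in> N \<Longrightarrow> inv\<^bsub>NG\<^esub> x = inv x"
  by (rule m_inv_consistent[OF N_subgroup])

lemma proj_inv: "x \<in> N \<Longrightarrow> proj (inv x) = inv\<^bsub>Ab\<^esub> proj x"
  using group_hom.hom_inv[OF proj_group_hom, of x] by (simp add: NG_inv)

lemma NG_pow: "x [^]\<^bsub>NG\<^esub> (n::nat) = x [^] n"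
  by (induction n) simp_all

lemma proj_pow: "x \<in> N \<Longrightarrow> proj (x [^] (n::nat)) = proj x [^]\<^bsub>Ab\<^esub> n"
  using group_hom.hom_nat_pow[OF proj_group_hom, of x n] by (simp add: NG_pow)

lemma Ab_finitely_generated: "\<exists>Y. finite Y \<and> Y \<subseteq> carrier Ab \<and> generate Ab Y = carrier Ab"
proof -
  obtain Y where Y: "finite Y" "Y \<subseteq> N" "generate G Y = N" using N_finitely_generated by blast
  have "generate NG Y = N" using generate_consistent[OF Y(2) N_subgroup] Y(3) by simp
  then have "generate Ab (proj ` Y) = carrier Ab"
    using group_hom.generate_img[OF proj_group_hom, of Y] Y(2) by (simp add: Ab_carrier)
  then show ?thesis using Y by (intro exI[of _ "proj ` Y"]) (auto simp: Ab_carrier)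
qed

lemma conj_proj:
  assumes g: "g \<in> carrier G" and x: "x \<in> N"
  shows "(\<lambda>y. inv g \<otimes> y \<otimes> g) ` proj x = proj (inv g \<otimes> x \<otimes> g)"
proof -
  have cc: "h \<in> carrier G" if "h \<in> commutators" for h using that commutators_N by auto
  have "(\<lambda>y. inv g \<otimes> y \<otimes> g) ` proj x = {inv g \<otimes> (h \<otimes> x) \<otimes> g | h. h \<in> commutators}"
    unfolding proj_alt r_coset_def by auto
  also have "\<dots> = {h \<otimes> (inv g \<otimes> x \<otimes> g) | h. h \<in> commutators}"
  proof (intro equalityI subsetI)
    fix y assume "y \<in> {inv g \<otimes> (h \<otimes> x) \<otimes> g | h. h \<in> commutators}"
    then obtain h where h: "h \<in> commutators" "y = inv g \<otimes> (h \<otimes> x) \<otimes> g" by blast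
    have "y = (inv g \<otimes> h \<otimes> g) \<otimes> (inv g \<otimes> x \<otimes> g)" unfolding h(2) using g x cc[OF h(1)] by (simp add: m_assoc)
    moreover have "inv g \<otimes> h \<otimes> g \<in> commutators" using normal.inv_op_closed1[OF commutators_normal g h(1)] .
    ultimately show "y \<in> {h \<otimes> (inv g \<otimes> x \<otimes> g) | h. h \<in> commutators}" by blast
  next
    fix y assume "y \<in> {h \<otimes> (inv g \<otimes> x \<otimes> g) | h. h \<in> commutators}"
    then obtain h where h: "h \<in> commutators" "y = h \<otimes> (inv g \<otimes> x \<otimes> g)" by blast
    have "y = inv g \<otimes> ((g \<otimes> h \<otimes> inv g) \<otimes> x) \<otimes> g" unfolding h(2) using g x cc[OF h(1)] by (simp add: m_assoc)
    moreover have "g \<otimes> h \<otimes> inv g \<in> commutators" using normal.inv_op_closed2[OF commutators_normal g h(1)] .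
    ultimately show "y \<in> {inv g \<otimes> (h \<otimes> x) \<otimes> g | h. h \<in> commutators}" by blast
  qed
  also have "\<dots> = proj (inv g \<otimes> x \<otimes> g)" unfolding proj_alt r_coset_def by auto
  finally show ?thesis .
qed

lemma conj_hom:
  assumes g: "g \<in> carrier G"
  shows "(\<lambda>C. (\<lambda>y. inv g \<otimes> y \<otimes> g) ` C) \<in> hom Ab Ab"
proof (rule homI)
  let ?\<phi> = "\<lambda>C. (\<lambda>y. inv g \<otimes> y \<otimes> g) ` C"
  fix A assume "A \<in> carrier Ab"
  then obtain x where x: "x \<in> N" "A = proj x" unfolding Ab_carrier by blast
  show "?\<phi> A \<in> carrier Ab" unfolding x(2) conj_proj[OF g x(1)] using N_conj'[OF g x(1)] by simp
  fix B assume "B \<in> carrier Ab"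
  then obtain y where y: "y \<in> N" "B = proj y" unfolding Ab_carrier by blast
  have "?\<phi> (A \<otimes>\<^bsub>Ab\<^esub> B) = proj (inv g \<otimes> (x \<otimes> y) \<otimes> g)"
    unfolding x(2) y(2) proj_mult[OF x(1) y(1), symmetric] using x y g by (intro conj_proj) auto
  also have "inv g \<otimes> (x \<otimes> y) \<otimes> g = (inv g \<otimes> x \<otimes> g) \<otimes> (inv g \<otimes> y \<otimes> g)"
    using x(1) y(1) g by (simp add: m_assoc)
  also have "proj \<dots> = ?\<phi> A \<otimes>\<^bsub>Ab\<^esub> ?\<phi> B"
    unfolding x(2) y(2) conj_proj[OF g x(1)] conj_proj[OF g y(1)] using N_conj'[OF g] x y by (intro proj_mult) auto
  finally show "?\<phi> (A \<otimes>\<^bsub>Ab\<^esub> B) = ?\<phi> A \<otimes>\<^bsub>Ab\<^esub> ?\<phi> B" .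
qed

end

lemma (in comm_group) torsion_subgroup: "subgroup (torsion G) G"
proof (rule subgroupI)
  show "torsion G \<subseteq> carrier G" by (auto simp: torsion_def)
  have "\<one> \<in> torsion G" by (auto simp: torsion_def intro: exI[of _ "1::nat"])
  then show "torsion G \<noteq> {}" by blast
  fix a assume "a \<in> torsion G"
  then obtain n :: nat where a: "a \<in> carrier G" "n > 0" "a [^] n = \<one>" by (auto simp: torsion_def)
  have "inv a [^] n = \<one>" using a by (simp add: nat_pow_inv)
  then show "inv a \<in> torsion G" using a by (auto simp: torsion_def)
  fix b assume "b \<in> torsion G"
  then obtain m :: nat where b: "b \<in> carrier G" "m > 0" "b [^] m = \<one>" by (auto simp: torsion_def)
  have "a [^] (n * m) = (a [^] n) [^] m" using a(1) by (rule nat_pow_pow[symmetric])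
  moreover have "b [^] (n * m) = (b [^] m) [^] n" using nat_pow_pow[OF b(1), of m n] by (simp add: mult.commute)
  ultimately have "(a \<otimes> b) [^] (n * m) = \<one>" using a b by (simp add: pow_mult_distrib m_comm)
  then show "a \<otimes> b \<in> torsion G" using a b unfolding torsion_def by (intro CollectI conjI exI[of _ "n * m"]) auto
qed

lemma (in comm_group) vec_norm_torsion_coset:
  assumes norm: "tensor_norm G \<Psi>" and a: "a \<in> carrier G"
  shows "\<Psi> (lattice_vec G (torsion G #> a)) = vec_norm \<Psi> a"
proof -
  let ?b = "SOME b. b \<in> torsion G #> a"
  have "a \<in> torsion G #> a" using a by (rule rcos_self[OF _ torsion_subgroup])
  then have "?b \<in> torsion G #> a" by (rule someI)
  then obtain t where t: "t \<in> torsion G" "?b = t \<otimes> a" by (auto simp: r_coset_def)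
  have tc: "t \<in> carrier G" using t by (simp add: torsion_def)
  have t0: "vec_norm \<Psi> t = 0" using t vec_norm_torsion[OF norm tc] by (auto simp: torsion_def)
  have "vec_norm \<Psi> (t \<otimes> a) \<le> vec_norm \<Psi> a" using vec_norm_mult[OF norm tc a] t0 by simp
  moreover have "vec_norm \<Psi> a \<le> vec_norm \<Psi> (t \<otimes> a)"
  proof -
    have "a = inv t \<otimes> (t \<otimes> a)" using tc a by (simp add: m_assoc[symmetric])
    then have "vec_norm \<Psi> a \<le> vec_norm \<Psi> (inv t) + vec_norm \<Psi> (t \<otimes> a)"
      using vec_norm_mult[OF norm, of "inv t" "t \<otimes> a"] tc a by simp
    then show ?thesis using vec_norm_inv[OF norm tc] t0 by simp
  qed
  ultimately show ?thesis unfolding lattice_vec_def t(2) by (simp add: vec_norm_def)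
qed

theorem theorem4:
  fixes G :: "'a monoid" and S N :: "'a set"
    and \<Psi> :: "(('a set \<times> real) \<Rightarrow>\<^sub>0 int) set \<Rightarrow> real"
  assumes "group G"
    and "finite S" and "S \<subseteq> carrier G" and "generate G S = carrier G"
    and "virtually_nilpotent G"
    and "N \<lhd> G" and "finite_index G N"
    and "torsion_free (G\<lparr>carrier := N\<rparr>)" and "nilpotent_group (G\<lparr>carrier := N\<rparr>)"
    and "tensor_norm (abelianization (G\<lparr>carrier := N\<rparr>)) \<Psi>"
    and "conj_invariant G N \<Psi>"
  shows "\<exists>(M :: ('a set \<Rightarrow> real) measure) act w.
    random_weights (cayley_edges G S) M w \<and>
    stationary_weights G (cayley_edges G S) M w \<and>
    ergodic_weights G (cayley_edges G S) M act w \<and>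
    (\<exists>k K. 0 < k \<and> k < K \<and>
      (AE \<omega> in M. \<forall>x\<in>carrier G. \<forall>y\<in>carrier G.
         k * real (word_dist G S x y) \<le> passage_time (cayley_edges G S) (w \<omega>) x y \<and>
         passage_time (cayley_edges G S) (w \<omega>) x y \<le> K * real (word_dist G S x y))) \<and>
    (\<forall>nrm. tensor_norm (abelianization (G\<lparr>carrier := N\<rparr>)) nrm \<longrightarrow>
      (\<lambda>y. induced_fun (G\<lparr>carrier := N\<rparr>)
             (\<lambda>x. \<integral>\<omega>. passage_time (cayley_edges G S) (w \<omega>) \<one>\<^bsub>G\<^esub> x \<partial>M) y
           - \<Psi> (lattice_vec (abelianization (G\<lparr>carrier := N\<rparr>)) y))
      \<in> o[lattice_at_infinity (abelianization (G\<lparr>carrier := N\<rparr>)) nrm](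
            \<lambda>y. nrm (lattice_vec (abelianization (G\<lparr>carrier := N\<rparr>)) y)))"
proof -
  interpret cayley_normal G S N
    using assms by (simp add: cayley_normal_def cayley_normal_axioms_def cayley_def cayley_axioms_def)
  interpret Ab: comm_group Ab by (rule Ab_comm_group)
  obtain Y where Y: "finite Y" "Y \<subseteq> carrier Ab" "generate Ab Y = carrier Ab" using Ab_finitely_generated by blast
  obtain d :: nat and m :: int and e' KA where coord: "m > 0" "\<forall>j<d. e' j \<in> carrier Ab"
    "\<forall>x\<in>carrier Ab. \<forall>y\<in>carrier Ab. \<forall>j. KA (x \<otimes>\<^bsub>Ab\<^esub> y) j = KA x j + (KA y j :: int)"
    "\<forall>i<d. \<forall>j<d. KA (e' i) j = (if i = j then m else 0)"
    "\<forall>x\<in>carrier Ab. (\<forall>j<d. KA x j = 0) \<longrightarrow> (\<exists>n::nat. n > 0 \<and> x [^]\<^bsub>Ab\<^esub> n = \<one>\<^bsub>Ab\<^esub>)"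
    using Ab.coordinates_exist[OF Y(1,2)] unfolding Y(3) by (elim exE conjE) (rule that)
  have KA: "KA (a \<otimes>\<^bsub>Ab\<^esub> b) j = KA a j + KA b j" if "a \<in> carrier Ab" "b \<in> carrier Ab" for a b j
    using coord(3) that by blast
  have equiv: "\<exists>c C. c > (0::real) \<and> C > (0::real) \<and> (\<forall>a\<in>carrier Ab. c * (\<Sum>j<d. \<bar>KA a j\<bar>) \<le> Ab.vec_norm \<Phi> a \<and>
      Ab.vec_norm \<Phi> a \<le> C * (\<Sum>j<d. \<bar>KA a j\<bar>))" if "tensor_norm Ab \<Phi>" for \<Phi>
    by (rule Ab.vec_norm_equiv_coordinates[OF that coord(1), of d e']) (use coord in blast)+
  define e where "e j = (SOME x. x \<in> N \<and> proj x = e' j)" for j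
  have e: "e j \<in> N" "proj (e j) = e' j" if j: "j < d" for j
  proof -
    have "e' j \<in> proj ` N" using coord(2) j by (simp add: Ab_carrier)
    then have "\<exists>x. x \<in> N \<and> proj x = e' j" by (metis imageE)
    then have "e j \<in> N \<and> proj (e j) = e' j" unfolding e_def by (rule someI_ex)
    then show "e j \<in> N" "proj (e j) = e' j" by simp_all
  qed
  obtain cl where cl: "lower_central NG cl = {\<one>\<^bsub>G\<^esub>}" using assms(9) by (auto simp: nilpotent_group_def)
  have norm: "tensor_norm Ab \<Psi>" by (rule assms(10))
  obtain c1 c2 where c: "c1 > (0::real)" "c2 > (0::real)"
    "\<And>a. a \<in> carrier Ab \<Longrightarrow> c1 * (\<Sum>j<d. \<bar>KA a j\<bar>) \<le> Ab.vec_norm \<Psi> a"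
    "\<And>a. a \<in> carrier Ab \<Longrightarrow> Ab.vec_norm \<Psi> a \<le> c2 * (\<Sum>j<d. \<bar>KA a j\<bar>)" using equiv[OF norm] by blast
  define \<psi> where "\<psi> x = Ab.vec_norm \<Psi> (proj x)" for x
  define K where "K x = KA (proj x)" for x
  have \<psi>_conj: "\<psi> (inv\<^bsub>G\<^esub> g \<otimes>\<^bsub>G\<^esub> x \<otimes>\<^bsub>G\<^esub> g) = \<psi> x" if x: "x \<in> N" and g: "g \<in> carrier G" for x g
  proof -
    have "\<psi> (inv\<^bsub>G\<^esub> g \<otimes>\<^bsub>G\<^esub> x \<otimes>\<^bsub>G\<^esub> g) = \<Psi> (conj_tensor G N g (pure_tensor Ab (proj x) 1))"
      unfolding \<psi>_def Ab.vec_norm_def conj_tensor_def Ab.pure_tensor_map[OF conj_hom[OF g]] conj_proj[OF g x] ..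
    also have "\<dots> = \<psi> x" using assms(11) g x unfolding conj_invariant_def \<psi>_def Ab.vec_norm_def
      using Ab.pure_tensor_in[OF proj_in[OF x]] by blast
    finally show ?thesis .
  qed
  interpret L: lattice_seminorm G S N \<psi> K d "nat m" e c1 c2 cl
  proof unfold_locales
    show "\<psi> (x \<otimes>\<^bsub>G\<^esub> y) \<le> \<psi> x + \<psi> y" if "x \<in> N" "y \<in> N" for x y
      unfolding \<psi>_def proj_mult[OF that] using that by (intro Ab.vec_norm_mult[OF norm]) auto
    show "\<psi> (x [^]\<^bsub>G\<^esub> n) = real n * \<psi> x" if "x \<in> N" for x and n :: nat
      unfolding \<psi>_def proj_pow[OF that] using that by (intro Ab.vec_norm_nat_pow[OF norm]) auto
    show "\<psi> (inv\<^bsub>G\<^esub> x) = \<psi> x" if "x \<in> N" for x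
      unfolding \<psi>_def proj_inv[OF that] using that by (intro Ab.vec_norm_inv[OF norm]) auto
    show "\<psi> (inv\<^bsub>G\<^esub> g \<otimes>\<^bsub>G\<^esub> x \<otimes>\<^bsub>G\<^esub> g) = \<psi> x" if "x \<in> N" "g \<in> carrier G" for x g by (rule \<psi>_conj[OF that])
    show "K (x \<otimes>\<^bsub>G\<^esub> y) j = K x j + K y j" if "x \<in> N" "y \<in> N" for x y j
      unfolding K_def proj_mult[OF that] using that by (intro KA) auto
    show "0 < nat m" using coord(1) by simp
    show "e j \<in> N" if "j < d" for j by (rule e(1)[OF that])
    show "K (e i) j = (if i = j then int (nat m) else 0)" if "i < d" "j < d" for i j
      unfolding K_def e(2)[OF that(1)] using coord(1,4) that by auto
    show "0 < c1" "0 < c2" by (rule c)+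
    show "c1 * (\<Sum>j<d. \<bar>K x j\<bar>) \<le> \<psi> x" if "x \<in> N" for x
      unfolding K_def \<psi>_def by (rule c(3)[OF proj_in[OF that]])
    show "\<psi> x \<le> c2 * (\<Sum>j<d. \<bar>K x j\<bar>)" if "x \<in> N" for x
      unfolding K_def \<psi>_def by (rule c(4)[OF proj_in[OF that]])
    show "lower_central NG cl = {\<one>\<^bsub>G\<^esub>}" by (rule cl)
  qed
  let ?q = "ab_free_map NG"
  have q_alt: "?q x = torsion Ab #>\<^bsub>Ab\<^esub> proj x" for x by (simp add: ab_free_map_def)
  have lattice: "\<Phi> (lattice_vec Ab (?q x)) = Ab.vec_norm \<Phi> (proj x)" if "tensor_norm Ab \<Phi>" "x \<in> N" for \<Phi> x
    unfolding q_alt using that by (intro Ab.vec_norm_torsion_coset) auto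
  have torsion_iff: "a \<in> torsion Ab \<longleftrightarrow> (\<forall>j<d. KA a j = 0)" if a: "a \<in> carrier Ab" for a
  proof
    assume "a \<in> torsion Ab"
    then have "Ab.vec_norm \<Psi> a = 0" using Ab.vec_norm_torsion[OF norm a] by (auto simp: torsion_def)
    then have "c1 * (\<Sum>j<d. \<bar>KA a j\<bar>) \<le> 0" using c(3)[OF a] by simp
    then have "real_of_int (\<Sum>j<d. \<bar>KA a j\<bar>) \<le> 0" using c(1) by (simp add: mult_le_0_iff)
    then have "(\<Sum>j<d. \<bar>KA a j\<bar>) \<le> 0" by (simp only: of_int_le_0_iff)
    then have "(\<Sum>j<d. \<bar>KA a j\<bar>) = 0" by (intro antisym sum_nonneg) auto
    then show "\<forall>j<d. KA a j = 0" by (simp add: sum_nonneg_eq_0_iff)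
  next
    assume "\<forall>j<d. KA a j = 0"
    then show "a \<in> torsion Ab" using coord(5) a by (auto simp: torsion_def)
  qed
  have q_eq: "?q x = ?q y \<longleftrightarrow> L.same_K x y" if x: "x \<in> N" and y: "y \<in> N" for x y
  proof -
    have "?q x = ?q y \<longleftrightarrow> proj x \<otimes>\<^bsub>Ab\<^esub> inv\<^bsub>Ab\<^esub> proj y \<in> torsion Ab"
    proof
      assume "?q x = ?q y"
      then have "proj x \<in> torsion Ab #>\<^bsub>Ab\<^esub> proj y"
        using Ab.rcos_self[OF proj_in[OF x] Ab.torsion_subgroup] unfolding q_alt by simp
      then obtain t where t: "t \<in> torsion Ab" "proj x = t \<otimes>\<^bsub>Ab\<^esub> proj y" by (auto simp: r_coset_def)
      then show "proj x \<otimes>\<^bsub>Ab\<^esub> inv\<^bsub>Ab\<^esub> proj y \<in> torsion Ab"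
        using y by (simp add: Ab.m_assoc torsion_def)
    next
      assume t: "proj x \<otimes>\<^bsub>Ab\<^esub> inv\<^bsub>Ab\<^esub> proj y \<in> torsion Ab"
      have "proj x = (proj x \<otimes>\<^bsub>Ab\<^esub> inv\<^bsub>Ab\<^esub> proj y) \<otimes>\<^bsub>Ab\<^esub> proj y" using x y by (simp add: Ab.m_assoc)
      then have "proj x \<in> torsion Ab #>\<^bsub>Ab\<^esub> proj y" using t by (auto simp: r_coset_def)
      then show "?q x = ?q y" unfolding q_alt
        using Ab.repr_independence[OF _ proj_in[OF y] Ab.torsion_subgroup] by metis
    qed
    also have "\<dots> \<longleftrightarrow> (\<forall>j<d. K (x \<otimes>\<^bsub>G\<^esub> inv\<^bsub>G\<^esub> y) j = 0)"
      using torsion_iff[of "proj x \<otimes>\<^bsub>Ab\<^esub> inv\<^bsub>Ab\<^esub> proj y"] x y by (simp add: K_def proj_mult proj_inv)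
    also have "\<dots> \<longleftrightarrow> L.same_K x y" using x y by (simp add: L.same_K_def L.K_mult)
    finally show ?thesis .
  qed
  have free_carrier: "carrier (free_part Ab) = ?q ` N"
    unfolding free_part_def carrier_FactGroup Ab_carrier image_image q_alt ..
  have "L.realisable" by (rule L.realisable)
  then obtain M :: "('a set \<Rightarrow> real) measure" and act w where w:
    "random_weights (cayley_edges G S) M w" "stationary_weights G (cayley_edges G S) M w"
    "ergodic_weights G (cayley_edges G S) M act w"
    "\<exists>k K. 0 < k \<and> k < K \<and> (AE \<omega> in M. \<forall>x\<in>carrier G. \<forall>y\<in>carrier G.
         k * real (word_dist G S x y) \<le> passage_time (cayley_edges G S) (w \<omega>) x y \<and>
         passage_time (cayley_edges G S) (w \<omega>) x y \<le> K * real (word_dist G S x y))"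
    "\<And>\<epsilon>. \<epsilon> > 0 \<Longrightarrow> \<exists>C'. \<forall>x\<in>N. \<bar>(INF x'\<in>{x' \<in> N. L.same_K x' x}.
        \<integral>\<omega>. passage_time (cayley_edges G S) (w \<omega>) \<one>\<^bsub>G\<^esub> x' \<partial>M) - \<psi> x\<bar> \<le> \<epsilon> * L.Kabs x + C'"
    unfolding L.realisable_def by (elim exE conjE) (rule that, auto)
  let ?ET = "\<lambda>x. \<integral>\<omega>. passage_time (cayley_edges G S) (w \<omega>) \<one>\<^bsub>G\<^esub> x \<partial>M"
  let ?h = "\<lambda>y. induced_fun NG ?ET y - \<Psi> (lattice_vec Ab y)"
  have induced: "induced_fun NG ?ET (?q x) = (INF x'\<in>{x' \<in> N. L.same_K x' x}. ?ET x')" if x: "x \<in> N" for x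
  proof -
    have "{x' \<in> carrier NG. ?q x' = ?q x} = {x' \<in> N. L.same_K x' x}" using q_eq[OF _ x] by auto
    then show ?thesis unfolding induced_fun_def by simp
  qed
  have small: "?h \<in> o[lattice_at_infinity Ab nrm](\<lambda>y. nrm (lattice_vec Ab y))" if nrm: "tensor_norm Ab nrm" for nrm
  proof (rule landau_o.smallI)
    fix c :: real assume c0: "c > 0"
    obtain b C where b: "b > (0::real)" "\<And>a. a \<in> carrier Ab \<Longrightarrow> b * (\<Sum>j<d. \<bar>KA a j\<bar>) \<le> Ab.vec_norm nrm a"
      using equiv[OF nrm] by blast
    obtain C' where C': "\<And>x. x \<in> N \<Longrightarrow> \<bar>(INF x'\<in>{x' \<in> N. L.same_K x' x}. ?ET x') - \<psi> x\<bar> \<le> c * b / 2 * L.Kabs x + C'"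
      using w(5)[of "c * b / 2"] c0 b(1) by auto
    have bound: "norm (?h (?q x)) \<le> c * norm (nrm (lattice_vec Ab (?q x)))"
      if x: "x \<in> N" and large: "2 * C' / c \<le> nrm (lattice_vec Ab (?q x))" for x
    proof -
      let ?n = "nrm (lattice_vec Ab (?q x))"
      have n: "?n = Ab.vec_norm nrm (proj x)" by (rule lattice[OF nrm x])
      have "b * L.Kabs x \<le> ?n" unfolding n L.Kabs_def K_def using b(2)[OF proj_in[OF x]] by simp
      then have "c / 2 * (b * L.Kabs x) \<le> c / 2 * ?n" using c0 by (intro mult_left_mono) auto
      then have 1: "c * b / 2 * L.Kabs x \<le> c / 2 * ?n" by simp
      have 2: "C' \<le> c / 2 * ?n" using large c0 by (simp add: field_simps)
      have "\<bar>?h (?q x)\<bar> \<le> c * b / 2 * L.Kabs x + C'"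
        using C'[OF x] unfolding induced[OF x] lattice[OF norm x] \<psi>_def .
      also have "\<dots> \<le> c * ?n" using 1 2 by simp
      also have "\<dots> \<le> c * \<bar>?n\<bar>" using c0 by (intro mult_left_mono) auto
      finally show ?thesis by simp
    qed
    have "eventually (\<lambda>y. 2 * C' / c \<le> nrm (lattice_vec Ab y)) (filtercomap (\<lambda>y. nrm (lattice_vec Ab y)) at_top)"
      by (rule eventually_filtercomapI[OF eventually_ge_at_top])
    then show "eventually (\<lambda>y. norm (?h y) \<le> c * norm (nrm (lattice_vec Ab y))) (lattice_at_infinity Ab nrm)"
      unfolding lattice_at_infinity_def eventually_inf_principal free_carrier
      by (rule eventually_mono) (use bound in auto)
  qed
  show ?thesis using w(1-4) small by blast
qed

end
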